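(* Let $n$ be a positive integer and let $X_n \to X_{n-1} \to \cdots \to X_1 \to X_0$ be a Bott tower all of whose Bott numbers $c_{i,j}$ ($1\le i<j\le n$) are positive integers. Let $x\in X_n$ be any point, and let $L$ be a nef line bundle on $X_n$ with $L\equiv a_1D_1+\cdots+a_nD_n$, $a_i\in\mathbb{Z}$. Let $X_n^{(2)}\subset X_n$ be the fibre through $x$ of $X_n\to X_1$, and let $\Gamma_n\subset X_n$ be the rational curve defined in the context. Then $$\varepsilon(X_n,L,x)=\begin{cases}\min\{a_1,\ \varepsilon(X_n^{(2)},L|_{X_n^{(2)}},x)\}, & \text{if } x\in\Gamma_n,\\ \varepsilon(X_n^{(2)},L|_{X_n^{(2)}},x), & \text{if } x\notin\Gamma_n.\end{cases}$$ When $n=1$ (where $X_1=\Gamma_1=\mathbb{P}^1$ and $X_1^{(2)}$ is not defined) the statement is to be read as $\varepsilon(X_1,L,x)=a_1$ for all $x$.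
   Context: We work over $\mathbb{C}$. A Bott tower of height $n$, $X_n\to X_{n-1}\to\cdots\to X_1\to X_0=\{\text{point}\}$, is an iterated $\mathbb{P}^1$-bundle with $X_k=\mathbb{P}(\mathcal{O}_{X_{k-1}}\oplus\mathcal{L})$ for some line bundle $\mathcal{L}$ on $X_{k-1}$. It is determined by integers $\{c_{i,j}\}_{1\le i<j\le n}$, its Bott numbers, as follows: $X_n$ is the quotient of $U_n=\{(z_1,w_1,\ldots,z_n,w_n)\in\mathbb{C}^{2n} : (z_i,w_i)\ne(0,0)\text{ for all } i\}$ by the action of $(\mathbb{C}^* )^n$ in which $(t_1,\ldots,t_n)$ multiplies $z_i$ by $t_1^{-c_{1,i}}\cdots t_{i-1}^{-c_{i-1,i}}t_i$ and $w_i$ by $t_i$. (Equivalently, it is the smooth projective toric variety whose complete fan has rays $v_i=e_i$ and $v_{n+i}=-e_i+\sum_{j>i}c_{i,j}e_j$, $1\le i\le n$, and whose $2^n$ maximal cones are spanned by choosing one of $v_i,v_{n+i}$ for each $i$.) Points of $X_n$ are written $[z_1:w_1:\cdots:z_n:w_n]$. For $i\le n$, $X_i$ is the Bott tower with Bott numbers $\{c_{k,l}\}_{1\le k<l\le i}$, and the map $X_i\to X_{i-1}$ forgets the last pair $(z_i,w_i)$. The divisor $D_i\subset X_n$ is the locus $w_i=0$, $1\le i\le n$. The symbol $\equiv$ denotes numerical equivalence. For $x=[z_1^0:w_1^0:\cdots:z_n^0:w_n^0]\in X_n$ and $n\ge2$, $X_n^{(2)}$ is the fibre of the composite map $X_n\to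 X_1$ through $x$, i.e. $X_n^{(2)}=\{[z_1^0:w_1^0:z_2:w_2:\cdots:z_n:w_n]\}\subset X_n$. The curve $\Gamma_n$ is the image of $X_1=\mathbb{P}^1$ under the composition of the sections $X_{i-1}\to X_i$, $[z_1:w_1:\cdots:z_{i-1}:w_{i-1}]\mapsto[z_1:w_1:\cdots:z_{i-1}:w_{i-1}:0:1]$, i.e. $\Gamma_n=\{[z_1:w_1:0:1:\cdots:0:1]\}$. For a nef line bundle $L$ on a complex projective variety $X$ and $x\in X$, the Seshadri constant is $\varepsilon(X,L,x)=\inf_{C\ni x}\frac{L\cdot C}{\mathrm{mult}_xC}$, the infimum being over all irreducible and reduced closed curves $C\subset X$ passing through $x$. On $\mathbb{P}^1$ one has, by convention, $\varepsilon(\mathbb{P}^1,\mathcal{O}_{\mathbb{P}^1}(a),x)=a$. *)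

theory Defs
  imports "HOL-Analysis.Analysis" "HOL-Library.Function_Algebras"
begin

section \<open>Varieties as spaces with functions\<close>

text \<open>
  A (reduced, complex) variety is given by its set of closed points with the Zariski topology,
  together with the sheaf of regular complex-valued functions. As usual in HOL, a function that is
  regular on an open set \<open>V\<close> is a total function whose values outside \<open>V\<close> are irrelevant.
\<close>

record 'a fspace =
  ftop :: "'a topology"
  reg :: "'a set \<Rightarrow> ('a \<Rightarrow> complex) set"

abbreviation pts :: "'a fspace \<Rightarrow> 'a set" where
  "pts X \<equiv> topspace (ftop X)"

definition subspace_of :: "'a fspace \<Rightarrow> 'a set \<Rightarrow> 'a fspace" where
  "subspace_of X Y = \<lparr>ftop = subtopology (ftop X) Y,
     reg = (\<lambda>V. {f. \<forall>p\<in>V. \<exists>U h. openin (ftop X) U \<and> p \<in> U \<and> h \<in> reg X U \<and>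
                           (\<forall>y\<in>U \<inter> V. f y = h y)})\<rparr>"

definition quotient_fspace :: "'a fspace \<Rightarrow> ('a \<Rightarrow> 'b) \<Rightarrow> 'b fspace" where
  "quotient_fspace X q = \<lparr>ftop = topology (\<lambda>V. V \<subseteq> q ` pts X \<and> openin (ftop X) {u \<in> pts X. q u \<in> V}),
     reg = (\<lambda>V. {f. f \<circ> q \<in> reg X {u \<in> pts X. q u \<in> V}})\<rparr>"

lemma openin_quotient_fspace:
  "openin (ftop (quotient_fspace X q)) V \<longleftrightarrow>
     V \<subseteq> q ` pts X \<and> openin (ftop X) {u \<in> pts X. q u \<in> V}"
proof -
  let ?P = "\<lambda>V. V \<subseteq> q ` pts X \<and> openin (ftop X) {u \<in> pts X. q u \<in> V}"
  have inter: "?P (S \<inter> T)" if S: "?P S" and T: "?P T" for S T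
  proof
    show "S \<inter> T \<subseteq> q ` pts X" using S by blast
    have "{u \<in> pts X. q u \<in> S \<inter> T} = {u \<in> pts X. q u \<in> S} \<inter> {u \<in> pts X. q u \<in> T}"
      by (intro set_eqI) auto
    moreover have "openin (ftop X) ({u \<in> pts X. q u \<in> S} \<inter> {u \<in> pts X. q u \<in> T})"
      using S T by (intro openin_Int) simp_all
    ultimately show "openin (ftop X) {u \<in> pts X. q u \<in> S \<inter> T}" by (simp only:)
  qed
  have union: "?P (\<Union>K)" if K: "\<forall>S\<in>K. ?P S" for K
  proof
    show "\<Union>K \<subseteq> q ` pts X" using K by blast
    have "{u \<in> pts X. q u \<in> \<Union>K} = \<Union>((\<lambda>S. {u \<in> pts X. q u \<in> S}) ` K)"
      by (intro set_eqI) auto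
    moreover have "openin (ftop X) (\<Union>((\<lambda>S. {u \<in> pts X. q u \<in> S}) ` K))"
      by (rule openin_Union) (use K in blast)
    ultimately show "openin (ftop X) {u \<in> pts X. q u \<in> \<Union>K}" by (simp only:)
  qed
  have "istopology ?P"
    unfolding istopology_def
  proof (rule conjI)
    show "\<forall>S T. ?P S \<longrightarrow> ?P T \<longrightarrow> ?P (S \<inter> T)"
      by (intro allI impI) (rule inter)
    show "\<forall>K. (\<forall>S\<in>K. ?P S) \<longrightarrow> ?P (\<Union>K)"
      by (intro allI impI) (rule union)
  qed
  then show ?thesis
    unfolding quotient_fspace_def by (simp only: fspace.simps topology_inverse')
qed

lemma pts_quotient_fspace: "pts (quotient_fspace X q) = q ` pts X"
proof
  have "{u \<in> pts X. q u \<in> q ` pts X} = pts X" by auto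
  then have "openin (ftop (quotient_fspace X q)) (q ` pts X)"
    by (simp add: openin_quotient_fspace)
  then show "q ` pts X \<subseteq> pts (quotient_fspace X q)" by (rule openin_subset)
  show "pts (quotient_fspace X q) \<subseteq> q ` pts X"
    using openin_quotient_fspace[of X q "pts (quotient_fspace X q)"] by simp
qed

definition irreducible_closed :: "'a topology \<Rightarrow> 'a set \<Rightarrow> bool" where
  "irreducible_closed T Z \<longleftrightarrow> closedin T Z \<and> Z \<noteq> {} \<and>
     (\<forall>A B. closedin T A \<longrightarrow> closedin T B \<longrightarrow> Z \<subseteq> A \<union> B \<longrightarrow> Z \<subseteq> A \<or> Z \<subseteq> B)"

definition krull_dim :: "'a topology \<Rightarrow> enat" where
  "krull_dim T = Sup {enat k |k. \<exists>Z. (\<forall>i\<le>k. irreducible_closed T (Z i)) \<and> (\<forall>i<k. Z i \<subset> Z (Suc i))}"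

definition is_curve :: "'a fspace \<Rightarrow> 'a set \<Rightarrow> bool" where
  "is_curve X C \<longleftrightarrow> irreducible_closed (ftop X) C \<and> krull_dim (subtopology (ftop X) C) = 1"


section \<open>Local rings and multiplicities\<close>

text \<open>
  The local ring at \<open>p\<close> is \<open>stalk X p\<close> modulo \<open>germ_eq X p\<close>. Ideals are represented by their
  preimages in \<open>stalk X p\<close>, i.e. by sets of functions closed under equality of germs.
\<close>

definition germ_eq :: "'a fspace \<Rightarrow> 'a \<Rightarrow> ('a \<Rightarrow> complex) \<Rightarrow> ('a \<Rightarrow> complex) \<Rightarrow> bool" where
  "germ_eq X p f g \<longleftrightarrow> (\<exists>U. openin (ftop X) U \<and> p \<in> U \<and> (\<forall>y\<in>U. f y = g y))"

definition stalk :: "'a fspace \<Rightarrow> 'a \<Rightarrow> ('a \<Rightarrow> complex) set" where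
  "stalk X p = {f. \<exists>U. openin (ftop X) U \<and> p \<in> U \<and> f \<in> reg X U}"

definition max_ideal :: "'a fspace \<Rightarrow> 'a \<Rightarrow> ('a \<Rightarrow> complex) set" where
  "max_ideal X p = {f \<in> stalk X p. f p = 0}"

definition principal_ideal :: "'a fspace \<Rightarrow> 'a \<Rightarrow> ('a \<Rightarrow> complex) \<Rightarrow> ('a \<Rightarrow> complex) set" where
  "principal_ideal X p a = {f \<in> stalk X p. \<exists>h\<in>stalk X p. germ_eq X p f (\<lambda>y. a y * h y)}"

definition vanishing_ideal :: "'a fspace \<Rightarrow> 'a set \<Rightarrow> 'a \<Rightarrow> ('a \<Rightarrow> complex) set" where
  "vanishing_ideal X D p =
     {f \<in> stalk X p. \<exists>U. openin (ftop X) U \<and> p \<in> U \<and> (\<forall>y\<in>U \<inter> D. f y = 0)}"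

global_interpretation fun_vs: vector_space "\<lambda>(c::complex) (f::'a \<Rightarrow> complex) y. c * f y"
  by unfold_locales (auto simp: fun_eq_iff algebra_simps)

text \<open>
  Functions with zero germ at \<open>p\<close> lie in every \<open>max_ideal_power X p k\<close>: such a function is its own
  product with the function that is 0 on a neighbourhood of \<open>p\<close> and 1 elsewhere.
\<close>

fun max_ideal_power :: "'a fspace \<Rightarrow> 'a \<Rightarrow> nat \<Rightarrow> ('a \<Rightarrow> complex) set" where
  "max_ideal_power X p 0 = stalk X p"
| "max_ideal_power X p (Suc k) =
     fun_vs.span {\<lambda>y. f y * g y |f g. f \<in> max_ideal X p \<and> g \<in> max_ideal_power X p k}"

text \<open>
  The dimension over the complex numbers of the local ring at \<open>p\<close> modulo the ideal \<open>J\<close>. It is only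
  used where this dimension is finite.
\<close>

definition colength :: "'a fspace \<Rightarrow> 'a \<Rightarrow> ('a \<Rightarrow> complex) set \<Rightarrow> nat" where
  "colength X p J = (LEAST k. \<exists>B. finite B \<and> card B = k \<and> B \<subseteq> stalk X p \<and>
                               stalk X p \<subseteq> fun_vs.span (B \<union> J))"

text \<open>
  The Hilbert-Samuel multiplicity of the local ring of \<open>C\<close> at \<open>p\<close>. Since this ring has dimension
  one, the sequence is convergent, so that the upper limit is the limit.
\<close>

definition mult_at :: "'a fspace \<Rightarrow> 'a set \<Rightarrow> 'a \<Rightarrow> real" where
  "mult_at X C p = real_of_ereal (limsup (\<lambda>k.
     ereal (real (colength (subspace_of X C) p (max_ideal_power (subspace_of X C) p k)) / real k)))"


section \<open>Line bundles and their degrees on curves\<close>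

text \<open>
  A line bundle is given by trivialising neighbourhoods and transition functions. It is no loss of
  generality to index the trivialising cover by the points of the space, \<open>nbh L p\<close> being a
  neighbourhood of \<open>p\<close>. A section \<open>s\<close> satisfies \<open>s p = trans_fun L p q * s q\<close>.
\<close>

record 'a line_bundle_data =
  nbh :: "'a \<Rightarrow> 'a set"
  trans_fun :: "'a \<Rightarrow> 'a \<Rightarrow> 'a \<Rightarrow> complex"

definition line_bundle :: "'a fspace \<Rightarrow> 'a line_bundle_data \<Rightarrow> bool" where
  "line_bundle X L \<longleftrightarrow>
     (\<forall>p\<in>pts X. openin (ftop X) (nbh L p) \<and> p \<in> nbh L p) \<and>
     (\<forall>p\<in>pts X. \<forall>q\<in>pts X. trans_fun L p q \<in> reg X (nbh L p \<inter> nbh L q)) \<and>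
     (\<forall>p\<in>pts X. \<forall>y\<in>nbh L p. trans_fun L p p y = 1) \<and>
     (\<forall>p\<in>pts X. \<forall>q\<in>pts X. \<forall>r\<in>pts X. \<forall>y\<in>nbh L p \<inter> nbh L q \<inter> nbh L r.
        trans_fun L p q y * trans_fun L q r y = trans_fun L p r y)"

definition restrict_bundle :: "'a line_bundle_data \<Rightarrow> 'a set \<Rightarrow> 'a line_bundle_data" where
  "restrict_bundle L Y = \<lparr>nbh = (\<lambda>p. nbh L p \<inter> Y), trans_fun = trans_fun L\<rparr>"

definition rational_section ::
    "'a fspace \<Rightarrow> 'a line_bundle_data \<Rightarrow> 'a set \<Rightarrow> ('a \<Rightarrow> 'a \<Rightarrow> complex) \<Rightarrow> bool" where
  "rational_section X L W s \<longleftrightarrow> openin (ftop X) W \<and> W \<noteq> {} \<and>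
     (\<forall>p\<in>pts X. s p \<in> reg X (W \<inter> nbh L p)) \<and>
     (\<forall>p\<in>pts X. \<forall>q\<in>pts X. \<forall>y\<in>W \<inter> nbh L p \<inter> nbh L q. s p y = trans_fun L p q y * s q y) \<and>
     (\<exists>p\<in>pts X. \<exists>y\<in>W \<inter> nbh L p. s p y \<noteq> 0)"

text \<open>
  The order at \<open>p\<close> of a nonzero rational function on a curve, given as a regular function \<open>h\<close> on a
  nonempty open set \<open>W\<close>: write \<open>h = a / b\<close> with \<open>a\<close> and \<open>b\<close> in the local ring at \<open>p\<close>. The curve may
  be singular at \<open>p\<close>.
\<close>

definition order_at :: "'a fspace \<Rightarrow> 'a \<Rightarrow> 'a set \<Rightarrow> ('a \<Rightarrow> complex) \<Rightarrow> int" where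
  "order_at X p W h = (THE d. \<exists>U a b. openin (ftop X) U \<and> p \<in> U \<and> a \<in> reg X U \<and> b \<in> reg X U \<and>
     \<not> germ_eq X p a (\<lambda>_. 0) \<and> \<not> germ_eq X p b (\<lambda>_. 0) \<and>
     (\<forall>y\<in>U \<inter> W. b y * h y = a y) \<and>
     d = int (colength X p (principal_ideal X p a)) - int (colength X p (principal_ideal X p b)))"

text \<open>
  The degree of a line bundle on a complete irreducible curve, computed with any nonzero rational
  section. The sum runs over the finite set of zeros and poles.
\<close>

definition degree_of :: "'a fspace \<Rightarrow> 'a line_bundle_data \<Rightarrow> int" where
  "degree_of X L = (THE d. \<exists>W s. rational_section X L W s \<and>
     d = (\<Sum>p | p \<in> pts X \<and> order_at X p (W \<inter> nbh L p) (s p) \<noteq> 0.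
            order_at X p (W \<inter> nbh L p) (s p)))"

definition intersection_number :: "'a fspace \<Rightarrow> 'a line_bundle_data \<Rightarrow> 'a set \<Rightarrow> int" where
  "intersection_number X L C = degree_of (subspace_of X C) (restrict_bundle L C)"

definition nef :: "'a fspace \<Rightarrow> 'a line_bundle_data \<Rightarrow> bool" where
  "nef X L \<longleftrightarrow> (\<forall>C. is_curve X C \<longrightarrow> 0 \<le> intersection_number X L C)"

definition seshadri :: "'a fspace \<Rightarrow> 'a line_bundle_data \<Rightarrow> 'a \<Rightarrow> real" where
  "seshadri X L x =
     Inf {real_of_int (intersection_number X L C) / mult_at X C x |C. is_curve X C \<and> x \<in> C}"

text \<open>
  \<open>L\<close> is the line bundle of the reduced effective divisor with support \<open>D\<close>: it has a section \<open>s\<close>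
  whose scheme of zeros is \<open>D\<close>.
\<close>

definition is_divisor_bundle :: "'a fspace \<Rightarrow> 'a set \<Rightarrow> 'a line_bundle_data \<Rightarrow> bool" where
  "is_divisor_bundle X D L \<longleftrightarrow> line_bundle X L \<and>
     (\<exists>s. (\<forall>p\<in>pts X. s p \<in> reg X (nbh L p)) \<and>
          (\<forall>p\<in>pts X. \<forall>q\<in>pts X. \<forall>y\<in>nbh L p \<inter> nbh L q. s p y = trans_fun L p q y * s q y) \<and>
          (\<forall>p\<in>pts X. vanishing_ideal X D p = principal_ideal X p (s p)))"

definition divisor_bundle :: "'a fspace \<Rightarrow> 'a set \<Rightarrow> 'a line_bundle_data" where
  "divisor_bundle X D = (SOME L. is_divisor_bundle X D L)"

text \<open>Numerical equivalence of \<open>L\<close> with the divisor that is the sum of the \<open>a i\<close> times \<open>D i\<close>.\<close>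

definition num_equiv_divisor ::
    "'a fspace \<Rightarrow> 'a line_bundle_data \<Rightarrow> 'i set \<Rightarrow> ('i \<Rightarrow> int) \<Rightarrow> ('i \<Rightarrow> 'a set) \<Rightarrow> bool" where
  "num_equiv_divisor X L I a D \<longleftrightarrow> (\<forall>C. is_curve X C \<longrightarrow>
     intersection_number X L C = (\<Sum>i\<in>I. a i * intersection_number X (divisor_bundle X (D i)) C))"


section \<open>Bott towers\<close>

text \<open>The value of \<open>u\<close> at \<open>i\<close> is the pair \<open>(z_i, w_i)\<close>; unused indices carry \<open>(0, 0)\<close>.\<close>

type_synonym coords = "nat \<Rightarrow> complex \<times> complex"

definition cox_points :: "nat \<Rightarrow> coords set" where
  "cox_points n = {u. (\<forall>i\<in>{1..n}. u i \<noteq> (0, 0)) \<and> (\<forall>i. i \<notin> {1..n} \<longrightarrow> u i = (0, 0))}"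

inductive poly_fun :: "nat \<Rightarrow> (coords \<Rightarrow> complex) \<Rightarrow> bool" for n where
  const: "poly_fun n (\<lambda>u. k)"
| z_coord: "i \<in> {1..n} \<Longrightarrow> poly_fun n (\<lambda>u. fst (u i))"
| w_coord: "i \<in> {1..n} \<Longrightarrow> poly_fun n (\<lambda>u. snd (u i))"
| add: "poly_fun n P \<Longrightarrow> poly_fun n Q \<Longrightarrow> poly_fun n (\<lambda>u. P u + Q u)"
| mult: "poly_fun n P \<Longrightarrow> poly_fun n Q \<Longrightarrow> poly_fun n (\<lambda>u. P u * Q u)"

definition cox_space :: "nat \<Rightarrow> coords fspace" where
  "cox_space n = \<lparr>ftop = topology_generated_by {{u \<in> cox_points n. P u \<noteq> 0} |P. poly_fun n P},
     reg = (\<lambda>V. {f. \<forall>u\<in>V. \<exists>P Q. poly_fun n P \<and> poly_fun n Q \<and> Q u \<noteq> 0 \<and>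
                          (\<forall>v\<in>V. Q v \<noteq> 0 \<longrightarrow> f v = P v / Q v)})\<rparr>"

definition torus_act :: "(nat \<Rightarrow> nat \<Rightarrow> int) \<Rightarrow> nat \<Rightarrow> (nat \<Rightarrow> complex) \<Rightarrow> coords \<Rightarrow> coords" where
  "torus_act c n t u = (\<lambda>i. if i \<in> {1..n}
     then ((\<Prod>k\<in>{1..<i}. t k powi (- c k i)) * t i * fst (u i), t i * snd (u i)) else (0, 0))"

definition bott_point :: "(nat \<Rightarrow> nat \<Rightarrow> int) \<Rightarrow> nat \<Rightarrow> coords \<Rightarrow> coords set" where
  "bott_point c n u = {torus_act c n t u |t. \<forall>i\<in>{1..n}. t i \<noteq> 0}"

definition bott_tower :: "(nat \<Rightarrow> nat \<Rightarrow> int) \<Rightarrow> nat \<Rightarrow> coords set fspace" where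
  "bott_tower c n = quotient_fspace (cox_space n) (bott_point c n)"

lemma pts_cox_space: "pts (cox_space n) = cox_points n"
proof -
  have "cox_points n = {u \<in> cox_points n. (1::complex) \<noteq> 0}" by simp
  then have "cox_points n \<in> {{u \<in> cox_points n. P u \<noteq> 0} |P. poly_fun n P}"
    using poly_fun.const[of n 1] unfolding mem_Collect_eq
    by (intro exI[of _ "\<lambda>_. 1"] conjI)
  then have "cox_points n \<subseteq> \<Union>{{u \<in> cox_points n. P u \<noteq> 0} |P. poly_fun n P}"
    by (rule Union_upper)
  moreover have "\<Union>{{u \<in> cox_points n. P u \<noteq> 0} |P. poly_fun n P} \<subseteq> cox_points n"
    by auto
  ultimately show ?thesis
    unfolding cox_space_def fspace.simps topology_generated_by_topspace by (rule equalityI[rotated])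
qed

lemma pts_bott_tower: "pts (bott_tower c n) = bott_point c n ` cox_points n"
  by (simp add: bott_tower_def pts_quotient_fspace pts_cox_space)

definition trunc_coords :: "nat \<Rightarrow> coords \<Rightarrow> coords" where
  "trunc_coords m u = (\<lambda>i. if i \<in> {1..m} then u i else (0, 0))"

text \<open>
  The composite \<open>X_n \<rightarrow> X_m\<close> of the maps of the tower. It forgets all but the first \<open>m\<close> coordinate
  pairs, which turns an orbit in \<open>cox_points n\<close> into an orbit in \<open>cox_points m\<close>.
\<close>

definition bott_proj :: "nat \<Rightarrow> coords set \<Rightarrow> coords set" where
  "bott_proj m x = trunc_coords m ` x"

lemma bott_proj_bott_point:
  assumes "m \<le> n"
  shows "bott_proj m (bott_point c n u) = bott_point c m (trunc_coords m u)"
proof (intro equalityI subsetI)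
  have act: "trunc_coords m (torus_act c n t u) = torus_act c m t (trunc_coords m u)" for t
    using assms by (intro ext) (simp add: trunc_coords_def torus_act_def)
  have point_iff: "v \<in> bott_point c k w \<longleftrightarrow> (\<exists>t. v = torus_act c k t w \<and> (\<forall>i\<in>{1..k}. t i \<noteq> 0))" for v k w
    unfolding bott_point_def mem_Collect_eq by (rule refl)
  {
    fix v assume "v \<in> bott_proj m (bott_point c n u)"
    then obtain w where w: "w \<in> bott_point c n u" "v = trunc_coords m w"
      unfolding bott_proj_def by (elim imageE) simp
    from w(1) obtain t where t: "w = torus_act c n t u" "\<forall>i\<in>{1..n}. t i \<noteq> 0"
      unfolding point_iff by (elim exE conjE) simp
    have "v = torus_act c m t (trunc_coords m u)" unfolding w(2) t(1) by (rule act)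
    moreover have "\<forall>i\<in>{1..m}. t i \<noteq> 0" using t(2) assms by simp
    ultimately show "v \<in> bott_point c m (trunc_coords m u)"
      unfolding point_iff by (intro exI[of _ t] conjI)
  }
  fix v assume "v \<in> bott_point c m (trunc_coords m u)"
  then obtain t where t: "v = torus_act c m t (trunc_coords m u)" "\<forall>i\<in>{1..m}. t i \<noteq> 0"
    unfolding point_iff by (elim exE conjE) simp
  define t' where "t' = (\<lambda>i. if i \<in> {1..m} then t i else 1)"
  have t': "t' i = t i" if "i \<in> {1..m}" for i using that by (simp add: t'_def)
  have "torus_act c m t' (trunc_coords m u) i = torus_act c m t (trunc_coords m u) i" for i
  proof (cases "i \<in> {1..m}")
    case True
    then have "(\<Prod>k\<in>{1..<i}. t' k powi (- c k i)) = (\<Prod>k\<in>{1..<i}. t k powi (- c k i))"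
      by (intro prod.cong refl) (simp add: t')
    with True t'[OF True] show ?thesis by (simp add: torus_act_def)
  qed (auto simp: torus_act_def)
  then have "v = trunc_coords m (torus_act c n t' u)"
    unfolding t(1) act by (intro ext) (rule sym)
  moreover have "\<forall>i\<in>{1..n}. t' i \<noteq> 0" using t(2) by (simp add: t'_def)
  then have "torus_act c n t' u \<in> bott_point c n u"
    unfolding point_iff by (intro exI[of _ t'] conjI refl)
  ultimately show "v \<in> bott_proj m (bott_point c n u)"
    unfolding bott_proj_def by (rule image_eqI)
qed

definition bott_divisor :: "(nat \<Rightarrow> nat \<Rightarrow> int) \<Rightarrow> nat \<Rightarrow> nat \<Rightarrow> coords set set" where
  "bott_divisor c n i = {bott_point c n u |u. u \<in> cox_points n \<and> snd (u i) = 0}"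

definition bott_fibre :: "(nat \<Rightarrow> nat \<Rightarrow> int) \<Rightarrow> nat \<Rightarrow> coords set \<Rightarrow> coords set set" where
  "bott_fibre c n x = {y \<in> pts (bott_tower c n). bott_proj 1 y = bott_proj 1 x}"

definition bott_Gamma :: "(nat \<Rightarrow> nat \<Rightarrow> int) \<Rightarrow> nat \<Rightarrow> coords set set" where
  "bott_Gamma c n = {bott_point c n u |u. u \<in> cox_points n \<and> (\<forall>i\<in>{2..n}. u i = (0, 1))}"

end

theory Submission
  imports Defs "HOL-Computational_Algebra.Fundamental_Theorem_Algebra"
begin

text \<open>
  If a form \<open>f\<close> in the Cox coordinates, of the weight of \<open>w\<^sub>i\<close>, does not vanish on a curve \<open>C\<close>, then
  \<open>D\<^sub>i \<cdot> C\<close> is the number \<open>N f\<close> of its zeros on \<open>C\<close>, counted with multiplicity. This number depends on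
  the weight \<open>\<alpha>\<close> only, because the forms of weight \<open>k \<alpha>\<close>, restricted to \<open>C\<close>, span a space whose
  dimension grows like \<open>k\<close> times \<open>N f\<close>.

  Let \<open>C\<close> pass through \<open>x\<close> and not lie in the fibre through \<open>x\<close>. The equation of this fibre has the
  weight of \<open>w\<^sub>1\<close>, hence the multiplicity of \<open>C\<close> at \<open>x\<close> is at most \<open>D\<^sub>1 \<cdot> C\<close>. Let \<open>k\<close> be the largest
  index for which \<open>z\<^sub>k\<close> does not vanish on \<open>C\<close>; if \<open>k \<le> 1\<close> or there is no such index, then \<open>C\<close> is \<open>\<Gamma>\<close>.
  If \<open>k \<ge> 2\<close>, the product of \<open>z\<^sub>k\<close> and forms of the weights of the \<open>w\<^sub>l\<close>, \<open>l < k\<close>, each taken \<open>c\<^sub>l\<^sub>k > 0\<close>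
  times, has the weight of \<open>w\<^sub>k\<close>, so that \<open>D\<^sub>1 \<cdot> C \<le> D\<^sub>k \<cdot> C\<close>. Since all \<open>a\<^sub>i\<close> are nonnegative, \<open>L \<cdot> C\<close> is
  at least \<open>a\<^sub>k\<close> times the multiplicity of \<open>C\<close> at \<open>x\<close>. As \<open>z\<^sub>i\<close> vanishes at \<open>x\<close> for \<open>i > k\<close>, the value \<open>a\<^sub>k\<close> is
  already attained in the fibre, by a fibre of \<open>X\<^sub>k \<rightarrow> X\<^sub>k\<^sub>-\<^sub>1\<close> that is embedded by the sections of the tower.
\<close>

section \<open>Codimension of subspaces of function spaces\<close>

text \<open>Curves, degrees and multiplicities come as bare definitions (Krull dimension,
  \<open>THE\<close>, \<open>LEAST\<close>, an upper limit), so every number has to be pinned down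
  from scratch, and codimension in function spaces is the common currency. Krull dimension one
  becomes algebra in the form that a function not vanishing on the curve generates an ideal of
  finite codimension: otherwise there would be a prime ideal of infinite codimension and, by the
  Nullstellensatz, an irreducible set strictly between a point and the curve. Finite generation,
  too, is always drawn from finite codimension. The claim that \<open>N f\<close> depends on the
  weight only is where completeness of the curve enters: a quotient of two forms of equal weight
  without poles is constant, because it acts on a finite-dimensional space of forms restricted to
  the curve. Curves may be singular, so orders of vanishing are lengths over local rings, additive
  under products. The multiplicity is bounded by such an order because \<open>f^k\<close> lies in
  the \<open>k\<close>-th power of the maximal ideal; its lower bound 1, which permits dividing by
  it, comes from Nakayama's lemma.\<close>

definition fincod :: "('a \<Rightarrow> complex) set \<Rightarrow> ('a \<Rightarrow> complex) set \<Rightarrow> bool" where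
  "fincod M J \<longleftrightarrow> (\<exists>B. finite B \<and> B \<subseteq> M \<and> M \<subseteq> fun_vs.span (B \<union> J))"

text \<open>The dimension of \<open>M\<close> modulo \<open>J\<close>, in the shape of
  \<open>colength\<close>, so that a colength is literally a \<open>codim\<close> of a stalk. As
  there, the value is meaningful only under \<open>fincod\<close>.\<close>

definition codim :: "('a \<Rightarrow> complex) set \<Rightarrow> ('a \<Rightarrow> complex) set \<Rightarrow> nat" where
  "codim M J = (LEAST k. \<exists>B. finite B \<and> card B = k \<and> B \<subseteq> M \<and> M \<subseteq> fun_vs.span (B \<union> J))"

text \<open>Linear independence of the images in the quotient by \<open>J\<close>, without forming
  the quotient. Distinct members then have distinct images, since two congruent members would each
  lie in the span of the other and \<open>J\<close>.\<close>

definition indep_mod :: "('a \<Rightarrow> complex) set \<Rightarrow> ('a \<Rightarrow> complex) set \<Rightarrow> bool" where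
  "indep_mod J B \<longleftrightarrow> (\<forall>b\<in>B. b \<notin> fun_vs.span ((B - {b}) \<union> J))"

definition lin :: "(('a \<Rightarrow> complex) \<Rightarrow> ('b \<Rightarrow> complex)) \<Rightarrow> bool" where
  "lin T \<longleftrightarrow> (\<forall>f g. T (f + g) = T f + T g) \<and> (\<forall>c f. T (\<lambda>y. c * f y) = (\<lambda>y. c * T f y))"

lemma subspaceI:
  assumes "(\<lambda>_. 0) \<in> S" "\<And>f g. f \<in> S \<Longrightarrow> g \<in> S \<Longrightarrow> (\<lambda>y. f y + g y) \<in> S"
    "\<And>c f. f \<in> S \<Longrightarrow> (\<lambda>y. c * f y) \<in> S"
  shows "fun_vs.subspace S"
  using assms unfolding fun_vs.subspace_def by (simp add: zero_fun_def plus_fun_def)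

lemma subspace_0': "fun_vs.subspace S \<Longrightarrow> (\<lambda>_. 0) \<in> S"
  using fun_vs.subspace_0[of S] by (simp add: zero_fun_def)

lemma subspace_add': "fun_vs.subspace S \<Longrightarrow> f \<in> S \<Longrightarrow> g \<in> S \<Longrightarrow> (\<lambda>y. f y + g y) \<in> S"
  using fun_vs.subspace_add[of S f g] by (simp add: plus_fun_def)

lemma subspace_diff': "fun_vs.subspace S \<Longrightarrow> f \<in> S \<Longrightarrow> g \<in> S \<Longrightarrow> (\<lambda>y. f y - g y) \<in> S"
  using fun_vs.subspace_diff[of S f g] by (simp add: fun_diff_def)

lemma subspace_scale': "fun_vs.subspace S \<Longrightarrow> f \<in> S \<Longrightarrow> (\<lambda>y. c * f y) \<in> S"
  by (rule fun_vs.subspace_scale)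

lemma subspace_sum':
  assumes "fun_vs.subspace S" "\<And>i. i \<in> A \<Longrightarrow> f i \<in> S"
  shows "(\<lambda>y. \<Sum>i\<in>A. f i y) \<in> S"
proof -
  have "(\<lambda>y. \<Sum>i\<in>A. f i y) = sum f A"
    by (induction A rule: infinite_finite_induct) (auto simp: fun_eq_iff)
  then show ?thesis using fun_vs.subspace_sum[OF assms(1), of A f] assms(2) by simp
qed

lemma span_eq_sum:
  assumes "finite B" "x \<in> fun_vs.span B"
  obtains c where "x = (\<lambda>y. \<Sum>b\<in>B. c b * b y)"
proof -
  obtain c where c: "x = (\<Sum>b\<in>B. (\<lambda>y. c b * b y))"
    using assms fun_vs.span_finite[of B] by auto
  have "(\<Sum>b\<in>B. (\<lambda>y. c b * b y)) = (\<lambda>y. \<Sum>b\<in>B. c b * b y)"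
    by (induction B rule: infinite_finite_induct) (auto simp: fun_eq_iff)
  with c that show ?thesis by simp
qed

lemma span_Un_subspaceE:
  assumes "fun_vs.subspace J" "x \<in> fun_vs.span (B \<union> J)"
  obtains a j where "a \<in> fun_vs.span B" "j \<in> J" "x = (\<lambda>y. a y + j y)"
proof -
  have "fun_vs.span J = J" using assms(1) by (simp add: fun_vs.span_eq_iff)
  then have "x \<in> {a + j |a j. a \<in> fun_vs.span B \<and> j \<in> J}"
    using assms(2) fun_vs.span_Un[of B J] by (simp only:)
  then show ?thesis using that by (auto simp: plus_fun_def)
qed

lemma span_finite_subset:
  assumes "x \<in> fun_vs.span S"
  obtains T where "finite T" "T \<subseteq> S" "x \<in> fun_vs.span T"
proof -
  obtain t r where t: "finite t" "t \<subseteq> S" "x = (\<Sum>a\<in>t. (\<lambda>y. r a * a y))"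
    using assms unfolding fun_vs.span_explicit by auto
  have "x \<in> fun_vs.span t"
    unfolding t(3) by (intro fun_vs.span_sum fun_vs.span_scale fun_vs.span_base)
  with t that show ?thesis by blast
qed

lemma span_finite_subset_set:
  assumes "finite B" "B \<subseteq> fun_vs.span S"
  obtains T where "finite T" "T \<subseteq> S" "B \<subseteq> fun_vs.span T"
proof -
  have "\<forall>b\<in>B. \<exists>T. finite T \<and> T \<subseteq> S \<and> b \<in> fun_vs.span T"
    using assms(2) span_finite_subset by (metis subset_iff)
  then obtain T where T: "\<And>b. b \<in> B \<Longrightarrow> finite (T b) \<and> T b \<subseteq> S \<and> b \<in> fun_vs.span (T b)"
    by metis
  have "B \<subseteq> fun_vs.span (\<Union>(T ` B))"
  proof
    fix b assume b: "b \<in> B"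
    then have "fun_vs.span (T b) \<subseteq> fun_vs.span (\<Union>(T ` B))" by (intro fun_vs.span_mono) auto
    with T[OF b] show "b \<in> fun_vs.span (\<Union>(T ` B))" by auto
  qed
  with T assms(1) show ?thesis by (intro that[of "\<Union>(T ` B)"]) auto
qed

lemma span_UnI:
  assumes "A \<subseteq> fun_vs.span (B \<union> J)" "J' \<subseteq> fun_vs.span (B \<union> J)"
  shows "fun_vs.span (A \<union> J') \<subseteq> fun_vs.span (B \<union> J)"
  using assms by (intro fun_vs.span_minimal) auto

lemma indep_mod_subset: "indep_mod J B \<Longrightarrow> A \<subseteq> B \<Longrightarrow> indep_mod J A"
  unfolding indep_mod_def
proof
  fix b assume *: "\<forall>b\<in>B. b \<notin> fun_vs.span (B - {b} \<union> J)" "A \<subseteq> B" "b \<in> A"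
  then have "fun_vs.span (A - {b} \<union> J) \<subseteq> fun_vs.span (B - {b} \<union> J)" by (intro fun_vs.span_mono) auto
  with * show "b \<notin> fun_vs.span (A - {b} \<union> J)" by blast
qed

lemma indep_mod_insert:
  assumes "indep_mod J B" "x \<notin> fun_vs.span (B \<union> J)"
  shows "indep_mod J (insert x B)"
  unfolding indep_mod_def
proof
  fix b assume b: "b \<in> insert x B"
  have xB: "x \<notin> B" using assms(2) fun_vs.span_base[of x "B \<union> J"] by auto
  show "b \<notin> fun_vs.span ((insert x B - {b}) \<union> J)"
  proof (cases "b = x")
    case True
    then have "insert x B - {b} = B" using xB by auto
    with True assms(2) show ?thesis by simp
  next
    case False
    then have bB: "b \<in> B" and eq: "(insert x B - {b}) \<union> J = insert x ((B - {b}) \<union> J)"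
      "insert b ((B - {b}) \<union> J) = B \<union> J"
      using b by auto
    have nb: "b \<notin> fun_vs.span ((B - {b}) \<union> J)" using assms(1) bB unfolding indep_mod_def by blast
    show ?thesis
    proof
      assume "b \<in> fun_vs.span ((insert x B - {b}) \<union> J)"
      then have "x \<in> fun_vs.span (insert b ((B - {b}) \<union> J))"
        unfolding eq(1) by (rule fun_vs.in_span_insert[OF _ nb])
      with eq(2) assms(2) show False by simp
    qed
  qed
qed

text \<open>Brings the ordinary exchange bound into reach: independence modulo \<open>J\<close>
  becomes plain independence once independent vectors of \<open>J\<close> are adjoined.\<close>

lemma indep_mod_independent:
  assumes "finite B" "indep_mod J B" "fun_vs.independent J0" "J0 \<subseteq> J"
  shows "fun_vs.independent (B \<union> J0)"
  using assms(1,2)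
proof (induction B rule: finite_induct)
  case empty then show ?case using assms(3) by simp
next
  case (insert b B)
  have "indep_mod J B" using indep_mod_subset[OF insert.prems] by blast
  then have "fun_vs.independent (B \<union> J0)" by (rule insert.IH)
  moreover have "b \<notin> fun_vs.span (B \<union> J)"
    using insert.prems insert.hyps unfolding indep_mod_def by (metis Diff_insert_absorb insertI1)
  then have "b \<notin> fun_vs.span (B \<union> J0)"
    using fun_vs.span_mono[of "B \<union> J0" "B \<union> J"] assms(4) by blast
  ultimately show ?case using fun_vs.independent_insertI by fastforce
qed

text \<open>Steinitz exchange in the quotient. A basis \<open>J0\<close> of \<open>J\<close> may be
  infinite, so only the finite part \<open>J1\<close> that occurs when \<open>B\<close> is written
  in terms of \<open>D\<close> and \<open>J0\<close> is added to both sides and then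
  cancelled.\<close>

lemma indep_mod_card_le:
  assumes B: "finite B" "indep_mod J B" and D: "finite D" "B \<subseteq> fun_vs.span (D \<union> J)"
  shows "card B \<le> card D"
proof -
  obtain J0 where J0: "J0 \<subseteq> J" "fun_vs.independent J0" "J \<subseteq> fun_vs.span J0"
    using fun_vs.maximal_independent_subset by blast
  have ind: "fun_vs.independent (B \<union> J0)"
    using indep_mod_independent B J0 by blast
  have "fun_vs.span (D \<union> J) \<subseteq> fun_vs.span (D \<union> J0)"
    using J0(3) fun_vs.span_mono[of J0 "D \<union> J0"] fun_vs.span_superset[of "D \<union> J0"]
    by (intro span_UnI) auto
  then have "B \<subseteq> fun_vs.span (D \<union> J0)" using D(2) by blast
  then obtain T where T: "finite T" "T \<subseteq> D \<union> J0" "B \<subseteq> fun_vs.span T"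
    using span_finite_subset_set B(1) by metis
  define J1 where "J1 = T \<inter> J0"
  have J1: "finite J1" "J1 \<subseteq> J0" using T by (auto simp: J1_def)
  have "fun_vs.span T \<subseteq> fun_vs.span (D \<union> J1)"
    by (rule fun_vs.span_mono) (use T J1_def in auto)
  then have sub: "B \<union> J1 \<subseteq> fun_vs.span (D \<union> J1)"
    using T(3) fun_vs.span_superset[of "D \<union> J1"] by auto
  have "fun_vs.independent (B \<union> J1)"
    using fun_vs.independent_mono[OF ind] J1 by blast
  from fun_vs.independent_span_bound[OF _ this sub]
  have "card (B \<union> J1) \<le> card (D \<union> J1)" using D(1) J1(1) by blast
  also have "\<dots> \<le> card D + card J1" by (rule card_Un_le)
  finally have le: "card (B \<union> J1) \<le> card D + card J1" .
  have "B \<inter> J1 = {}"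
  proof (rule ccontr)
    assume "B \<inter> J1 \<noteq> {}"
    then obtain b where "b \<in> B" "b \<in> J" using J1 J0 by blast
    then have "b \<in> fun_vs.span ((B - {b}) \<union> J)" by (intro fun_vs.span_base) auto
    with B(2) \<open>b \<in> B\<close> show False unfolding indep_mod_def by blast
  qed
  with le B(1) J1(1) show ?thesis by (simp add: card_Un_disjoint)
qed

text \<open>A spanning set of least size is independent modulo \<open>J\<close>, since a redundant
  member could be dropped.\<close>

lemma codim_basis:
  assumes "fincod M J"
  obtains B where "finite B" "B \<subseteq> M" "M \<subseteq> fun_vs.span (B \<union> J)" "indep_mod J B" "card B = codim M J"
proof -
  let ?P = "\<lambda>k. \<exists>B. finite B \<and> card B = k \<and> B \<subseteq> M \<and> M \<subseteq> fun_vs.span (B \<union> J)"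
  have "\<exists>k. ?P k" using assms unfolding fincod_def by blast
  then have "?P (codim M J)" unfolding codim_def by (rule LeastI_ex)
  then obtain B where B: "finite B" "card B = codim M J" "B \<subseteq> M" "M \<subseteq> fun_vs.span (B \<union> J)" by blast
  have "indep_mod J B"
    unfolding indep_mod_def
  proof (intro ballI notI)
    fix b assume b: "b \<in> B" "b \<in> fun_vs.span ((B - {b}) \<union> J)"
    have "fun_vs.span (B \<union> J) \<subseteq> fun_vs.span ((B - {b}) \<union> J)"
    proof (rule span_UnI)
      show "B \<subseteq> fun_vs.span (B - {b} \<union> J)"
        using b(2) fun_vs.span_superset[of "(B - {b}) \<union> J"] by blast
      show "J \<subseteq> fun_vs.span (B - {b} \<union> J)" using fun_vs.span_superset[of "(B - {b}) \<union> J"] by blast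
    qed
    then have "?P (card (B - {b}))" using B by (intro exI[of _ "B - {b}"]) auto
    then have "codim M J \<le> card (B - {b})" unfolding codim_def by (rule Least_le)
    moreover have "card (B - {b}) < card B" using B(1) b(1) by (rule card_Diff1_less)
    ultimately show False using B(2) by simp
  qed
  with B that show ?thesis by blast
qed

lemma codim_le_card:
  assumes "finite B" "B \<subseteq> M" "M \<subseteq> fun_vs.span (B \<union> J)"
  shows "codim M J \<le> card B"
  unfolding codim_def by (rule Least_le) (use assms in blast)

lemma fincodI: "finite B \<Longrightarrow> B \<subseteq> M \<Longrightarrow> M \<subseteq> fun_vs.span (B \<union> J) \<Longrightarrow> fincod M J"
  unfolding fincod_def by blast

lemma indep_card_le_codim:
  assumes "fincod M J" "finite B" "B \<subseteq> M" "indep_mod J B"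
  shows "card B \<le> codim M J"
proof -
  obtain D where D: "finite D" "M \<subseteq> fun_vs.span (D \<union> J)" "card D = codim M J"
    using codim_basis[OF assms(1)] by metis
  have "card B \<le> card D" by (rule indep_mod_card_le[OF assms(2,4) D(1)]) (use D assms in blast)
  with D show ?thesis by simp
qed

lemma codim_eqI:
  assumes "finite B" "B \<subseteq> M" "M \<subseteq> fun_vs.span (B \<union> J)" "indep_mod J B"
  shows "codim M J = card B"
  using codim_le_card[OF assms(1-3)] indep_card_le_codim[OF fincodI assms(1,2,4)] assms by (meson le_antisym)

text \<open>An independent set of largest size spans. Finiteness is obtained this way for subspaces
  and for sources of linear maps, where no spanning set is at hand.\<close>

lemma fincod_bounded:
  assumes "\<And>B. finite B \<Longrightarrow> B \<subseteq> M \<Longrightarrow> indep_mod J B \<Longrightarrow> card B \<le> k"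
  shows "fincod M J" "codim M J \<le> k"
proof -
  let ?P = "\<lambda>m. \<exists>B. finite B \<and> B \<subseteq> M \<and> indep_mod J B \<and> card B = m"
  have "?P 0" by (intro exI[of _ "{}"]) (simp add: indep_mod_def)
  then have "\<exists>m. ?P m \<and> (\<forall>m'. ?P m' \<longrightarrow> m' \<le> m)"
    using assms by (intro Nat.ex_has_greatest_nat[where b = k]) auto
  then obtain B where B: "finite B" "B \<subseteq> M" "indep_mod J B" "\<And>m'. ?P m' \<Longrightarrow> m' \<le> card B" by blast
  have "M \<subseteq> fun_vs.span (B \<union> J)"
  proof (rule ccontr)
    assume "\<not> M \<subseteq> fun_vs.span (B \<union> J)"
    then obtain x where x: "x \<in> M" "x \<notin> fun_vs.span (B \<union> J)" by blast
    then have "x \<notin> B" using fun_vs.span_base[of x "B \<union> J"] by auto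
    have "?P (Suc (card B))"
      using indep_mod_insert[OF B(3) x(2)] B(1,2) x(1) \<open>x \<notin> B\<close>
      by (intro exI[of _ "insert x B"]) auto
    from B(4)[OF this] show False by simp
  qed
  with B assms[OF B(1-3)] show "fincod M J" "codim M J \<le> k"
    using codim_eqI fincodI by metis+
qed

lemma fincod_mono:
  assumes "fincod M J" "J \<subseteq> I"
  shows "fincod M I"
proof -
  obtain B where B: "finite B" "B \<subseteq> M" "M \<subseteq> fun_vs.span (B \<union> J)" using assms(1) unfolding fincod_def by auto
  have "fun_vs.span (B \<union> J) \<subseteq> fun_vs.span (B \<union> I)" using assms(2) by (intro fun_vs.span_mono) auto
  then show ?thesis using fincodI[of B M I] B by simp
qed

lemma codim_antimono:
  assumes "fincod M J" "J \<subseteq> I"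
  shows "codim M I \<le> codim M J"
proof -
  obtain B where B: "finite B" "B \<subseteq> M" "M \<subseteq> fun_vs.span (B \<union> J)" "card B = codim M J"
    using codim_basis[OF assms(1)] by metis
  have "fun_vs.span (B \<union> J) \<subseteq> fun_vs.span (B \<union> I)" using assms(2) by (intro fun_vs.span_mono) auto
  then show ?thesis using codim_le_card[of B M I] B by auto
qed

lemma fincod_subset: "fincod M J \<Longrightarrow> I \<subseteq> M \<Longrightarrow> fincod I J"
  by (rule fincod_bounded(1)[where k = "codim M J"]) (meson indep_card_le_codim order_trans)

text \<open>A combination that lies in \<open>I\<close> and has a nonzero coefficient could be
  solved for the corresponding member of \<open>B\<close>.\<close>

lemma indep_mod_span_disjoint:
  assumes "finite B" "indep_mod I B" "x \<in> fun_vs.span B" "x \<in> I" "fun_vs.subspace I"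
  shows "x = (\<lambda>_. 0)"
proof -
  obtain c where c: "x = (\<lambda>y. \<Sum>b\<in>B. c b * b y)" using span_eq_sum[OF assms(1,3)] .
  have "c b = 0" if b: "b \<in> B" for b
  proof (rule ccontr)
    assume cb: "c b \<noteq> 0"
    let ?S = "fun_vs.span ((B - {b}) \<union> I)"
    have "b = (\<lambda>y. (1 / c b) * (x y - (\<Sum>b'\<in>B - {b}. c b' * b' y)))"
    proof
      fix y
      have "x y = c b * b y + (\<Sum>b'\<in>B - {b}. c b' * b' y)"
        unfolding c using assms(1) b by (rule sum.remove)
      then show "b y = (1 / c b) * (x y - (\<Sum>b'\<in>B - {b}. c b' * b' y))" using cb by simp
    qed
    also have "\<dots> \<in> ?S"
      by (intro subspace_scale' subspace_diff' subspace_sum' fun_vs.subspace_span fun_vs.span_base)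
        (use assms(4) in \<open>auto intro: fun_vs.span_base\<close>)
    finally show False using assms(2) b unfolding indep_mod_def by blast
  qed
  then show ?thesis unfolding c by simp
qed

text \<open>A basis of \<open>M\<close> modulo \<open>I\<close> and a basis of \<open>I\<close>
  modulo \<open>J\<close> together form a basis of \<open>M\<close> modulo \<open>J\<close>.\<close>

lemma codim_trans:
  assumes "fincod M I" "fincod I J" "J \<subseteq> I" "I \<subseteq> M" "fun_vs.subspace I" "fun_vs.subspace J"
  shows "fincod M J" "codim M J = codim M I + codim I J"
proof -
  obtain B where B: "finite B" "B \<subseteq> M" "M \<subseteq> fun_vs.span (B \<union> I)" "indep_mod I B" "card B = codim M I"
    using codim_basis[OF assms(1)] .
  obtain D where D: "finite D" "D \<subseteq> I" "I \<subseteq> fun_vs.span (D \<union> J)" "indep_mod J D" "card D = codim I J"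
    using codim_basis[OF assms(2)] .
  have BI: "B \<inter> I = {}"
  proof (rule ccontr)
    assume "B \<inter> I \<noteq> {}"
    then obtain b where b: "b \<in> B" "b \<in> I" by blast
    then have "b \<in> fun_vs.span ((B - {b}) \<union> I)" by (intro fun_vs.span_base) auto
    with B(4) b show False unfolding indep_mod_def by blast
  qed
  have span: "M \<subseteq> fun_vs.span (B \<union> D \<union> J)"
  proof -
    have "fun_vs.span (D \<union> J) \<subseteq> fun_vs.span (B \<union> D \<union> J)" by (intro fun_vs.span_mono) auto
    then have "fun_vs.span (B \<union> I) \<subseteq> fun_vs.span (B \<union> D \<union> J)"
      using D(3) fun_vs.span_superset[of "B \<union> D \<union> J"] by (intro span_UnI) auto
    with B(3) show ?thesis by blast
  qed
  have ind: "indep_mod J (B \<union> D)"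
    unfolding indep_mod_def
  proof (intro ballI notI)
    fix b assume b: "b \<in> B \<union> D" and bs: "b \<in> fun_vs.span ((B \<union> D - {b}) \<union> J)"
    show False
    proof (cases "b \<in> B")
      case True
      have "fun_vs.span ((B \<union> D - {b}) \<union> J) \<subseteq> fun_vs.span ((B - {b}) \<union> I)"
        using D(2) assms(3) by (intro fun_vs.span_mono) auto
      with bs B(4) True show False unfolding indep_mod_def by blast
    next
      case False
      then have bD: "b \<in> D" using b by blast
      have "b \<in> fun_vs.span (B \<union> fun_vs.span ((D - {b}) \<union> J))"
        using bs fun_vs.span_mono[of "(B \<union> D - {b}) \<union> J" "B \<union> fun_vs.span ((D - {b}) \<union> J)"]
          fun_vs.span_superset[of "(D - {b}) \<union> J"] by blast
      then obtain x j where x: "x \<in> fun_vs.span B" "j \<in> fun_vs.span ((D - {b}) \<union> J)" "b = (\<lambda>y. x y + j y)"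
        by (rule span_Un_subspaceE[OF fun_vs.subspace_span])
      have "fun_vs.span ((D - {b}) \<union> J) \<subseteq> I"
        using D(2) assms(3,5) by (intro fun_vs.span_minimal) auto
      then have "j \<in> I" using x by blast
      have "x = (\<lambda>y. b y - j y)" using x(3) by (auto simp: fun_eq_iff)
      also have "\<dots> \<in> I" using \<open>j \<in> I\<close> bD D(2) assms(5) by (intro subspace_diff') auto
      finally have "x = (\<lambda>_. 0)" using indep_mod_span_disjoint[OF B(1,4) x(1)] assms(5) by blast
      then have "b = j" using x(3) by simp
      with x(2) D(4) bD show False unfolding indep_mod_def by blast
    qed
  qed
  have sub: "B \<union> D \<subseteq> M" using B(2) D(2) assms(4) by blast
  show "fincod M J" using fincodI[OF _ sub span] B(1) D(1) by blast
  have "codim M J = card (B \<union> D)" using codim_eqI[OF _ sub span ind] B(1) D(1) by blast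
  also have "\<dots> = card B + card D" using B(1) D(1) BI D(2) by (intro card_Un_disjoint) auto
  finally show "codim M J = codim M I + codim I J" using B(5) D(5) by simp
qed

section \<open>Codimension under linear maps\<close>

lemma lin_0: "lin T \<Longrightarrow> T (\<lambda>_. 0) = (\<lambda>_. 0)"
proof -
  assume "lin T"
  then have "T (\<lambda>y. 0 * (0::'a \<Rightarrow> complex) y) = (\<lambda>y. 0 * T 0 y)" unfolding lin_def by blast
  then show ?thesis by simp
qed

lemma lin_add: "lin T \<Longrightarrow> T (\<lambda>y. f y + g y) = (\<lambda>y. T f y + T g y)"
  unfolding lin_def plus_fun_def by blast

lemma lin_scale: "lin T \<Longrightarrow> T (\<lambda>y. c * f y) = (\<lambda>y. c * T f y)"
  unfolding lin_def by blast

lemma lin_diff: "lin T \<Longrightarrow> T (\<lambda>y. f y - g y) = (\<lambda>y. T f y - T g y)"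
  using lin_add[of T f "\<lambda>y. -1 * g y"] lin_scale[of T "-1" g] by simp

lemma subspace_vimage:
  assumes "lin T" "fun_vs.subspace S" "fun_vs.subspace M"
  shows "fun_vs.subspace {x \<in> M. T x \<in> S}"
  by (rule subspaceI) (use assms in \<open>auto simp: lin_0 lin_add lin_scale intro: subspace_0' subspace_add' subspace_scale'\<close>)

lemma subspace_image:
  assumes "lin T" "fun_vs.subspace S"
  shows "fun_vs.subspace (T ` S)"
proof (rule subspaceI)
  show "(\<lambda>_. 0) \<in> T ` S" using lin_0[OF assms(1)] subspace_0'[OF assms(2)] by (metis image_eqI)
next
  fix f g assume "f \<in> T ` S" "g \<in> T ` S"
  then obtain x y where xy: "x \<in> S" "y \<in> S" "f = T x" "g = T y" by blast
  then have "T (\<lambda>z. x z + y z) \<in> T ` S" using subspace_add'[OF assms(2)] by blast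
  then show "(\<lambda>z. f z + g z) \<in> T ` S" using xy by (simp add: lin_add[OF assms(1)])
next
  fix c f assume "f \<in> T ` S"
  then obtain x where x: "x \<in> S" "f = T x" by blast
  then have "T (\<lambda>z. c * x z) \<in> T ` S" using subspace_scale'[OF assms(2)] by blast
  then show "(\<lambda>z. c * f z) \<in> T ` S" using x by (simp add: lin_scale[OF assms(1)])
qed

lemma lin_span:
  assumes "lin T"
  shows "T ` fun_vs.span S \<subseteq> fun_vs.span (T ` S)"
proof -
  have "fun_vs.span S \<subseteq> {x \<in> UNIV. T x \<in> fun_vs.span (T ` S)}"
    by (intro fun_vs.span_minimal subspace_vimage assms fun_vs.subspace_span fun_vs.subspace_UNIV)
      (auto intro: fun_vs.span_base)
  then show ?thesis by auto
qed

text \<open>Independence modulo \<open>J\<close> is carried over by \<open>T\<close>, because a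
  combination that \<open>T\<close> sends into \<open>J'\<close> already lies in
  \<open>J\<close>.\<close>

lemma codim_le_map:
  assumes T: "lin T" "T ` M \<subseteq> M'" and J: "{x \<in> M. T x \<in> J'} \<subseteq> J"
    and sub: "fun_vs.subspace M" "fun_vs.subspace J'" "fun_vs.subspace J" and fin: "fincod M' J'"
  shows "fincod M J" "codim M J \<le> codim M' J'"
proof -
  have "card B \<le> codim M' J'" if B: "finite B" "B \<subseteq> M" "indep_mod J B" for B
  proof -
    have key: "False" if "b \<in> B" "x \<in> fun_vs.span (B - {b})" "j \<in> J'" "T b = (\<lambda>y. T x y + j y)" for b x j
    proof -
      have "fun_vs.span (B - {b}) \<subseteq> M" using B(2) sub(1) by (intro fun_vs.span_minimal) auto
      then have "(\<lambda>y. b y - x y) \<in> M" using that B(2) sub(1) by (intro subspace_diff') auto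
      moreover have "T (\<lambda>y. b y - x y) \<in> J'" using that(3,4) by (simp add: lin_diff[OF T(1)])
      ultimately have d: "(\<lambda>y. b y - x y) \<in> J" using J by blast
      have "b = (\<lambda>y. (b y - x y) + x y)" by auto
      also have "\<dots> \<in> fun_vs.span ((B - {b}) \<union> J)"
        using d that(2) fun_vs.span_mono[of "B - {b}" "(B - {b}) \<union> J"]
        by (intro subspace_add' fun_vs.subspace_span) (auto intro: fun_vs.span_base)
      finally show False using B(3) that(1) unfolding indep_mod_def by blast
    qed
    have inj: "inj_on T B"
    proof
      fix b b' assume b: "b \<in> B" "b' \<in> B" "T b = T b'"
      show "b = b'"
      proof (rule ccontr)
        assume "b \<noteq> b'"
        then have "b' \<in> fun_vs.span (B - {b})" using b by (intro fun_vs.span_base) auto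
        from key[OF b(1) this subspace_0'[OF sub(2)]] b(3) show False by simp
      qed
    qed
    have "indep_mod J' (T ` B)"
      unfolding indep_mod_def
    proof (intro ballI notI)
      fix t assume "t \<in> T ` B" and s: "t \<in> fun_vs.span ((T ` B - {t}) \<union> J')"
      then obtain b where b: "b \<in> B" "t = T b" by blast
      obtain a j where a: "a \<in> fun_vs.span (T ` B - {t})" "j \<in> J'" "t = (\<lambda>y. a y + j y)"
        using span_Un_subspaceE[OF sub(2) s] .
      have "T ` B - {t} = T ` (B - {b})" using inj b by (auto simp: inj_on_def)
      moreover have "fun_vs.span (T ` (B - {b})) \<subseteq> T ` fun_vs.span (B - {b})"
      proof (rule fun_vs.span_minimal)
        show "T ` (B - {b}) \<subseteq> T ` fun_vs.span (B - {b})" by (intro image_mono fun_vs.span_superset)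
        show "fun_vs.subspace (T ` fun_vs.span (B - {b}))" by (rule subspace_image[OF T(1) fun_vs.subspace_span])
      qed
      ultimately obtain x where x: "x \<in> fun_vs.span (B - {b})" "a = T x" using a(1) by auto
      show False by (rule key[OF b(1) x(1) a(2)]) (use a(3) b(2) x(2) in simp)
    qed
    then have "card (T ` B) \<le> codim M' J'"
      using B T(2) by (intro indep_card_le_codim[OF fin]) auto
    then show ?thesis using card_image[OF inj] by simp
  qed
  then show "fincod M J" "codim M J \<le> codim M' J'"
    using fincod_bounded[of M J "codim M' J'"] by blast+
qed

text \<open>\<open>T\<close> induces a surjection from \<open>M\<close> modulo \<open>J\<close> onto
  \<open>M'\<close> modulo \<open>J'\<close>, so the image of a spanning set spans.\<close>

lemma codim_map_ge:
  assumes T: "lin T" "T ` M \<subseteq> M'" "M' \<subseteq> fun_vs.span (T ` M \<union> J')" and J: "T ` J \<subseteq> J'"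
    and fin: "fincod M J"
  shows "fincod M' J'" "codim M' J' \<le> codim M J"
proof -
  obtain B where B: "finite B" "B \<subseteq> M" "M \<subseteq> fun_vs.span (B \<union> J)" "card B = codim M J"
    using codim_basis[OF fin] by metis
  have "T ` M \<subseteq> T ` fun_vs.span (B \<union> J)" using B(3) by blast
  also have "\<dots> \<subseteq> fun_vs.span (T ` (B \<union> J))" by (rule lin_span[OF T(1)])
  also have "\<dots> \<subseteq> fun_vs.span (T ` B \<union> J')" by (rule fun_vs.span_mono) (use J in auto)
  finally have "fun_vs.span (T ` M \<union> J') \<subseteq> fun_vs.span (T ` B \<union> J')"
    using fun_vs.span_superset[of "T ` B \<union> J'"] by (intro span_UnI) auto
  then have s: "M' \<subseteq> fun_vs.span (T ` B \<union> J')" using T(3) by blast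
  have TB: "finite (T ` B)" "T ` B \<subseteq> M'" using B(1,2) T(2) by auto
  show "fincod M' J'" by (rule fincodI[OF TB s])
  have "codim M' J' \<le> card (T ` B)" by (rule codim_le_card[OF TB s])
  also have "\<dots> \<le> card B" by (rule card_image_le[OF B(1)])
  finally show "codim M' J' \<le> codim M J" using B(4) by simp
qed

section \<open>Linear dependence forced by finite or countable dimension\<close>

text \<open>The family is indexed and may repeat values, and the relation comes with nonzero
  coefficients on a nonempty \<open>F\<close>. In this form the powers of one element yield a
  nonzero polynomial.\<close>

lemma fincod_dependent:
  assumes fin: "fincod M J" and J: "fun_vs.subspace J" and L: "infinite L"
    and a: "\<And>i. i \<in> L \<Longrightarrow> a i \<in> M"
  obtains F c where "finite F" "F \<subseteq> L" "F \<noteq> {}" "\<And>i. i \<in> F \<Longrightarrow> c i \<noteq> 0" "(\<lambda>y. \<Sum>i\<in>F. c i * a i y) \<in> J"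
proof -
  obtain F0 where F0: "finite F0" "F0 \<subseteq> L" "card F0 = Suc (codim M J)"
    using infinite_arbitrarily_large[OF L] by blast
  have "\<exists>c. (\<exists>i\<in>F0. c i \<noteq> 0) \<and> (\<lambda>y. \<Sum>i\<in>F0. c i * a i y) \<in> J"
  \<comment> \<open>\<open>indep_mod\<close> speaks of sets and cannot see repetitions, so two
    indices with equal values are treated apart, by the coefficients 1 and -1.\<close>
  proof (cases "inj_on a F0")
    case False
    then obtain i j where ij: "i \<in> F0" "j \<in> F0" "i \<noteq> j" "a i = a j" by (auto simp: inj_on_def)
    define c where "c = (\<lambda>k. if k = i then 1 else if k = j then -1 else (0::complex))"
    have "(\<Sum>k\<in>F0. c k * a k y) = 0" for y
    proof -
      have "(\<Sum>k\<in>F0. c k * a k y) = (\<Sum>k\<in>{i,j}. c k * a k y)"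
        by (rule sum.mono_neutral_right) (use F0 ij in \<open>auto simp: c_def\<close>)
      also have "\<dots> = 0" using ij by (simp add: c_def)
      finally show ?thesis .
    qed
    then have "(\<lambda>y. \<Sum>i\<in>F0. c i * a i y) \<in> J" using subspace_0'[OF J] by simp
    moreover have "\<exists>i\<in>F0. c i \<noteq> 0" using ij by (auto simp: c_def)
    ultimately show ?thesis by blast
  next
    case True
    have "\<not> indep_mod J (a ` F0)"
    proof
      assume "indep_mod J (a ` F0)"
      moreover have "finite (a ` F0)" "a ` F0 \<subseteq> M" using F0 a by auto
      ultimately have "card (a ` F0) \<le> codim M J" using indep_card_le_codim[OF fin] by blast
      with F0(3) card_image[OF True] show False by simp
    qed
    then obtain i where i: "i \<in> F0" "a i \<in> fun_vs.span ((a ` F0 - {a i}) \<union> J)"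
      unfolding indep_mod_def by auto
    have eq: "a ` F0 - {a i} = a ` (F0 - {i})" using True i(1) by (auto simp: inj_on_def)
    obtain x j where x: "x \<in> fun_vs.span (a ` (F0 - {i}))" "j \<in> J" "a i = (\<lambda>y. x y + j y)"
      using span_Un_subspaceE[OF J i(2)] unfolding eq by metis
    obtain d where d: "x = (\<lambda>y. \<Sum>b\<in>a ` (F0 - {i}). d b * b y)"
      using span_eq_sum[OF _ x(1)] F0(1) by blast
    define c where "c = (\<lambda>k. if k = i then 1 else - d (a k))"
    have "(\<Sum>k\<in>F0. c k * a k y) = j y" for y
    proof -
      have "x y = (\<Sum>k\<in>F0 - {i}. d (a k) * a k y)"
        unfolding d using True by (subst sum.reindex) (auto intro: inj_on_subset)
      moreover have "(\<Sum>k\<in>F0. c k * a k y) = a i y + (\<Sum>k\<in>F0 - {i}. - (d (a k) * a k y))"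
        using i(1) F0(1) by (subst sum.remove[OF _ i(1)]) (auto simp: c_def)
      ultimately show ?thesis using fun_cong[OF x(3), of y] by (simp add: sum_negf)
    qed
    then have "(\<lambda>y. \<Sum>i\<in>F0. c i * a i y) \<in> J" using x(2) by simp
    moreover have "c i \<noteq> 0" by (simp add: c_def)
    ultimately show ?thesis using i(1) by blast
  qed
  then obtain c where c: "\<exists>i\<in>F0. c i \<noteq> 0" "(\<lambda>y. \<Sum>i\<in>F0. c i * a i y) \<in> J" by blast
  define F where "F = {i \<in> F0. c i \<noteq> 0}"
  have "(\<Sum>i\<in>F0. c i * a i y) = (\<Sum>i\<in>F. c i * a i y)" for y
    by (rule sum.mono_neutral_right) (use F0 in \<open>auto simp: F_def\<close>)
  with c F0 show ?thesis by (intro that[of F c]) (auto simp: F_def)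
qed

text \<open>Pigeonhole: a countable \<open>E\<close> has only countably many finite subsets, so a
  single finite subset spans infinitely many of the vectors.\<close>

lemma uncountable_dependent:
  assumes L: "uncountable L" and E: "countable E" and a: "\<And>i. i \<in> L \<Longrightarrow> a i \<in> fun_vs.span E"
  obtains F c where "finite F" "F \<subseteq> L" "F \<noteq> {}" "\<And>i. i \<in> F \<Longrightarrow> c i \<noteq> 0" "\<And>y. (\<Sum>i\<in>F. c i * a i y) = 0"
proof -
  have "\<forall>i\<in>L. \<exists>T. finite T \<and> T \<subseteq> E \<and> a i \<in> fun_vs.span T"
    using a span_finite_subset by metis
  then obtain T where T: "\<And>i. i \<in> L \<Longrightarrow> finite (T i) \<and> T i \<subseteq> E \<and> a i \<in> fun_vs.span (T i)" by metis
  have "T ` L \<subseteq> {A. A \<subseteq> E \<and> finite A}" using T by auto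
  then have cT: "countable (T ` L)"
    using countable_Collect_finite_subset[OF E] countable_subset by (simp add: conj_commute countable_subset)
  have "\<exists>D\<in>T ` L. infinite {i \<in> L. T i = D}"
  proof (rule ccontr)
    assume "\<not> ?thesis"
    then have "countable (\<Union>D\<in>T ` L. {i \<in> L. T i = D})"
      using cT by (intro countable_UN) (auto intro: countable_finite)
    moreover have "(\<Union>D\<in>T ` L. {i \<in> L. T i = D}) = L" by auto
    ultimately show False using L by simp
  qed
  then obtain D where D: "D \<in> T ` L" "infinite {i \<in> L. T i = D}" by blast
  then have fD: "finite D" using T by auto
  have fc: "fincod (fun_vs.span D) {\<lambda>_. 0}"
    by (rule fincodI[OF fD fun_vs.span_superset]) (rule fun_vs.span_mono, auto)
  have sub: "fun_vs.subspace {\<lambda>_::'b. 0::complex}" by (rule subspaceI) auto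
  have aD: "a i \<in> fun_vs.span D" if "i \<in> {i \<in> L. T i = D}" for i using T that by auto
  show ?thesis
  proof (rule fincod_dependent[OF fc sub D(2) aD])
    fix F c assume "finite F" "F \<subseteq> {i \<in> L. T i = D}" "F \<noteq> {}" "\<And>i. i \<in> F \<Longrightarrow> c i \<noteq> 0"
      "(\<lambda>y. \<Sum>i\<in>F. c i * a i y) \<in> {\<lambda>_. 0}"
    then show thesis by (intro that[of F c]) (auto simp: fun_eq_iff)
  qed
qed

section \<open>Ideals of polynomial functions\<close>

lemma poly_fun_subspace: "fun_vs.subspace (Collect (poly_fun n))"
  by (rule subspaceI) (auto intro: poly_fun.intros)

lemma poly_fun_diff: "poly_fun n P \<Longrightarrow> poly_fun n Q \<Longrightarrow> poly_fun n (\<lambda>u. P u - Q u)"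
  using subspace_diff'[OF poly_fun_subspace, of P n Q] by simp

lemma poly_fun_scale: "poly_fun n P \<Longrightarrow> poly_fun n (\<lambda>u. c * P u)"
  by (intro poly_fun.intros)

lemma poly_fun_prod: "(\<And>i. i \<in> A \<Longrightarrow> poly_fun n (f i)) \<Longrightarrow> poly_fun n (\<lambda>u. \<Prod>i\<in>A. f i u)"
  by (induction A rule: infinite_finite_induct) (auto intro: poly_fun.intros)

lemma poly_fun_power: "poly_fun n P \<Longrightarrow> poly_fun n (\<lambda>u. P u ^ k)"
  by (induction k) (auto intro: poly_fun.intros)

lemma poly_fun_poly: "poly_fun n P \<Longrightarrow> poly_fun n (\<lambda>u. poly R (P u))"
  by (induction R) (auto intro: poly_fun.intros)

lemma lin_mult: "lin (\<lambda>f u. P u * f u)"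
  unfolding lin_def by (auto simp: fun_eq_iff algebra_simps)

definition pideal :: "nat \<Rightarrow> (coords \<Rightarrow> complex) set \<Rightarrow> bool" where
  "pideal n J \<longleftrightarrow> fun_vs.subspace J \<and> J \<subseteq> Collect (poly_fun n) \<and>
     (\<forall>P f. poly_fun n P \<longrightarrow> f \<in> J \<longrightarrow> (\<lambda>u. P u * f u) \<in> J)"

lemma pideal_subspace: "pideal n J \<Longrightarrow> fun_vs.subspace J"
  and pideal_poly: "pideal n J \<Longrightarrow> f \<in> J \<Longrightarrow> poly_fun n f"
  and pideal_mult: "pideal n J \<Longrightarrow> poly_fun n P \<Longrightarrow> f \<in> J \<Longrightarrow> (\<lambda>u. P u * f u) \<in> J"
  unfolding pideal_def by auto

text \<open>The sum of \<open>J\<close> and the principal ideal of \<open>y\<close>.\<close>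

definition adj_ideal :: "nat \<Rightarrow> (coords \<Rightarrow> complex) set \<Rightarrow> (coords \<Rightarrow> complex) \<Rightarrow> (coords \<Rightarrow> complex) set" where
  "adj_ideal n J y = {\<lambda>u. j u + y u * b u |j b. j \<in> J \<and> poly_fun n b}"

lemma adj_idealI: "j \<in> J \<Longrightarrow> poly_fun n b \<Longrightarrow> (\<And>u. f u = j u + y u * b u) \<Longrightarrow> f \<in> adj_ideal n J y"
  unfolding adj_ideal_def by blast

lemma adj_idealE:
  assumes "f \<in> adj_ideal n J y"
  obtains j b where "j \<in> J" "poly_fun n b" "\<And>u. f u = j u + y u * b u"
  using assms unfolding adj_ideal_def by auto

lemma pideal_adj:
  assumes J: "pideal n J" and y: "poly_fun n y"
  shows "pideal n (adj_ideal n J y)" "J \<subseteq> adj_ideal n J y" "y \<in> adj_ideal n J y"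
proof -
  note sub = pideal_subspace[OF J]
  have z: "(\<lambda>_. 0) \<in> J" by (rule subspace_0'[OF sub])
  show "J \<subseteq> adj_ideal n J y"
  proof
    fix f assume "f \<in> J"
    then show "f \<in> adj_ideal n J y" by (rule adj_idealI[where b = "\<lambda>_. 0"]) (auto intro: poly_fun.const)
  qed
  show "y \<in> adj_ideal n J y" by (rule adj_idealI[OF z poly_fun.const[of n 1]]) simp
  show "pideal n (adj_ideal n J y)"
    unfolding pideal_def
  proof (intro conjI allI impI)
    show "fun_vs.subspace (adj_ideal n J y)"
    proof (rule subspaceI)
      show "(\<lambda>_. 0) \<in> adj_ideal n J y" by (rule adj_idealI[OF z poly_fun.const[of n 0]]) simp
    next
      fix f g assume "f \<in> adj_ideal n J y" "g \<in> adj_ideal n J y"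
      then obtain j b j' b' where "j \<in> J" "poly_fun n b" "\<And>u. f u = j u + y u * b u"
        "j' \<in> J" "poly_fun n b'" "\<And>u. g u = j' u + y u * b' u" by (elim adj_idealE) blast
      then show "(\<lambda>u. f u + g u) \<in> adj_ideal n J y"
        by (intro adj_idealI[OF subspace_add'[OF sub, of j j'] poly_fun.add[of n b b']]) (auto simp: algebra_simps)
    next
      fix c f assume "f \<in> adj_ideal n J y"
      then obtain j b where "j \<in> J" "poly_fun n b" "\<And>u. f u = j u + y u * b u" by (elim adj_idealE) blast
      then show "(\<lambda>u. c * f u) \<in> adj_ideal n J y"
        by (intro adj_idealI[OF subspace_scale'[OF sub, of j c] poly_fun_scale[of n b c]]) (auto simp: algebra_simps)
    qed
    show "adj_ideal n J y \<subseteq> Collect (poly_fun n)"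
      unfolding adj_ideal_def using pideal_poly[OF J] y by (auto intro!: poly_fun.intros)
    fix P f assume P: "poly_fun n P" and "f \<in> adj_ideal n J y"
    then obtain j b where "j \<in> J" "poly_fun n b" "\<And>u. f u = j u + y u * b u" by (elim adj_idealE) blast
    then show "(\<lambda>u. P u * f u) \<in> adj_ideal n J y"
      by (intro adj_idealI[OF pideal_mult[OF J P, of j] poly_fun.mult[OF P, of b]]) (auto simp: algebra_simps)
  qed
qed

definition coordf :: "bool \<times> nat \<Rightarrow> coords \<Rightarrow> complex" where
  "coordf x u = (if fst x then fst (u (snd x)) else snd (u (snd x)))"

text \<open>Monomials as words in the coordinates. Words form a countable type, which makes the
  spanning set countable; that several words name the same monomial does no harm.\<close>

definition mlist :: "(bool \<times> nat) list \<Rightarrow> coords \<Rightarrow> complex" where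
  "mlist xs u = prod_list (map (\<lambda>x. coordf x u) xs)"

lemma poly_fun_coordf: "snd x \<in> {1..n} \<Longrightarrow> poly_fun n (coordf x)"
  by (cases x; cases "fst x") (auto simp: coordf_def[abs_def] intro: poly_fun.intros)

lemma poly_fun_span_mlist:
  assumes "poly_fun n P"
  shows "P \<in> fun_vs.span (range mlist)"
  using assms
proof induction
  case (const k)
  have "(\<lambda>u. k * mlist [] u) \<in> fun_vs.span (range mlist)"
    by (intro subspace_scale' fun_vs.subspace_span fun_vs.span_base rangeI)
  moreover have "(\<lambda>u. k * mlist [] u) = (\<lambda>u. k)" by (simp add: mlist_def)
  ultimately show ?case by simp
next
  case (z_coord i)
  have "mlist [(True, i)] = (\<lambda>u. fst (u i))" by (auto simp: mlist_def coordf_def)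
  then show ?case using fun_vs.span_base[OF rangeI[of mlist "[(True, i)]"]] by simp
next
  case (w_coord i)
  have "mlist [(False, i)] = (\<lambda>u. snd (u i))" by (auto simp: mlist_def coordf_def)
  then show ?case using fun_vs.span_base[OF rangeI[of mlist "[(False, i)]"]] by simp
next
  case (add P Q)
  then show ?case by (intro subspace_add' fun_vs.subspace_span)
next
  case (mult P Q)
  let ?S = "fun_vs.span (range mlist)"
  have 1: "(\<lambda>u. mlist xs u * f u) \<in> ?S" if f: "f \<in> ?S" for xs f
  proof -
    have "(\<lambda>f u. mlist xs u * f u) ` ?S \<subseteq> fun_vs.span ((\<lambda>f u. mlist xs u * f u) ` range mlist)"
      by (rule lin_span[OF lin_mult])
    also have "\<dots> \<subseteq> ?S"
    proof (rule fun_vs.span_mono, clarify)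
      fix ys
      have "(\<lambda>u. mlist xs u * mlist ys u) = mlist (xs @ ys)" by (simp add: mlist_def[abs_def])
      then show "(\<lambda>u. mlist xs u * mlist ys u) \<in> range mlist" by simp
    qed
    finally show ?thesis using f by blast
  qed
  have "(\<lambda>f u. Q u * f u) ` ?S \<subseteq> fun_vs.span ((\<lambda>f u. Q u * f u) ` range mlist)"
    by (rule lin_span[OF lin_mult])
  also have "\<dots> \<subseteq> ?S"
  proof (rule fun_vs.span_minimal[OF _ fun_vs.subspace_span], clarify)
    fix xs show "(\<lambda>u. Q u * mlist xs u) \<in> ?S" using 1[OF mult.IH(2), of xs] by (simp add: mult.commute)
  qed
  finally show ?case using mult.IH(1) by (auto simp: mult.commute)
qed

section \<open>The Nullstellensatz over the complex numbers\<close>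

text \<open>In a quotient of finite dimension the powers of an element are dependent, so the element
  is algebraic.\<close>

lemma poly_relation:
  assumes "fincod M J" "fun_vs.subspace J" "\<And>k::nat. (\<lambda>u. y u ^ k) \<in> M"
  obtains R where "R \<noteq> 0" "(\<lambda>u. poly R (y u)) \<in> J"
proof (rule fincod_dependent[OF assms(1,2), of "UNIV :: nat set" "\<lambda>k u. y u ^ k"])
  show "infinite (UNIV :: nat set)" by simp
  show "(\<lambda>u. y u ^ i) \<in> M" for i by (rule assms(3))
  fix F :: "nat set" and c assume F: "finite F" "F \<noteq> {}" "\<And>i. i \<in> F \<Longrightarrow> c i \<noteq> 0" "(\<lambda>u. \<Sum>i\<in>F. c i * y u ^ i) \<in> J"
  define R where "R = (\<Sum>i\<in>F. monom (c i) i)"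
  have "poly R x = (\<Sum>i\<in>F. c i * x ^ i)" for x by (simp add: R_def poly_sum poly_monom)
  then have J: "(\<lambda>u. poly R (y u)) \<in> J" using F(4) by simp
  obtain i where i: "i \<in> F" using F(2) by blast
  have "coeff R i = c i" using F(1) i by (simp add: R_def coeff_sum)
  then have "R \<noteq> 0" using F(3)[OF i] by auto
  then show thesis using J by (rule that)
qed

text \<open>\<open>R\<close> splits into linear factors. Modulo \<open>J\<close> each factor
  \<open>y - l\<close> divides a power of \<open>g\<close>, so a root can be removed from
  \<open>R\<close> at the price of raising the exponent of \<open>g\<close>.\<close>

lemma power_in_ideal_of_poly:
  assumes J: "pideal n J" and g: "poly_fun n g" and y: "poly_fun n y"
    and h: "\<And>l. \<exists>k j b. j \<in> J \<and> poly_fun n b \<and> (\<forall>u. g u ^ k = j u + (y u - l) * b u)"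
  shows "R \<noteq> 0 \<Longrightarrow> (\<lambda>u. g u ^ K * poly R (y u)) \<in> J \<Longrightarrow> \<exists>k. (\<lambda>u. g u ^ k) \<in> J"
proof (induction "degree R" arbitrary: R K)
  case 0
  then obtain a where R: "R = [:a:]" "a \<noteq> 0" by (metis degree_eq_zeroE pCons_0_0)
  have "(\<lambda>u. (1 / a) * (g u ^ K * poly R (y u))) \<in> J"
    using 0(3) by (intro subspace_scale'[OF pideal_subspace[OF J]])
  then show ?case using R by (intro exI[of _ K]) simp
next
  case (Suc d)
  have "\<not> (\<exists>a l. a \<noteq> 0 \<and> l = 0 \<and> R = pCons a l)" using Suc(2) by auto
  from fundamental_theorem_of_algebra_alt[OF this] obtain l where l: "poly R l = 0" by blast
  then obtain R' where R': "R = [:-l, 1:] * R'" using poly_eq_0_iff_dvd by (metis dvdE)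
  with Suc(3) have R'0: "R' \<noteq> 0" by auto
  have "degree R = Suc (degree R')" unfolding R' using R'0 by (subst degree_mult_eq) auto
  then have deg: "d = degree R'" using Suc(2) by simp
  obtain k j b where kjb: "j \<in> J" "poly_fun n b" "\<And>u. g u ^ k = j u + (y u - l) * b u" using h[of l] by blast
  have 1: "(\<lambda>u. b u * (g u ^ K * poly R (y u))) \<in> J" by (rule pideal_mult[OF J kjb(2) Suc(4)])
  have 2: "(\<lambda>u. (g u ^ K * poly R' (y u)) * j u) \<in> J"
    by (intro pideal_mult[OF J _ kjb(1)] poly_fun.mult poly_fun_power poly_fun_poly g y)
  have "g u ^ (K + k) * poly R' (y u) = b u * (g u ^ K * poly R (y u)) + (g u ^ K * poly R' (y u)) * j u" for u
    unfolding power_add kjb(3) R' by (simp add: algebra_simps)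
  then have "(\<lambda>u. g u ^ (K + k) * poly R' (y u)) \<in> J"
    using subspace_add'[OF pideal_subspace[OF J] 1 2] by simp
  from Suc(1)[OF deg R'0 this] show ?case .
qed

text \<open>Over an uncountable field, an element of an algebra of countable dimension cannot have
  all its translates invertible unless it is algebraic.\<close>

lemma nullstellensatz_step:
  assumes J: "pideal n J" and g: "poly_fun n g" and y: "poly_fun n y"
    and gJ: "\<And>k. (\<lambda>u. g u ^ k) \<notin> J"
  shows "\<exists>l. \<forall>k. (\<lambda>u. g u ^ k) \<notin> adj_ideal n J (\<lambda>u. y u - l)"
proof (rule ccontr)
  assume "\<not> ?thesis"
  then have "\<forall>l. \<exists>k. (\<lambda>u. g u ^ k) \<in> adj_ideal n J (\<lambda>u. y u - l)" by blast
  then have h: "\<exists>k j b. j \<in> J \<and> poly_fun n b \<and> (\<forall>u. g u ^ k = j u + (y u - l) * b u)" for l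
    by (meson adj_idealE)
  then obtain k j b where kjb: "\<And>l. j l \<in> J" "\<And>l. poly_fun n (b l)" "\<And>l u. g u ^ k l = j l u + (y u - l) * b l u"
    by metis
  \<comment> \<open>The exponents are natural numbers, so uncountably many \<open>l\<close> share
    one of them.\<close>
  have "\<exists>m. uncountable {l. k l = m}"
  proof (rule ccontr)
    assume "\<not> ?thesis"
    then have "countable (\<Union>m. {l. k l = m})" by (intro countable_UN) auto
    moreover have "(\<Union>m. {l. k l = m}) = UNIV" by auto
    ultimately show False using uncountable_UNIV_complex by simp
  qed
  then obtain m where m: "uncountable {l. k l = m}" by blast
  show False
  proof (rule uncountable_dependent[OF m])
    show "countable (range mlist)" by simp
    show "b l \<in> fun_vs.span (range mlist)" for l by (rule poly_fun_span_mlist[OF kjb(2)])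
    fix F c assume F: "finite F" "F \<subseteq> {l. k l = m}" "F \<noteq> {}" "\<And>l. l \<in> F \<Longrightarrow> c l \<noteq> 0"
      "\<And>u. (\<Sum>l\<in>F. c l * b l u) = 0"
    \<comment> \<open>Partial fractions: modulo \<open>J\<close> the function \<open>b l\<close>
      plays the role of \<open>g^m / (y - l)\<close>. Clearing denominators in the relation between
      the \<open>b l\<close> leaves \<open>g^m * R(y)\<close> in \<open>J\<close>.\<close>
    define R where "R = (\<Sum>l\<in>F. smult (c l) (\<Prod>l'\<in>F - {l}. [:-l', 1:]))"
    have R: "poly R x = (\<Sum>l\<in>F. c l * (\<Prod>l'\<in>F - {l}. x - l'))" for x
      by (simp add: R_def poly_sum poly_prod)
    have "g u ^ m * poly R (y u) = (\<Sum>l\<in>F. (c l * (\<Prod>l'\<in>F - {l}. y u - l')) * j l u)" for u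
    proof -
      have "g u ^ m * poly R (y u) = (\<Sum>l\<in>F. (c l * (\<Prod>l'\<in>F - {l}. y u - l')) * g u ^ m)"
        unfolding R by (simp add: sum_distrib_left mult.commute)
      also have "\<dots> = (\<Sum>l\<in>F. (c l * (\<Prod>l'\<in>F - {l}. y u - l')) * j l u + (\<Prod>l'\<in>F. y u - l') * (c l * b l u))"
      proof (rule sum.cong[OF refl])
        fix l assume l: "l \<in> F"
        have 1: "(\<Prod>l'\<in>F. y u - l') = (y u - l) * (\<Prod>l'\<in>F - {l}. y u - l')" using F(1) l by (rule prod.remove)
        have 2: "g u ^ m = j l u + (y u - l) * b l u" using kjb(3)[of u l] F(2) l by auto
        show "(c l * (\<Prod>l'\<in>F - {l}. y u - l')) * g u ^ m =
          (c l * (\<Prod>l'\<in>F - {l}. y u - l')) * j l u + (\<Prod>l'\<in>F. y u - l') * (c l * b l u)"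
          unfolding 1 2 by (simp add: algebra_simps)
      qed
      also have "\<dots> = (\<Sum>l\<in>F. (c l * (\<Prod>l'\<in>F - {l}. y u - l')) * j l u) + (\<Prod>l'\<in>F. y u - l') * (\<Sum>l\<in>F. c l * b l u)"
        by (simp add: sum.distrib sum_distrib_left)
      finally show ?thesis using F(5) by simp
    qed
    moreover have "(\<lambda>u. \<Sum>l\<in>F. (c l * (\<Prod>l'\<in>F - {l}. y u - l')) * j l u) \<in> J"
      by (intro subspace_sum' pideal_subspace[OF J] pideal_mult[OF J _ kjb(1)] poly_fun_scale poly_fun_prod
          poly_fun_diff y poly_fun.const)
    ultimately have inJ: "(\<lambda>u. g u ^ m * poly R (y u)) \<in> J" by simp
    obtain l0 where l0: "l0 \<in> F" using F(3) by blast
    \<comment> \<open>At \<open>l0\<close> only the summand of \<open>l0\<close> survives, and its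
      coefficient is nonzero; hence \<open>R\<close> is not the zero polynomial.\<close>
    have "poly R l0 = (\<Sum>l\<in>{l0}. c l * (\<Prod>l'\<in>F - {l}. l0 - l'))"
      unfolding R
    proof (rule sum.mono_neutral_right[OF F(1)])
      show "\<forall>i\<in>F - {l0}. c i * (\<Prod>l'\<in>F - {i}. l0 - l') = 0"
      proof
        fix i assume "i \<in> F - {l0}"
        then have "(\<Prod>l'\<in>F - {i}. l0 - l') = 0" using F(1) l0 by (intro prod_zero) auto
        then show "c i * (\<Prod>l'\<in>F - {i}. l0 - l') = 0" by simp
      qed
    qed (use l0 in auto)
    also have "\<dots> \<noteq> 0" using F(1,4) l0 by simp
    finally have "R \<noteq> 0" by auto
    from power_in_ideal_of_poly[OF J g y h this inJ] gJ show False by blast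
  qed
qed

text \<open>The differences of the coordinates and suitable constants are adjoined to
  \<open>J\<close> one at a time, always keeping the powers of \<open>g\<close> out. The constants
  are the coordinates of the zero.\<close>

lemma nullstellensatz:
  assumes J: "pideal n J" and g: "poly_fun n g" and gJ: "\<And>k. (\<lambda>u. g u ^ k) \<notin> J"
  obtains u where "\<forall>i. i \<notin> {1..n} \<longrightarrow> u i = (0, 0)" "\<forall>f\<in>J. f u = 0" "g u \<noteq> 0"
proof -
  have step: "X \<subseteq> UNIV \<times> {1..n} \<Longrightarrow> \<exists>J' lam. pideal n J' \<and> J \<subseteq> J' \<and> (\<forall>k. (\<lambda>u. g u ^ k) \<notin> J') \<and>
      (\<forall>x\<in>X. (\<lambda>u. coordf x u - lam x) \<in> J')" if "finite X" for X :: "(bool \<times> nat) set"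
    using that
  proof (induction X rule: finite_induct)
    case empty then show ?case using J gJ by blast
  next
    case (insert x X)
    then obtain J' lam where J': "pideal n J'" "J \<subseteq> J'" "\<forall>k. (\<lambda>u. g u ^ k) \<notin> J'"
      "\<forall>x\<in>X. (\<lambda>u. coordf x u - lam x) \<in> J'" by auto
    have x: "poly_fun n (coordf x)" using insert.prems by (intro poly_fun_coordf) auto
    obtain l where l: "\<forall>k. (\<lambda>u. g u ^ k) \<notin> adj_ideal n J' (\<lambda>u. coordf x u - l)"
      using nullstellensatz_step[OF J'(1) g x] J'(3) by blast
    let ?J = "adj_ideal n J' (\<lambda>u. coordf x u - l)"
    note adj = pideal_adj[OF J'(1) poly_fun_diff[OF x poly_fun.const[of n l]]]
    have "(\<lambda>u. coordf x' u - (lam(x := l)) x') \<in> ?J" if "x' \<in> insert x X" for x'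
      using that adj(2,3) J'(4) insert.hyps(2) by (cases "x' = x") auto
    with adj(1,2) J'(2) l show ?case by (intro exI[of _ ?J] exI[of _ "lam(x := l)"]) auto
  qed
  obtain J' lam where J': "pideal n J'" "J \<subseteq> J'" "\<forall>k. (\<lambda>u. g u ^ k) \<notin> J'"
      "\<forall>x\<in>UNIV \<times> {1..n}. (\<lambda>u. coordf x u - lam x) \<in> J'" using step[of "UNIV \<times> {1..n}"] by auto
  note sub = pideal_subspace[OF J'(1)]
  define u0 :: coords where "u0 = (\<lambda>i. if i \<in> {1..n} then (lam (True, i), lam (False, i)) else (0, 0))"
  \<comment> \<open>Modulo \<open>J'\<close> every polynomial is congruent to its value at
    \<open>u0\<close>. As 1 is not in \<open>J'\<close>, members of \<open>J'\<close> vanish at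
    \<open>u0\<close>, and \<open>g\<close> does not.\<close>
  have ev: "(\<lambda>u. P u - P u0) \<in> J'" if "poly_fun n P" for P
    using that
  proof induction
    case (const k) then show ?case using subspace_0'[OF sub] by simp
  next
    case (z_coord i)
    then have "(True, i) \<in> UNIV \<times> {1..n}" by simp
    from bspec[OF J'(4) this] z_coord show ?case by (simp add: coordf_def u0_def)
  next
    case (w_coord i)
    then have "(False, i) \<in> UNIV \<times> {1..n}" by simp
    from bspec[OF J'(4) this] w_coord show ?case by (simp add: coordf_def u0_def)
  next
    case (add P Q)
    from subspace_add'[OF sub add.IH] show ?case by (simp add: algebra_simps)
  next
    case (mult P Q)
    have 1: "(\<lambda>u. Q u * (P u - P u0)) \<in> J'" by (rule pideal_mult[OF J'(1) mult.hyps(2) mult.IH(1)])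
    have 2: "(\<lambda>u. P u0 * (Q u - Q u0)) \<in> J'" by (rule subspace_scale'[OF sub mult.IH(2)])
    from subspace_add'[OF sub 1 2] show ?case by (simp add: algebra_simps)
  qed
  have one: "(\<lambda>u. 1) \<notin> J'" using spec[OF J'(3), of 0] by simp
  show ?thesis
  proof (rule that[of u0])
    show "\<forall>i. i \<notin> {1..n} \<longrightarrow> u0 i = (0, 0)" by (auto simp: u0_def)
    show "\<forall>f\<in>J. f u0 = 0"
    proof (intro ballI, rule ccontr)
      fix f assume f: "f \<in> J"
      assume ne: "f u0 \<noteq> 0"
      have fJ: "f \<in> J'" using f J'(2) by blast
      have "(\<lambda>u. (1 / f u0) * (f u - (f u - f u0))) \<in> J'"
        by (intro subspace_scale'[OF sub] subspace_diff'[OF sub] fJ ev pideal_poly[OF J'(1)])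
      with ne one show False by simp
    qed
    show "g u0 \<noteq> 0"
    proof
      assume "g u0 = 0"
      with ev[OF g] spec[OF J'(3), of 1] show False by simp
    qed
  qed
qed

section \<open>Prime ideals of infinite codimension\<close>

text \<open>Finite codimension is witnessed by finitely many relations: they express 1 and the
  products of the coordinates with the members of \<open>B\<close>. One member of the chain contains
  all elements of the union that occur in them.\<close>

lemma fincod_chain:
  assumes ch: "\<And>X. X \<in> Ch \<Longrightarrow> pideal n X" "subset.chain A Ch" "Ch \<noteq> {}"
    and fin: "fincod (Collect (poly_fun n)) (\<Union>Ch)"
  obtains X where "X \<in> Ch" "fincod (Collect (poly_fun n)) X"
proof -
  let ?P = "Collect (poly_fun n)"
  obtain B where B: "finite B" "B \<subseteq> ?P" "?P \<subseteq> fun_vs.span (B \<union> \<Union>Ch)"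
    using fin unfolding fincod_def by auto
  define S where "S = insert (\<lambda>_. 1) (\<Union>x\<in>UNIV \<times> {1..n}. (\<lambda>b u. coordf x u * b u) ` B)"
  have "finite S" using B(1) by (auto simp: S_def)
  moreover have "S \<subseteq> fun_vs.span (B \<union> \<Union>Ch)"
  proof (rule order_trans[OF _ B(3)])
    show "S \<subseteq> ?P" using B(2) by (auto simp: S_def intro!: poly_fun.intros poly_fun_coordf)
  qed
  ultimately obtain T where T: "finite T" "T \<subseteq> B \<union> \<Union>Ch" "S \<subseteq> fun_vs.span T"
    by (rule span_finite_subset_set)
  have "finite (T - B)" "T - B \<subseteq> \<Union>Ch" using T by auto
  then obtain X where X: "X \<in> Ch" "T - B \<subseteq> X"
    using ch(3,2) by (rule finite_subset_Union_chain)
  \<comment> \<open>This space contains 1 and is stable under multiplication by every coordinate,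
    hence it contains all polynomial functions.\<close>
  let ?W = "fun_vs.span (B \<union> X)"
  have "fun_vs.span T \<subseteq> ?W" using X(2) by (intro fun_vs.span_mono) auto
  then have SW: "S \<subseteq> ?W" using T(3) by blast
  have Xid: "pideal n X" using ch(1) X(1) .
  have xW: "(\<lambda>u. coordf x u * f u) \<in> ?W" if x: "x \<in> UNIV \<times> {1..n}" and f: "f \<in> ?W" for x f
  proof -
    have "(\<lambda>f u. coordf x u * f u) ` ?W \<subseteq> fun_vs.span ((\<lambda>f u. coordf x u * f u) ` (B \<union> X))"
      by (rule lin_span[OF lin_mult])
    also have "\<dots> \<subseteq> ?W"
    proof (rule fun_vs.span_minimal[OF _ fun_vs.subspace_span], clarify)
      fix b assume b: "b \<in> B \<union> X"
      show "(\<lambda>u. coordf x u * b u) \<in> ?W"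
      proof (cases "b \<in> B")
        case True
        then have "(\<lambda>u. coordf x u * b u) \<in> S" using x by (auto simp: S_def)
        then show ?thesis using SW by blast
      next
        case False
        then have "(\<lambda>u. coordf x u * b u) \<in> X"
          using b x by (intro pideal_mult[OF Xid poly_fun_coordf]) auto
        then show ?thesis by (intro fun_vs.span_base) auto
      qed
    qed
    finally show ?thesis using f by blast
  qed
  have "\<forall>f\<in>?W. (\<lambda>u. P u * f u) \<in> ?W" if "poly_fun n P" for P
    using that
  proof induction
    case (const k) then show ?case by (intro ballI subspace_scale' fun_vs.subspace_span)
  next
    case (z_coord i) then show ?case using xW[of "(True, i)"] by (simp add: coordf_def)
  next
    case (w_coord i) then show ?case using xW[of "(False, i)"] by (simp add: coordf_def)
  next
    case (add P Q)
    show ?case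
    proof
      fix f assume "f \<in> ?W"
      then have "(\<lambda>u. P u * f u + Q u * f u) \<in> ?W" using add.IH by (intro subspace_add' fun_vs.subspace_span) auto
      then show "(\<lambda>u. (P u + Q u) * f u) \<in> ?W" by (simp add: algebra_simps)
    qed
  next
    case (mult P Q)
    show ?case
    proof
      fix f assume "f \<in> ?W"
      from bspec[OF mult.IH(1) bspec[OF mult.IH(2) this]] have "(\<lambda>u. P u * (Q u * f u)) \<in> ?W" .
      then show "(\<lambda>u. (P u * Q u) * f u) \<in> ?W" by (simp add: mult.assoc)
    qed
  qed
  moreover have "(\<lambda>_. 1) \<in> ?W" using SW by (auto simp: S_def)
  ultimately have "?P \<subseteq> ?W" by force
  then show ?thesis using that[OF X(1)] fincodI[OF B(1,2)] by blast
qed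

lemma pideal_Union_chain:
  assumes "\<And>X. X \<in> Ch \<Longrightarrow> pideal n X" "subset.chain A Ch" "Ch \<noteq> {}"
  shows "pideal n (\<Union>Ch)"
  unfolding pideal_def
proof (intro conjI allI impI)
  show "fun_vs.subspace (\<Union>Ch)"
  proof (rule subspaceI)
    obtain X where "X \<in> Ch" using assms(3) by blast
    then show "(\<lambda>_. 0) \<in> \<Union>Ch" using subspace_0'[OF pideal_subspace[OF assms(1)]] by blast
  next
    fix f g assume "f \<in> \<Union>Ch" "g \<in> \<Union>Ch"
    then have "finite {f, g}" "{f, g} \<subseteq> \<Union>Ch" by auto
    then obtain X where "X \<in> Ch" "{f, g} \<subseteq> X" using assms(3,2) by (rule finite_subset_Union_chain)
    then show "(\<lambda>y. f y + g y) \<in> \<Union>Ch" using subspace_add'[OF pideal_subspace[OF assms(1)]] by blast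
  next
    fix c f assume "f \<in> \<Union>Ch"
    then show "(\<lambda>y. c * f y) \<in> \<Union>Ch" using subspace_scale'[OF pideal_subspace[OF assms(1)]] by blast
  qed
  show "\<Union>Ch \<subseteq> Collect (poly_fun n)" using pideal_poly[OF assms(1)] by blast
  fix P f assume "poly_fun n P" "f \<in> \<Union>Ch"
  then show "(\<lambda>u. P u * f u) \<in> \<Union>Ch" using pideal_mult[OF assms(1)] by blast
qed

text \<open>An ideal that is maximal among the ideals of infinite codimension is prime. Zorn's lemma
  applies because ideals of finite codimension are finitely generated.\<close>

lemma ex_prime_infinite_codim:
  assumes J0: "pideal n J0" and inf: "\<not> fincod (Collect (poly_fun n)) J0"
  obtains J where "pideal n J" "J0 \<subseteq> J" "\<not> fincod (Collect (poly_fun n)) J"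
    "\<forall>a b. poly_fun n a \<longrightarrow> poly_fun n b \<longrightarrow> (\<lambda>u. a u * b u) \<in> J \<longrightarrow> a \<in> J \<or> b \<in> J"
proof -
  let ?P = "Collect (poly_fun n)"
  define A where "A = {J. pideal n J \<and> J0 \<subseteq> J \<and> \<not> fincod ?P J}"
  have "\<exists>M\<in>A. \<forall>X\<in>A. M \<subseteq> X \<longrightarrow> X = M"
  proof (rule subset_Zorn_nonempty)
    show "A \<noteq> {}" using assms by (auto simp: A_def)
    fix Ch assume Ch: "Ch \<noteq> {}" "subset.chain A Ch"
    then have sub: "Ch \<subseteq> A" by (simp add: subset.chain_def)
    then have id: "\<And>X. X \<in> Ch \<Longrightarrow> pideal n X" by (auto simp: A_def)
    have "\<not> fincod ?P (\<Union>Ch)"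
    proof
      assume "fincod ?P (\<Union>Ch)"
      from fincod_chain[OF id Ch(2,1) this] obtain X where "X \<in> Ch" "fincod ?P X" by blast
      with sub show False by (auto simp: A_def)
    qed
    moreover have "J0 \<subseteq> \<Union>Ch" using Ch(1) sub by (auto simp: A_def)
    ultimately show "\<Union>Ch \<in> A" using pideal_Union_chain[OF id Ch(2,1)] by (simp add: A_def)
  qed
  then obtain J where JA: "J \<in> A" and max: "\<And>X. X \<in> A \<Longrightarrow> J \<subseteq> X \<Longrightarrow> X = J" by blast
  have J: "pideal n J" "J0 \<subseteq> J" "\<not> fincod ?P J" using JA by (auto simp: A_def)
  note sub = pideal_subspace[OF J(1)]
  have fin: "fincod ?P X" if "pideal n X" "J \<subseteq> X" "x \<in> X" "x \<notin> J" for X x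
  proof (rule ccontr)
    assume "\<not> fincod ?P X"
    then have "X \<in> A" using that J(2) by (auto simp: A_def)
    from max[OF this that(2)] that show False by blast
  qed
  have prime: "a \<in> J \<or> b \<in> J" if ab: "poly_fun n a" "poly_fun n b" "(\<lambda>u. a u * b u) \<in> J" for a b
  proof (rule ccontr)
    assume "\<not> (a \<in> J \<or> b \<in> J)"
    then have na: "a \<notin> J" and nb: "b \<notin> J" by auto
    let ?I = "adj_ideal n J a"
    note adj = pideal_adj[OF J(1) ab(1)]
    have fI: "fincod ?P ?I" by (rule fin[OF adj na])
    \<comment> \<open>The quotient ideal of \<open>J\<close> by \<open>a\<close>. It contains
      \<open>b\<close>, so by maximality both \<open>Q\<close> and \<open>?I\<close> have finite
      codimension. Multiplication by \<open>a\<close> maps all polynomials modulo \<open>Q\<close>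
      onto \<open>?I\<close> modulo \<open>J\<close>, and \<open>J\<close> would have finite
      codimension too.\<close>
    define Q where "Q = {f \<in> ?P. (\<lambda>u. a u * f u) \<in> J}"
    have Q: "pideal n Q"
      unfolding pideal_def
    proof (intro conjI allI impI)
      show "fun_vs.subspace Q"
        unfolding Q_def by (rule subspace_vimage[OF lin_mult sub poly_fun_subspace])
      show "Q \<subseteq> ?P" by (auto simp: Q_def)
      fix P f assume P: "poly_fun n P" and f: "f \<in> Q"
      then have "(\<lambda>u. a u * f u) \<in> J" by (auto simp: Q_def)
      then have "(\<lambda>u. P u * (a u * f u)) \<in> J" by (rule pideal_mult[OF J(1) P])
      moreover have "(\<lambda>u. P u * (a u * f u)) = (\<lambda>u. a u * (P u * f u))" by (auto simp: fun_eq_iff)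
      ultimately show "(\<lambda>u. P u * f u) \<in> Q" using P f by (auto simp: Q_def intro: poly_fun.mult)
    qed
    have JQ: "J \<subseteq> Q" using pideal_mult[OF J(1) ab(1)] pideal_poly[OF J(1)] by (auto simp: Q_def)
    have bQ: "b \<in> Q" using ab by (auto simp: Q_def)
    have fQ: "fincod ?P Q" by (rule fin[OF Q JQ bQ nb])
    have "fincod ?I J"
    proof (rule codim_map_ge(1)[where T = "\<lambda>f u. a u * f u", OF lin_mult _ _ _ fQ])
      show "(\<lambda>f u. a u * f u) ` ?P \<subseteq> ?I"
      proof
        fix x assume "x \<in> (\<lambda>f u. a u * f u) ` ?P"
        then obtain f where f: "poly_fun n f" "x = (\<lambda>u. a u * f u)" by blast
        show "x \<in> ?I" by (rule adj_idealI[OF subspace_0'[OF sub] f(1)]) (simp add: f(2))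
      qed
      show "?I \<subseteq> fun_vs.span ((\<lambda>f u. a u * f u) ` ?P \<union> J)" (is "_ \<subseteq> ?S")
      proof
        fix x assume "x \<in> ?I"
        then obtain j p where jp: "j \<in> J" "poly_fun n p" "\<And>u. x u = j u + a u * p u" by (rule adj_idealE) blast
        have "(\<lambda>u. j u + a u * p u) \<in> ?S"
          using jp(1,2) by (intro subspace_add' fun_vs.subspace_span) (auto intro!: fun_vs.span_base)
        then show "x \<in> ?S" using jp(3) by presburger
      qed
      show "(\<lambda>f u. a u * f u) ` Q \<subseteq> J" by (auto simp: Q_def)
    qed
    moreover have "?I \<subseteq> ?P" using pideal_poly[OF adj(1)] by blast
    ultimately have "fincod ?P J"
      using codim_trans(1)[OF fI _ adj(2) _ pideal_subspace[OF adj(1)] sub] by blast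
    with J(3) show False ..
  qed
  show ?thesis by (rule that[OF J]) (intro allI impI prime)
qed

section \<open>Polynomial functions on lines\<close>

definition line :: "coords \<Rightarrow> coords \<Rightarrow> complex \<Rightarrow> coords" where
  "line u v s = (\<lambda>i. (fst (u i) + s * (fst (v i) - fst (u i)), snd (u i) + s * (snd (v i) - snd (u i))))"

lemma line_0 [simp]: "line u v 0 = u" and line_1 [simp]: "line u v 1 = v"
  by (auto simp: line_def)

lemma poly_fun_line: "poly_fun n P \<Longrightarrow> \<exists>q. \<forall>s. P (line u v s) = poly q s"
proof (induction rule: poly_fun.induct)
  case (const k) then show ?case by (intro exI[of _ "[:k:]"]) simp
next
  case (z_coord i) then show ?case
    by (intro exI[of _ "[:fst (u i), fst (v i) - fst (u i):]"]) (simp add: line_def)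
next
  case (w_coord i) then show ?case
    by (intro exI[of _ "[:snd (u i), snd (v i) - snd (u i):]"]) (simp add: line_def)
next
  case (add P Q) then show ?case by (metis poly_add)
next
  case (mult P Q) then show ?case by (metis poly_mult)
qed

text \<open>Irreducibility of affine space in a usable form: on the line through \<open>u\<close>
  and \<open>v\<close> both functions are nonzero polynomials in one variable. The point found stays
  in every affine subspace that contains \<open>u\<close> and \<open>v\<close>.\<close>

lemma poly_fun_line_nonzero:
  assumes "poly_fun n P" "poly_fun n Q" "P u \<noteq> 0" "Q v \<noteq> 0"
  obtains s where "P (line u v s) \<noteq> 0" "Q (line u v s) \<noteq> 0"
proof -
  obtain p q where pq: "\<And>s. P (line u v s) = poly p s" "\<And>s. Q (line u v s) = poly q s"
    using poly_fun_line[OF assms(1), of u v] poly_fun_line[OF assms(2), of u v] by blast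
  have "p \<noteq> 0" using assms(3) pq(1)[of 0] by auto
  moreover have "q \<noteq> 0" using assms(4) pq(2)[of 1] by auto
  ultimately have "p * q \<noteq> 0" by simp
  then obtain s where "poly (p * q) s \<noteq> 0" using poly_all_0_iff_0 by blast
  then show ?thesis using that[of s] pq by simp
qed

section \<open>One-dimensional local rings\<close>

lemma colength_eq_codim: "colength Y p J = codim (stalk Y p) J"
  by (simp add: colength_def codim_def)

text \<open>The largest power of the variable is split off. At an element of a local ring one of the
  two factors is a unit: the power if the element is a unit, the bracket if it vanishes at the
  point.\<close>

lemma poly_split_zero:
  fixes R :: "complex poly"
  assumes "R \<noteq> 0"
  shows "\<exists>e r R'. r \<noteq> 0 \<and> (\<forall>x. poly R x = x ^ e * (r + x * poly R' x))"
proof -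
  obtain q where q: "R = [:- 0, 1:] ^ order 0 R * q" "\<not> [:- 0, 1:] dvd q"
    using order_decomp[OF assms, of 0] by blast
  obtain r R' where r: "q = pCons r R'" by (cases q)
  have "poly q 0 \<noteq> 0" using q(2) poly_eq_0_iff_dvd[of q 0] by simp
  then have "r \<noteq> 0" by (simp add: r)
  moreover have "poly R x = x ^ order 0 R * (r + x * poly R' x)" for x
    using arg_cong[OF q(1), of "\<lambda>R. poly R x"] by (simp add: r algebra_simps)
  ultimately show ?thesis by blast
qed

text \<open>\<open>D\<close> is an affine piece of an integral curve and \<open>A\<close> its
  coordinate ring. The stalk is the localisation of \<open>A\<close> at \<open>p\<close>; functions
  are total, so all equalities in it hold only as germs. The last assumption expresses that the ring
  has dimension one.\<close>

locale local_curve =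
  fixes Y :: "'a fspace" and p :: 'a and D :: "'a set" and A :: "('a \<Rightarrow> complex) set"
  assumes pD: "p \<in> D"
    and A_const: "(\<lambda>_. c) \<in> A"
    and A_add: "a \<in> A \<Longrightarrow> b \<in> A \<Longrightarrow> (\<lambda>y. a y + b y) \<in> A"
    and A_mult: "a \<in> A \<Longrightarrow> b \<in> A \<Longrightarrow> (\<lambda>y. a y * b y) \<in> A"
    and stalk_iff: "f \<in> stalk Y p \<longleftrightarrow> (\<exists>a\<in>A. \<exists>b\<in>A. b p \<noteq> 0 \<and> (\<forall>y\<in>D. b y \<noteq> 0 \<longrightarrow> f y = a y / b y))"
    and germ_iff: "germ_eq Y p f g \<longleftrightarrow> (\<exists>b\<in>A. b p \<noteq> 0 \<and> (\<forall>y\<in>D. b y \<noteq> 0 \<longrightarrow> f y = g y))"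
    and domain: "a \<in> A \<Longrightarrow> b \<in> A \<Longrightarrow> (\<And>y. y \<in> D \<Longrightarrow> a y * b y = 0) \<Longrightarrow>
      (\<forall>y\<in>D. a y = 0) \<or> (\<forall>y\<in>D. b y = 0)"
    and fincod_A: "a \<in> A \<Longrightarrow> \<not> (\<forall>y\<in>D. a y = 0) \<Longrightarrow>
      fincod A {x \<in> A. \<exists>h\<in>A. \<forall>y\<in>D. x y = a y * h y}"
begin

abbreviation "\<O> \<equiv> stalk Y p"
abbreviation germ (infix \<open>\<doteq>\<close> 50) where "f \<doteq> g \<equiv> germ_eq Y p f g"
abbreviation "PI \<equiv> principal_ideal Y p"
abbreviation "\<mm> \<equiv> max_ideal Y p"
abbreviation "len f \<equiv> colength Y p (PI f)"

section \<open>Germs and the ring structure of the stalk\<close>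

lemma germI: "b \<in> A \<Longrightarrow> b p \<noteq> 0 \<Longrightarrow> (\<And>y. y \<in> D \<Longrightarrow> b y \<noteq> 0 \<Longrightarrow> f y = g y) \<Longrightarrow> f \<doteq> g"
  unfolding germ_iff by blast

lemma germE:
  assumes "f \<doteq> g"
  obtains b where "b \<in> A" "b p \<noteq> 0" "\<And>y. y \<in> D \<Longrightarrow> b y \<noteq> 0 \<Longrightarrow> f y = g y"
  using assms unfolding germ_iff by blast

lemma stalkI: "a \<in> A \<Longrightarrow> b \<in> A \<Longrightarrow> b p \<noteq> 0 \<Longrightarrow> (\<And>y. y \<in> D \<Longrightarrow> b y \<noteq> 0 \<Longrightarrow> f y = a y / b y) \<Longrightarrow> f \<in> \<O>"
  unfolding stalk_iff by blast

lemma stalkE: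
  assumes "f \<in> \<O>"
  obtains a b where "a \<in> A" "b \<in> A" "b p \<noteq> 0" "\<And>y. y \<in> D \<Longrightarrow> b y \<noteq> 0 \<Longrightarrow> f y = a y / b y"
  using assms unfolding stalk_iff by blast

lemma germ_combine:
  assumes "f \<doteq> g" "f' \<doteq> g'" "\<And>y. f y = g y \<Longrightarrow> f' y = g' y \<Longrightarrow> h y = k y"
  shows "h \<doteq> k"
proof -
  obtain b where b: "b \<in> A" "b p \<noteq> 0" "\<And>y. y \<in> D \<Longrightarrow> b y \<noteq> 0 \<Longrightarrow> f y = g y" using germE[OF assms(1)] by blast
  obtain b' where b': "b' \<in> A" "b' p \<noteq> 0" "\<And>y. y \<in> D \<Longrightarrow> b' y \<noteq> 0 \<Longrightarrow> f' y = g' y" using germE[OF assms(2)] by blast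
  show ?thesis by (rule germI[OF A_mult[OF b(1) b'(1)]]) (use b b' assms(3) in auto)
qed

lemma germ_refl: "f \<doteq> f" by (rule germI[OF A_const[of 1]]) auto

lemma germ_map: "f \<doteq> g \<Longrightarrow> (\<And>y. f y = g y \<Longrightarrow> h y = k y) \<Longrightarrow> h \<doteq> k"
  by (rule germ_combine[OF _ germ_refl])

lemma germ_sym: "f \<doteq> g \<Longrightarrow> g \<doteq> f" by (erule germ_map) simp

lemma germ_trans: "f \<doteq> g \<Longrightarrow> g \<doteq> h \<Longrightarrow> f \<doteq> h" by (erule germ_combine) auto

lemma germ_add: "f \<doteq> g \<Longrightarrow> f' \<doteq> g' \<Longrightarrow> (\<lambda>y. f y + f' y) \<doteq> (\<lambda>y. g y + g' y)"
  by (erule germ_combine) auto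

lemma germ_mult: "f \<doteq> g \<Longrightarrow> f' \<doteq> g' \<Longrightarrow> (\<lambda>y. f y * f' y) \<doteq> (\<lambda>y. g y * g' y)"
  by (erule germ_combine) auto

lemma germ_sum:
  "(\<And>i. i \<in> I \<Longrightarrow> f i \<doteq> g i) \<Longrightarrow> (\<lambda>y. \<Sum>i\<in>I. f i y) \<doteq> (\<lambda>y. \<Sum>i\<in>I. g i y)"
  by (induction I rule: infinite_finite_induct) (auto intro: germ_refl germ_add)

lemma germ_at: "f \<doteq> g \<Longrightarrow> f p = g p"
  using pD by (auto elim: germE)

lemma A_in: "a \<in> A \<Longrightarrow> a \<in> \<O>"
  by (rule stalkI[OF _ A_const[of 1]]) auto

lemma O_const: "(\<lambda>_. c) \<in> \<O>" by (rule A_in[OF A_const])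

lemma O_germ: "f \<in> \<O> \<Longrightarrow> f \<doteq> g \<Longrightarrow> g \<in> \<O>"
proof -
  assume "f \<in> \<O>" "f \<doteq> g"
  then obtain a b c where "a \<in> A" "b \<in> A" "b p \<noteq> 0" "\<And>y. y \<in> D \<Longrightarrow> b y \<noteq> 0 \<Longrightarrow> f y = a y / b y"
    and c: "c \<in> A" "c p \<noteq> 0" "\<And>y. y \<in> D \<Longrightarrow> c y \<noteq> 0 \<Longrightarrow> f y = g y" by (elim stalkE germE) blast
  then show ?thesis
    by (intro stalkI[OF A_mult[of a c] A_mult[of b c]]) (auto, metis)
qed

lemma O_add: "f \<in> \<O> \<Longrightarrow> g \<in> \<O> \<Longrightarrow> (\<lambda>y. f y + g y) \<in> \<O>"
proof -
  assume "f \<in> \<O>" "g \<in> \<O>"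
  then obtain a b a' b' where "a \<in> A" "b \<in> A" "b p \<noteq> 0" "\<And>y. y \<in> D \<Longrightarrow> b y \<noteq> 0 \<Longrightarrow> f y = a y / b y"
    and "a' \<in> A" "b' \<in> A" "b' p \<noteq> 0" "\<And>y. y \<in> D \<Longrightarrow> b' y \<noteq> 0 \<Longrightarrow> g y = a' y / b' y"
    by (elim stalkE) blast
  then show ?thesis
    by (intro stalkI[OF A_add[OF A_mult[of a b'] A_mult[of a' b]] A_mult[of b b']])
      (auto simp: add_frac_eq)
qed

lemma O_mult: "f \<in> \<O> \<Longrightarrow> g \<in> \<O> \<Longrightarrow> (\<lambda>y. f y * g y) \<in> \<O>"
proof -
  assume "f \<in> \<O>" "g \<in> \<O>"
  then obtain a b a' b' where "a \<in> A" "b \<in> A" "b p \<noteq> 0" "\<And>y. y \<in> D \<Longrightarrow> b y \<noteq> 0 \<Longrightarrow> f y = a y / b y"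
    and "a' \<in> A" "b' \<in> A" "b' p \<noteq> 0" "\<And>y. y \<in> D \<Longrightarrow> b' y \<noteq> 0 \<Longrightarrow> g y = a' y / b' y"
    by (elim stalkE) blast
  then show ?thesis
    by (intro stalkI[OF A_mult[of a a'] A_mult[of b b']]) auto
qed

lemma O_scale: "f \<in> \<O> \<Longrightarrow> (\<lambda>y. c * f y) \<in> \<O>"
  by (rule O_mult[OF O_const])

lemma O_subspace: "fun_vs.subspace \<O>"
  by (rule subspaceI) (auto intro: O_const O_add O_scale)

lemma O_diff: "f \<in> \<O> \<Longrightarrow> g \<in> \<O> \<Longrightarrow> (\<lambda>y. f y - g y) \<in> \<O>"
  by (rule subspace_diff'[OF O_subspace])

lemma O_power: "f \<in> \<O> \<Longrightarrow> (\<lambda>y. f y ^ k) \<in> \<O>"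
  by (induction k) (auto intro: O_const O_mult)

lemma O_poly: "f \<in> \<O> \<Longrightarrow> (\<lambda>y. poly R (f y)) \<in> \<O>"
  by (induction R) (auto intro: O_const O_add O_mult)

lemma A_power: "f \<in> A \<Longrightarrow> (\<lambda>y. f y ^ k) \<in> A"
  by (induction k) (auto intro: A_const A_mult)

lemma A_poly: "f \<in> A \<Longrightarrow> (\<lambda>y. poly R (f y)) \<in> A"
  by (induction R) (auto intro: A_const A_add A_mult)

lemma O_unit:
  assumes "f \<in> \<O>" "f p \<noteq> 0"
  obtains h where "h \<in> \<O>" "(\<lambda>y. f y * h y) \<doteq> (\<lambda>_. 1)"
proof -
  obtain a b where ab: "a \<in> A" "b \<in> A" "b p \<noteq> 0" "\<And>y. y \<in> D \<Longrightarrow> b y \<noteq> 0 \<Longrightarrow> f y = a y / b y"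
    using stalkE[OF assms(1)] by blast
  have ap: "a p \<noteq> 0" using assms(2) ab(4)[OF pD ab(3)] by auto
  show ?thesis
  proof (rule that[of "\<lambda>y. b y / a y"])
    show "(\<lambda>y. b y / a y) \<in> \<O>" by (rule stalkI[OF ab(2,1) ap]) auto
    show "(\<lambda>y. f y * (b y / a y)) \<doteq> (\<lambda>_. 1)"
      by (rule germI[OF A_mult[OF ab(1,2)]]) (use ap ab in auto)
  qed
qed

text \<open>After clearing the denominators the product vanishes on all of \<open>D\<close>, and the
  integrality of \<open>A\<close> applies.\<close>

lemma O_domain:
  assumes "f \<in> \<O>" "g \<in> \<O>" "(\<lambda>y. f y * g y) \<doteq> (\<lambda>_. 0)"
  shows "f \<doteq> (\<lambda>_. 0) \<or> g \<doteq> (\<lambda>_. 0)"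
proof -
  obtain a b where ab: "a \<in> A" "b \<in> A" "b p \<noteq> 0" "\<And>y. y \<in> D \<Longrightarrow> b y \<noteq> 0 \<Longrightarrow> f y = a y / b y"
    using stalkE[OF assms(1)] by blast
  obtain a' b' where ab': "a' \<in> A" "b' \<in> A" "b' p \<noteq> 0" "\<And>y. y \<in> D \<Longrightarrow> b' y \<noteq> 0 \<Longrightarrow> g y = a' y / b' y"
    using stalkE[OF assms(2)] by blast
  obtain c where c: "c \<in> A" "c p \<noteq> 0" "\<And>y. y \<in> D \<Longrightarrow> c y \<noteq> 0 \<Longrightarrow> f y * g y = 0"
    using germE[OF assms(3)] by blast
  let ?d = "\<lambda>y. b y * (b' y * c y)"
  have d: "?d \<in> A" by (intro A_mult ab ab' c)
  have "(a y * a' y) * ?d y = 0" if y: "y \<in> D" for y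
  proof (cases "?d y = 0")
    case False
    then have "f y * g y = 0" "f y = a y / b y" "g y = a' y / b' y" using ab(4) ab'(4) c(3)[OF y] y by auto
    then have "(a y / b y) * (a' y / b' y) = 0" by simp
    then have "a y * a' y = 0" using False by auto
    then show ?thesis by simp
  qed simp
  from domain[OF A_mult[OF ab(1) ab'(1)] d this]
  have "(\<forall>y\<in>D. a y * a' y = 0)" using pD ab(3) ab'(3) c(2) by auto
  then consider "\<forall>y\<in>D. a y = 0" | "\<forall>y\<in>D. a' y = 0" using domain[OF ab(1) ab'(1)] by blast
  then show ?thesis
  proof cases
    case 1
    then have "f \<doteq> (\<lambda>_. 0)" by (intro germI[OF ab(2,3)]) (use ab in auto)
    then show ?thesis ..
  next
    case 2
    then have "g \<doteq> (\<lambda>_. 0)" by (intro germI[OF ab'(2,3)]) (use ab' in auto)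
    then show ?thesis ..
  qed
qed

section \<open>Ideals of the local ring\<close>

text \<open>Containing all functions with zero germ makes such a set the full preimage of an ideal
  of the ring of germs.\<close>

definition oideal :: "('a \<Rightarrow> complex) set \<Rightarrow> bool" where
  "oideal J \<longleftrightarrow> fun_vs.subspace J \<and> J \<subseteq> \<O> \<and> (\<forall>z. z \<doteq> (\<lambda>_. 0) \<longrightarrow> z \<in> J) \<and>
     (\<forall>h\<in>\<O>. \<forall>x\<in>J. (\<lambda>y. h y * x y) \<in> J)"

lemma oideal_subspace: "oideal J \<Longrightarrow> fun_vs.subspace J"
  and oideal_O: "oideal J \<Longrightarrow> x \<in> J \<Longrightarrow> x \<in> \<O>"
  and oideal_zero: "oideal J \<Longrightarrow> z \<doteq> (\<lambda>_. 0) \<Longrightarrow> z \<in> J"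
  and oideal_mult: "oideal J \<Longrightarrow> h \<in> \<O> \<Longrightarrow> x \<in> J \<Longrightarrow> (\<lambda>y. h y * x y) \<in> J"
  unfolding oideal_def by auto

lemma oideal_germ:
  assumes J: "oideal J" and x: "x \<in> J" "x \<doteq> x'"
  shows "x' \<in> J"
proof -
  have "(\<lambda>y. x' y - x y) \<doteq> (\<lambda>_. 0)" using x(2) by (rule germ_map) simp
  from subspace_add'[OF oideal_subspace[OF J] x(1) oideal_zero[OF J this]] show ?thesis by simp
qed

lemma PI_iff: "x \<in> PI f \<longleftrightarrow> x \<in> \<O> \<and> (\<exists>h\<in>\<O>. x \<doteq> (\<lambda>y. f y * h y))"
  by (simp add: principal_ideal_def)

lemma PI_I: "f \<in> \<O> \<Longrightarrow> h \<in> \<O> \<Longrightarrow> x \<doteq> (\<lambda>y. f y * h y) \<Longrightarrow> x \<in> PI f"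
  unfolding PI_iff using O_germ[OF O_mult germ_sym] by blast

lemma PI_oideal:
  assumes f: "f \<in> \<O>"
  shows "oideal (PI f)"
  unfolding oideal_def
proof (intro conjI allI ballI impI)
  show "fun_vs.subspace (PI f)"
  proof (rule subspaceI)
    show "(\<lambda>_. 0) \<in> PI f" by (rule PI_I[OF f O_const[of 0]]) (simp add: germ_refl)
  next
    fix x y assume "x \<in> PI f" "y \<in> PI f"
    then obtain h k where h: "h \<in> \<O>" "x \<doteq> (\<lambda>y. f y * h y)" "k \<in> \<O>" "y \<doteq> (\<lambda>y. f y * k y)"
      unfolding PI_iff by blast
    show "(\<lambda>z. x z + y z) \<in> PI f"
      by (rule PI_I[OF f O_add[OF h(1,3)]]) (use germ_add[OF h(2,4)] in \<open>simp add: algebra_simps\<close>)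
  next
    fix c x assume "x \<in> PI f"
    then obtain h where h: "h \<in> \<O>" "x \<doteq> (\<lambda>y. f y * h y)" unfolding PI_iff by blast
    show "(\<lambda>z. c * x z) \<in> PI f"
      by (rule PI_I[OF f O_scale[OF h(1), of c]]) (use germ_mult[OF germ_refl[of "\<lambda>_. c"] h(2)] in \<open>simp add: algebra_simps\<close>)
  qed
  show "PI f \<subseteq> \<O>" by (simp add: subset_iff PI_iff)
  show "z \<in> PI f" if "z \<doteq> (\<lambda>_. 0)" for z by (rule PI_I[OF f O_const[of 0]]) (use that in simp)
  fix g x assume g: "g \<in> \<O>" and "x \<in> PI f"
  then obtain h where h: "h \<in> \<O>" "x \<doteq> (\<lambda>y. f y * h y)" unfolding PI_iff by blast
  show "(\<lambda>z. g z * x z) \<in> PI f"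
    by (rule PI_I[OF f O_mult[OF g h(1)]]) (use germ_mult[OF germ_refl[of g] h(2)] in \<open>simp add: algebra_simps\<close>)
qed

lemma PI_self: "f \<in> \<O> \<Longrightarrow> f \<in> PI f"
  by (rule PI_I[OF _ O_const[of 1]]) (auto intro: germ_refl)

lemma PI_subset: "oideal J \<Longrightarrow> f \<in> J \<Longrightarrow> PI f \<subseteq> J"
proof
  fix x assume J: "oideal J" "f \<in> J" "x \<in> PI f"
  then obtain h where h: "h \<in> \<O>" "x \<doteq> (\<lambda>y. f y * h y)" unfolding PI_iff by blast
  have "(\<lambda>y. f y * h y) \<in> J" using oideal_mult[OF J(1) h(1) J(2)] by (simp add: mult.commute)
  then show "x \<in> J" using oideal_germ[OF J(1) _ germ_sym[OF h(2)]] by blast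
qed

lemma PI_cong: "f \<doteq> g \<Longrightarrow> PI f = PI g"
proof -
  have "x \<in> PI f" if "f \<doteq> g" "x \<in> PI g" for f g x
  proof -
    obtain h where h: "x \<in> \<O>" "h \<in> \<O>" "x \<doteq> (\<lambda>y. g y * h y)" using \<open>x \<in> PI g\<close> unfolding PI_iff by auto
    have "x \<doteq> (\<lambda>y. f y * h y)" by (rule germ_trans[OF h(3) germ_mult[OF germ_sym[OF that(1)] germ_refl]])
    with h show ?thesis unfolding PI_iff by auto
  qed
  then show "PI f = PI g" if "f \<doteq> g" using that germ_sym[OF that] by (intro equalityI subsetI) simp_all
qed

lemma PI_unit:
  assumes "f \<in> \<O>" "f p \<noteq> 0"
  shows "PI f = \<O>"
proof
  show "PI f \<subseteq> \<O>" by (simp add: subset_iff PI_iff)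
  obtain h where h: "h \<in> \<O>" "(\<lambda>y. f y * h y) \<doteq> (\<lambda>_. 1)" using O_unit[OF assms] .
  show "\<O> \<subseteq> PI f"
  proof
    fix x assume x: "x \<in> \<O>"
    show "x \<in> PI f"
      by (rule PI_I[OF assms(1) O_mult[OF h(1) x]])
        (rule germ_map[OF h(2)], simp add: mult.assoc[symmetric])
  qed
qed

lemma oideal_cancel_unit:
  assumes J: "oideal J" and v: "v \<in> \<O>" "v p \<noteq> 0" and x: "(\<lambda>y. v y * x y) \<in> J"
  shows "x \<in> J"
proof -
  obtain h where h: "h \<in> \<O>" "(\<lambda>y. v y * h y) \<doteq> (\<lambda>_. 1)" using O_unit[OF v] .
  show ?thesis
  proof (rule oideal_germ[OF J oideal_mult[OF J h(1) x]])
    show "(\<lambda>y. h y * (v y * x y)) \<doteq> x" by (rule germ_map[OF h(2)]) (simp add: mult.assoc[symmetric] mult.commute)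
  qed
qed

text \<open>Since \<open>g\<close> is a unit, the power of \<open>g\<close> in \<open>R(g)\<close>
  can be cancelled, and the remaining relation \<open>r + g * R'(g)\<close> gives an inverse of
  \<open>g\<close> modulo \<open>J\<close>. This inverse is a polynomial in \<open>g\<close>, hence
  lies in \<open>A\<close> and not merely in the stalk.\<close>

lemma inverse_mod_ideal:
  assumes J: "oideal J" and g: "g \<in> A" "g p \<noteq> 0" and R: "R \<noteq> 0" "(\<lambda>y. poly R (g y)) \<in> J"
  obtains h where "h \<in> A" "(\<lambda>y. 1 - g y * h y) \<in> J"
proof -
  obtain e r R' where e: "r \<noteq> 0" "\<And>x. poly R x = x ^ e * (r + x * poly R' x)"
    using poly_split_zero[OF R(1)] by blast
  have "(\<lambda>y. r + g y * poly R' (g y)) \<in> J"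
    by (rule oideal_cancel_unit[OF J, of "\<lambda>y. g y ^ e"]) (use R(2) g O_power[OF A_in] e(2) in auto)
  from subspace_scale'[OF oideal_subspace[OF J] this, of "1 / r"]
  have 1: "(\<lambda>y. 1 / r * (r + g y * poly R' (g y))) \<in> J" .
  show ?thesis
  proof (rule that[of "\<lambda>y. (- 1 / r) * poly R' (g y)"])
    show "(\<lambda>y. (- 1 / r) * poly R' (g y)) \<in> A" by (intro A_mult A_const A_poly g)
    have "(\<lambda>y. 1 - g y * ((- 1 / r) * poly R' (g y))) = (\<lambda>y. 1 / r * (r + g y * poly R' (g y)))"
      using e(1) by (auto simp: field_simps)
    with 1 show "(\<lambda>y. 1 - g y * ((- 1 / r) * poly R' (g y))) \<in> J" by simp
  qed
qed

text \<open>Here the bracket in the splitting of \<open>R(g)\<close> is the unit, and the power of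
  \<open>g\<close> remains.\<close>

lemma nilpotent_mod_ideal:
  assumes J: "oideal J" and fin: "fincod \<O> J" and g: "g \<in> \<O>" "g p = 0"
  obtains e where "(\<lambda>y. g y ^ e) \<in> J"
proof -
  obtain R where R: "R \<noteq> 0" "(\<lambda>y. poly R (g y)) \<in> J"
    by (rule poly_relation[OF fin oideal_subspace[OF J] O_power[OF g(1)]])
  obtain e r R' where e: "r \<noteq> 0" "\<And>x. poly R x = x ^ e * (r + x * poly R' x)"
    using poly_split_zero[OF R(1)] by blast
  have "(\<lambda>y. g y ^ e) \<in> J"
  proof (rule oideal_cancel_unit[OF J, of "\<lambda>y. r + g y * poly R' (g y)"])
    show "(\<lambda>y. r + g y * poly R' (g y)) \<in> \<O>" by (intro O_add O_const O_mult O_poly g)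
    show "(\<lambda>y. (r + g y * poly R' (g y)) * g y ^ e) \<in> J" using R(2) e(2) by (simp add: mult.commute)
  qed (use e g in auto)
  then show ?thesis by (rule that)
qed

text \<open>Localising adds nothing to the quotient by \<open>f\<close>: denominators are already
  invertible modulo the ideal by elements of \<open>A\<close>. Basis elements in \<open>A\<close>
  are wanted because these can be homogenised to global forms.\<close>

lemma
  assumes f: "f \<in> \<O>" "\<not> f \<doteq> (\<lambda>_. 0)"
  shows fincod_PI: "fincod \<O> (PI f)"
    and ex_A_basis: "\<exists>B. finite B \<and> B \<subseteq> A \<and> \<O> \<subseteq> fun_vs.span (B \<union> PI f)"
proof -
  obtain a b where ab: "a \<in> A" "b \<in> A" "b p \<noteq> 0" "\<And>y. y \<in> D \<Longrightarrow> b y \<noteq> 0 \<Longrightarrow> f y = a y / b y"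
    using stalkE[OF f(1)] by blast
  have "\<not> (\<forall>y\<in>D. a y = 0)"
  proof
    assume "\<forall>y\<in>D. a y = 0"
    then have "f \<doteq> (\<lambda>_. 0)" by (intro germI[OF ab(2,3)]) (use ab in auto)
    with f show False by simp
  qed
  from fincod_A[OF ab(1) this] have fin: "fincod A {x \<in> A. \<exists>h\<in>A. \<forall>y\<in>D. x y = a y * h y}" (is "fincod A ?J") .
  have subJ: "fun_vs.subspace ?J"
  proof (rule subspaceI)
    show "(\<lambda>_. 0) \<in> ?J" using A_const[of 0] by auto
  next
    fix x y assume "x \<in> ?J" "y \<in> ?J"
    then obtain h k where "x \<in> A" "y \<in> A" "h \<in> A" "\<forall>y\<in>D. x y = a y * h y" "k \<in> A" "\<forall>z\<in>D. y z = a z * k z" by blast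
    then show "(\<lambda>z. x z + y z) \<in> ?J"
      using A_add[of x y] A_add[of h k] by (auto simp: distrib_left intro!: bexI[of _ "\<lambda>z. h z + k z"])
  next
    fix c x assume "x \<in> ?J"
    then obtain h where "x \<in> A" "h \<in> A" "\<forall>y\<in>D. x y = a y * h y" by blast
    then show "(\<lambda>z. c * x z) \<in> ?J"
      using A_mult[OF A_const[of c]] by (auto intro!: bexI[of _ "\<lambda>z. c * h z"])
  qed
  have sub: "?J \<subseteq> PI f"
  proof
    fix x assume "x \<in> ?J"
    then obtain h where h: "x \<in> A" "h \<in> A" "\<forall>y\<in>D. x y = a y * h y" by blast
    show "x \<in> PI f"
    proof (rule PI_I[OF f(1) A_in[OF A_mult[OF ab(2) h(2)]]])
      show "x \<doteq> (\<lambda>y. f y * (b y * h y))" by (rule germI[OF ab(2,3)]) (use h ab in auto)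
    qed
  qed
  note J = PI_oideal[OF f(1)]
  obtain B where B: "finite B" "B \<subseteq> A" "A \<subseteq> fun_vs.span (B \<union> ?J)" using fin unfolding fincod_def by auto
  have "fun_vs.span (B \<union> ?J) \<subseteq> fun_vs.span (B \<union> PI f)" by (rule fun_vs.span_mono) (use sub in blast)
  then have AB: "A \<subseteq> fun_vs.span (B \<union> PI f)" using B(3) by blast
  have "\<O> \<subseteq> fun_vs.span (B \<union> PI f)"
  proof
    fix x assume "x \<in> \<O>"
    then obtain a' b' where ab': "a' \<in> A" "b' \<in> A" "b' p \<noteq> 0" "\<And>y. y \<in> D \<Longrightarrow> b' y \<noteq> 0 \<Longrightarrow> x y = a' y / b' y"
      using stalkE by blast
    obtain R where R: "R \<noteq> 0" "(\<lambda>y. poly R (b' y)) \<in> ?J"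
      by (rule poly_relation[OF fin subJ A_power[OF ab'(2)]])
    have "(\<lambda>y. poly R (b' y)) \<in> PI f" using R(2) sub by blast
    from inverse_mod_ideal[OF J ab'(2,3) R(1) this]
    obtain h where h: "h \<in> A" "(\<lambda>y. 1 - b' y * h y) \<in> PI f" .
    \<comment> \<open>With \<open>x = a' / b'\<close> and \<open>h\<close> inverse to
      \<open>b'\<close> modulo the ideal, \<open>x\<close> is congruent to
      \<open>a' * h\<close>.\<close>
    have "(\<lambda>y. x y * (1 - b' y * h y)) \<in> PI f" by (rule oideal_mult[OF J \<open>x \<in> \<O>\<close> h(2)])
    moreover have "(\<lambda>y. x y * (1 - b' y * h y)) \<doteq> (\<lambda>y. x y - a' y * h y)"
      by (rule germI[OF ab'(2,3)]) (use ab'(4) in \<open>auto simp: field_simps\<close>)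
    ultimately have "(\<lambda>y. x y - a' y * h y) \<in> PI f" by (rule oideal_germ[OF J])
    then have 1: "(\<lambda>y. x y - a' y * h y) \<in> fun_vs.span (B \<union> PI f)" by (intro fun_vs.span_base) simp
    have "(\<lambda>y. a' y * h y) \<in> fun_vs.span (B \<union> PI f)" using AB A_mult[OF ab'(1) h(1)] by blast
    from subspace_add'[OF fun_vs.subspace_span 1 this] show "x \<in> fun_vs.span (B \<union> PI f)" by simp
  qed
  with B show "\<exists>B. finite B \<and> B \<subseteq> A \<and> \<O> \<subseteq> fun_vs.span (B \<union> PI f)" by blast
  then show "fincod \<O> (PI f)" using A_in unfolding fincod_def by (metis subset_iff)
qed

section \<open>Length of the quotient by a principal ideal\<close>

lemma len_unit: "f \<in> \<O> \<Longrightarrow> f p \<noteq> 0 \<Longrightarrow> len f = 0"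
  unfolding colength_eq_codim PI_unit
  using codim_le_card[of "{}" \<O> \<O>] fun_vs.span_superset[of \<O>] by simp

lemma len_cong: "f \<doteq> g \<Longrightarrow> len f = len g"
  by (simp add: PI_cong)

lemma O_cancel:
  assumes "f \<in> \<O>" "\<not> f \<doteq> (\<lambda>_. 0)" "x \<in> \<O>" "x' \<in> \<O>" "(\<lambda>y. f y * x y) \<doteq> (\<lambda>y. f y * x' y)"
  shows "x \<doteq> x'"
proof -
  have "(\<lambda>y. f y * (x y - x' y)) \<doteq> (\<lambda>_. 0)" by (rule germ_map[OF assms(5)]) (simp add: algebra_simps)
  then have "(\<lambda>y. x y - x' y) \<doteq> (\<lambda>_. 0)" using O_domain[OF assms(1) O_diff[OF assms(3,4)]] assms(2) by blast
  then show ?thesis by (rule germ_map) simp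
qed

text \<open>Multiplication by \<open>f\<close> identifies the local ring modulo \<open>g\<close>
  with the ideal of \<open>f\<close> modulo that of \<open>f * g\<close>; injectivity is the
  cancellation of \<open>f\<close>. The lengths then add along the chain of ideals.\<close>

lemma len_mult:
  assumes f: "f \<in> \<O>" "\<not> f \<doteq> (\<lambda>_. 0)" and g: "g \<in> \<O>" "\<not> g \<doteq> (\<lambda>_. 0)"
  shows "len (\<lambda>y. f y * g y) = len f + len g"
proof -
  let ?fg = "\<lambda>y. f y * g y"
  have fg: "?fg \<in> \<O>" "\<not> ?fg \<doteq> (\<lambda>_. 0)" using O_mult f g O_domain[OF f(1) g(1)] by auto
  note If = PI_oideal[OF f(1)] and Ig = PI_oideal[OF g(1)] and Ifg = PI_oideal[OF fg(1)]
  have sub: "PI ?fg \<subseteq> PI f"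
    by (rule PI_subset[OF If]) (use oideal_mult[OF If g(1) PI_self[OF f(1)]] in \<open>simp add: mult.commute\<close>)
  have subO: "PI f \<subseteq> \<O>" using oideal_O[OF If] by blast
  let ?T = "\<lambda>x y. f y * x y"
  have T: "?T ` \<O> \<subseteq> PI f" using PI_I[OF f(1) _ germ_refl] by blast
  have J1: "{x \<in> \<O>. ?T x \<in> PI ?fg} \<subseteq> PI g"
  proof
    fix x assume "x \<in> {x \<in> \<O>. ?T x \<in> PI ?fg}"
    then obtain h where h: "x \<in> \<O>" "h \<in> \<O>" "(\<lambda>y. f y * x y) \<doteq> (\<lambda>y. f y * g y * h y)" unfolding PI_iff by blast
    have "x \<doteq> (\<lambda>y. g y * h y)"
      by (rule O_cancel[OF f h(1) O_mult[OF g(1) h(2)]]) (use h(3) in \<open>simp add: mult.assoc\<close>)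
    then show "x \<in> PI g" by (rule PI_I[OF g(1) h(2)])
  qed
  have J2: "?T ` PI g \<subseteq> PI ?fg"
  proof
    fix z assume "z \<in> ?T ` PI g"
    then obtain x where x: "x \<in> PI g" "z = ?T x" by (elim imageE) simp
    then obtain h where h: "h \<in> \<O>" "x \<doteq> (\<lambda>y. g y * h y)" unfolding PI_iff by auto
    show "z \<in> PI ?fg"
      by (rule PI_I[OF fg(1) h(1)]) (use germ_mult[OF germ_refl[of f] h(2)] x(2) in \<open>simp add: mult.assoc\<close>)
  qed
  have surj: "PI f \<subseteq> fun_vs.span (?T ` \<O> \<union> PI ?fg)" (is "_ \<subseteq> ?S")
  proof
    fix x assume "x \<in> PI f"
    then obtain h where h: "h \<in> \<O>" "x \<doteq> (\<lambda>y. f y * h y)" unfolding PI_iff by blast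
    have "(\<lambda>y. x y - f y * h y) \<doteq> (\<lambda>_. 0)" by (rule germ_map[OF h(2)]) simp
    then have "(\<lambda>y. x y - f y * h y) \<in> PI ?fg" by (rule oideal_zero[OF Ifg])
    then have 1: "(\<lambda>y. x y - f y * h y) \<in> ?S" by (intro fun_vs.span_base) simp
    have "(\<lambda>y. f y * h y) \<in> ?S" using h(1) by (intro fun_vs.span_base) auto
    from subspace_add'[OF fun_vs.subspace_span 1 this] show "x \<in> ?S" by simp
  qed
  note fin = codim_map_ge[OF lin_mult T surj J2 fincod_PI[OF g]]
  have "codim \<O> (PI g) \<le> codim (PI f) (PI ?fg)"
    by (rule codim_le_map(2)[OF lin_mult T J1 O_subspace oideal_subspace[OF Ifg] oideal_subspace[OF Ig] fin(1)])
  with fin(2) have "codim (PI f) (PI ?fg) = codim \<O> (PI g)" by simp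
  with codim_trans(2)[OF fincod_PI[OF f] fin(1) sub subO oideal_subspace[OF If] oideal_subspace[OF Ifg]]
  show ?thesis by (simp add: colength_eq_codim)
qed

lemma power_nonzero:
  assumes "f \<in> \<O>" "\<not> f \<doteq> (\<lambda>_. 0)"
  shows "\<not> (\<lambda>y. f y ^ k) \<doteq> (\<lambda>_. 0)"
proof (induction k)
  case 0 then show ?case using germ_at[of "\<lambda>_. 1" "\<lambda>_. 0"] by auto
next
  case (Suc k) then show ?case using O_domain[OF assms(1) O_power[OF assms(1)]] assms(2) by auto
qed

lemma len_power:
  assumes "f \<in> \<O>" "\<not> f \<doteq> (\<lambda>_. 0)"
  shows "len (\<lambda>y. f y ^ k) = k * len f"
proof (induction k)
  case 0 then show ?case using len_unit[OF O_const[of 1]] by simp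
next
  case (Suc k)
  then show ?case using len_mult[OF assms O_power[OF assms(1)] power_nonzero[OF assms]] by simp
qed

text \<open>\<open>t\<close> generates the maximal ideal, so the quotient consists of the
  constants.\<close>

lemma len_eq_1:
  assumes t: "t \<in> \<O>" "t p = 0" and m: "\<And>x. x \<in> \<O> \<Longrightarrow> x p = 0 \<Longrightarrow> x \<in> PI t"
  shows "len t = 1"
proof -
  have s: "\<O> \<subseteq> fun_vs.span ({\<lambda>_. 1} \<union> PI t)"
  proof
    fix x assume x: "x \<in> \<O>"
    have "(\<lambda>y. x y - x p) \<in> PI t" by (rule m[OF O_diff[OF x O_const]]) simp
    then have 1: "(\<lambda>y. x y - x p) \<in> fun_vs.span ({\<lambda>_. 1} \<union> PI t)" by (intro fun_vs.span_base) simp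
    have "(\<lambda>y. x p * 1) \<in> fun_vs.span ({\<lambda>_. 1} \<union> PI t)"
      by (intro subspace_scale' fun_vs.subspace_span fun_vs.span_base) simp
    from subspace_add'[OF fun_vs.subspace_span 1 this] show "x \<in> fun_vs.span ({\<lambda>_. 1} \<union> PI t)" by simp
  qed
  have "indep_mod (PI t) {\<lambda>_. 1}"
    unfolding indep_mod_def
  proof (intro ballI notI)
    fix b :: "'a \<Rightarrow> complex" assume "b \<in> {\<lambda>_. 1}" "b \<in> fun_vs.span ({\<lambda>_. 1} - {b} \<union> PI t)"
    then have "(\<lambda>_. 1) \<in> fun_vs.span (PI t)" by simp
    also have "fun_vs.span (PI t) = PI t"
      using oideal_subspace[OF PI_oideal[OF t(1)]] by (simp add: fun_vs.span_eq_iff)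
    finally obtain h where "(\<lambda>_. 1) \<doteq> (\<lambda>y. t y * h y)" unfolding PI_iff by blast
    from germ_at[OF this] t(2) show False by simp
  qed
  from codim_eqI[OF _ _ s this] O_const show ?thesis by (simp add: colength_eq_codim)
qed

section \<open>Powers of the maximal ideal\<close>

abbreviation "MP \<equiv> max_ideal_power Y p"

lemma mm_iff: "f \<in> \<mm> \<longleftrightarrow> f \<in> \<O> \<and> f p = 0"
  by (simp add: max_ideal_def)

lemma mm_mult: "h \<in> \<O> \<Longrightarrow> f \<in> \<mm> \<Longrightarrow> (\<lambda>y. h y * f y) \<in> \<mm>"
  unfolding mm_iff using O_mult by auto

lemma MP_oideal: "oideal (MP k)"
proof (induction k)
  case 0
  show ?case unfolding oideal_def using O_subspace O_mult O_germ[OF O_const[of 0]] germ_sym by auto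
next
  case (Suc k)
  let ?G = "{\<lambda>y. f y * g y |f g. f \<in> \<mm> \<and> g \<in> MP k}"
  show ?case
    unfolding oideal_def max_ideal_power.simps
  proof (intro conjI allI impI ballI)
    show "fun_vs.subspace (fun_vs.span ?G)" by (rule fun_vs.subspace_span)
    show "fun_vs.span ?G \<subseteq> \<O>"
      by (rule fun_vs.span_minimal[OF _ O_subspace]) (use oideal_O[OF Suc] in \<open>auto simp: mm_iff intro: O_mult\<close>)
    fix z assume z: "z \<doteq> (\<lambda>_. 0)"
    define e where "e = (\<lambda>y. if z y = 0 then 0 else (1::complex))"
    have "e \<doteq> (\<lambda>_. 0)" by (rule germ_map[OF z]) (simp add: e_def)
    then have "e \<in> MP k" by (rule oideal_zero[OF Suc])
    moreover have "z \<in> \<mm>" using O_germ[OF O_const germ_sym[OF z]] germ_at[OF z] by (simp add: mm_iff)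
    moreover have "z = (\<lambda>y. z y * e y)" by (auto simp: e_def)
    ultimately have "z \<in> ?G" by blast
    then show "z \<in> fun_vs.span ?G" by (rule fun_vs.span_base)
  next
    fix h x assume h: "h \<in> \<O>" and x: "x \<in> fun_vs.span ?G"
    have "(\<lambda>x y. h y * x y) ` fun_vs.span ?G \<subseteq> fun_vs.span ((\<lambda>x y. h y * x y) ` ?G)"
      by (rule lin_span[OF lin_mult])
    also have "\<dots> \<subseteq> fun_vs.span ?G"
    proof (rule fun_vs.span_mono, clarify)
      fix f g assume "f \<in> \<mm>" "g \<in> MP k"
      then show "\<exists>f' g'. (\<lambda>y. h y * (f y * g y)) = (\<lambda>y. f' y * g' y) \<and> f' \<in> \<mm> \<and> g' \<in> MP k"
        using mm_mult[OF h] by (intro exI[of _ "\<lambda>y. h y * f y"] exI[of _ g]) (auto simp: mult.assoc)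
    qed
    finally show "(\<lambda>y. h y * x y) \<in> fun_vs.span ?G" using x by blast
  qed
qed

lemma MP_Suc_subset: "MP (Suc k) \<subseteq> MP k"
  unfolding max_ideal_power.simps
  by (rule fun_vs.span_minimal[OF _ oideal_subspace[OF MP_oideal]])
    (use oideal_mult[OF MP_oideal] in \<open>auto simp: mm_iff\<close>)

lemma power_in_MP: "f \<in> \<mm> \<Longrightarrow> (\<lambda>y. f y ^ k) \<in> MP k"
proof (induction k)
  case 0 then show ?case using O_const by simp
next
  case (Suc k)
  have "(\<lambda>y. f y * f y ^ k) \<in> {\<lambda>y. f y * g y |f g. f \<in> \<mm> \<and> g \<in> MP k}"
    unfolding mem_Collect_eq
    by (intro exI[of _ f] exI[of _ "\<lambda>y. f y ^ k"] conjI refl Suc.prems Suc.IH)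
  then show ?case by (auto intro: fun_vs.span_base)
qed

text \<open>The generators are eliminated one by one: in the relation for \<open>g\<close> the
  coefficient of \<open>g\<close> itself lies in the maximal ideal, so \<open>1 - c g\<close> is a
  unit and \<open>g\<close> can be expressed by the others, again with coefficients in the maximal
  ideal.\<close>

lemma nakayama:
  assumes "finite G" "G \<subseteq> \<O>"
    "\<And>g. g \<in> G \<Longrightarrow> \<exists>c. (\<forall>g'\<in>G. c g' \<in> \<mm>) \<and> g \<doteq> (\<lambda>y. \<Sum>g'\<in>G. c g' y * g' y)"
  shows "\<forall>g\<in>G. g \<doteq> (\<lambda>_. 0)"
  using assms
proof (induction G rule: finite_induct)
  case empty then show ?case by simp
next
  case (insert g G)
  have GO: "G \<subseteq> \<O>" "g \<in> \<O>" using insert.prems by auto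
  obtain c where c: "\<And>g'. g' \<in> insert g G \<Longrightarrow> c g' \<in> \<mm>" "g \<doteq> (\<lambda>y. \<Sum>g'\<in>insert g G. c g' y * g' y)"
    using insert.prems(2)[of g] by blast
  have "(\<lambda>y. 1 - c g y) \<in> \<O>" "1 - c g p \<noteq> 0"
    using c(1)[of g] by (auto simp: mm_iff intro: O_diff O_const)
  then obtain v where v: "v \<in> \<O>" "(\<lambda>y. (1 - c g y) * v y) \<doteq> (\<lambda>_. 1)" by (rule O_unit)
  have g: "g \<doteq> (\<lambda>y. \<Sum>g'\<in>G. v y * c g' y * g' y)"
  proof (rule germ_combine[OF c(2) v(2)])
    fix y assume 1: "g y = (\<Sum>g'\<in>insert g G. c g' y * g' y)" and 2: "(1 - c g y) * v y = 1"
    have "(1 - c g y) * g y = (\<Sum>g'\<in>G. c g' y * g' y)" using 1 insert.hyps by (simp add: algebra_simps)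
    then have "v y * ((1 - c g y) * g y) = (\<Sum>g'\<in>G. v y * c g' y * g' y)"
      by (simp add: sum_distrib_left mult.assoc)
    moreover have "v y * ((1 - c g y) * g y) = ((1 - c g y) * v y) * g y" by (simp add: algebra_simps)
    then have "v y * ((1 - c g y) * g y) = g y" using 2 by simp
    ultimately show "g y = (\<Sum>g'\<in>G. v y * c g' y * g' y)" by simp
  qed
  have "\<forall>h\<in>G. h \<doteq> (\<lambda>_. 0)"
  proof (rule insert.IH[OF GO(1)])
    fix h assume h: "h \<in> G"
    obtain d where d: "\<And>g'. g' \<in> insert g G \<Longrightarrow> d g' \<in> \<mm>" "h \<doteq> (\<lambda>y. \<Sum>g'\<in>insert g G. d g' y * g' y)"
      using insert.prems(2)[of h] h by blast
    show "\<exists>c. (\<forall>g'\<in>G. c g' \<in> \<mm>) \<and> h \<doteq> (\<lambda>y. \<Sum>g'\<in>G. c g' y * g' y)"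
    proof (intro exI conjI ballI)
      fix g' assume g': "g' \<in> G"
      have "d g' \<in> \<mm>" "d g \<in> \<mm>" "c g' \<in> \<mm>" using c(1) d(1) g' by auto
      then show "(\<lambda>y. d g' y + d g y * (v y * c g' y)) \<in> \<mm>"
        using v(1) by (auto simp: mm_iff intro!: O_add O_mult)
    next
      show "h \<doteq> (\<lambda>y. \<Sum>g'\<in>G. (d g' y + d g y * (v y * c g' y)) * g' y)"
      proof (rule germ_combine[OF d(2) g])
        fix y assume 1: "h y = (\<Sum>g'\<in>insert g G. d g' y * g' y)" and 2: "g y = (\<Sum>g'\<in>G. v y * c g' y * g' y)"
        have "h y = d g y * g y + (\<Sum>g'\<in>G. d g' y * g' y)" using 1 insert.hyps by simp
        also have "d g y * g y = (\<Sum>g'\<in>G. d g y * (v y * c g' y) * g' y)"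
          by (subst 2) (simp add: sum_distrib_left mult.assoc)
        finally show "h y = (\<Sum>g'\<in>G. (d g' y + d g y * (v y * c g' y)) * g' y)"
          by (simp add: sum.distrib algebra_simps)
      qed
    qed
  qed
  moreover from this have "(\<lambda>y. \<Sum>g'\<in>G. v y * c g' y * g' y) \<doteq> (\<lambda>y. \<Sum>g'\<in>G. v y * c g' y * 0)"
    by (intro germ_sum germ_mult germ_refl) auto
  then have "g \<doteq> (\<lambda>_. 0)" using germ_trans[OF g] by simp
  ultimately show ?case by simp
qed

text \<open>Used with \<open>H\<close> the whole stalk and with \<open>H\<close> the maximal ideal;
  the combinations describe the ideal generated by \<open>G\<close> and its product with the maximal
  ideal.\<close>

lemma combination_subspace:
  assumes H: "fun_vs.subspace H" "H \<subseteq> \<O>" and G: "G \<subseteq> \<O>"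
  shows "fun_vs.subspace {x \<in> \<O>. \<exists>c. (\<forall>g\<in>G. c g \<in> H) \<and> x \<doteq> (\<lambda>y. \<Sum>g\<in>G. c g y * g y)}" (is "fun_vs.subspace ?S")
proof (rule subspaceI)
  show "(\<lambda>_. 0) \<in> ?S"
    using O_const subspace_0'[OF H(1)] by (auto intro!: exI[of _ "\<lambda>_ _. 0"] germ_refl)
next
  fix x x' assume "x \<in> ?S" "x' \<in> ?S"
  then obtain c c' where x: "x \<in> \<O>" "\<forall>g\<in>G. c g \<in> H" "x \<doteq> (\<lambda>y. \<Sum>g\<in>G. c g y * g y)"
    "x' \<in> \<O>" "\<forall>g\<in>G. c' g \<in> H" "x' \<doteq> (\<lambda>y. \<Sum>g\<in>G. c' g y * g y)" by blast
  have "(\<lambda>y. x y + x' y) \<doteq> (\<lambda>y. \<Sum>g\<in>G. (c g y + c' g y) * g y)"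
    using germ_add[OF x(3,6)] by (simp add: sum.distrib algebra_simps)
  then show "(\<lambda>y. x y + x' y) \<in> ?S"
    using O_add[OF x(1,4)] x(2,5) subspace_add'[OF H(1)]
    by (auto intro!: exI[of _ "\<lambda>g y. c g y + c' g y"])
next
  fix a x assume "x \<in> ?S"
  then obtain c where x: "x \<in> \<O>" "\<forall>g\<in>G. c g \<in> H" "x \<doteq> (\<lambda>y. \<Sum>g\<in>G. c g y * g y)" by blast
  have "(\<lambda>y. a * x y) \<doteq> (\<lambda>y. \<Sum>g\<in>G. (a * c g y) * g y)"
    using germ_mult[OF germ_refl[of "\<lambda>_. a"] x(3)] by (simp add: sum_distrib_left mult.assoc)
  then show "(\<lambda>y. a * x y) \<in> ?S"
    using O_scale[OF x(1)] x(2) subspace_scale'[OF H(1)]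
    by (auto intro!: exI[of _ "\<lambda>g y. a * c g y"])
qed

lemma mm_subspace: "fun_vs.subspace \<mm>"
  by (rule subspaceI) (auto simp: mm_iff intro: O_const O_add O_scale)

text \<open>If two consecutive powers agreed, Nakayama's lemma would make all of \<open>MP k\<close>
  zero, including the power \<open>f^k\<close>, which is a nonzero germ.\<close>

lemma MP_strict:
  assumes f: "f \<in> \<mm>" "\<not> f \<doteq> (\<lambda>_. 0)"
  shows "\<not> MP k \<subseteq> MP (Suc k)"
proof
  assume sub: "MP k \<subseteq> MP (Suc k)"
  have fO: "f \<in> \<O>" using f(1) by (simp add: mm_iff)
  let ?fk = "\<lambda>y. f y ^ k"
  note fk = O_power[OF fO, of k] power_nonzero[OF fO f(2), of k]
  have subMP: "MP k \<subseteq> \<O>" using oideal_O[OF MP_oideal] by blast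
  obtain B where B: "finite B" "B \<subseteq> MP k" "MP k \<subseteq> fun_vs.span (B \<union> PI ?fk)"
    using fincod_subset[OF fincod_PI[OF fk] subMP] unfolding fincod_def by auto
  \<comment> \<open>\<open>MP k\<close> is finitely generated: it has finite codimension over the
    ideal of \<open>f^k\<close>, so a basis \<open>B\<close> modulo that ideal together with
    \<open>f^k\<close> generates it.\<close>
  define G where "G = insert ?fk B"
  have G: "finite G" "G \<subseteq> MP k" using B power_in_MP[OF f(1)] by (auto simp: G_def)
  have GO: "G \<subseteq> \<O>" using G(2) subMP by blast
  define S where "S = (\<lambda>H. {x \<in> \<O>. \<exists>c. (\<forall>g\<in>G. c g \<in> H) \<and> x \<doteq> (\<lambda>y. \<Sum>g\<in>G. c g y * g y)})"
  have mO: "\<mm> \<subseteq> \<O>" by (auto simp: mm_iff)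
  have one: "(\<lambda>y. h y * g0 y) \<doteq> (\<lambda>y. \<Sum>g\<in>G. (if g = g0 then h y else 0) * g y)" if "g0 \<in> G" for h g0
  proof -
    have "(\<Sum>g\<in>G. (if g = g0 then h y else 0) * g y) = h y * g0 y" for y
      using that G(1) by (simp add: if_distrib[of "\<lambda>a. a * _"] cong: if_cong)
    then show ?thesis by (simp add: germ_refl)
  qed
  have 1: "MP k \<subseteq> S \<O>"
  proof (rule order_trans[OF B(3)], rule fun_vs.span_minimal)
    show "fun_vs.subspace (S \<O>)" unfolding S_def by (rule combination_subspace[OF O_subspace order_refl GO])
    have c: "x \<in> S \<O>" if x: "g0 \<in> G" "h \<in> \<O>" "x \<in> \<O>" "x \<doteq> (\<lambda>y. h y * g0 y)" for x h g0
    proof -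
      have "\<forall>g\<in>G. (\<lambda>y. if g = g0 then h y else 0) \<in> \<O>"
      proof
        fix g show "(\<lambda>y. if g = g0 then h y else 0) \<in> \<O>" using x(2) O_const[of 0] by (cases "g = g0") auto
      qed
      with x(3) germ_trans[OF x(4) one[OF x(1)]] show ?thesis
        unfolding S_def by (auto intro!: exI[of _ "\<lambda>g y. if g = g0 then h y else 0"])
    qed
    show "B \<union> PI ?fk \<subseteq> S \<O>"
    proof
      fix x assume "x \<in> B \<union> PI ?fk"
      then show "x \<in> S \<O>"
      proof
        assume "x \<in> B"
        then show ?thesis using c[of x "\<lambda>_. 1" x] GO O_const[of 1] by (auto simp: G_def germ_refl)
      next
        assume "x \<in> PI ?fk"
        then obtain h where "x \<in> \<O>" "h \<in> \<O>" "x \<doteq> (\<lambda>y. ?fk y * h y)" unfolding PI_iff by blast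
        then show ?thesis using c[of ?fk h x] by (simp add: G_def mult.commute)
      qed
    qed
  qed
  have "MP (Suc k) \<subseteq> S \<mm>"
    unfolding max_ideal_power.simps
  proof (rule fun_vs.span_minimal)
    show "fun_vs.subspace (S \<mm>)" unfolding S_def by (rule combination_subspace[OF mm_subspace mO GO])
    show "{\<lambda>y. f y * g y |f g. f \<in> \<mm> \<and> g \<in> MP k} \<subseteq> S \<mm>"
    proof clarify
      fix h x assume h: "h \<in> \<mm>" and "x \<in> MP k"
      then obtain c where c: "x \<in> \<O>" "\<forall>g\<in>G. c g \<in> \<O>" "x \<doteq> (\<lambda>y. \<Sum>g\<in>G. c g y * g y)"
        using 1 unfolding S_def by blast
      have "(\<lambda>y. h y * x y) \<doteq> (\<lambda>y. \<Sum>g\<in>G. (h y * c g y) * g y)"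
        using germ_mult[OF germ_refl[of h] c(3)] by (simp add: sum_distrib_left mult.assoc)
      moreover have "(\<lambda>y. h y * c g y) \<in> \<mm>" if "g \<in> G" for g
        using mm_mult[of "c g" h] h c(2) that by (simp add: mult.commute)
      moreover have "(\<lambda>y. h y * x y) \<in> \<O>" using O_mult c(1) h by (auto simp: mm_iff)
      ultimately show "(\<lambda>y. h y * x y) \<in> S \<mm>"
        unfolding S_def by (auto intro!: exI[of _ "\<lambda>g y. h y * c g y"])
    qed
  qed
  then have "G \<subseteq> S \<mm>" using G(2) sub by blast
  then have "\<forall>g\<in>G. g \<doteq> (\<lambda>_. 0)"
    by (intro nakayama[OF G(1) GO]) (auto simp: S_def)
  with fk(2) show False by (simp add: G_def)
qed

text \<open>The upper bound comes from \<open>f^k\<close> lying in \<open>MP k\<close> and from the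
  additivity of lengths, the lower one from the strict decrease of the powers, each step
  contributing at least 1.\<close>

lemma
  assumes f: "f \<in> \<mm>" "\<not> f \<doteq> (\<lambda>_. 0)"
  shows fincod_MP: "fincod \<O> (MP k)"
    and colength_MP_le: "colength Y p (MP k) \<le> k * len f"
    and colength_MP_ge: "k \<le> colength Y p (MP k)"
proof -
  have fO: "f \<in> \<O>" using f(1) by (simp add: mm_iff)
  have sub: "PI (\<lambda>y. f y ^ k) \<subseteq> MP k" for k by (rule PI_subset[OF MP_oideal power_in_MP[OF f(1)]])
  note fk = fincod_PI[OF O_power[OF fO] power_nonzero[OF fO f(2)]]
  show fin: "fincod \<O> (MP k)" for k by (rule fincod_mono[OF fk sub])
  show "colength Y p (MP k) \<le> k * len f"
    using codim_antimono[OF fk sub, of k] len_power[OF fO f(2), of k] by (simp add: colength_eq_codim)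
  show "k \<le> colength Y p (MP k)"
  proof (induction k)
    case (Suc k)
    have kO: "MP k \<subseteq> \<O>" using oideal_O[OF MP_oideal] by blast
    note fin' = fincod_subset[OF fin kO]
    have "codim (MP k) (MP (Suc k)) \<noteq> 0"
    proof
      assume z: "codim (MP k) (MP (Suc k)) = 0"
      obtain B where B: "finite B" "MP k \<subseteq> fun_vs.span (B \<union> MP (Suc k))" "card B = 0"
        using codim_basis[OF fin'[of "Suc k"]] z by metis
      have "fun_vs.span (MP (Suc k)) = MP (Suc k)"
        using oideal_subspace[OF MP_oideal] by (simp only: fun_vs.span_eq_iff)
      moreover have "B = {}" using B by simp
      ultimately have "MP k \<subseteq> MP (Suc k)" using B(2) by (simp only: Un_empty_left)
      with MP_strict[OF f] show False by blast
    qed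
    then show ?case
      using codim_trans(2)[OF fin fin' MP_Suc_subset kO oideal_subspace[OF MP_oideal] oideal_subspace[OF MP_oideal]] Suc
      by (simp only: colength_eq_codim)
  qed simp
qed

end

text \<open>The bounds on the quotients hold for positive \<open>k\<close> only, because division by
  0 gives 0; an upper limit ignores that term.\<close>

lemma limsup_ratio_bounds:
  fixes c :: "nat \<Rightarrow> nat"
  assumes "\<And>k. k \<le> c k" "\<And>k. c k \<le> k * d"
  shows "1 \<le> real_of_ereal (limsup (\<lambda>k. ereal (real (c k) / real k)))"
    and "real_of_ereal (limsup (\<lambda>k. ereal (real (c k) / real k))) \<le> real d"
proof -
  let ?L = "limsup (\<lambda>k. ereal (real (c k) / real k))"
  have ev: "\<forall>\<^sub>F k in sequentially. 1 \<le> ereal (real (c k) / real k)"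
    using eventually_gt_at_top[of 0]
  proof eventually_elim
    case (elim k)
    then have "real k \<le> real (c k)" using assms(1)[of k] by simp
    with elim show ?case by (simp add: field_simps one_ereal_def)
  qed
  have "limsup (\<lambda>_::nat. 1::ereal) \<le> ?L" by (rule Limsup_mono[OF ev])
  then have 1: "1 \<le> ?L" by (simp add: Limsup_const)
  have ev2: "\<forall>\<^sub>F k in sequentially. ereal (real (c k) / real k) \<le> ereal (real d)"
    using eventually_gt_at_top[of 0]
  proof eventually_elim
    case (elim k)
    have "real (c k) \<le> real (k * d)" using assms(2)[of k] by linarith
    with elim show ?case by (simp add: field_simps)
  qed
  have "?L \<le> limsup (\<lambda>_::nat. ereal (real d))" by (rule Limsup_mono[OF ev2])
  then have 2: "?L \<le> ereal (real d)" by (simp add: Limsup_const)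
  then show "1 \<le> real_of_ereal ?L" "real_of_ereal ?L \<le> real d"
    using 1 by (cases ?L; simp add: one_ereal_def)+
qed

text \<open>Valid for arbitrary \<open>C\<close> and \<open>p\<close>: should the upper limit be
  infinite, its real value is 0.\<close>

lemma mult_at_nonneg: "0 \<le> mult_at X C p"
proof -
  have "0 \<le> liminf (\<lambda>k. ereal (real (colength (subspace_of X C) p (max_ideal_power (subspace_of X C) p k)) / real k))"
    by (rule Liminf_bounded) auto
  also have "\<dots> \<le> limsup (\<lambda>k. ereal (real (colength (subspace_of X C) p (max_ideal_power (subspace_of X C) p k)) / real k))"
    by (rule Liminf_le_Limsup) simp
  finally show ?thesis unfolding mult_at_def by (rule real_of_ereal_pos)
qed

section \<open>Affine charts of a Bott tower\<close>

text \<open>In the chart \<open>\<tau>\<close> this coordinate of the pair is invertible and gets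
  normalised to 1.\<close>

definition cc :: "(nat \<Rightarrow> bool) \<Rightarrow> nat \<Rightarrow> coords \<Rightarrow> complex" where
  "cc \<tau> i u = (if \<tau> i then fst (u i) else snd (u i))"

text \<open>The torus element that moves a point to the representative all of whose coordinates
  selected by \<open>\<tau>\<close> are 1.\<close>

fun nt :: "(nat \<Rightarrow> nat \<Rightarrow> int) \<Rightarrow> (nat \<Rightarrow> bool) \<Rightarrow> coords \<Rightarrow> nat \<Rightarrow> complex" where
  "nt c \<tau> u i = (if \<tau> i then (\<Prod>k\<in>{1..<i}. nt c \<tau> u k powi (c k i)) / fst (u i) else 1 / snd (u i))"

declare nt.simps [simp del]

lemma prod_powi_minus:
  fixes t :: "'b \<Rightarrow> complex"
  shows "(\<Prod>k\<in>K. t k powi (- e k)) = 1 / (\<Prod>k\<in>K. t k powi e k)"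
  by (induction K rule: infinite_finite_induct) (auto simp: power_int_minus field_simps)

lemma prod_powi_divide:
  fixes t :: "'b \<Rightarrow> complex"
  shows "(\<Prod>k\<in>K. (t k / s k) powi e k) = (\<Prod>k\<in>K. t k powi e k) / (\<Prod>k\<in>K. s k powi e k)"
  by (simp add: power_int_divide_distrib prod_dividef)

text \<open>The generating sets are stable under intersection, by multiplying the polynomials, and
  so form a basis of the topology.\<close>

lemma openin_cox_basic:
  assumes "openin (ftop (cox_space n)) W" "u \<in> W"
  obtains P where "poly_fun n P" "P u \<noteq> 0" "\<And>v. v \<in> cox_points n \<Longrightarrow> P v \<noteq> 0 \<Longrightarrow> v \<in> W"
proof -
  have "generate_topology_on {{u \<in> cox_points n. P u \<noteq> 0} |P. poly_fun n P} W"
    using assms(1) by (simp add: cox_space_def openin_topology_generated_by_iff)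
  then have "\<forall>u\<in>W. \<exists>P. poly_fun n P \<and> P u \<noteq> 0 \<and> (\<forall>v\<in>cox_points n. P v \<noteq> 0 \<longrightarrow> v \<in> W)"
  proof (induction rule: generate_topology_on.induct)
    case Empty then show ?case by simp
  next
    case (Int a b)
    show ?case
    proof
      fix u assume u: "u \<in> a \<inter> b"
      then have "u \<in> a" "u \<in> b" by auto
      from bspec[OF Int.IH(1) this(1)] bspec[OF Int.IH(2) this(2)]
      obtain P Q where "poly_fun n P" "P u \<noteq> 0" "\<forall>v\<in>cox_points n. P v \<noteq> 0 \<longrightarrow> v \<in> a"
        "poly_fun n Q" "Q u \<noteq> 0" "\<forall>v\<in>cox_points n. Q v \<noteq> 0 \<longrightarrow> v \<in> b" by blast
      then show "\<exists>P. poly_fun n P \<and> P u \<noteq> 0 \<and> (\<forall>v\<in>cox_points n. P v \<noteq> 0 \<longrightarrow> v \<in> a \<inter> b)"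
        by (intro exI[of _ "\<lambda>u. P u * Q u"]) (auto intro: poly_fun.mult)
    qed
  next
    case (UN K)
    show ?case
    proof
      fix u assume "u \<in> \<Union>K"
      then obtain k where k: "k \<in> K" "u \<in> k" by blast
      from bspec[OF UN.IH[OF k(1)] k(2)] obtain P where
        "poly_fun n P" "P u \<noteq> 0" "\<forall>v\<in>cox_points n. P v \<noteq> 0 \<longrightarrow> v \<in> k" by blast
      with k(1) show "\<exists>P. poly_fun n P \<and> P u \<noteq> 0 \<and> (\<forall>v\<in>cox_points n. P v \<noteq> 0 \<longrightarrow> v \<in> \<Union>K)" by blast
    qed
  next
    case (Basis s) then show ?case by auto
  qed
  with assms(2) that show ?thesis by blast
qed

lemma openin_cox_points:
  assumes "poly_fun n P"
  shows "openin (ftop (cox_space n)) {u \<in> cox_points n. P u \<noteq> 0}"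
  unfolding cox_space_def fspace.simps openin_topology_generated_by_iff
  by (rule generate_topology_on.Basis) (use assms in blast)

locale bott =
  fixes n :: nat and c :: "nat \<Rightarrow> nat \<Rightarrow> int"
  assumes n_pos: "1 \<le> n"
    and c_pos: "1 \<le> i \<Longrightarrow> i < j \<Longrightarrow> j \<le> n \<Longrightarrow> 0 < c i j"
begin

abbreviation "X \<equiv> bott_tower c n"
abbreviation "bp \<equiv> bott_point c n"
abbreviation "act \<equiv> torus_act c n"

section \<open>Torus orbits and their normal forms\<close>

definition nz :: "(nat \<Rightarrow> complex) \<Rightarrow> bool" where
  "nz t \<longleftrightarrow> (\<forall>i\<in>{1..n}. t i \<noteq> 0)"

lemma nzD: "nz t \<Longrightarrow> 1 \<le> i \<Longrightarrow> i \<le> n \<Longrightarrow> t i \<noteq> 0"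
  by (simp add: nz_def)

lemma nz_prod: "nz t \<Longrightarrow> i \<le> n \<Longrightarrow> (\<Prod>k\<in>{1..<i}. t k powi e k) \<noteq> 0"
  by (auto simp: nz_def)

lemma act_act: "act s (act t u) = act (\<lambda>i. s i * t i) u"
  by (intro ext) (auto simp: torus_act_def power_int_mult_distrib prod.distrib)

lemma cox_outside: "u \<in> cox_points n \<Longrightarrow> i \<notin> {1..n} \<Longrightarrow> u i = (0, 0)"
  by (auto simp: cox_points_def)

lemma act_one: "u \<in> cox_points n \<Longrightarrow> act (\<lambda>_. 1) u = u"
  by (intro ext) (auto simp: torus_act_def cox_outside)

lemma act_cong: "(\<And>i. i \<in> {1..n} \<Longrightarrow> s i = t i) \<Longrightarrow> act s u = act t u"
  by (intro ext) (auto simp: torus_act_def intro!: prod.cong)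

lemma fst_act: "i \<in> {1..n} \<Longrightarrow> fst (act t u i) = t i / (\<Prod>k\<in>{1..<i}. t k powi (c k i)) * fst (u i)"
  unfolding torus_act_def by (simp add: prod_powi_minus)

lemma snd_act: "i \<in> {1..n} \<Longrightarrow> snd (act t u i) = t i * snd (u i)"
  unfolding torus_act_def by simp

lemma fst_act_eq_0: "nz t \<Longrightarrow> i \<in> {1..n} \<Longrightarrow> fst (act t u i) = 0 \<longleftrightarrow> fst (u i) = 0"
  using nz_prod[of t i "\<lambda>k. c k i"] by (simp add: fst_act nzD)

lemma snd_act_eq_0: "nz t \<Longrightarrow> i \<in> {1..n} \<Longrightarrow> snd (act t u i) = 0 \<longleftrightarrow> snd (u i) = 0"
  by (simp add: snd_act nzD)

lemma act_cox:
  assumes u: "u \<in> cox_points n" and t: "nz t"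
  shows "act t u \<in> cox_points n"
proof -
  have "act t u i \<noteq> (0, 0)" if i: "i \<in> {1..n}" for i
  proof
    assume "act t u i = (0, 0)"
    then have "fst (u i) = 0" "snd (u i) = 0"
      using fst_act_eq_0[OF t i, of u] snd_act_eq_0[OF t i, of u] by auto
    then have "u i = (0, 0)" by (simp add: prod_eq_iff)
    with u i show False by (auto simp: cox_points_def)
  qed
  moreover have "act t u i = (0, 0)" if "i \<notin> {1..n}" for i using that unfolding torus_act_def by (simp only: if_False)
  ultimately show ?thesis by (simp add: cox_points_def)
qed

lemma bp_iff: "v \<in> bp u \<longleftrightarrow> (\<exists>t. nz t \<and> v = act t u)"
  unfolding bott_point_def nz_def by blast

lemma bp_self: "u \<in> cox_points n \<Longrightarrow> u \<in> bp u"
  unfolding bp_iff using act_one by (intro exI[of _ "\<lambda>_. 1"]) (auto simp: nz_def)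

lemma bp_act: "nz t \<Longrightarrow> bp (act t u) = bp u"
proof -
  assume t: "nz t"
  show ?thesis
  proof (intro set_eqI iffI)
    fix v assume "v \<in> bp (act t u)"
    then obtain s where "nz s" "v = act s (act t u)" unfolding bp_iff by blast
    then show "v \<in> bp u" using t unfolding bp_iff act_act
      by (intro exI[of _ "\<lambda>i. s i * t i"]) (auto simp: nz_def)
  next
    fix v assume "v \<in> bp u"
    then obtain s where s: "nz s" "v = act s u" unfolding bp_iff by blast
    have "act (\<lambda>i. s i / t i) (act t u) = act s u"
      unfolding act_act by (rule act_cong) (use t in \<open>auto simp: nz_def\<close>)
    then show "v \<in> bp (act t u)" using t s unfolding bp_iff
      by (intro exI[of _ "\<lambda>i. s i / t i"]) (auto simp: nz_def)
  qed
qed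

lemma bp_mem: "v \<in> bp u \<Longrightarrow> bp v = bp u"
  unfolding bp_iff using bp_act by blast

lemma bp_cox: "v \<in> bp u \<Longrightarrow> u \<in> cox_points n \<Longrightarrow> v \<in> cox_points n"
  unfolding bp_iff using act_cox by blast

lemma ptsE:
  assumes "x \<in> pts X"
  obtains u where "u \<in> cox_points n" "x = bp u"
  using assms unfolding pts_bott_tower by blast

lemma pts_mem: "x \<in> pts X \<Longrightarrow> u \<in> x \<Longrightarrow> u \<in> cox_points n \<and> x = bp u"
  by (metis ptsE bp_mem bp_cox)

definition inU :: "(nat \<Rightarrow> bool) \<Rightarrow> coords \<Rightarrow> bool" where
  "inU \<tau> u \<longleftrightarrow> u \<in> cox_points n \<and> (\<forall>i\<in>{1..n}. cc \<tau> i u \<noteq> 0)"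

definition nrm :: "(nat \<Rightarrow> bool) \<Rightarrow> coords \<Rightarrow> coords" where
  "nrm \<tau> u = act (nt c \<tau> u) u"

text \<open>A section of the torus action over the chart: every orbit in the chart meets it in
  exactly one point. It is a copy of affine \<open>n\<close>-space, which makes charts
  affine.\<close>

definition slice :: "(nat \<Rightarrow> bool) \<Rightarrow> coords set" where
  "slice \<tau> = {u. (\<forall>i. i \<notin> {1..n} \<longrightarrow> u i = (0, 0)) \<and> (\<forall>i\<in>{1..n}. cc \<tau> i u = 1)}"

definition chart :: "(nat \<Rightarrow> bool) \<Rightarrow> coords set set" where
  "chart \<tau> = {bp u |u. inU \<tau> u}"

text \<open>The arbitrary choice of a point of the orbit has no effect, because \<open>nrm\<close>
  is constant on orbits inside the chart.\<close>

definition rep :: "(nat \<Rightarrow> bool) \<Rightarrow> coords set \<Rightarrow> coords" where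
  "rep \<tau> x = nrm \<tau> (SOME u. u \<in> x)"

lemma nt_nz: "inU \<tau> u \<Longrightarrow> nz (nt c \<tau> u)"
proof -
  assume u: "inU \<tau> u"
  have "i \<in> {1..n} \<longrightarrow> nt c \<tau> u i \<noteq> 0" for i
  proof (induction i rule: less_induct)
    case (less i)
    show ?case
    proof
      assume i: "i \<in> {1..n}"
      then have "(\<Prod>k\<in>{1..<i}. nt c \<tau> u k powi (c k i)) \<noteq> 0" using less by auto
      moreover have "cc \<tau> i u \<noteq> 0" using u i by (auto simp: inU_def)
      ultimately show "nt c \<tau> u i \<noteq> 0" by (subst nt.simps) (auto simp: cc_def split: if_splits)
    qed
  qed
  then show ?thesis by (simp add: nz_def)
qed

lemma nrm_slice: "inU \<tau> u \<Longrightarrow> nrm \<tau> u \<in> slice \<tau>"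
proof -
  assume u: "inU \<tau> u"
  note nz = nt_nz[OF u]
  have "cc \<tau> i (nrm \<tau> u) = 1" if i: "i \<in> {1..n}" for i
  proof -
    have 1: "(\<Prod>k\<in>{1..<i}. nt c \<tau> u k powi (c k i)) \<noteq> 0" by (rule nz_prod[OF nz]) (use i in auto)
    have 2: "cc \<tau> i u \<noteq> 0" using u i by (auto simp: inU_def)
    show ?thesis
    proof (cases "\<tau> i")
      case True
      then show ?thesis using 1 2
        unfolding cc_def nrm_def fst_act[OF i] nt.simps[of c \<tau> u i] by (simp del: prod_zero_iff)
    next
      case False
      then show ?thesis using 2
        unfolding cc_def nrm_def snd_act[OF i] nt.simps[of c \<tau> u i] by simp
    qed
  qed
  then show ?thesis by (auto simp: slice_def nrm_def torus_act_def)
qed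

lemma slice_inU:
  assumes "u \<in> slice \<tau>"
  shows "inU \<tau> u"
proof -
  have cc: "cc \<tau> i u = 1" if "i \<in> {1..n}" for i using assms that by (auto simp: slice_def)
  have "u i \<noteq> (0, 0)" if "i \<in> {1..n}" for i using cc[OF that] by (auto simp: cc_def split: if_splits)
  with assms cc show ?thesis by (auto simp: inU_def cox_points_def slice_def)
qed

lemma slice_cox: "u \<in> slice \<tau> \<Longrightarrow> u \<in> cox_points n"
  using slice_inU unfolding inU_def by blast

lemma bp_nrm: "inU \<tau> u \<Longrightarrow> bp (nrm \<tau> u) = bp u"
  unfolding nrm_def by (rule bp_act[OF nt_nz])

lemma inU_act: "inU \<tau> u \<Longrightarrow> nz t \<Longrightarrow> inU \<tau> (act t u)"
  unfolding inU_def using act_cox by (auto simp: cc_def fst_act_eq_0 snd_act_eq_0)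

text \<open>Induction up the tower: the entry at \<open>i\<close> involves the entries at smaller
  indices, and the factors they pick up cancel against the twist in the action on
  \<open>z_i\<close>. The lemma is also the source of the cocycle rule for the bundles of the
  boundary divisors.\<close>

lemma nt_act:
  assumes u: "inU \<tau> u" and s: "nz s" and i: "i \<in> {1..n}"
  shows "nt c \<tau> (act s u) i = nt c \<tau> u i / s i"
  using i
proof (induction i rule: less_induct)
  case (less i)
  have 1: "(\<Prod>k\<in>{1..<i}. nt c \<tau> (act s u) k powi (c k i)) = (\<Prod>k\<in>{1..<i}. (nt c \<tau> u k / s k) powi (c k i))"
    by (rule prod.cong) (use less in auto)
  have 2: "(\<Prod>k\<in>{1..<i}. s k powi (c k i)) \<noteq> 0" by (rule nz_prod[OF s]) (use less.prems in auto)
  have 3: "s i \<noteq> 0" using s less.prems by (auto simp: nz_def)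
  have 4: "cc \<tau> i u \<noteq> 0" using u less.prems by (auto simp: inU_def)
  show ?case
  proof (cases "\<tau> i")
    case True
    then have "nt c \<tau> (act s u) i = (\<Prod>k\<in>{1..<i}. (nt c \<tau> u k / s k) powi (c k i)) / fst (act s u i)"
      by (subst nt.simps) (simp only: 1 if_True)
    also have "\<dots> = (\<Prod>k\<in>{1..<i}. nt c \<tau> u k powi (c k i)) / fst (u i) / s i"
      unfolding prod_powi_divide fst_act[OF less.prems] using 2 3 by (simp del: prod_zero_iff)
    finally show ?thesis using True by (simp only: nt.simps[of c \<tau> u i] if_True)
  next
    case False
    then show ?thesis by (simp only: nt.simps[of c \<tau> _ i] snd_act[OF less.prems] if_False) simp
  qed
qed

lemma nrm_act: "inU \<tau> u \<Longrightarrow> nz s \<Longrightarrow> nrm \<tau> (act s u) = nrm \<tau> u"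
  unfolding nrm_def act_act by (rule act_cong) (auto simp: nt_act nz_def)

lemma nt_slice: "u \<in> slice \<tau> \<Longrightarrow> i \<in> {1..n} \<Longrightarrow> nt c \<tau> u i = 1"
proof (induction i rule: less_induct)
  case (less i)
  have "(\<Prod>k\<in>{1..<i}. nt c \<tau> u k powi (c k i)) = (\<Prod>k\<in>{1..<i}. 1)"
    by (rule prod.cong) (use less in auto)
  then show ?case using less.prems by (auto simp: nt.simps[of c \<tau> u i] slice_def cc_def split: if_splits)
qed

lemma nrm_of_slice: "u \<in> slice \<tau> \<Longrightarrow> nrm \<tau> u = u"
  using act_cong[of "nt c \<tau> u" "\<lambda>_. 1" u] act_one[OF slice_cox] by (simp add: nrm_def nt_slice)

lemma rep_bp: "inU \<tau> u \<Longrightarrow> rep \<tau> (bp u) = nrm \<tau> u"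
proof -
  assume u: "inU \<tau> u"
  then have "u \<in> bp u" by (intro bp_self) (simp add: inU_def)
  then have "(SOME v. v \<in> bp u) \<in> bp u" by (rule someI[of "\<lambda>v. v \<in> bp u"])
  then obtain t where "nz t" "(SOME v. v \<in> bp u) = act t u" unfolding bp_iff by blast
  then show ?thesis using nrm_act[OF u] by (simp add: rep_def)
qed

lemma chart_bp: "u \<in> cox_points n \<Longrightarrow> bp u \<in> chart \<tau> \<longleftrightarrow> inU \<tau> u"
proof
  assume u: "u \<in> cox_points n" and "bp u \<in> chart \<tau>"
  then obtain v where v: "inU \<tau> v" "bp u = bp v" unfolding chart_def by blast
  then have "u \<in> bp v" using bp_self[OF u] by simp
  then obtain t where "nz t" "u = act t v" unfolding bp_iff by blast
  then show "inU \<tau> u" using inU_act v by simp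
qed (auto simp: chart_def)

lemma rep_slice: "x \<in> chart \<tau> \<Longrightarrow> rep \<tau> x \<in> slice \<tau>"
  unfolding chart_def using rep_bp nrm_slice by auto

lemma bp_rep: "x \<in> chart \<tau> \<Longrightarrow> bp (rep \<tau> x) = x"
  unfolding chart_def using rep_bp bp_nrm by auto

lemma rep_of_slice: "u \<in> slice \<tau> \<Longrightarrow> rep \<tau> (bp u) = u"
  using rep_bp[OF slice_inU] nrm_of_slice by simp

lemma bp_slice_chart: "u \<in> slice \<tau> \<Longrightarrow> bp u \<in> chart \<tau>"
  unfolding chart_def using slice_inU by blast

lemma bp_pts: "u \<in> cox_points n \<Longrightarrow> bp u \<in> pts X"
  by (simp add: pts_bott_tower)

lemma chart_pts: "x \<in> chart \<tau> \<Longrightarrow> x \<in> pts X"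
  unfolding chart_def inU_def using bp_pts by blast

lemma rep_cox: "x \<in> chart \<tau> \<Longrightarrow> rep \<tau> x \<in> cox_points n"
  using rep_slice slice_cox by blast

lemma rep_mem: "x \<in> chart \<tau> \<Longrightarrow> rep \<tau> x \<in> x"
  using bp_self[OF rep_cox] bp_rep by metis

lemma rep_inj: "x \<in> chart \<tau> \<Longrightarrow> y \<in> chart \<tau> \<Longrightarrow> rep \<tau> x = rep \<tau> y \<Longrightarrow> x = y"
  using bp_rep by metis

lemma ex_chart:
  assumes "x \<in> pts X"
  obtains \<tau> where "x \<in> chart \<tau>"
proof -
  obtain u where u: "u \<in> cox_points n" "x = bp u" using assms by (rule ptsE)
  have "inU (\<lambda>i. fst (u i) \<noteq> 0) u"
    using u(1) by (auto simp: inU_def cox_points_def cc_def prod_eq_iff)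
  with u that show ?thesis unfolding chart_def by blast
qed

section \<open>Rational functions without poles over a chart\<close>

text \<open>One fraction is required to be valid over the whole chart. Negative powers of the
  selected coordinates are allowed, which is what normalising a point produces.\<close>

definition rfun :: "(nat \<Rightarrow> bool) \<Rightarrow> (coords \<Rightarrow> complex) \<Rightarrow> bool" where
  "rfun \<tau> f \<longleftrightarrow> (\<exists>P Q. poly_fun n P \<and> poly_fun n Q \<and> (\<forall>u. inU \<tau> u \<longrightarrow> Q u \<noteq> 0 \<and> f u = P u / Q u))"

lemma rfunI: "poly_fun n P \<Longrightarrow> poly_fun n Q \<Longrightarrow> (\<And>u. inU \<tau> u \<Longrightarrow> Q u \<noteq> 0 \<and> f u = P u / Q u) \<Longrightarrow> rfun \<tau> f"
  unfolding rfun_def by blast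

lemma rfun_poly: "poly_fun n P \<Longrightarrow> rfun \<tau> P"
  by (rule rfunI[OF _ poly_fun.const[of n 1]]) auto

lemma rfun_add: "rfun \<tau> f \<Longrightarrow> rfun \<tau> g \<Longrightarrow> rfun \<tau> (\<lambda>u. f u + g u)"
proof -
  assume "rfun \<tau> f" "rfun \<tau> g"
  then obtain P Q P' Q' where "poly_fun n P" "poly_fun n Q" "\<forall>u. inU \<tau> u \<longrightarrow> Q u \<noteq> 0 \<and> f u = P u / Q u"
    "poly_fun n P'" "poly_fun n Q'" "\<forall>u. inU \<tau> u \<longrightarrow> Q' u \<noteq> 0 \<and> g u = P' u / Q' u" unfolding rfun_def by blast
  then show ?thesis
    by (intro rfunI[of "\<lambda>u. P u * Q' u + P' u * Q u" "\<lambda>u. Q u * Q' u"] poly_fun.add poly_fun.mult)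
      (auto simp: add_frac_eq)
qed

lemma rfun_mult: "rfun \<tau> f \<Longrightarrow> rfun \<tau> g \<Longrightarrow> rfun \<tau> (\<lambda>u. f u * g u)"
proof -
  assume "rfun \<tau> f" "rfun \<tau> g"
  then obtain P Q P' Q' where "poly_fun n P" "poly_fun n Q" "\<forall>u. inU \<tau> u \<longrightarrow> Q u \<noteq> 0 \<and> f u = P u / Q u"
    "poly_fun n P'" "poly_fun n Q'" "\<forall>u. inU \<tau> u \<longrightarrow> Q' u \<noteq> 0 \<and> g u = P' u / Q' u" unfolding rfun_def by blast
  then show ?thesis
    by (intro rfunI[of "\<lambda>u. P u * P' u" "\<lambda>u. Q u * Q' u"] poly_fun.mult) auto
qed

lemma rfun_inverse: "rfun \<tau> f \<Longrightarrow> (\<And>u. inU \<tau> u \<Longrightarrow> f u \<noteq> 0) \<Longrightarrow> rfun \<tau> (\<lambda>u. inverse (f u))"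
proof -
  assume "rfun \<tau> f" and nz: "\<And>u. inU \<tau> u \<Longrightarrow> f u \<noteq> 0"
  then obtain P Q where "poly_fun n P" "poly_fun n Q" "\<forall>u. inU \<tau> u \<longrightarrow> Q u \<noteq> 0 \<and> f u = P u / Q u"
    unfolding rfun_def by blast
  then show ?thesis by (intro rfunI[of Q P]) (use nz in force)+
qed

lemma rfun_power: "rfun \<tau> f \<Longrightarrow> rfun \<tau> (\<lambda>u. f u ^ k)"
  by (induction k) (auto intro: rfun_mult rfun_poly poly_fun.const)

lemma rfun_powi: "rfun \<tau> f \<Longrightarrow> (\<And>u. inU \<tau> u \<Longrightarrow> f u \<noteq> 0) \<Longrightarrow> rfun \<tau> (\<lambda>u. f u powi k)"
  unfolding power_int_def using rfun_power[of \<tau> f "nat k"] rfun_power[OF rfun_inverse[of \<tau> f], of "nat (- k)"]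
  by (cases "0 \<le> k") auto

lemma rfun_prod: "(\<And>i. i \<in> I \<Longrightarrow> rfun \<tau> (f i)) \<Longrightarrow> rfun \<tau> (\<lambda>u. \<Prod>i\<in>I. f i u)"
  by (induction I rule: infinite_finite_induct) (auto intro: rfun_mult rfun_poly poly_fun.const)

lemma poly_cc: "i \<in> {1..n} \<Longrightarrow> poly_fun n (cc \<tau> i)"
  unfolding cc_def[abs_def] by (cases "\<tau> i") (auto intro: poly_fun.intros)

lemma rfun_nt: "i \<in> {1..n} \<Longrightarrow> rfun \<tau> (\<lambda>u. nt c \<tau> u i)"
proof (induction i rule: less_induct)
  case (less i)
  have cc: "rfun \<tau> (\<lambda>u. inverse (cc \<tau> i u))"
    by (rule rfun_inverse[OF rfun_poly[OF poly_cc[OF less.prems]]]) (use less.prems in \<open>auto simp: inU_def\<close>)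
  show ?case
  proof (cases "\<tau> i")
    case True
    have "rfun \<tau> (\<lambda>u. (\<Prod>k\<in>{1..<i}. nt c \<tau> u k powi (c k i)) * inverse (cc \<tau> i u))"
      by (intro rfun_mult rfun_prod rfun_powi cc less.IH) (use less.prems nzD[OF nt_nz] in auto)
    then show ?thesis using True by (simp add: nt.simps[of c \<tau> _ i] cc_def divide_inverse)
  next
    case False
    then show ?thesis using cc by (simp add: nt.simps[of c \<tau> _ i] cc_def divide_inverse)
  qed
qed

lemma rfun_nrm: "poly_fun n P \<Longrightarrow> rfun \<tau> (\<lambda>u. P (nrm \<tau> u))"
proof (induction rule: poly_fun.induct)
  case (const k) then show ?case by (intro rfun_poly poly_fun.intros)
next
  case (z_coord i)
  have "rfun \<tau> (\<lambda>u. (\<Prod>k\<in>{1..<i}. nt c \<tau> u k powi (- c k i)) * nt c \<tau> u i * fst (u i))"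
    by (intro rfun_mult rfun_prod rfun_powi rfun_nt rfun_poly poly_fun.intros)
      (use z_coord nzD[OF nt_nz] in auto)
  then show ?case using z_coord by (simp add: nrm_def torus_act_def)
next
  case (w_coord i)
  have "rfun \<tau> (\<lambda>u. nt c \<tau> u i * snd (u i))"
    by (intro rfun_mult rfun_nt rfun_poly poly_fun.intros) (use w_coord in auto)
  then show ?case using w_coord by (simp add: nrm_def torus_act_def)
next
  case (add P Q) then show ?case by (intro rfun_add)
next
  case (mult P Q) then show ?case by (intro rfun_mult)
qed

subsection \<open>Topology and regular functions in a chart\<close>

definition dist_open :: "(nat \<Rightarrow> bool) \<Rightarrow> (coords \<Rightarrow> complex) \<Rightarrow> coords set set" where
  "dist_open \<tau> P = {y \<in> chart \<tau>. P (rep \<tau> y) \<noteq> 0}"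

lemma openin_X: "openin (ftop X) V \<longleftrightarrow> V \<subseteq> pts X \<and> openin (ftop (cox_space n)) {u \<in> cox_points n. bp u \<in> V}"
  unfolding pts_bott_tower unfolding bott_tower_def openin_quotient_fspace pts_cox_space ..

text \<open>Over the chart \<open>P(rep)\<close> pulls back to a fraction without poles. The product
  of the selected coordinates in the defining polynomial cuts away the complement of the
  chart.\<close>

lemma openin_dist_open: "poly_fun n P \<Longrightarrow> openin (ftop X) (dist_open \<tau> P)"
proof -
  assume P: "poly_fun n P"
  obtain A B where AB: "poly_fun n A" "poly_fun n B" "\<And>u. inU \<tau> u \<Longrightarrow> B u \<noteq> 0 \<and> P (nrm \<tau> u) = A u / B u"
    using rfun_nrm[OF P] unfolding rfun_def by blast
  have "{u \<in> cox_points n. bp u \<in> dist_open \<tau> P} = {u \<in> cox_points n. (\<Prod>i\<in>{1..n}. cc \<tau> i u) * A u \<noteq> 0}"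
  proof (intro Collect_cong conj_cong refl)
    fix u assume u: "u \<in> cox_points n"
    have "bp u \<in> dist_open \<tau> P \<longleftrightarrow> inU \<tau> u \<and> P (nrm \<tau> u) \<noteq> 0"
      unfolding dist_open_def using chart_bp[OF u] rep_bp by auto
    also have "\<dots> \<longleftrightarrow> inU \<tau> u \<and> A u \<noteq> 0" using AB(3) by auto
    also have "\<dots> \<longleftrightarrow> (\<Prod>i\<in>{1..n}. cc \<tau> i u) * A u \<noteq> 0" using u by (auto simp: inU_def)
    finally show "bp u \<in> dist_open \<tau> P \<longleftrightarrow> (\<Prod>i\<in>{1..n}. cc \<tau> i u) * A u \<noteq> 0" .
  qed
  moreover have "openin (ftop (cox_space n)) {u \<in> cox_points n. (\<Prod>i\<in>{1..n}. cc \<tau> i u) * A u \<noteq> 0}"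
    by (intro openin_cox_points poly_fun.mult poly_fun_prod AB poly_cc)
  moreover have "dist_open \<tau> P \<subseteq> pts X" unfolding dist_open_def using chart_pts by blast
  ultimately show ?thesis unfolding openin_X by simp
qed

lemma openin_chart: "openin (ftop X) (chart \<tau>)"
  using openin_dist_open[OF poly_fun.const[of n 1], of \<tau>] by (simp add: dist_open_def)

lemma open_local:
  assumes "openin (ftop X) V" "x \<in> V" "x \<in> chart \<tau>"
  obtains P where "poly_fun n P" "P (rep \<tau> x) \<noteq> 0" "dist_open \<tau> P \<subseteq> V"
proof -
  have "openin (ftop (cox_space n)) {u \<in> cox_points n. bp u \<in> V}" using assms(1) openin_X by blast
  moreover have "rep \<tau> x \<in> {u \<in> cox_points n. bp u \<in> V}" using assms rep_cox bp_rep by simp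
  ultimately obtain P where P: "poly_fun n P" "P (rep \<tau> x) \<noteq> 0"
    "\<And>v. v \<in> cox_points n \<Longrightarrow> P v \<noteq> 0 \<Longrightarrow> v \<in> {u \<in> cox_points n. bp u \<in> V}" by (rule openin_cox_basic) blast
  have "dist_open \<tau> P \<subseteq> V"
  proof
    fix y assume "y \<in> dist_open \<tau> P"
    then have "y \<in> chart \<tau>" "P (rep \<tau> y) \<noteq> 0" by (auto simp: dist_open_def)
    then show "y \<in> V" using P(3)[OF rep_cox] bp_rep by auto
  qed
  with P that show ?thesis by blast
qed

lemma reg_X: "f \<in> reg X V \<longleftrightarrow> (\<forall>u\<in>{u \<in> cox_points n. bp u \<in> V}. \<exists>P Q. poly_fun n P \<and> poly_fun n Q \<and> Q u \<noteq> 0 \<and>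
    (\<forall>v\<in>{u \<in> cox_points n. bp u \<in> V}. Q v \<noteq> 0 \<longrightarrow> f (bp v) = P v / Q v))"
proof -
  have "f \<in> reg X V \<longleftrightarrow> f \<circ> bp \<in> reg (cox_space n) {u \<in> cox_points n. bp u \<in> V}"
    unfolding bott_tower_def quotient_fspace_def pts_cox_space by simp
  then show ?thesis by (simp add: cox_space_def)
qed

text \<open>A local fraction on Cox space is restricted to the slice, on which the quotient map is
  injective.\<close>

lemma reg_local:
  assumes "f \<in> reg X V" "x \<in> V" "x \<in> chart \<tau>"
  obtains P Q where "poly_fun n P" "poly_fun n Q" "Q (rep \<tau> x) \<noteq> 0"
    "\<forall>y\<in>V \<inter> chart \<tau>. Q (rep \<tau> y) \<noteq> 0 \<longrightarrow> f y = P (rep \<tau> y) / Q (rep \<tau> y)"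
proof -
  have "rep \<tau> x \<in> {u \<in> cox_points n. bp u \<in> V}" using assms rep_cox bp_rep by simp
  then obtain P Q where PQ: "poly_fun n P" "poly_fun n Q" "Q (rep \<tau> x) \<noteq> 0"
    "\<forall>v\<in>{u \<in> cox_points n. bp u \<in> V}. Q v \<noteq> 0 \<longrightarrow> f (bp v) = P v / Q v"
    using assms(1) unfolding reg_X by blast
  have "\<forall>y\<in>V \<inter> chart \<tau>. Q (rep \<tau> y) \<noteq> 0 \<longrightarrow> f y = P (rep \<tau> y) / Q (rep \<tau> y)"
  proof (intro ballI impI)
    fix y assume y: "y \<in> V \<inter> chart \<tau>" "Q (rep \<tau> y) \<noteq> 0"
    then have "rep \<tau> y \<in> {u \<in> cox_points n. bp u \<in> V}" using rep_cox bp_rep by auto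
    with PQ(4) y bp_rep show "f y = P (rep \<tau> y) / Q (rep \<tau> y)" by auto
  qed
  with PQ that show ?thesis by blast
qed

lemma reg_cong: "f \<in> reg X V \<Longrightarrow> V' \<subseteq> V \<Longrightarrow> (\<And>y. y \<in> V' \<Longrightarrow> f y = g y) \<Longrightarrow> g \<in> reg X V'"
  unfolding reg_X by (simp add: subset_iff) metis

lemma reg_frac:
  assumes P: "poly_fun n P" and Q: "poly_fun n Q" and V: "V \<subseteq> dist_open \<tau> Q"
    and f: "\<And>y. y \<in> V \<Longrightarrow> f y = P (rep \<tau> y) / Q (rep \<tau> y)"
  shows "f \<in> reg X V"
  unfolding reg_X
proof
  fix u assume u: "u \<in> {u \<in> cox_points n. bp u \<in> V}"
  obtain A B where AB: "poly_fun n A" "poly_fun n B" "\<And>u. inU \<tau> u \<Longrightarrow> B u \<noteq> 0 \<and> P (nrm \<tau> u) = A u / B u"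
    using rfun_nrm[OF P] unfolding rfun_def by blast
  obtain A' B' where AB': "poly_fun n A'" "poly_fun n B'" "\<And>u. inU \<tau> u \<Longrightarrow> B' u \<noteq> 0 \<and> Q (nrm \<tau> u) = A' u / B' u"
    using rfun_nrm[OF Q] unfolding rfun_def by blast
  have v: "B v * A' v \<noteq> 0 \<and> f (bp v) = (A v * B' v) / (B v * A' v)" if "v \<in> {u \<in> cox_points n. bp u \<in> V}" for v
  proof -
    have "bp v \<in> dist_open \<tau> Q" using that V by blast
    then have v: "inU \<tau> v" "Q (nrm \<tau> v) \<noteq> 0" using that chart_bp[of v \<tau>] rep_bp[of \<tau> v] by (auto simp: dist_open_def)
    have "f (bp v) = P (nrm \<tau> v) / Q (nrm \<tau> v)" using f[of "bp v"] rep_bp[OF v(1)] that by simp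
    with AB(3)[OF v(1)] AB'(3)[OF v(1)] v(2) show ?thesis by auto
  qed
  then show "\<exists>P Q. poly_fun n P \<and> poly_fun n Q \<and> Q u \<noteq> 0 \<and>
    (\<forall>v\<in>{u \<in> cox_points n. bp u \<in> V}. Q v \<noteq> 0 \<longrightarrow> f (bp v) = P v / Q v)"
    using u AB AB'
    by (intro exI[of _ "\<lambda>v. A v * B' v"] exI[of _ "\<lambda>v. B v * A' v"]) (auto intro: poly_fun.mult)
qed

lemma germ_X_iff:
  assumes "p \<in> chart \<tau>"
  shows "germ_eq X p f g \<longleftrightarrow> (\<exists>P. poly_fun n P \<and> P (rep \<tau> p) \<noteq> 0 \<and> (\<forall>y\<in>dist_open \<tau> P. f y = g y))"
proof
  assume "germ_eq X p f g"
  then obtain U where U: "openin (ftop X) U" "p \<in> U" "\<forall>y\<in>U. f y = g y" unfolding germ_eq_def by blast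
  obtain P where "poly_fun n P" "P (rep \<tau> p) \<noteq> 0" "dist_open \<tau> P \<subseteq> U" using open_local[OF U(1,2) assms] .
  with U show "\<exists>P. poly_fun n P \<and> P (rep \<tau> p) \<noteq> 0 \<and> (\<forall>y\<in>dist_open \<tau> P. f y = g y)" by blast
next
  assume "\<exists>P. poly_fun n P \<and> P (rep \<tau> p) \<noteq> 0 \<and> (\<forall>y\<in>dist_open \<tau> P. f y = g y)"
  then obtain P where P: "poly_fun n P" "P (rep \<tau> p) \<noteq> 0" "\<forall>y\<in>dist_open \<tau> P. f y = g y" by blast
  then show "germ_eq X p f g" unfolding germ_eq_def
    using openin_dist_open[OF P(1)] assms by (intro exI[of _ "dist_open \<tau> P"]) (simp add: dist_open_def)
qed

text \<open>With this the local ring of \<open>X\<close> is a localisation of the ring of polynomial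
  functions on a slice, and topology and sheaf drop out of the later arguments.\<close>

lemma stalk_X_iff:
  assumes "p \<in> chart \<tau>"
  shows "f \<in> stalk X p \<longleftrightarrow> (\<exists>P Q. poly_fun n P \<and> poly_fun n Q \<and> Q (rep \<tau> p) \<noteq> 0 \<and>
    (\<forall>y\<in>dist_open \<tau> Q. f y = P (rep \<tau> y) / Q (rep \<tau> y)))"
proof
  assume "f \<in> stalk X p"
  then obtain U where U: "openin (ftop X) U" "p \<in> U" "f \<in> reg X U" unfolding stalk_def by blast
  obtain R where R: "poly_fun n R" "R (rep \<tau> p) \<noteq> 0" "dist_open \<tau> R \<subseteq> U" using open_local[OF U(1,2) assms] .
  obtain P Q where PQ: "poly_fun n P" "poly_fun n Q" "Q (rep \<tau> p) \<noteq> 0"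
    "\<forall>y\<in>U \<inter> chart \<tau>. Q (rep \<tau> y) \<noteq> 0 \<longrightarrow> f y = P (rep \<tau> y) / Q (rep \<tau> y)" using reg_local[OF U(3,2) assms] .
  \<comment> \<open>Expanding the fraction by \<open>R\<close> shrinks its domain into
    \<open>U\<close>, where \<open>f\<close> is regular.\<close>
  show "\<exists>P Q. poly_fun n P \<and> poly_fun n Q \<and> Q (rep \<tau> p) \<noteq> 0 \<and>
    (\<forall>y\<in>dist_open \<tau> Q. f y = P (rep \<tau> y) / Q (rep \<tau> y))"
    using PQ R by (intro exI[of _ "\<lambda>u. P u * R u"] exI[of _ "\<lambda>u. Q u * R u"])
      (auto simp: dist_open_def intro: poly_fun.mult)
next
  assume "\<exists>P Q. poly_fun n P \<and> poly_fun n Q \<and> Q (rep \<tau> p) \<noteq> 0 \<and>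
    (\<forall>y\<in>dist_open \<tau> Q. f y = P (rep \<tau> y) / Q (rep \<tau> y))"
  then obtain P Q where PQ: "poly_fun n P" "poly_fun n Q" "Q (rep \<tau> p) \<noteq> 0"
    "\<forall>y\<in>dist_open \<tau> Q. f y = P (rep \<tau> y) / Q (rep \<tau> y)" by blast
  have "f \<in> reg X (dist_open \<tau> Q)" by (rule reg_frac[OF PQ(1,2) order_refl]) (use PQ(4) in auto)
  then show "f \<in> stalk X p" unfolding stalk_def
    using openin_dist_open[OF PQ(2), of \<tau>] assms PQ(3) by (auto simp: dist_open_def)
qed

lemma openin_sub: "openin (ftop (subspace_of X Z)) W \<longleftrightarrow> (\<exists>T. openin (ftop X) T \<and> W = T \<inter> Z)"
  by (simp add: subspace_of_def openin_subtopology)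

lemma pts_sub: "pts (subspace_of X Z) = pts X \<inter> Z"
  by (simp add: subspace_of_def)

lemma reg_sub: "f \<in> reg (subspace_of X Z) V \<longleftrightarrow>
    (\<forall>p\<in>V. \<exists>U h. openin (ftop X) U \<and> p \<in> U \<and> h \<in> reg X U \<and> (\<forall>y\<in>U \<inter> V. f y = h y))"
  by (simp add: subspace_of_def)

lemma germ_sub_iff:
  assumes "p \<in> chart \<tau>" "p \<in> Z"
  shows "germ_eq (subspace_of X Z) p f g \<longleftrightarrow>
    (\<exists>P. poly_fun n P \<and> P (rep \<tau> p) \<noteq> 0 \<and> (\<forall>y\<in>dist_open \<tau> P \<inter> Z. f y = g y))"
proof
  assume "germ_eq (subspace_of X Z) p f g"
  then obtain U where U: "openin (ftop X) U" "p \<in> U" "\<forall>y\<in>U \<inter> Z. f y = g y"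
    unfolding germ_eq_def openin_sub by blast
  obtain P where "poly_fun n P" "P (rep \<tau> p) \<noteq> 0" "dist_open \<tau> P \<subseteq> U" using open_local[OF U(1,2) assms(1)] .
  with U show "\<exists>P. poly_fun n P \<and> P (rep \<tau> p) \<noteq> 0 \<and> (\<forall>y\<in>dist_open \<tau> P \<inter> Z. f y = g y)" by blast
next
  assume "\<exists>P. poly_fun n P \<and> P (rep \<tau> p) \<noteq> 0 \<and> (\<forall>y\<in>dist_open \<tau> P \<inter> Z. f y = g y)"
  then obtain P where P: "poly_fun n P" "P (rep \<tau> p) \<noteq> 0" "\<forall>y\<in>dist_open \<tau> P \<inter> Z. f y = g y" by blast
  then show "germ_eq (subspace_of X Z) p f g" unfolding germ_eq_def openin_sub
    using openin_dist_open[OF P(1)] assms by (intro exI[of _ "dist_open \<tau> P \<inter> Z"]) (auto simp: dist_open_def)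
qed

lemma stalk_sub_iff:
  assumes "p \<in> chart \<tau>" "p \<in> Z"
  shows "f \<in> stalk (subspace_of X Z) p \<longleftrightarrow> (\<exists>P Q. poly_fun n P \<and> poly_fun n Q \<and> Q (rep \<tau> p) \<noteq> 0 \<and>
    (\<forall>y\<in>dist_open \<tau> Q \<inter> Z. f y = P (rep \<tau> y) / Q (rep \<tau> y)))"
proof
  assume "f \<in> stalk (subspace_of X Z) p"
  then obtain T where T: "openin (ftop X) T" "p \<in> T" "f \<in> reg (subspace_of X Z) (T \<inter> Z)"
    unfolding stalk_def openin_sub by blast
  obtain U h where U: "openin (ftop X) U" "p \<in> U" "h \<in> reg X U" "\<forall>y\<in>U \<inter> (T \<inter> Z). f y = h y"
    using T(2,3) assms(2) unfolding reg_sub by blast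
  have "openin (ftop X) (U \<inter> T)" "p \<in> U \<inter> T" using U T by auto
  then obtain R where R: "poly_fun n R" "R (rep \<tau> p) \<noteq> 0" "dist_open \<tau> R \<subseteq> U \<inter> T" using open_local[OF _ _ assms(1)] by blast
  obtain P Q where PQ: "poly_fun n P" "poly_fun n Q" "Q (rep \<tau> p) \<noteq> 0"
    "\<forall>y\<in>U \<inter> chart \<tau>. Q (rep \<tau> y) \<noteq> 0 \<longrightarrow> h y = P (rep \<tau> y) / Q (rep \<tau> y)" using reg_local[OF U(3,2) assms(1)] .
  have "f y = (P (rep \<tau> y) * R (rep \<tau> y)) / (Q (rep \<tau> y) * R (rep \<tau> y))"
    if y: "y \<in> dist_open \<tau> (\<lambda>u. Q u * R u) \<inter> Z" for y
  proof -
    have y': "y \<in> chart \<tau>" "Q (rep \<tau> y) \<noteq> 0" "R (rep \<tau> y) \<noteq> 0" "y \<in> Z" using y by (auto simp: dist_open_def)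
    then have "y \<in> U" "y \<in> T" using R(3) by (auto simp: dist_open_def)
    with U(4) PQ(4) y' show ?thesis by simp
  qed
  then show "\<exists>P Q. poly_fun n P \<and> poly_fun n Q \<and> Q (rep \<tau> p) \<noteq> 0 \<and>
    (\<forall>y\<in>dist_open \<tau> Q \<inter> Z. f y = P (rep \<tau> y) / Q (rep \<tau> y))"
    using PQ R by (intro exI[of _ "\<lambda>u. P u * R u"] exI[of _ "\<lambda>u. Q u * R u"])
      (auto intro: poly_fun.mult)
next
  assume "\<exists>P Q. poly_fun n P \<and> poly_fun n Q \<and> Q (rep \<tau> p) \<noteq> 0 \<and>
    (\<forall>y\<in>dist_open \<tau> Q \<inter> Z. f y = P (rep \<tau> y) / Q (rep \<tau> y))"
  then obtain P Q where PQ: "poly_fun n P" "poly_fun n Q" "Q (rep \<tau> p) \<noteq> 0"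
    "\<forall>y\<in>dist_open \<tau> Q \<inter> Z. f y = P (rep \<tau> y) / Q (rep \<tau> y)" by blast
  note o = openin_dist_open[OF PQ(2), of \<tau>]
  have h: "(\<lambda>y. P (rep \<tau> y) / Q (rep \<tau> y)) \<in> reg X (dist_open \<tau> Q)" by (rule reg_frac[OF PQ(1,2) order_refl refl])
  have "f \<in> reg (subspace_of X Z) (dist_open \<tau> Q \<inter> Z)"
    unfolding reg_sub
  proof
    fix q assume "q \<in> dist_open \<tau> Q \<inter> Z"
    then show "\<exists>U h. openin (ftop X) U \<and> q \<in> U \<and> h \<in> reg X U \<and> (\<forall>y\<in>U \<inter> (dist_open \<tau> Q \<inter> Z). f y = h y)"
      using o h PQ(4) by (intro exI[of _ "dist_open \<tau> Q"] exI[of _ "\<lambda>y. P (rep \<tau> y) / Q (rep \<tau> y)"]) auto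
  qed
  moreover have "openin (ftop (subspace_of X Z)) (dist_open \<tau> Q \<inter> Z)" unfolding openin_sub using o by blast
  moreover have "p \<in> dist_open \<tau> Q \<inter> Z" using assms PQ(3) by (simp add: dist_open_def)
  ultimately show "f \<in> stalk (subspace_of X Z) p" unfolding stalk_def by blast
qed

text \<open>A point outside a chart containing \<open>y\<close> is avoided by that chart; a point in
  the same chart differs from \<open>y\<close> in a coordinate of the slice.\<close>

lemma closedin_point: "x \<in> pts X \<Longrightarrow> closedin (ftop X) {x}"
proof -
  assume x: "x \<in> pts X"
  have "openin (ftop X) (pts X - {x})"
  proof (subst openin_subopen, intro ballI)
    fix y assume y: "y \<in> pts X - {x}"
    then obtain \<tau> where \<tau>: "y \<in> chart \<tau>" using ex_chart by blast
    show "\<exists>T. openin (ftop X) T \<and> y \<in> T \<and> T \<subseteq> pts X - {x}"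
    proof (cases "x \<in> chart \<tau>")
      case False
      then show ?thesis using \<tau> openin_chart[of \<tau>] chart_pts by (intro exI[of _ "chart \<tau>"]) auto
    next
      case True
      then have "rep \<tau> x \<noteq> rep \<tau> y" using rep_inj \<tau> y by blast
      then obtain i where i: "rep \<tau> x i \<noteq> rep \<tau> y i" by blast
      then have "i \<in> {1..n}" using cox_outside rep_cox \<tau> True by metis
      then have "poly_fun n (\<lambda>u. fst (u i))" "poly_fun n (\<lambda>u. snd (u i))" by (auto intro: poly_fun.intros)
      moreover have "fst (rep \<tau> x i) \<noteq> fst (rep \<tau> y i) \<or> snd (rep \<tau> x i) \<noteq> snd (rep \<tau> y i)"
        using i by (simp add: prod_eq_iff)
      ultimately have "\<exists>P. poly_fun n P \<and> P (rep \<tau> x) \<noteq> P (rep \<tau> y)" by auto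
      then obtain P where P: "poly_fun n P" "P (rep \<tau> x) \<noteq> P (rep \<tau> y)" by blast
      show ?thesis
        using \<tau> P chart_pts openin_dist_open[OF poly_fun_diff[OF P(1) poly_fun.const[of n "P (rep \<tau> x)"]], of \<tau>]
        by (intro exI[of _ "dist_open \<tau> (\<lambda>u. P u - P (rep \<tau> x))"]) (auto simp: dist_open_def)
    qed
  qed
  with x show ?thesis by (simp add: closedin_def)
qed

end

section \<open>Irreducible closed subsets and curves\<close>

lemma irreducible_closed_subtopology:
  assumes "irreducible_closed T A" "A \<subseteq> Z" "closedin T Z"
  shows "irreducible_closed (subtopology T Z) A"
  using assms unfolding irreducible_closed_def closedin_closed_subtopology[OF assms(3)] by blast

lemma irreducible_closed_point: "closedin T {x} \<Longrightarrow> irreducible_closed T {x}"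
  unfolding irreducible_closed_def by blast

lemma irreducible_closure:
  assumes "W \<noteq> {}" "W \<subseteq> topspace T"
    and "\<And>V V'. openin T V \<Longrightarrow> openin T V' \<Longrightarrow> V \<inter> W \<noteq> {} \<Longrightarrow> V' \<inter> W \<noteq> {} \<Longrightarrow> V \<inter> V' \<inter> W \<noteq> {}"
  shows "irreducible_closed T (T closure_of W)"
  unfolding irreducible_closed_def
proof (intro conjI allI impI)
  show "closedin T (T closure_of W)" by simp
  show "T closure_of W \<noteq> {}" using assms(1) closure_of_subset[OF assms(2)] by blast
  fix A B assume A: "closedin T A" and B: "closedin T B" and AB: "T closure_of W \<subseteq> A \<union> B"
  show "T closure_of W \<subseteq> A \<or> T closure_of W \<subseteq> B"
  proof (rule ccontr)
    assume "\<not> ?thesis"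
    then have "\<not> W \<subseteq> A" "\<not> W \<subseteq> B" using closure_of_minimal A B by blast+
    then have "(topspace T - A) \<inter> W \<noteq> {}" "(topspace T - B) \<inter> W \<noteq> {}" using assms(2) by blast+
    moreover have "openin T (topspace T - A)" "openin T (topspace T - B)" using A B by auto
    ultimately have "(topspace T - A) \<inter> (topspace T - B) \<inter> W \<noteq> {}" using assms(3) by blast
    with AB closure_of_subset[OF assms(2)] show False by blast
  qed
qed

lemma krull_dim_ge:
  assumes "\<And>i. i \<le> k \<Longrightarrow> irreducible_closed T (Z i)" "\<And>i. i < k \<Longrightarrow> Z i \<subset> Z (Suc i)"
  shows "enat k \<le> krull_dim T"
  unfolding krull_dim_def by (rule Sup_upper) (use assms in blast)

context bott
begin

text \<open>Fixing the values outside \<open>{1..n}\<close> leaves finitely many selections, and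
  they still cover.\<close>

definition Charts :: "(nat \<Rightarrow> bool) set" where
  "Charts = {\<tau>. \<forall>i. i \<notin> {1..n} \<longrightarrow> \<not> \<tau> i}"

lemma finite_Charts: "finite Charts"
proof -
  have "Charts \<subseteq> {f. \<forall>x. (x \<in> {1..n} \<longrightarrow> f x \<in> UNIV) \<and> (x \<notin> {1..n} \<longrightarrow> f x = False)}"
    by (auto simp: Charts_def)
  moreover have "finite {f. \<forall>x. (x \<in> {1..n} \<longrightarrow> f x \<in> (UNIV :: bool set)) \<and> (x \<notin> {1..n} \<longrightarrow> f x = False)}"
    by (rule finite_set_of_finite_funs) auto
  ultimately show ?thesis by (rule finite_subset)
qed

lemma ex_Charts:
  assumes "x \<in> pts X"
  shows "\<exists>\<tau>\<in>Charts. x \<in> chart \<tau>"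
proof -
  obtain u where u: "u \<in> cox_points n" "x = bp u" using assms by (rule ptsE)
  let ?\<tau> = "\<lambda>i. i \<in> {1..n} \<and> fst (u i) \<noteq> 0"
  have "inU ?\<tau> u"
    using u(1) by (auto simp: inU_def cox_points_def cc_def prod_eq_iff)
  then have "x \<in> chart ?\<tau>" using u(2) unfolding chart_def by blast
  moreover have "?\<tau> \<in> Charts" by (auto simp: Charts_def)
  ultimately show ?thesis by (rule bexI)
qed

text \<open>The ideal lives in the ring of all Cox coordinates rather than in that of the slice; by
  \<open>vI_cc\<close> it contains the equations of the slice, so its zeros lie there
  automatically.\<close>

definition vI :: "(nat \<Rightarrow> bool) \<Rightarrow> coords set set \<Rightarrow> (coords \<Rightarrow> complex) set" where
  "vI \<tau> Z = {P. poly_fun n P \<and> (\<forall>y\<in>Z \<inter> chart \<tau>. P (rep \<tau> y) = 0)}"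

lemma vI_pideal: "pideal n (vI \<tau> Z)"
  unfolding pideal_def vI_def
  by (auto intro!: subspaceI poly_fun.intros poly_fun_scale)

lemma vI_cc: "i \<in> {1..n} \<Longrightarrow> (\<lambda>u. cc \<tau> i u - 1) \<in> vI \<tau> Z"
  unfolding vI_def using poly_fun_diff[OF poly_cc poly_fun.const] rep_slice by (auto simp: slice_def)

lemma in_closed_of_vI:
  assumes Z: "closedin (ftop X) Z" and u: "u \<in> slice \<tau>" "\<And>P. P \<in> vI \<tau> Z \<Longrightarrow> P u = 0"
  shows "bp u \<in> Z"
proof (rule ccontr)
  assume "bp u \<notin> Z"
  then have "bp u \<in> pts X - Z" using bp_pts[OF slice_cox[OF u(1)]] by blast
  moreover have "openin (ftop X) (pts X - Z)" using Z by auto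
  ultimately obtain P where P: "poly_fun n P" "P (rep \<tau> (bp u)) \<noteq> 0" "dist_open \<tau> P \<subseteq> pts X - Z"
    using open_local[OF _ _ bp_slice_chart[OF u(1)]] by blast
  have "P \<in> vI \<tau> Z" using P by (auto simp: vI_def dist_open_def)
  with u(2) P(2) rep_of_slice[OF u(1)] show False by simp
qed

lemma slice_of_zero:
  assumes "\<And>i. i \<notin> {1..n} \<Longrightarrow> u i = (0, 0)" "\<And>f. f \<in> J \<Longrightarrow> f u = 0" "vI \<tau> Z \<subseteq> J"
  shows "u \<in> slice \<tau>"
proof -
  have "cc \<tau> i u = 1" if "i \<in> {1..n}" for i
    using assms(2)[of "\<lambda>u. cc \<tau> i u - 1"] vI_cc[OF that] assms(3) by auto
  with assms(1) show ?thesis by (auto simp: slice_def)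
qed

end

locale bott_irr = bott +
  fixes Z :: "coords set set"
  assumes irr: "irreducible_closed (ftop X) Z"
begin

abbreviation "Y \<equiv> subspace_of X Z"

lemma Z_closed: "closedin (ftop X) Z" using irr by (simp add: irreducible_closed_def)

lemma Z_pts: "Z \<subseteq> pts X" using Z_closed closedin_subset by blast

lemma Z_ne: "Z \<noteq> {}" using irr by (simp add: irreducible_closed_def)

lemma irr_open:
  assumes "openin (ftop X) V" "openin (ftop X) V'" "V \<inter> Z \<noteq> {}" "V' \<inter> Z \<noteq> {}"
  shows "V \<inter> V' \<inter> Z \<noteq> {}"
proof
  assume e: "V \<inter> V' \<inter> Z = {}"
  have "closedin (ftop X) (pts X - V)" "closedin (ftop X) (pts X - V')" using assms by auto
  moreover have "Z \<subseteq> (pts X - V) \<union> (pts X - V')" using e Z_pts by blast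
  ultimately have "Z \<subseteq> pts X - V \<or> Z \<subseteq> pts X - V'" using irr unfolding irreducible_closed_def by blast
  with assms show False by blast
qed

lemma vI_prime:
  assumes P: "poly_fun n P" and Q: "poly_fun n Q" and PQ: "(\<lambda>u. P u * Q u) \<in> vI \<tau> Z"
  shows "P \<in> vI \<tau> Z \<or> Q \<in> vI \<tau> Z"
proof (rule ccontr)
  assume "\<not> ?thesis"
  then have "dist_open \<tau> P \<inter> Z \<noteq> {}" "dist_open \<tau> Q \<inter> Z \<noteq> {}"
    using P Q by (auto simp: vI_def dist_open_def)
  from irr_open[OF openin_dist_open[OF P] openin_dist_open[OF Q] this]
  show False using PQ by (auto simp: vI_def dist_open_def)
qed

text \<open>Identity theorem: a polynomial that vanishes on the part of \<open>Z\<close> near one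
  point vanishes on all of \<open>Z\<close> in the chart, since its product with \<open>R\<close>
  does and \<open>R\<close> does not.\<close>

lemma vI_local:
  assumes P: "poly_fun n P" and R: "poly_fun n R" "p \<in> Z" "p \<in> chart \<tau>" "R (rep \<tau> p) \<noteq> 0"
    and z: "\<And>y. y \<in> dist_open \<tau> R \<inter> Z \<Longrightarrow> P (rep \<tau> y) = 0"
  shows "P \<in> vI \<tau> Z"
proof -
  have "(\<lambda>u. P u * R u) \<in> vI \<tau> Z" using P R(1) z by (auto simp: vI_def dist_open_def intro: poly_fun.mult)
  moreover have "R \<notin> vI \<tau> Z" using R by (auto simp: vI_def)
  ultimately show ?thesis using vI_prime[OF P R(1)] by blast
qed

lemma reg_sub_stalk:
  assumes "openin (ftop Y) V" "f \<in> reg Y V" "p \<in> V"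
  shows "f \<in> stalk Y p"
  using assms unfolding stalk_def by blast

end

context bott
begin

text \<open>Two nonempty open sets are joined by a line in Cox space. A line may leave
  \<open>cox_points\<close>; the polynomial \<open>?w\<close>, nonzero only where all
  \<open>w_i\<close> are, guards against this.\<close>

lemma X_irreducible: "irreducible_closed (ftop X) (pts X)"
proof -
  let ?e = "\<lambda>i. if i \<in> {1..n} then (0, 1) else (0::complex, 0::complex)"
  let ?w = "\<lambda>u::coords. \<Prod>i\<in>{1..n}. snd (u i)"
  have w: "poly_fun n ?w" by (intro poly_fun_prod poly_fun.intros)
  have supp: "(\<forall>i. i \<notin> {1..n} \<longrightarrow> line u v s i = (0, 0))"
    if "\<And>i. i \<notin> {1..n} \<Longrightarrow> u i = (0, 0)" "\<And>i. i \<notin> {1..n} \<Longrightarrow> v i = (0, 0)" for u v s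
    using that by (simp add: line_def)
  \<comment> \<open>A point of a distinguished set is moved along the line to \<open>?e\<close>
    until all its \<open>w_i\<close> are nonzero as well.\<close>
  have gen: "\<exists>u. (\<forall>i. i \<notin> {1..n} \<longrightarrow> u i = (0, 0)) \<and> P u \<noteq> 0 \<and> ?w u \<noteq> 0"
    if P: "poly_fun n P" "P u \<noteq> 0" "u \<in> cox_points n" for P u
  proof -
    have "?w ?e \<noteq> 0" by simp
    from poly_fun_line_nonzero[OF P(1) w P(2) this] obtain s
      where s: "P (line u ?e s) \<noteq> 0" "?w (line u ?e s) \<noteq> 0" .
    show ?thesis using s supp[of u ?e s] cox_outside[OF P(3)] by (intro exI[of _ "line u ?e s"]) auto
  qed
  have inter: "V \<inter> V' \<inter> pts X \<noteq> {}"
    if V: "openin (ftop X) V" "openin (ftop X) V'" "V \<inter> pts X \<noteq> {}" "V' \<inter> pts X \<noteq> {}" for V V'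
  proof -
    have ex: "\<exists>P u. poly_fun n P \<and> P u \<noteq> 0 \<and> u \<in> cox_points n \<and> (\<forall>v\<in>cox_points n. P v \<noteq> 0 \<longrightarrow> bp v \<in> V)"
      if V: "openin (ftop X) V" "V \<inter> pts X \<noteq> {}" for V
    proof -
      obtain x where x: "x \<in> V" "x \<in> pts X" using V(2) by blast
      then obtain u where u: "u \<in> cox_points n" "x = bp u" using ptsE by blast
      then have "u \<in> {u \<in> cox_points n. bp u \<in> V}" using x by simp
      moreover have "openin (ftop (cox_space n)) {u \<in> cox_points n. bp u \<in> V}" using V(1) openin_X by blast
      ultimately obtain P where "poly_fun n P" "P u \<noteq> 0"
        "\<And>v. v \<in> cox_points n \<Longrightarrow> P v \<noteq> 0 \<Longrightarrow> v \<in> {u \<in> cox_points n. bp u \<in> V}"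
        using openin_cox_basic by blast
      with u(1) show ?thesis by (intro exI[of _ P] exI[of _ u]) auto
    qed
    obtain P u where P: "poly_fun n P" "P u \<noteq> 0" "u \<in> cox_points n" "\<forall>v\<in>cox_points n. P v \<noteq> 0 \<longrightarrow> bp v \<in> V"
      using ex[OF V(1,3)] by blast
    obtain Q v where Q: "poly_fun n Q" "Q v \<noteq> 0" "v \<in> cox_points n" "\<forall>v\<in>cox_points n. Q v \<noteq> 0 \<longrightarrow> bp v \<in> V'"
      using ex[OF V(2,4)] by blast
    obtain u' where u': "\<And>i. i \<notin> {1..n} \<Longrightarrow> u' i = (0, 0)" "P u' \<noteq> 0" "?w u' \<noteq> 0" using gen[OF P(1-3)] by blast
    obtain v' where v': "\<And>i. i \<notin> {1..n} \<Longrightarrow> v' i = (0, 0)" "Q v' \<noteq> 0" "?w v' \<noteq> 0" using gen[OF Q(1-3)] by blast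
    have "P u' * ?w u' \<noteq> 0" using u' by simp
    from poly_fun_line_nonzero[OF poly_fun.mult[OF P(1) w] Q(1) this v'(2)]
    obtain s where s: "P (line u' v' s) * ?w (line u' v' s) \<noteq> 0" "Q (line u' v' s) \<noteq> 0" .
    have c: "line u' v' s \<in> cox_points n"
      unfolding cox_points_def using supp[OF u'(1) v'(1), where s = s] s(1) by auto
    have "bp (line u' v' s) \<in> V \<inter> V' \<inter> pts X" using P(4) Q(4) c s bp_pts[OF c] by auto
    then show ?thesis by blast
  qed
  have ne: "pts X \<noteq> {}"
  proof -
    have "?e \<in> cox_points n" by (simp add: cox_points_def)
    from bp_pts[OF this] show ?thesis by blast
  qed
  from irreducible_closure[OF ne order_refl inter] show ?thesis by simp
qed

lemma curve_irr: "is_curve X Z \<Longrightarrow> bott_irr n c Z"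
  by unfold_locales (simp add: is_curve_def)

text \<open>Otherwise there is a prime \<open>J\<close> of infinite codimension containing the ideal
  of \<open>Z\<close> and \<open>P\<close>. Its zero set is irreducible, smaller than
  \<open>Z\<close> because of \<open>P\<close>, and not a point, so that \<open>Z\<close> has a
  chain of length 2 against Krull dimension 1.\<close>

lemma curve_fincod:
  assumes Z: "is_curve X Z" and P: "poly_fun n P" "P \<notin> vI \<tau> Z"
  shows "fincod (Collect (poly_fun n)) (adj_ideal n (vI \<tau> Z) P)"
proof (rule ccontr)
  interpret bott_irr n c Z by (rule curve_irr[OF Z])
  let ?A = "Collect (poly_fun n)"
  assume inf: "\<not> fincod ?A (adj_ideal n (vI \<tau> Z) P)"
  note adj = pideal_adj[OF vI_pideal P(1), of \<tau> Z]
  obtain J where J: "pideal n J" "adj_ideal n (vI \<tau> Z) P \<subseteq> J" "\<not> fincod ?A J"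
    and prime: "\<forall>a b. poly_fun n a \<longrightarrow> poly_fun n b \<longrightarrow> (\<lambda>u. a u * b u) \<in> J \<longrightarrow> a \<in> J \<or> b \<in> J"
    by (rule ex_prime_infinite_codim[OF adj(1) inf])
  have J4: "a \<in> J \<or> b \<in> J" if "poly_fun n a" "poly_fun n b" "(\<lambda>u. a u * b u) \<in> J" for a b
    using prime[THEN spec[of _ a], THEN spec[of _ b]] that by simp
  have vJ: "vI \<tau> Z \<subseteq> J" and PJ: "P \<in> J" using adj J(2) by auto
  note subJ = pideal_subspace[OF J(1)]
  have one: "(\<lambda>_. 1) \<notin> J"
  proof
    assume 1: "(\<lambda>_. 1) \<in> J"
    have "?A \<subseteq> J" using pideal_mult[OF J(1) _ 1] by auto
    then have "?A \<subseteq> fun_vs.span ({} \<union> J)" using fun_vs.span_superset[of J] by auto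
    then have "fincod ?A J" by (intro fincodI[of "{}"]) auto
    with J(3) show False ..
  qed
  have pow: "(\<lambda>u. g u ^ k) \<notin> J" if g: "poly_fun n g" "g \<notin> J" for g k
  proof (induction k)
    case (Suc k)
    then show ?case using J4[OF g(1) poly_fun_power[OF g(1), of k]] g(2) by auto
  qed (use one in simp)
  define W where "W = {y \<in> chart \<tau>. \<forall>f\<in>J. f (rep \<tau> y) = 0}"
  have nss: "\<exists>y\<in>W. g (rep \<tau> y) \<noteq> 0" if g: "poly_fun n g" "g \<notin> J" for g
  proof -
    obtain u where u: "\<forall>i. i \<notin> {1..n} \<longrightarrow> u i = (0, 0)" "\<forall>f\<in>J. f u = 0" "g u \<noteq> 0"
      by (rule nullstellensatz[OF J(1) g(1) pow[OF g]])
    have s: "u \<in> slice \<tau>" by (rule slice_of_zero[OF _ _ vJ]) (use u in auto)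
    show ?thesis
      using u bp_slice_chart[OF s] rep_of_slice[OF s] by (intro bexI[of _ "bp u"]) (auto simp: W_def)
  qed
  have WZ: "W \<subseteq> Z"
  proof
    fix y assume y: "y \<in> W"
    then have "bp (rep \<tau> y) \<in> Z" using vJ by (intro in_closed_of_vI[OF Z_closed rep_slice]) (auto simp: W_def)
    then show "y \<in> Z" using bp_rep y by (simp add: W_def)
  qed
  have Wpts: "W \<subseteq> pts X" using WZ Z_pts by blast
  obtain x where x: "x \<in> W" using nss[OF poly_fun.const one] by blast
  \<comment> \<open>If \<open>W\<close> were a point, the Nullstellensatz would put every function
    vanishing at it into \<open>J\<close>, leaving codimension at most 1.\<close>
  have "W \<noteq> {x}"
  proof
    assume Wx: "W = {x}"
    have max: "f \<in> J" if "poly_fun n f" "f (rep \<tau> x) = 0" for f using nss[of f] that Wx by auto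
    have "?A \<subseteq> fun_vs.span ({\<lambda>_. 1} \<union> J)"
    proof
      fix f assume f: "f \<in> ?A"
      have "(\<lambda>u. f u - f (rep \<tau> x)) \<in> J" using f by (intro max poly_fun_diff poly_fun.const) auto
      then have 1: "(\<lambda>u. f u - f (rep \<tau> x)) \<in> fun_vs.span ({\<lambda>_. 1} \<union> J)" by (intro fun_vs.span_base) simp
      have "(\<lambda>u. f (rep \<tau> x) * 1) \<in> fun_vs.span ({\<lambda>_. 1} \<union> J)"
        by (intro subspace_scale' fun_vs.subspace_span fun_vs.span_base) simp
      from subspace_add'[OF fun_vs.subspace_span 1 this] show "f \<in> fun_vs.span ({\<lambda>_. 1} \<union> J)" by simp
    qed
    then have "fincod ?A J" by (intro fincodI[of "{\<lambda>_. 1}"]) (auto intro: poly_fun.const)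
    with J(3) show False ..
  qed
  then obtain x' where x': "x' \<in> W" "x' \<noteq> x" using x by blast
  define Z1 where "Z1 = (ftop X) closure_of W"
  have W1: "W \<subseteq> Z1" unfolding Z1_def by (rule closure_of_subset[OF Wpts])
  have irr1: "irreducible_closed (ftop X) Z1"
    unfolding Z1_def
  proof (rule irreducible_closure[OF _ Wpts])
    show "W \<noteq> {}" using x by blast
    fix V V' assume V: "openin (ftop X) V" "openin (ftop X) V'" "V \<inter> W \<noteq> {}" "V' \<inter> W \<noteq> {}"
    have ex: "\<exists>P. poly_fun n P \<and> P \<notin> J \<and> dist_open \<tau> P \<subseteq> V" if V: "openin (ftop X) V" "V \<inter> W \<noteq> {}" for V
    proof -
      obtain y where y: "y \<in> V" "y \<in> W" using V(2) by blast
      then have "y \<in> chart \<tau>" by (simp add: W_def)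
      then obtain P where "poly_fun n P" "P (rep \<tau> y) \<noteq> 0" "dist_open \<tau> P \<subseteq> V" by (rule open_local[OF V(1) y(1)])
      with y(2) show ?thesis by (auto simp: W_def)
    qed
    obtain A where A: "poly_fun n A" "A \<notin> J" "dist_open \<tau> A \<subseteq> V" using ex[OF V(1,3)] by blast
    obtain B where B: "poly_fun n B" "B \<notin> J" "dist_open \<tau> B \<subseteq> V'" using ex[OF V(2,4)] by blast
    have "(\<lambda>u. A u * B u) \<notin> J" using J4[OF A(1) B(1)] A(2) B(2) by blast
    from nss[OF poly_fun.mult[OF A(1) B(1)] this] obtain y where y: "y \<in> W" "A (rep \<tau> y) * B (rep \<tau> y) \<noteq> 0" by blast
    then have "y \<in> dist_open \<tau> A" "y \<in> dist_open \<tau> B" by (auto simp: dist_open_def W_def)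
    with A(3) B(3) y(1) show "V \<inter> V' \<inter> W \<noteq> {}" by blast
  qed
  have Z1Z: "Z1 \<subseteq> Z" unfolding Z1_def by (rule closure_of_minimal[OF WZ Z_closed])
  obtain y where y: "y \<in> Z" "y \<in> chart \<tau>" "P (rep \<tau> y) \<noteq> 0" using P by (auto simp: vI_def)
  have "y \<notin> Z1"
  proof
    assume "y \<in> Z1"
    moreover have "y \<in> dist_open \<tau> P" using y by (simp add: dist_open_def)
    ultimately obtain z where "z \<in> W" "z \<in> dist_open \<tau> P"
      unfolding Z1_def in_closure_of using openin_dist_open[OF P(1)] by blast
    with PJ show False by (auto simp: W_def dist_open_def)
  qed
  \<comment> \<open>The forbidden chain: a point, the closure of \<open>W\<close>, and
    \<open>Z\<close>.\<close>
  define F where "F = (\<lambda>i::nat. if i = 0 then {x} else if i = 1 then Z1 else Z)"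
  have "enat 2 \<le> krull_dim (subtopology (ftop X) Z)"
  proof (rule krull_dim_ge[of 2 _ F])
    fix i :: nat
    have "irreducible_closed (ftop X) (F i)" "F i \<subseteq> Z"
      using irreducible_closed_point[OF closedin_point] irr1 irr x Wpts WZ Z1Z by (auto simp: F_def)
    then show "irreducible_closed (subtopology (ftop X) Z) (F i)"
      by (rule irreducible_closed_subtopology[OF _ _ Z_closed])
    assume i: "i < 2"
    then have "i = 0 \<or> i = 1" by auto
    then show "F i \<subset> F (Suc i)" using x x' W1 Z1Z y(1) \<open>y \<notin> Z1\<close> by (auto simp: F_def)
  qed
  then show False using Z by (simp add: is_curve_def one_enat_def)
qed

lemma finite_of_coord_relations:
  assumes "\<And>x. x \<in> UNIV \<times> {1..n} \<Longrightarrow> \<exists>R. R \<noteq> 0 \<and> (\<forall>u\<in>S. poly R (coordf x u) = 0)"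
    and "\<And>u i. u \<in> S \<Longrightarrow> i \<notin> {1..n} \<Longrightarrow> u i = (0, 0)"
  shows "finite S"
proof -
  obtain R where R: "\<And>x. x \<in> UNIV \<times> {1..n} \<Longrightarrow> R x \<noteq> 0 \<and> (\<forall>u\<in>S. poly (R x) (coordf x u) = 0)"
    using assms(1) by metis
  define F where "F = (\<Union>x\<in>UNIV \<times> {1..n}. {z. poly (R x) z = 0})"
  have F: "finite F" unfolding F_def by (intro finite_UN_I poly_roots_finite) (use R in auto)
  have "S \<subseteq> {f. \<forall>i. (i \<in> {1..n} \<longrightarrow> f i \<in> F \<times> F) \<and> (i \<notin> {1..n} \<longrightarrow> f i = (0, 0))}"
  proof (intro subsetI CollectI allI conjI impI)
    fix u i assume u: "u \<in> S" and i: "i \<in> {1..n}"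
    have "coordf (True, i) u \<in> F" "coordf (False, i) u \<in> F" unfolding F_def using R u i by blast+
    then show "u i \<in> F \<times> F" by (simp add: coordf_def mem_Times_iff)
  qed (use assms(2) in auto)
  moreover have "finite {f. \<forall>i. (i \<in> {1..n} \<longrightarrow> f i \<in> F \<times> F) \<and> (i \<notin> {1..n} \<longrightarrow> f i = (0, 0))}"
    using F by (intro finite_set_of_finite_funs) auto
  ultimately show ?thesis by (rule finite_subset)
qed

text \<open>Modulo an ideal of finite codimension each coordinate is algebraic, so it takes only
  finitely many values on the zeros.\<close>

lemma curve_finite_zeros:
  assumes Z: "is_curve X Z" and P: "poly_fun n P" "P \<notin> vI \<tau> Z"
  shows "finite {y \<in> Z \<inter> chart \<tau>. P (rep \<tau> y) = 0}" (is "finite ?S")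
proof -
  let ?J = "adj_ideal n (vI \<tau> Z) P"
  note adj = pideal_adj[OF vI_pideal P(1), of \<tau> Z]
  have J0: "f (rep \<tau> y) = 0" if f: "f \<in> ?J" and y: "y \<in> ?S" for f y
  proof -
    obtain j b where "j \<in> vI \<tau> Z" "\<And>u. f u = j u + P u * b u" using f by (rule adj_idealE) blast
    with y show ?thesis by (auto simp: vI_def)
  qed
  have "finite (rep \<tau> ` ?S)"
  proof (rule finite_of_coord_relations)
    fix x :: "bool \<times> nat" assume x: "x \<in> UNIV \<times> {1..n}"
    have "poly_fun n (coordf x)" using x by (intro poly_fun_coordf) auto
    then have "(\<lambda>u. coordf x u ^ k) \<in> Collect (poly_fun n)" for k by (simp add: poly_fun_power)
    then obtain R where "R \<noteq> 0" "(\<lambda>u. poly R (coordf x u)) \<in> ?J"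
      by (rule poly_relation[OF curve_fincod[OF Z P] pideal_subspace[OF adj(1)]])
    then show "\<exists>R. R \<noteq> 0 \<and> (\<forall>u\<in>rep \<tau> ` ?S. poly R (coordf x u) = 0)" using J0 by (intro exI[of _ R]) blast
  next
    fix u i assume "u \<in> rep \<tau> ` ?S" "i \<notin> {1..n}"
    then show "u i = (0, 0)" using rep_cox cox_outside by blast
  qed
  moreover have "inj_on (rep \<tau>) ?S" using rep_inj by (auto intro!: inj_onI)
  ultimately show ?thesis by (rule finite_imageD)
qed

end

context bott_irr
begin

text \<open>In every chart meeting \<open>Z\<close>, a polynomial vanishes on \<open>B\<close> and
  not on \<open>Z\<close>; finitely many charts cover. Stated with finiteness of zeros as a premise
  so that it also serves to prove that a given set is a curve.\<close>

lemma finite_closed_subset: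
  assumes fz: "\<And>P \<tau>. poly_fun n P \<Longrightarrow> P \<notin> vI \<tau> Z \<Longrightarrow> finite {y \<in> Z \<inter> chart \<tau>. P (rep \<tau> y) = 0}"
    and B: "closedin (ftop X) B" "B \<subseteq> Z" "B \<noteq> Z"
  shows "finite B"
proof -
  have "finite (B \<inter> chart \<tau>)" for \<tau>
  proof (cases "chart \<tau> \<inter> Z = {}")
    case True
    then have "B \<inter> chart \<tau> = {}" using B(2) by blast
    then show ?thesis by simp
  next
    case False
    have o: "openin (ftop X) (pts X - B)" using B(1) by auto
    have "(pts X - B) \<inter> Z \<noteq> {}" using B(2,3) Z_pts by blast
    from irr_open[OF o openin_chart this False] obtain y where y: "y \<in> pts X - B" "y \<in> chart \<tau>" "y \<in> Z" by blast
    obtain P where P: "poly_fun n P" "P (rep \<tau> y) \<noteq> 0" "dist_open \<tau> P \<subseteq> pts X - B" by (rule open_local[OF o y(1,2)])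
    have "P \<notin> vI \<tau> Z" using P y by (auto simp: vI_def)
    from fz[OF P(1) this] show ?thesis
      by (rule rev_finite_subset) (use P(3) B(2) in \<open>auto simp: dist_open_def\<close>)
  qed
  then have "finite (\<Union>\<tau>\<in>Charts. B \<inter> chart \<tau>)" using finite_Charts by blast
  moreover have "B \<subseteq> (\<Union>\<tau>\<in>Charts. B \<inter> chart \<tau>)" using ex_Charts B(2) Z_pts by blast
  ultimately show ?thesis by (rule rev_finite_subset)
qed

text \<open>Subsets of a finite \<open>Z\<close> are closed, as points are; splitting off one point
  contradicts irreducibility.\<close>

lemma finite_singleton:
  assumes fin: "finite Z"
  shows "\<exists>x. Z = {x}"
proof -
  obtain x where x: "x \<in> Z" using Z_ne by blast
  have cl: "closedin (ftop X) F" if F: "F \<subseteq> Z" for F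
  proof -
    have "closedin (ftop X) (\<Union>y\<in>F. {y})"
      using finite_subset[OF F fin] by (intro closedin_Union) (use F Z_pts closedin_point in auto)
    then show ?thesis by simp
  qed
  have "Z \<subseteq> {x} \<or> Z \<subseteq> Z - {x}"
    using irr cl[of "{x}"] cl[of "Z - {x}"] x unfolding irreducible_closed_def by blast
  then show ?thesis using x by blast
qed

end

context bott
begin

lemma curve_finite_closed_subset:
  assumes Z: "is_curve X Z" and B: "closedin (ftop X) B" "B \<subseteq> Z" "B \<noteq> Z"
  shows "finite B"
  by (rule bott_irr.finite_closed_subset[OF curve_irr[OF Z] curve_finite_zeros[OF Z] B])

lemma curve_infinite:
  assumes Z: "is_curve X Z"
  shows "infinite Z"
proof
  assume fin: "finite Z"
  then obtain x where Zx: "Z = {x}" using bott_irr.finite_singleton[OF curve_irr[OF Z]] by blast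
  have "krull_dim (subtopology (ftop X) Z) \<le> 0"
    unfolding krull_dim_def
  proof (rule Sup_least, clarify)
    fix k F assume F: "\<forall>i\<le>k. irreducible_closed (subtopology (ftop X) Z) (F i)" "\<forall>i<k. F i \<subset> F (Suc i)"
    have "F i = {x}" if "i \<le> k" for i
      using F(1) that closedin_subset[of "subtopology (ftop X) Z" "F i"] Zx
      unfolding irreducible_closed_def by auto
    then have "k = 0" using F(2) by (metis Suc_leI gr0I less_imp_le psubsetE subset_refl)
    then show "enat k \<le> 0" by (simp add: zero_enat_def)
  qed
  with Z show False by (simp add: is_curve_def)
qed

lemma curve_subset_eq:
  assumes "is_curve X Z" "is_curve X Z'" "Z' \<subseteq> Z"
  shows "Z' = Z"
  using curve_finite_closed_subset[OF assms(1) _ assms(3)] curve_infinite[OF assms(2)] assms(2)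
  by (auto simp: is_curve_def irreducible_closed_def)

end

locale bott_curve = bott +
  fixes C :: "coords set set"
  assumes curve: "is_curve X C"
begin

sublocale bott_irr n c C by (rule curve_irr[OF curve])

text \<open>The coordinate ring of the affine piece of \<open>C\<close> in the chart, as functions
  of points of \<open>X\<close>.\<close>

definition A :: "(nat \<Rightarrow> bool) \<Rightarrow> (coords set \<Rightarrow> complex) set" where
  "A \<tau> = {\<lambda>y. P (rep \<tau> y) |P. poly_fun n P}"

lemma AE: "a \<in> A \<tau> \<Longrightarrow> \<exists>P. poly_fun n P \<and> a = (\<lambda>y. P (rep \<tau> y))"
  by (auto simp: A_def)

lemma A_ex: "(\<exists>a\<in>A \<tau>. \<Phi> a) \<longleftrightarrow> (\<exists>P. poly_fun n P \<and> \<Phi> (\<lambda>y. P (rep \<tau> y)))"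
  by (auto simp: A_def)

lemma lin_rep: "lin (\<lambda>P y. P (rep \<tau> y))"
  by (auto simp: lin_def)

text \<open>Integrality is the primality of \<open>vI\<close>, and the condition of dimension one is
  \<open>curve_fincod\<close>, pushed forward from polynomials to functions on the chart.\<close>

lemma local_curve_at:
  assumes p: "p \<in> C" "p \<in> chart \<tau>"
  shows "local_curve Y p (C \<inter> chart \<tau>) (A \<tau>)"
proof
  show "p \<in> C \<inter> chart \<tau>" using p by simp
  show "(\<lambda>_. k) \<in> A \<tau>" for k unfolding A_def by (auto intro!: exI[of _ "\<lambda>_. k"] poly_fun.const)
  show "(\<lambda>y. a y + b y) \<in> A \<tau>" if ab: "a \<in> A \<tau>" "b \<in> A \<tau>" for a b
  proof -
    obtain P Q where "poly_fun n P" "a = (\<lambda>y. P (rep \<tau> y))" "poly_fun n Q" "b = (\<lambda>y. Q (rep \<tau> y))"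
      using AE[OF ab(1)] AE[OF ab(2)] by auto
    then show ?thesis unfolding A_def by (auto intro!: exI[of _ "\<lambda>u. P u + Q u"] poly_fun.add)
  qed
  show "(\<lambda>y. a y * b y) \<in> A \<tau>" if ab: "a \<in> A \<tau>" "b \<in> A \<tau>" for a b
  proof -
    obtain P Q where "poly_fun n P" "a = (\<lambda>y. P (rep \<tau> y))" "poly_fun n Q" "b = (\<lambda>y. Q (rep \<tau> y))"
      using AE[OF ab(1)] AE[OF ab(2)] by auto
    then show ?thesis unfolding A_def by (auto intro!: exI[of _ "\<lambda>u. P u * Q u"] poly_fun.mult)
  qed
  have dist: "(\<forall>y\<in>dist_open \<tau> Q \<inter> C. \<phi> y) \<longleftrightarrow> (\<forall>y\<in>C \<inter> chart \<tau>. Q (rep \<tau> y) \<noteq> 0 \<longrightarrow> \<phi> y)" for Q \<phi>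
    by (auto simp: dist_open_def)
  show "f \<in> stalk Y p \<longleftrightarrow> (\<exists>a\<in>A \<tau>. \<exists>b\<in>A \<tau>. b p \<noteq> 0 \<and> (\<forall>y\<in>C \<inter> chart \<tau>. b y \<noteq> 0 \<longrightarrow> f y = a y / b y))" for f
    unfolding stalk_sub_iff[OF p(2,1)] dist A_ex by (simp only: ex_simps)
  show "germ_eq Y p f g \<longleftrightarrow> (\<exists>b\<in>A \<tau>. b p \<noteq> 0 \<and> (\<forall>y\<in>C \<inter> chart \<tau>. b y \<noteq> 0 \<longrightarrow> f y = g y))" for f g
    unfolding germ_sub_iff[OF p(2,1)] dist A_ex by (rule refl)
  show "(\<forall>y\<in>C \<inter> chart \<tau>. a y = 0) \<or> (\<forall>y\<in>C \<inter> chart \<tau>. b y = 0)"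
    if a: "a \<in> A \<tau>" and b: "b \<in> A \<tau>" and z: "\<And>y. y \<in> C \<inter> chart \<tau> \<Longrightarrow> a y * b y = 0" for a b
  proof -
    obtain P Q where P: "poly_fun n P" "a = (\<lambda>y. P (rep \<tau> y))" "poly_fun n Q" "b = (\<lambda>y. Q (rep \<tau> y))"
      using AE[OF a] AE[OF b] by auto
    have "(\<lambda>u. P u * Q u) \<in> vI \<tau> C" using z P by (auto simp: vI_def intro: poly_fun.mult)
    from vI_prime[OF P(1,3) this] show ?thesis using P by (auto simp: vI_def)
  qed
  show "fincod (A \<tau>) {x \<in> A \<tau>. \<exists>h\<in>A \<tau>. \<forall>y\<in>C \<inter> chart \<tau>. x y = a y * h y}" (is "fincod _ ?J")
    if a: "a \<in> A \<tau>" "\<not> (\<forall>y\<in>C \<inter> chart \<tau>. a y = 0)" for a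
  proof -
    obtain P where P: "poly_fun n P" "a = (\<lambda>y. P (rep \<tau> y))" using AE[OF a(1)] by auto
    have "P \<notin> vI \<tau> C" using a(2) P by (auto simp: vI_def)
    note fin = curve_fincod[OF curve P(1) this]
    let ?T = "\<lambda>P y. P (rep \<tau> y)"
    have im: "?T ` Collect (poly_fun n) = A \<tau>" unfolding A_def by auto
    show ?thesis
    proof (rule codim_map_ge(1)[OF lin_rep _ _ _ fin])
      show "?T ` Collect (poly_fun n) \<subseteq> A \<tau>" using im by simp
      show "A \<tau> \<subseteq> fun_vs.span (?T ` Collect (poly_fun n) \<union> ?J)"
        unfolding im using fun_vs.span_superset[of "A \<tau> \<union> ?J"] by blast
      show "?T ` adj_ideal n (vI \<tau> C) P \<subseteq> ?J"
      proof
        fix x assume "x \<in> ?T ` adj_ideal n (vI \<tau> C) P"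
        then obtain f where f: "f \<in> adj_ideal n (vI \<tau> C) P" "x = (\<lambda>y. f (rep \<tau> y))" by (elim imageE) simp
        obtain j b where j: "j \<in> vI \<tau> C" "poly_fun n b" "\<And>u. f u = j u + P u * b u" using f(1) by (rule adj_idealE) blast
        have "poly_fun n f" using pideal_poly[OF pideal_adj(1)[OF vI_pideal P(1)] f(1)] .
        then have "x \<in> A \<tau>" unfolding f(2) A_def by blast
        moreover have "(\<lambda>y. b (rep \<tau> y)) \<in> A \<tau>" unfolding A_def using j(2) by blast
        moreover have "\<forall>y\<in>C \<inter> chart \<tau>. x y = a y * b (rep \<tau> y)"
          using j(1,3) P(2) f(2) by (auto simp: vI_def)
        ultimately show "x \<in> ?J" by (auto intro!: bexI[of _ "\<lambda>y. b (rep \<tau> y)"])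
      qed
    qed
  qed
qed

end

section \<open>Homogeneous Cox coordinates\<close>

lemma power_int_sum: "(x::complex) \<noteq> 0 \<Longrightarrow> x powi (\<Sum>i\<in>I. e i) = (\<Prod>i\<in>I. x powi e i)"
  by (induction I rule: infinite_finite_induct) (auto simp: power_int_add)

text \<open>Exponents of the \<open>z\<^sub>i\<close> in the monomial of weight \<open>\<beta>\<close> whose restriction to the chart \<open>\<tau>\<close> is
  the monomial with exponents \<open>d\<close> in the chart coordinates.\<close>

function hexp :: "(nat \<Rightarrow> nat \<Rightarrow> int) \<Rightarrow> nat \<Rightarrow> (nat \<Rightarrow> bool) \<Rightarrow> (nat \<Rightarrow> int) \<Rightarrow> (nat \<Rightarrow> nat) \<Rightarrow> nat \<Rightarrow> nat" where
  "hexp c n \<tau> \<beta> d i =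
    (if \<tau> i then nat (\<beta> i + (\<Sum>j\<in>{i<..n}. c i j * int (hexp c n \<tau> \<beta> d j)) - int (d i)) else d i)"
  by auto
termination by (relation "Wellfounded.measure (\<lambda>(c, n, \<tau>, \<beta>, d, i). n - i)") auto

declare hexp.simps [simp del]

context bott
begin

section \<open>The graded pieces of the Cox ring\<close>

definition mono :: "(nat \<Rightarrow> nat) \<Rightarrow> (nat \<Rightarrow> nat) \<Rightarrow> coords \<Rightarrow> complex" where
  "mono p q u = (\<Prod>i\<in>{1..n}. fst (u i) ^ p i * snd (u i) ^ q i)"

text \<open>The exponent of \<open>t_i\<close> by which the torus scales the monomial:
  \<open>z_j\<close> contributes 1 at \<open>j\<close> and \<open>- c i j\<close> at every
  \<open>i < j\<close>, while \<open>w_j\<close> contributes 1 at \<open>j\<close>.\<close>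

definition wt :: "(nat \<Rightarrow> nat) \<Rightarrow> (nat \<Rightarrow> nat) \<Rightarrow> nat \<Rightarrow> int" where
  "wt p q i = int (p i) + int (q i) - (\<Sum>j\<in>{i<..n}. c i j * int (p j))"

definition chi :: "(nat \<Rightarrow> int) \<Rightarrow> (nat \<Rightarrow> complex) \<Rightarrow> complex" where
  "chi \<beta> t = (\<Prod>i\<in>{1..n}. t i powi \<beta> i)"

definition has_wt :: "(nat \<Rightarrow> nat) \<Rightarrow> (nat \<Rightarrow> nat) \<Rightarrow> (nat \<Rightarrow> int) \<Rightarrow> bool" where
  "has_wt p q \<beta> \<longleftrightarrow> (\<forall>i\<in>{1..n}. wt p q i = \<beta> i)"

text \<open>The Cox coordinate model of the sections of a line bundle of class
  \<open>\<beta>\<close>. Weights are compared on \<open>{1..n}\<close> only.\<close>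

definition S :: "(nat \<Rightarrow> int) \<Rightarrow> (coords \<Rightarrow> complex) set" where
  "S \<beta> = fun_vs.span {mono p q |p q. has_wt p q \<beta>}"

lemma S_subspace: "fun_vs.subspace (S \<beta>)"
  unfolding S_def by (rule fun_vs.subspace_span)

lemmas S_0 = subspace_0'[OF S_subspace]
  and S_add = subspace_add'[OF S_subspace]
  and S_diff = subspace_diff'[OF S_subspace]
  and S_scale = subspace_scale'[OF S_subspace]

lemma mono_S: "has_wt p q \<beta> \<Longrightarrow> mono p q \<in> S \<beta>"
  unfolding S_def by (rule fun_vs.span_base) blast

lemma poly_mono: "poly_fun n (mono p q)"
  unfolding mono_def[abs_def]
  by (intro poly_fun_prod poly_fun.mult poly_fun_power poly_fun.z_coord poly_fun.w_coord)

lemma S_poly: "s \<in> S \<beta> \<Longrightarrow> poly_fun n s"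
proof -
  have "S \<beta> \<subseteq> Collect (poly_fun n)"
    unfolding S_def by (rule fun_vs.span_minimal[OF _ poly_fun_subspace]) (auto intro: poly_mono)
  then show "s \<in> S \<beta> \<Longrightarrow> poly_fun n s" by blast
qed

lemma S_cong: "(\<And>i. i \<in> {1..n} \<Longrightarrow> \<alpha> i = \<beta> i) \<Longrightarrow> S \<alpha> = S \<beta>"
  unfolding S_def has_wt_def by simp

lemma mono_mult: "mono p q u * mono p' q' u = mono (\<lambda>i. p i + p' i) (\<lambda>i. q i + q' i) u"
  unfolding mono_def by (simp add: prod.distrib[symmetric] power_add mult_ac)

lemma mono_power: "mono p q u ^ k = mono (\<lambda>i. k * p i) (\<lambda>i. k * q i) u"
  unfolding mono_def by (simp add: prod_power_distrib power_mult_distrib power_mult[symmetric] mult.commute)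

lemma wt_add: "wt (\<lambda>i. p i + p' i) (\<lambda>i. q i + q' i) i = wt p q i + wt p' q' i"
  unfolding wt_def by (simp add: sum.distrib algebra_simps)

lemma wt_scale: "wt (\<lambda>i. k * p i) (\<lambda>i. k * q i) i = int k * wt p q i"
  unfolding wt_def by (simp add: sum_distrib_left algebra_simps)

lemma span_mult_closed:
  fixes T :: "(coords \<Rightarrow> complex) set"
  assumes "fun_vs.subspace T" "\<And>f g. f \<in> A \<Longrightarrow> g \<in> B \<Longrightarrow> (\<lambda>u. f u * g u) \<in> T"
    "f \<in> fun_vs.span A" "g \<in> fun_vs.span B"
  shows "(\<lambda>u. f u * g u) \<in> T"
proof -
  have 1: "(\<lambda>u. f u * g u) \<in> T" if "f \<in> A" "g \<in> fun_vs.span B" for f g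
  proof -
    have "fun_vs.span B \<subseteq> {g \<in> UNIV. (\<lambda>u. f u * g u) \<in> T}"
      by (intro fun_vs.span_minimal subspace_vimage[OF lin_mult assms(1) fun_vs.subspace_UNIV])
        (use assms(2) that(1) in auto)
    with that(2) show ?thesis by auto
  qed
  have "fun_vs.span A \<subseteq> {f \<in> UNIV. (\<lambda>u. g u * f u) \<in> T}"
    by (intro fun_vs.span_minimal subspace_vimage[OF lin_mult assms(1) fun_vs.subspace_UNIV])
      (use 1 assms(4) in \<open>auto simp: mult.commute\<close>)
  with assms(3) show ?thesis by (auto simp: mult.commute)
qed

lemma S_mult: "s \<in> S \<alpha> \<Longrightarrow> s' \<in> S \<beta> \<Longrightarrow> (\<lambda>u. s u * s' u) \<in> S (\<lambda>i. \<alpha> i + \<beta> i)"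
proof -
  assume "s \<in> S \<alpha>" "s' \<in> S \<beta>"
  then show ?thesis
    unfolding S_def[of \<alpha>] S_def[of \<beta>]
  proof (rule span_mult_closed[OF S_subspace, rotated])
    fix f g assume "f \<in> {mono p q |p q. has_wt p q \<alpha>}" "g \<in> {mono p q |p q. has_wt p q \<beta>}"
    then obtain p q p' q' where *: "has_wt p q \<alpha>" "f = mono p q" "has_wt p' q' \<beta>" "g = mono p' q'" by blast
    have "mono (\<lambda>i. p i + p' i) (\<lambda>i. q i + q' i) \<in> S (\<lambda>i. \<alpha> i + \<beta> i)"
      by (rule mono_S) (use * in \<open>simp add: has_wt_def wt_add\<close>)
    moreover have "(\<lambda>u. f u * g u) = mono (\<lambda>i. p i + p' i) (\<lambda>i. q i + q' i)"
      using * by (simp add: mono_mult fun_eq_iff)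
    ultimately show "(\<lambda>u. f u * g u) \<in> S (\<lambda>i. \<alpha> i + \<beta> i)" by simp
  qed
qed

lemma S_one: "(\<lambda>_. 1) \<in> S (\<lambda>_. 0)"
proof -
  have "mono (\<lambda>_. 0) (\<lambda>_. 0) \<in> S (\<lambda>_. 0)" by (rule mono_S) (simp add: has_wt_def wt_def)
  then show ?thesis by (simp add: mono_def[abs_def])
qed

lemma S_power: "s \<in> S \<alpha> \<Longrightarrow> (\<lambda>u. s u ^ k) \<in> S (\<lambda>i. int k * \<alpha> i)"
proof (induction k)
  case 0 then show ?case using S_one by simp
next
  case (Suc k)
  from S_mult[OF Suc.prems Suc.IH[OF Suc.prems]] show ?case by (simp add: algebra_simps)
qed

lemma prod_triangle:
  fixes g :: "nat \<Rightarrow> nat \<Rightarrow> complex"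
  shows "(\<Prod>i\<in>{1..n}. \<Prod>k\<in>{1..<i}. g k i) = (\<Prod>k\<in>{1..n}. \<Prod>i\<in>{k<..n}. g k i)"
proof -
  have "(\<Prod>i\<in>{1..n}. \<Prod>k\<in>{1..<i}. g k i) = (\<Prod>i\<in>{1..n}. \<Prod>k\<in>{k \<in> {1..n}. k < i}. g k i)"
    by (intro prod.cong refl) auto
  also have "\<dots> = (\<Prod>k\<in>{1..n}. \<Prod>i\<in>{i \<in> {1..n}. k < i}. g k i)"
    by (rule prod.swap_restrict) auto
  also have "\<dots> = (\<Prod>k\<in>{1..n}. \<Prod>i\<in>{k<..n}. g k i)"
    by (intro prod.cong refl) auto
  finally show ?thesis .
qed

text \<open>The factor picked up by each coordinate \<open>z_i\<close> involves all
  \<open>t_k\<close> with \<open>k < i\<close>; \<open>prod_triangle\<close> regroups these factors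
  by \<open>k\<close>, which gives the weight.\<close>

lemma mono_act:
  assumes t: "nz t"
  shows "mono p q (act t u) = chi (wt p q) t * mono p q u"
proof -
  have "mono p q (act t u) = (\<Prod>i\<in>{1..n}. (t i ^ (p i + q i) / (\<Prod>k\<in>{1..<i}. t k powi (c k i * int (p i)))) *
      (fst (u i) ^ p i * snd (u i) ^ q i))"
    unfolding mono_def
  proof (rule prod.cong[OF refl])
    fix i assume i: "i \<in> {1..n}"
    have "(\<Prod>k\<in>{1..<i}. t k powi (c k i)) ^ p i = (\<Prod>k\<in>{1..<i}. t k powi (c k i * int (p i)))"
      by (simp add: prod_power_distrib power_int_mult)
    then show "fst (act t u i) ^ p i * snd (act t u i) ^ q i =
      (t i ^ (p i + q i) / (\<Prod>k\<in>{1..<i}. t k powi (c k i * int (p i)))) * (fst (u i) ^ p i * snd (u i) ^ q i)"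
      unfolding fst_act[OF i] snd_act[OF i] by (simp add: power_mult_distrib power_divide power_add)
  qed
  also have "\<dots> = (\<Prod>i\<in>{1..n}. t i ^ (p i + q i)) / (\<Prod>i\<in>{1..n}. \<Prod>k\<in>{1..<i}. t k powi (c k i * int (p i))) * mono p q u"
    unfolding mono_def by (simp add: prod.distrib prod_dividef)
  also have "(\<Prod>i\<in>{1..n}. \<Prod>k\<in>{1..<i}. t k powi (c k i * int (p i))) = (\<Prod>k\<in>{1..n}. \<Prod>i\<in>{k<..n}. t k powi (c k i * int (p i)))"
    by (rule prod_triangle)
  also have "(\<Prod>i\<in>{1..n}. t i ^ (p i + q i)) / (\<Prod>k\<in>{1..n}. \<Prod>i\<in>{k<..n}. t k powi (c k i * int (p i))) = chi (wt p q) t"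
    unfolding chi_def prod_dividef[symmetric]
  proof (rule prod.cong[OF refl])
    fix i assume i: "i \<in> {1..n}"
    then have "t i \<noteq> 0" using t by (auto simp: nz_def)
    then have "t i powi wt p q i = t i powi int (p i + q i) / t i powi (\<Sum>j\<in>{i<..n}. c i j * int (p j))"
      unfolding wt_def by (simp add: power_int_diff)
    then show "t i ^ (p i + q i) / (\<Prod>j\<in>{i<..n}. t i powi (c i j * int (p j))) = t i powi wt p q i"
      using power_int_sum[OF \<open>t i \<noteq> 0\<close>, of "\<lambda>j. c i j * int (p j)" "{i<..n}"]
        power_int_of_nat[of "t i" "p i + q i"] by (simp del: of_nat_add power_int_of_nat)
  qed
  finally show ?thesis .
qed

lemma S_act:
  assumes s: "s \<in> S \<beta>" and t: "nz t"
  shows "s (act t u) = chi \<beta> t * s u"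
proof -
  have "fun_vs.span {mono p q |p q. has_wt p q \<beta>} \<subseteq> {s. \<forall>u. s (act t u) = chi \<beta> t * s u}"
  proof (rule fun_vs.span_minimal)
    show "{mono p q |p q. has_wt p q \<beta>} \<subseteq> {s. \<forall>u. s (act t u) = chi \<beta> t * s u}"
      unfolding has_wt_def using mono_act[OF t] by (auto simp: chi_def)
    show "fun_vs.subspace {s. \<forall>u. s (act t u) = chi \<beta> t * s u}"
      by (rule subspaceI) (auto simp: algebra_simps)
  qed
  with s show ?thesis unfolding S_def by blast
qed

lemma chi_nz: "nz t \<Longrightarrow> chi \<beta> t \<noteq> 0"
  unfolding chi_def nz_def by simp

lemma chi_add: "nz t \<Longrightarrow> chi (\<lambda>i. \<alpha> i + \<beta> i) t = chi \<alpha> t * chi \<beta> t"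
  unfolding chi_def prod.distrib[symmetric] by (rule prod.cong) (auto simp: nz_def power_int_add)

lemma S_zero_bp: "s \<in> S \<beta> \<Longrightarrow> v \<in> bp u \<Longrightarrow> s v = 0 \<longleftrightarrow> s u = 0"
proof -
  assume s: "s \<in> S \<beta>" and "v \<in> bp u"
  then obtain t where t: "nz t" "v = act t u" unfolding bp_iff by blast
  show ?thesis unfolding t(2) S_act[OF s t(1)] using chi_nz[OF t(1), of \<beta>] by simp
qed

lemma S_zero_rep: "s \<in> S \<beta> \<Longrightarrow> x \<in> chart \<tau> \<Longrightarrow> v \<in> x \<Longrightarrow> s v = 0 \<longleftrightarrow> s (rep \<tau> x) = 0"
  using S_zero_bp[of s \<beta> v "rep \<tau> x"] bp_rep by auto

text \<open>The quotient of two forms of equal weight is a function on \<open>X\<close>, expressed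
  without division.\<close>

lemma S_ratio:
  assumes "s \<in> S \<beta>" "h \<in> S \<beta>" "x \<in> pts X" "u \<in> x" "v \<in> x"
  shows "s u * h v = s v * h u"
proof -
  have "x = bp u" using pts_mem assms(3,4) by blast
  then obtain t where t: "nz t" "v = act t u" using assms(5) bp_iff by blast
  show ?thesis unfolding t(2) S_act[OF assms(1) t(1)] S_act[OF assms(2) t(1)] by simp
qed

text \<open>The weight determines \<open>p i + q i\<close> from the exponents of the
  \<open>z_j\<close> with \<open>j > i\<close>, so the bounds are found from the top index
  downwards.\<close>

lemma exponents_bounded: "\<exists>E. \<forall>p q. has_wt p q \<beta> \<longrightarrow> (\<forall>i\<in>{1..n}. p i \<le> E \<and> q i \<le> E)"
proof -
  \<comment> \<open>The induction on \<open>m\<close> treats the last \<open>m\<close>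
    indices.\<close>
  have "\<exists>E. \<forall>p q. has_wt p q \<beta> \<longrightarrow> (\<forall>i\<in>{1..n}. n < i + m \<longrightarrow> p i \<le> E \<and> q i \<le> E)" for m
  proof (induction m)
    case 0
    show ?case by (intro exI[of _ 0]) auto
  next
    case (Suc m)
    then obtain E where E: "\<And>p q i. has_wt p q \<beta> \<Longrightarrow> i \<in> {1..n} \<Longrightarrow> n < i + m \<Longrightarrow> p i \<le> E \<and> q i \<le> E" by blast
    define B where "B = (\<Sum>i\<in>{1..n}. \<bar>\<beta> i\<bar> + (\<Sum>j\<in>{i<..n}. \<bar>c i j\<bar> * int E))"
    have "p i \<le> E + nat B \<and> q i \<le> E + nat B"
      if pq: "has_wt p q \<beta>" and i: "i \<in> {1..n}" "n < i + Suc m" for p q i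
    proof (cases "n < i + m")
      case True
      then show ?thesis using E[OF pq i(1)] by (auto intro: trans_le_add1)
    next
      case False
      have "(\<Sum>j\<in>{i<..n}. c i j * int (p j)) \<le> (\<Sum>j\<in>{i<..n}. \<bar>c i j\<bar> * int E)"
      proof (rule sum_mono)
        fix j assume j: "j \<in> {i<..n}"
        then have "p j \<le> E" using E[OF pq, of j] i False by auto
        then have "\<bar>c i j\<bar> * int (p j) \<le> \<bar>c i j\<bar> * int E" by (intro mult_left_mono) auto
        moreover have "c i j * int (p j) \<le> \<bar>c i j\<bar> * int (p j)" by (intro mult_right_mono) auto
        ultimately show "c i j * int (p j) \<le> \<bar>c i j\<bar> * int E" by linarith
      qed
      moreover have "int (p i) + int (q i) = \<beta> i + (\<Sum>j\<in>{i<..n}. c i j * int (p j))"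
        using bspec[OF pq[unfolded has_wt_def] i(1)] unfolding wt_def by linarith
      moreover have "\<bar>\<beta> i\<bar> + (\<Sum>j\<in>{i<..n}. \<bar>c i j\<bar> * int E) \<le> B"
        unfolding B_def by (rule member_le_sum[OF i(1)]) (auto intro!: add_nonneg_nonneg sum_nonneg)
      ultimately have "int (p i) + int (q i) \<le> B" by linarith
      then show ?thesis by linarith
    qed
    then show ?case by blast
  qed
  from this[of n] show ?thesis by (auto simp: Suc_le_eq)
qed

text \<open>The space itself has finite dimension, hence so has its quotient by any
  \<open>J\<close>.\<close>

lemma S_finite_dim: "fincod (S \<beta>) J"
proof -
  obtain E where E: "\<And>p q i. has_wt p q \<beta> \<Longrightarrow> i \<in> {1..n} \<Longrightarrow> p i \<le> E \<and> q i \<le> E"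
    using exponents_bounded by blast
  define F where "F = {f. \<forall>x. (x \<in> {1..n} \<longrightarrow> f x \<in> {..E}) \<and> (x \<notin> {1..n} \<longrightarrow> f x = 0)}"
  have F: "finite F" unfolding F_def by (rule finite_set_of_finite_funs) auto
  let ?M = "{mono p q |p q. has_wt p q \<beta>}"
  have "?M \<subseteq> (\<lambda>(p, q). mono p q) ` (F \<times> F)"
  proof clarify
    fix p q assume pq: "has_wt p q \<beta>"
    define p' where "p' = (\<lambda>i. if i \<in> {1..n} then p i else 0)"
    define q' where "q' = (\<lambda>i. if i \<in> {1..n} then q i else 0)"
    have "mono p q = mono p' q'" by (intro ext) (auto simp: mono_def p'_def q'_def intro!: prod.cong)
    moreover have "(p', q') \<in> F \<times> F" using E[OF pq] by (auto simp: F_def p'_def q'_def)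
    ultimately show "mono p q \<in> (\<lambda>(p, q). mono p q) ` (F \<times> F)" by auto
  qed
  then have "finite ?M" by (rule finite_subset) (use F in auto)
  moreover have "?M \<subseteq> S \<beta>" unfolding S_def by (rule fun_vs.span_superset)
  moreover have "S \<beta> \<subseteq> fun_vs.span (?M \<union> J)" unfolding S_def by (rule fun_vs.span_mono) auto
  ultimately show ?thesis by (rule fincodI)
qed

subsection \<open>Homogenisation\<close>

lemma sum_c_nonneg:
  assumes "1 \<le> i"
  shows "0 \<le> (\<Sum>j\<in>{i<..n}. c i j * int (p j))"
proof (rule sum_nonneg)
  fix j assume "j \<in> {i<..n}"
  then have "0 < c i j" using c_pos[of i j] assms by auto
  then show "0 \<le> c i j * int (p j)" by (intro mult_nonneg_nonneg) auto
qed

text \<open>The exponent of the free coordinate of each pair is prescribed; that of the normalised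
  coordinate is determined by the weight. It is nonnegative since the Bott numbers are positive, and
  the last conclusion records how large it is.\<close>

lemma hom_exponents:
  assumes d: "\<And>i. i \<in> {1..n} \<Longrightarrow> int (d i) \<le> \<beta> i"
  obtains p q where "has_wt p q \<beta>"
    "\<forall>i\<in>{1..n}. (if \<tau> i then q i else p i) = d i"
    "\<forall>i\<in>{1..n}. \<beta> i - int (d i) \<le> int (if \<tau> i then p i else q i)"
proof -
  define p where "p = hexp c n \<tau> \<beta> d"
  define X' where "X' = (\<lambda>i. \<beta> i + (\<Sum>j\<in>{i<..n}. c i j * int (p j)) - int (d i))"
  define q where "q = (\<lambda>i. if \<tau> i then d i else nat (X' i))"
  have p: "p i = (if \<tau> i then nat (X' i) else d i)" for i
    unfolding p_def X'_def by (subst hexp.simps) simp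
  have X': "\<beta> i - int (d i) \<le> X' i" if i: "i \<in> {1..n}" for i
  proof -
    have "0 \<le> (\<Sum>j\<in>{i<..n}. c i j * int (p j))"
      by (rule sum_c_nonneg) (use i in auto)
    then show ?thesis by (simp add: X'_def)
  qed
  have X0: "0 \<le> X' i" if i: "i \<in> {1..n}" for i using X'[OF i] d[OF i] by linarith
  show ?thesis
  proof (rule that[of p q])
    show "has_wt p q \<beta>"
      unfolding has_wt_def
    proof
      fix i assume i: "i \<in> {1..n}"
      have "int (p i) + int (q i) = X' i + int (d i)" using X0[OF i] by (simp add: p q_def)
      then show "wt p q i = \<beta> i" unfolding wt_def X'_def by simp
    qed
    show "\<forall>i\<in>{1..n}. (if \<tau> i then q i else p i) = d i" by (auto simp: p q_def)
    show "\<forall>i\<in>{1..n}. \<beta> i - int (d i) \<le> int (if \<tau> i then p i else q i)"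
      using X' X0 by (auto simp: p q_def)
  qed
qed

lemma mono_slice:
  assumes "u \<in> slice \<tau>" "\<forall>i\<in>{1..n}. (if \<tau> i then q i else p i) = d i"
  shows "mono p q u = (\<Prod>i\<in>{1..n}. cc (\<lambda>i. \<not> \<tau> i) i u ^ d i)"
  unfolding mono_def
proof (rule prod.cong[OF refl])
  fix i assume i: "i \<in> {1..n}"
  then have "cc \<tau> i u = 1" using assms(1) by (auto simp: slice_def)
  with bspec[OF assms(2) i] show "fst (u i) ^ p i * snd (u i) ^ q i = cc (\<lambda>i. \<not> \<tau> i) i u ^ d i"
    by (auto simp: cc_def split: if_splits)
qed

text \<open>The homogenisation of the constant 1. If all \<open>\<beta> i\<close> are positive, it
  contains every normalised coordinate and thus vanishes exactly off the chart.\<close>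

lemma unit_section:
  assumes "\<And>i. i \<in> {1..n} \<Longrightarrow> 0 \<le> \<beta> i"
  obtains p q where "has_wt p q \<beta>" "\<forall>i\<in>{1..n}. (if \<tau> i then q i else p i) = 0"
    "\<forall>i\<in>{1..n}. \<beta> i \<le> int (if \<tau> i then p i else q i)" "\<forall>u\<in>slice \<tau>. mono p q u = 1"
proof -
  obtain p q where pq: "has_wt p q \<beta>" "\<forall>i\<in>{1..n}. (if \<tau> i then q i else p i) = 0"
    "\<forall>i\<in>{1..n}. \<beta> i - int 0 \<le> int (if \<tau> i then p i else q i)"
    by (rule hom_exponents[of "\<lambda>_. 0" \<beta> \<tau>]) (use assms in auto)
  show ?thesis
    using pq mono_slice[OF _ pq(2)] by (intro that[of p q]) auto
qed

lemma hom_coord: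
  assumes i: "i \<in> {1..n}" and \<beta>: "\<And>j. j \<in> {1..n} \<Longrightarrow> 1 \<le> \<beta> j"
  shows "\<exists>s\<in>S \<beta>. \<forall>u\<in>slice \<tau>. s u = cc \<sigma> i u"
proof (cases "\<sigma> i = \<tau> i")
  case True
  obtain p q where "has_wt p q \<beta>" "\<forall>u\<in>slice \<tau>. mono p q u = 1"
    by (rule unit_section[of \<beta> \<tau>]) (use \<beta> in force)+
  moreover have "cc \<sigma> i u = 1" if "u \<in> slice \<tau>" for u
    using that i True by (auto simp: slice_def cc_def)
  ultimately show ?thesis using mono_S by (intro bexI[of _ "mono p q"]) auto
next
  case False
  let ?d = "\<lambda>j. if j = i then 1 else 0 :: nat"
  obtain p q where pq: "has_wt p q \<beta>" "\<forall>i\<in>{1..n}. (if \<tau> i then q i else p i) = ?d i"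
    by (rule hom_exponents[of ?d \<beta> \<tau>]) (use \<beta> in \<open>force split: if_splits\<close>)+
  have "mono p q u = cc \<sigma> i u" if u: "u \<in> slice \<tau>" for u
  proof -
    have "mono p q u = (\<Prod>j\<in>{1..n}. cc (\<lambda>i. \<not> \<tau> i) j u ^ ?d j)" by (rule mono_slice[OF u pq(2)])
    also have "\<dots> = (\<Prod>j\<in>{1..n}. if j = i then cc (\<lambda>i. \<not> \<tau> i) j u else 1)" by (intro prod.cong) auto
    also have "\<dots> = cc (\<lambda>i. \<not> \<tau> i) i u" using i by simp
    finally show ?thesis using False by (auto simp: cc_def)
  qed
  then show ?thesis using mono_S[OF pq(1)] by (intro bexI[of _ "mono p q"]) auto
qed

text \<open>One bound \<open>D\<close> has to serve for all larger weights, because later the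
  weights are prescribed from outside.\<close>

lemma homogenise:
  assumes "poly_fun n P"
  shows "\<exists>D::nat. \<forall>\<beta>. (\<forall>i\<in>{1..n}. int D \<le> \<beta> i) \<longrightarrow> (\<exists>s\<in>S \<beta>. \<forall>u\<in>slice \<tau>. s u = P u)"
  using assms
proof induction
  case (const k)
  show ?case
  proof (intro exI[of _ 0] allI impI)
    fix \<beta> :: "nat \<Rightarrow> int" assume b: "\<forall>i\<in>{1..n}. int 0 \<le> \<beta> i"
    obtain p q where "has_wt p q \<beta>" "\<forall>u\<in>slice \<tau>. mono p q u = 1"
      by (rule unit_section[of \<beta> \<tau>]) (use b in auto)
    then show "\<exists>s\<in>S \<beta>. \<forall>u\<in>slice \<tau>. s u = k"
      using S_scale[OF mono_S, of p q \<beta> k] by (intro bexI[of _ "\<lambda>u. k * mono p q u"]) auto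
  qed
next
  case (z_coord i)
  have "\<exists>s\<in>S \<beta>. \<forall>u\<in>slice \<tau>. s u = cc (\<lambda>_. True) i u" if "\<forall>i\<in>{1..n}. int 1 \<le> \<beta> i" for \<beta>
    by (rule hom_coord[OF z_coord]) (use that in auto)
  then show ?case by (intro exI[of _ 1]) (simp add: cc_def)
next
  case (w_coord i)
  have "\<exists>s\<in>S \<beta>. \<forall>u\<in>slice \<tau>. s u = cc (\<lambda>_. False) i u" if "\<forall>i\<in>{1..n}. int 1 \<le> \<beta> i" for \<beta>
    by (rule hom_coord[OF w_coord]) (use that in auto)
  then show ?case by (intro exI[of _ 1]) (simp add: cc_def)
next
  case (add P Q)
  obtain D D' where D: "\<And>\<beta>. \<forall>i\<in>{1..n}. int D \<le> \<beta> i \<Longrightarrow> \<exists>s\<in>S \<beta>. \<forall>u\<in>slice \<tau>. s u = P u"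
    "\<And>\<beta>. \<forall>i\<in>{1..n}. int D' \<le> \<beta> i \<Longrightarrow> \<exists>s\<in>S \<beta>. \<forall>u\<in>slice \<tau>. s u = Q u" using add.IH by blast
  show ?case
  proof (intro exI[of _ "D + D'"] allI impI)
    fix \<beta> :: "nat \<Rightarrow> int" assume b: "\<forall>i\<in>{1..n}. int (D + D') \<le> \<beta> i"
    have "\<forall>i\<in>{1..n}. int D \<le> \<beta> i" "\<forall>i\<in>{1..n}. int D' \<le> \<beta> i" using b by force+
    note D(1)[OF this(1)] D(2)[OF this(2)]
    then obtain s s' where "s \<in> S \<beta>" "\<forall>u\<in>slice \<tau>. s u = P u" "s' \<in> S \<beta>" "\<forall>u\<in>slice \<tau>. s' u = Q u"
      by (elim bexE) blast
    then show "\<exists>s\<in>S \<beta>. \<forall>u\<in>slice \<tau>. s u = P u + Q u"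
      using S_add[of s \<beta> s'] by (intro bexI[of _ "\<lambda>u. s u + s' u"]) auto
  qed
next
  case (mult P Q)
  obtain D D' where D: "\<And>\<beta>. \<forall>i\<in>{1..n}. int D \<le> \<beta> i \<Longrightarrow> \<exists>s\<in>S \<beta>. \<forall>u\<in>slice \<tau>. s u = P u"
    "\<And>\<beta>. \<forall>i\<in>{1..n}. int D' \<le> \<beta> i \<Longrightarrow> \<exists>s\<in>S \<beta>. \<forall>u\<in>slice \<tau>. s u = Q u" using mult.IH by blast
  show ?case
  proof (intro exI[of _ "D + D'"] allI impI)
    fix \<beta> :: "nat \<Rightarrow> int" assume b: "\<forall>i\<in>{1..n}. int (D + D') \<le> \<beta> i"
    \<comment> \<open>The weight is divided between the factors: the constant weight
      \<open>D\<close> for \<open>P\<close> and the rest for \<open>Q\<close>.\<close>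
    have "\<forall>i\<in>{1..n}. int D \<le> int D" "\<forall>i\<in>{1..n}. int D' \<le> \<beta> i - int D" using b by force+
    note D(1)[OF this(1)] D(2)[OF this(2)]
    then obtain s s' where s: "s \<in> S (\<lambda>_. int D)" "\<forall>u\<in>slice \<tau>. s u = P u"
      "s' \<in> S (\<lambda>i. \<beta> i - int D)" "\<forall>u\<in>slice \<tau>. s' u = Q u" by (elim bexE) blast
    have "(\<lambda>u. s u * s' u) \<in> S \<beta>" using S_mult[OF s(1,3)] by simp
    with s show "\<exists>s\<in>S \<beta>. \<forall>u\<in>slice \<tau>. s u = P u * Q u" by (intro bexI[of _ "\<lambda>u. s u * s' u"]) auto
  qed
qed

lemma mono_outside:
  assumes u: "u \<in> cox_points n" "\<not> inU \<tau> u" and \<beta>: "\<forall>i\<in>{1..n}. 1 \<le> int (if \<tau> i then p i else q i)"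
  shows "mono p q u = 0"
proof -
  obtain i where i: "i \<in> {1..n}" "cc \<tau> i u = 0" using u by (auto simp: inU_def)
  have "1 \<le> int (if \<tau> i then p i else q i)" using \<beta> i(1) by blast
  then have "fst (u i) ^ p i * snd (u i) ^ q i = 0" using i(2) by (auto simp: cc_def split: if_splits)
  then show ?thesis unfolding mono_def using i(1) by (intro prod_zero) auto
qed

text \<open>If \<open>y\<close> is in the chart, a coordinate minus its value at \<open>y\<close> is
  homogenised; otherwise the form equal to 1 on the slice already vanishes at
  \<open>y\<close>.\<close>

lemma separate_point:
  assumes x: "x \<in> chart \<tau>" and y: "y \<in> pts X" "x \<noteq> y"
  shows "\<exists>D::nat. \<forall>\<beta>. (\<forall>i\<in>{1..n}. int D \<le> \<beta> i) \<longrightarrow> (\<exists>s\<in>S \<beta>. s (rep \<tau> x) \<noteq> 0 \<and> (\<forall>v\<in>y. s v = 0))"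
proof (cases "y \<in> chart \<tau>")
  case True
  then have "rep \<tau> x \<noteq> rep \<tau> y" using rep_inj x y by blast
  then obtain i where i: "rep \<tau> x i \<noteq> rep \<tau> y i" by blast
  then have "i \<in> {1..n}" using cox_outside rep_cox x True by metis
  then have "poly_fun n (\<lambda>u. fst (u i))" "poly_fun n (\<lambda>u. snd (u i))" by (auto intro: poly_fun.intros)
  moreover have "fst (rep \<tau> x i) \<noteq> fst (rep \<tau> y i) \<or> snd (rep \<tau> x i) \<noteq> snd (rep \<tau> y i)"
    using i by (simp add: prod_eq_iff)
  ultimately have "\<exists>P. poly_fun n P \<and> P (rep \<tau> x) \<noteq> P (rep \<tau> y)" by auto
  then obtain P where P: "poly_fun n P" "P (rep \<tau> x) \<noteq> P (rep \<tau> y)" by blast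
  obtain D where D: "\<And>\<beta>. \<forall>i\<in>{1..n}. int D \<le> \<beta> i \<Longrightarrow> \<exists>s\<in>S \<beta>. \<forall>u\<in>slice \<tau>. s u = P u - P (rep \<tau> y)"
    using homogenise[OF poly_fun_diff[OF P(1) poly_fun.const[of n "P (rep \<tau> y)"]], of \<tau>] by blast
  show ?thesis
  proof (intro exI[of _ D] allI impI)
    fix \<beta> :: "nat \<Rightarrow> int" assume "\<forall>i\<in>{1..n}. int D \<le> \<beta> i"
    from D[OF this] obtain s where s: "s \<in> S \<beta>" "\<forall>u\<in>slice \<tau>. s u = P u - P (rep \<tau> y)" by blast
    have "s (rep \<tau> x) \<noteq> 0" "s (rep \<tau> y) = 0" using s(2) rep_slice[OF x] rep_slice[OF True] P(2) by auto
    with s(1) show "\<exists>s\<in>S \<beta>. s (rep \<tau> x) \<noteq> 0 \<and> (\<forall>v\<in>y. s v = 0)"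
      using S_zero_rep[OF s(1) True] by blast
  qed
next
  case False
  show ?thesis
  proof (intro exI[of _ 1] allI impI)
    fix \<beta> :: "nat \<Rightarrow> int" assume b: "\<forall>i\<in>{1..n}. int 1 \<le> \<beta> i"
    obtain p q where pq: "has_wt p q \<beta>" "\<forall>i\<in>{1..n}. \<beta> i \<le> int (if \<tau> i then p i else q i)" "\<forall>u\<in>slice \<tau>. mono p q u = 1"
      by (rule unit_section[of \<beta> \<tau>]) (use b in force)+
    have "mono p q v = 0" if "v \<in> y" for v
    proof (rule mono_outside)
      show "v \<in> cox_points n" "\<not> inU \<tau> v" using pts_mem[OF y(1) that] chart_bp[of v \<tau>] False by auto
      show "\<forall>i\<in>{1..n}. 1 \<le> int (if \<tau> i then p i else q i)" using pq(2) b by force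
    qed
    with pq rep_slice[OF x] show "\<exists>s\<in>S \<beta>. s (rep \<tau> x) \<noteq> 0 \<and> (\<forall>v\<in>y. s v = 0)"
      using mono_S by (intro bexI[of _ "mono p q"]) auto
  qed
qed

lemma separate_points:
  assumes x: "x \<in> chart \<tau>" and F: "finite F" "F \<subseteq> pts X" "x \<notin> F"
  shows "\<exists>D::nat. \<forall>\<beta>. (\<forall>i\<in>{1..n}. int D \<le> \<beta> i) \<longrightarrow> (\<exists>s\<in>S \<beta>. s (rep \<tau> x) \<noteq> 0 \<and> (\<forall>y\<in>F. \<forall>v\<in>y. s v = 0))"
  using F
proof (induction F rule: finite_induct)
  case empty
  show ?case
  proof (intro exI[of _ 0] allI impI)
    fix \<beta> :: "nat \<Rightarrow> int" assume b: "\<forall>i\<in>{1..n}. int 0 \<le> \<beta> i"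
    obtain p q where "has_wt p q \<beta>" "\<forall>u\<in>slice \<tau>. mono p q u = 1"
      by (rule unit_section[of \<beta> \<tau>]) (use b in auto)
    then show "\<exists>s\<in>S \<beta>. s (rep \<tau> x) \<noteq> 0 \<and> (\<forall>y\<in>{}. \<forall>v\<in>y. s v = 0)"
      using rep_slice[OF x] mono_S by (intro bexI[of _ "mono p q"]) auto
  qed
next
  case (insert y F)
  have "F \<subseteq> pts X" "x \<notin> F" "y \<in> pts X" "x \<noteq> y" using insert.prems by auto
  note IH = insert.IH[OF this(1,2)] and y = separate_point[OF x this(3,4)]
  obtain D where D: "\<And>\<beta>. \<forall>i\<in>{1..n}. int D \<le> \<beta> i \<Longrightarrow> \<exists>s\<in>S \<beta>. s (rep \<tau> x) \<noteq> 0 \<and> (\<forall>y\<in>F. \<forall>v\<in>y. s v = 0)"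
    using IH by blast
  obtain D' where D': "\<And>\<beta>. \<forall>i\<in>{1..n}. int D' \<le> \<beta> i \<Longrightarrow> \<exists>s\<in>S \<beta>. s (rep \<tau> x) \<noteq> 0 \<and> (\<forall>v\<in>y. s v = 0)"
    using y by blast
  show ?case
  proof (intro exI[of _ "D + D'"] allI impI)
    fix \<beta> :: "nat \<Rightarrow> int" assume b: "\<forall>i\<in>{1..n}. int (D + D') \<le> \<beta> i"
    have "\<forall>i\<in>{1..n}. int D \<le> int D" "\<forall>i\<in>{1..n}. int D' \<le> \<beta> i - int D" using b by force+
    note D[OF this(1)] D'[OF this(2)]
    then obtain s s' where s: "s \<in> S (\<lambda>_. int D)" "s (rep \<tau> x) \<noteq> 0" "\<forall>y\<in>F. \<forall>v\<in>y. s v = 0"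
      and s': "s' \<in> S (\<lambda>i. \<beta> i - int D)" "s' (rep \<tau> x) \<noteq> 0" "\<forall>v\<in>y. s' v = 0" by (elim bexE conjE) blast
    have "(\<lambda>u. s u * s' u) \<in> S \<beta>" using S_mult[OF s(1) s'(1)] by simp
    with s s' show "\<exists>s\<in>S \<beta>. s (rep \<tau> x) \<noteq> 0 \<and> (\<forall>y\<in>insert y F. \<forall>v\<in>y. s v = 0)"
      by (intro bexI[of _ "\<lambda>u. s u * s' u"]) auto
  qed
qed

text \<open>A monomial of large weight is divisible by the \<open>K\<close>-th power of a monomial supported on a
  single chart: in each pair \<open>(z\<^sub>i, w\<^sub>i)\<close> at least one exponent is large.\<close>

lemma large_monomials:
  fixes K :: nat
  assumes ex: "\<And>\<tau>. \<tau> \<in> Charts \<Longrightarrow> has_wt (pt \<tau>) (qt \<tau>) (\<lambda>_. 1) \<and> (\<forall>i\<in>{1..n}. (if \<tau> i then qt \<tau> i else pt \<tau> i) = 0)"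
  obtains M :: nat where "1 \<le> M"
    "\<And>p q. has_wt p q (\<lambda>_. int M) \<Longrightarrow> \<exists>\<tau>\<in>Charts. \<exists>p' q'. has_wt p' q' (\<lambda>_. int M - int K) \<and>
      (\<forall>u. mono p q u = mono (pt \<tau>) (qt \<tau>) u ^ K * mono p' q' u)"
proof -
  obtain E where E: "\<And>p q i. has_wt p q (\<lambda>_. 1) \<Longrightarrow> i \<in> {1..n} \<Longrightarrow> p i \<le> E \<and> q i \<le> E"
    using exponents_bounded[of "\<lambda>_. 1"] by blast
  \<comment> \<open>The positive Bott numbers give \<open>p i + q i \<ge> M\<close>, which exceeds
    \<open>2 * (K * E)\<close>, so one of the two exponents is at least
    \<open>K * E\<close>.\<close>
  define M where "M = 2 * (K * E) + 1"
  have "\<exists>\<tau>\<in>Charts. \<exists>p' q'. has_wt p' q' (\<lambda>_. int M - int K) \<and>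
      (\<forall>u. mono p q u = mono (pt \<tau>) (qt \<tau>) u ^ K * mono p' q' u)"
    if pq: "has_wt p q (\<lambda>_. int M)" for p q
  proof -
    \<comment> \<open>The chart that selects \<open>z_i\<close> wherever its exponent is large
      enough and \<open>w_i\<close> otherwise.\<close>
    define \<tau> where "\<tau> = (\<lambda>i. i \<in> {1..n} \<and> K * E \<le> p i)"
    have \<tau>: "\<tau> \<in> Charts" by (auto simp: Charts_def \<tau>_def)
    note T = ex[OF \<tau>]
    have le: "K * pt \<tau> i \<le> p i \<and> K * qt \<tau> i \<le> q i" if i: "i \<in> {1..n}" for i
    proof -
      have b: "pt \<tau> i \<le> E" "qt \<tau> i \<le> E" using E T i by blast+
      then have b': "K * pt \<tau> i \<le> K * E" "K * qt \<tau> i \<le> K * E" by auto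
      have z: "(if \<tau> i then qt \<tau> i else pt \<tau> i) = 0" using T i by blast
      show ?thesis
      proof (cases "\<tau> i")
        case True
        then have "K * E \<le> p i" by (simp add: \<tau>_def)
        with b'(1) have "K * pt \<tau> i \<le> p i" by (rule order_trans)
        with z True show ?thesis by simp
      next
        case False
        then have "p i < K * E" using i by (auto simp: \<tau>_def)
        moreover have "0 \<le> (\<Sum>j\<in>{i<..n}. c i j * int (p j))"
          by (rule sum_c_nonneg) (use i in auto)
        moreover have "int (p i) + int (q i) - (\<Sum>j\<in>{i<..n}. c i j * int (p j)) = int M"
          using bspec[OF pq[unfolded has_wt_def] i] unfolding wt_def by simp
        ultimately have "K * E \<le> q i" unfolding M_def by linarith
        with b'(2) have "K * qt \<tau> i \<le> q i" by (rule order_trans)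
        with z False show ?thesis by simp
      qed
    qed
    define p' where "p' = (\<lambda>i. p i - K * pt \<tau> i)"
    define q' where "q' = (\<lambda>i. q i - K * qt \<tau> i)"
    have "wt p' q' i = int M - int K" if i: "i \<in> {1..n}" for i
    proof -
      have "wt p q i = wt (\<lambda>i. p' i + K * pt \<tau> i) (\<lambda>i. q' i + K * qt \<tau> i) i"
        unfolding wt_def using le i by (auto simp: p'_def q'_def intro!: sum.cong)
      also have "\<dots> = wt p' q' i + int K * wt (pt \<tau>) (qt \<tau>) i" by (simp only: wt_add wt_scale)
      finally show ?thesis using pq T i by (simp add: has_wt_def)
    qed
    moreover have "mono p q u = mono (pt \<tau>) (qt \<tau>) u ^ K * mono p' q' u" for u
    proof -
      have "mono p q u = mono (\<lambda>i. K * pt \<tau> i + p' i) (\<lambda>i. K * qt \<tau> i + q' i) u"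
        unfolding mono_def using le by (intro prod.cong) (auto simp: p'_def q'_def)
      then show ?thesis by (simp only: mono_mult[symmetric] mono_power)
    qed
    ultimately show ?thesis using \<tau> unfolding has_wt_def by blast
  qed
  then show ?thesis by (intro that[of M]) (auto simp: M_def)
qed

end

section \<open>The degree of a homogeneous form on a curve\<close>

context bott
begin

text \<open>A chart fixed once and for all around each point, so that forms have definite local
  expressions.\<close>

definition tc :: "coords set \<Rightarrow> nat \<Rightarrow> bool" where
  "tc p = (SOME \<tau>. \<tau> \<in> Charts \<and> p \<in> chart \<tau>)"

lemma tc_chart: "p \<in> pts X \<Longrightarrow> p \<in> chart (tc p)"
  unfolding tc_def using someI_ex[of "\<lambda>\<tau>. \<tau> \<in> Charts \<and> p \<in> chart \<tau>"] ex_Charts by blast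

end

context bott_curve
begin

lemma tc_C: "p \<in> C \<Longrightarrow> p \<in> chart (tc p)"
  using tc_chart Z_pts by blast

text \<open>The form in the trivialisation of the chart \<open>tc p\<close>. Other representatives
  would change it by a unit only.\<close>

definition loc :: "coords set \<Rightarrow> (coords \<Rightarrow> complex) \<Rightarrow> coords set \<Rightarrow> complex" where
  "loc p s = (\<lambda>y. s (rep (tc p) y))"

lemma lin_loc: "lin (loc p)"
  unfolding loc_def[abs_def] by (rule lin_rep)

lemma loc_mult: "loc p (\<lambda>u. s u * s' u) = (\<lambda>y. loc p s y * loc p s' y)"
  and loc_power: "loc p (\<lambda>u. s u ^ k) = (\<lambda>y. loc p s y ^ k)"
  by (simp_all add: loc_def)

lemma local_curve_p: "p \<in> C \<Longrightarrow> local_curve Y p (C \<inter> chart (tc p)) (A (tc p))"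
  by (rule local_curve_at[OF _ tc_C])

lemma loc_A: "poly_fun n s \<Longrightarrow> loc p s \<in> A (tc p)"
  unfolding loc_def A_def by blast

lemma loc_stalk: "p \<in> C \<Longrightarrow> poly_fun n s \<Longrightarrow> loc p s \<in> stalk Y p"
  by (rule local_curve.A_in[OF local_curve_p loc_A])

definition zeroC :: "(coords \<Rightarrow> complex) \<Rightarrow> bool" where
  "zeroC s \<longleftrightarrow> (\<forall>x\<in>C. \<forall>u\<in>x. s u = 0)"

lemma zeroC_subspace: "fun_vs.subspace (Collect zeroC)"
  by (rule subspaceI) (auto simp: zeroC_def)

text \<open>Vanishing on one chart that meets \<open>C\<close> suffices: two nonempty open parts of
  \<open>C\<close> intersect, and vanishing at a point does not depend on the
  representative.\<close>

lemma zeroC_vI: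
  assumes s: "s \<in> S \<beta>" and \<tau>: "C \<inter> chart \<tau> \<noteq> {}"
  shows "zeroC s \<longleftrightarrow> s \<in> vI \<tau> C"
proof
  assume "zeroC s"
  then show "s \<in> vI \<tau> C" using S_poly[OF s] rep_mem by (auto simp: zeroC_def vI_def)
next
  assume v: "s \<in> vI \<tau> C"
  show "zeroC s"
  proof (rule ccontr)
    assume "\<not> zeroC s"
    then obtain x u where x: "x \<in> C" "u \<in> x" "s u \<noteq> 0" by (auto simp: zeroC_def)
    have xc: "x \<in> chart (tc x)" using tc_C x(1) .
    have "s (rep (tc x) x) \<noteq> 0" using S_zero_rep[OF s xc x(2)] x(3) by simp
    then have "x \<in> dist_open (tc x) s" using xc by (simp add: dist_open_def)
    then have ne: "dist_open (tc x) s \<inter> C \<noteq> {}" using x(1) by blast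
    have "chart \<tau> \<inter> C \<noteq> {}" using \<tau> by blast
    from irr_open[OF openin_dist_open[OF S_poly[OF s]] openin_chart ne this]
    obtain y where y: "y \<in> dist_open (tc x) s" "y \<in> chart \<tau>" "y \<in> C" by blast
    have yc: "y \<in> chart (tc x)" "s (rep (tc x) y) \<noteq> 0" using y(1) by (auto simp: dist_open_def)
    have "s (rep \<tau> y) \<noteq> 0" using S_zero_rep[OF s y(2) rep_mem[OF yc(1)]] yc(2) by simp
    with v y show False by (auto simp: vI_def)
  qed
qed

lemma zeroC_mult:
  assumes "s \<in> S \<alpha>" "s' \<in> S \<beta>" "\<not> zeroC s" "\<not> zeroC s'"
  shows "\<not> zeroC (\<lambda>u. s u * s' u)"
proof -
  obtain x where x: "x \<in> C" using Z_ne by blast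
  then have ne: "C \<inter> chart (tc x) \<noteq> {}" using tc_C by blast
  show ?thesis
    using vI_prime[OF S_poly[OF assms(1)] S_poly[OF assms(2)], of "tc x"] assms(3,4)
    unfolding zeroC_vI[OF assms(1) ne] zeroC_vI[OF assms(2) ne] zeroC_vI[OF S_mult[OF assms(1,2)] ne] by blast
qed

lemma zeroC_power: "s \<in> S \<alpha> \<Longrightarrow> \<not> zeroC s \<Longrightarrow> \<not> zeroC (\<lambda>u. s u ^ k)"
proof (induction k)
  case 0
  obtain x where "x \<in> C" using Z_ne by blast
  then show ?case using rep_mem[OF tc_C] by (auto simp: zeroC_def)
next
  case (Suc k)
  from zeroC_mult[OF Suc.prems(1) S_power[OF Suc.prems(1)] Suc.prems(2) Suc.IH[OF Suc.prems]]
  show ?case by simp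
qed

lemma germ_loc:
  assumes p: "p \<in> C" and s: "s \<in> S \<beta>"
  shows "germ_eq Y p (loc p s) (\<lambda>_. 0) \<longleftrightarrow> zeroC s"
proof
  assume "zeroC s"
  then have "loc p s y = 0" if "y \<in> C \<inter> chart (tc p)" for y
    using that rep_mem by (auto simp: zeroC_def loc_def)
  then show "germ_eq Y p (loc p s) (\<lambda>_. 0)"
    unfolding germ_sub_iff[OF tc_C[OF p] p]
    by (intro exI[of _ "\<lambda>_. 1"]) (auto simp: dist_open_def intro: poly_fun.const)
next
  assume "germ_eq Y p (loc p s) (\<lambda>_. 0)"
  then obtain P where P: "poly_fun n P" "P (rep (tc p) p) \<noteq> 0" "\<forall>y\<in>dist_open (tc p) P \<inter> C. loc p s y = 0"
    unfolding germ_sub_iff[OF tc_C[OF p] p] by blast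
  have "s \<in> vI (tc p) C"
    by (rule vI_local[OF S_poly[OF s] P(1) p tc_C[OF p] P(2)]) (use P(3) in \<open>auto simp: loc_def\<close>)
  then show "zeroC s" using zeroC_vI[OF s] p tc_C by blast
qed

text \<open>The ideal generated by the form in the local ring of the curve.\<close>

definition PIs :: "coords set \<Rightarrow> (coords \<Rightarrow> complex) \<Rightarrow> (coords set \<Rightarrow> complex) set" where
  "PIs p s = principal_ideal Y p (loc p s)"

definition ordp :: "coords set \<Rightarrow> (coords \<Rightarrow> complex) \<Rightarrow> nat" where
  "ordp p s = colength Y p (PIs p s)"

definition Zs :: "(coords \<Rightarrow> complex) \<Rightarrow> coords set set" where
  "Zs s = {p \<in> C. \<forall>u\<in>p. s u = 0}"

definition N :: "(coords \<Rightarrow> complex) \<Rightarrow> nat" where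
  "N s = (\<Sum>p\<in>Zs s. ordp p s)"

lemma Zs_iff: "s \<in> S \<beta> \<Longrightarrow> p \<in> C \<Longrightarrow> p \<in> Zs s \<longleftrightarrow> loc p s p = 0"
  unfolding Zs_def loc_def using S_zero_rep[OF _ tc_C] rep_mem[OF tc_C] by blast

lemma Zs_C: "Zs s \<subseteq> C"
  by (auto simp: Zs_def)

lemma finite_Zs:
  assumes s: "s \<in> S \<beta>" "\<not> zeroC s"
  shows "finite (Zs s)"
proof -
  have "finite {y \<in> C \<inter> chart \<tau>. s (rep \<tau> y) = 0}" for \<tau>
  proof (cases "C \<inter> chart \<tau> = {}")
    case False
    then have "s \<notin> vI \<tau> C" using zeroC_vI[OF s(1)] s(2) by blast
    then show ?thesis by (rule curve_finite_zeros[OF curve S_poly[OF s(1)]])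
  qed simp
  then have "finite (\<Union>\<tau>\<in>Charts. {y \<in> C \<inter> chart \<tau>. s (rep \<tau> y) = 0})" using finite_Charts by blast
  moreover have "Zs s \<subseteq> (\<Union>\<tau>\<in>Charts. {y \<in> C \<inter> chart \<tau>. s (rep \<tau> y) = 0})"
  proof
    fix p assume p: "p \<in> Zs s"
    then obtain \<tau> where "\<tau> \<in> Charts" "p \<in> chart \<tau>" using ex_Charts Z_pts Zs_C by blast
    then show "p \<in> (\<Union>\<tau>\<in>Charts. {y \<in> C \<inter> chart \<tau>. s (rep \<tau> y) = 0})"
      using p rep_mem by (auto simp: Zs_def)
  qed
  ultimately show ?thesis by (rule rev_finite_subset)
qed

lemma ordp_0: "s \<in> S \<beta> \<Longrightarrow> p \<in> C \<Longrightarrow> p \<notin> Zs s \<Longrightarrow> ordp p s = 0"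
  unfolding ordp_def PIs_def using local_curve.len_unit[OF local_curve_p loc_stalk[OF _ S_poly]] Zs_iff by blast

lemma ordp_mult:
  assumes "p \<in> C" "s \<in> S \<alpha>" "s' \<in> S \<beta>" "\<not> zeroC s" "\<not> zeroC s'"
  shows "ordp p (\<lambda>u. s u * s' u) = ordp p s + ordp p s'"
  unfolding ordp_def PIs_def loc_mult
  by (rule local_curve.len_mult[OF local_curve_p[OF assms(1)]])
    (use assms germ_loc loc_stalk S_poly in auto)

lemma ordp_power:
  assumes "p \<in> C" "s \<in> S \<alpha>" "\<not> zeroC s"
  shows "ordp p (\<lambda>u. s u ^ k) = k * ordp p s"
  unfolding ordp_def PIs_def loc_power
  by (rule local_curve.len_power[OF local_curve_p[OF assms(1)]])
    (use assms germ_loc loc_stalk S_poly in auto)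

text \<open>Allows comparing the zero counts of several forms over one common finite set.\<close>

lemma N_superset:
  assumes "s \<in> S \<beta>" "finite F" "Zs s \<subseteq> F" "F \<subseteq> C"
  shows "N s = (\<Sum>p\<in>F. ordp p s)"
  unfolding N_def by (rule sum.mono_neutral_left) (use assms ordp_0 in auto)

lemma N_mult:
  assumes "s \<in> S \<alpha>" "s' \<in> S \<beta>" "\<not> zeroC s" "\<not> zeroC s'"
  shows "N (\<lambda>u. s u * s' u) = N s + N s'"
proof -
  have Z: "Zs (\<lambda>u. s u * s' u) \<subseteq> Zs s \<union> Zs s'"
  proof
    fix p assume p: "p \<in> Zs (\<lambda>u. s u * s' u)"
    then have pC: "p \<in> C" using Zs_C by blast
    with p have "loc p s p = 0 \<or> loc p s' p = 0"
      using Zs_iff[OF S_mult[OF assms(1,2)] pC] by (auto simp: loc_mult)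
    then show "p \<in> Zs s \<union> Zs s'" using Zs_iff[OF _ pC] assms by blast
  qed
  let ?F = "Zs s \<union> Zs s'"
  have F: "finite ?F" "?F \<subseteq> C" using finite_Zs assms Zs_C by blast+
  have "N (\<lambda>u. s u * s' u) = (\<Sum>p\<in>?F. ordp p (\<lambda>u. s u * s' u))"
    by (rule N_superset[OF S_mult[OF assms(1,2)] F(1) Z F(2)])
  also have "\<dots> = (\<Sum>p\<in>?F. ordp p s + ordp p s')"
    by (intro sum.cong refl ordp_mult) (use assms F in auto)
  also have "\<dots> = N s + N s'"
    unfolding sum.distrib using N_superset[OF assms(1) F(1) _ F(2)] N_superset[OF assms(2) F(1) _ F(2)] by simp
  finally show ?thesis .
qed

subsection \<open>Lower bound for the dimension of the space of forms\<close>

text \<open>The points are added one at a time; by \<open>surj\<close>, an approximation property of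
  Chinese remainder type, each of them imposes as many new conditions as its order says.\<close>

lemma codim_vanishing_ge:
  fixes V :: "(coords \<Rightarrow> complex) set"
  assumes Vsub: "fun_vs.subspace V" and Vfin: "\<And>J. fincod V J" and Vpoly: "\<And>s. s \<in> V \<Longrightarrow> poly_fun n s"
    and F: "finite F" "F \<subseteq> C" and f: "f \<in> S \<beta>" "\<not> zeroC f"
    and surj: "\<And>p b. p \<in> F \<Longrightarrow> b \<in> stalk Y p \<Longrightarrow> \<exists>s\<in>V. (\<lambda>y. loc p s y - b y) \<in> PIs p f \<and> (\<forall>q\<in>F - {p}. loc q s \<in> PIs q f)"
  shows "(\<Sum>p\<in>F. ordp p f) \<le> codim V {s \<in> V. \<forall>p\<in>F. loc p s \<in> PIs p f}"
proof -
  have PIsub: "fun_vs.subspace (PIs p f)" if "p \<in> C" for p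
    unfolding PIs_def using local_curve.oideal_subspace[OF local_curve_p local_curve.PI_oideal[OF local_curve_p loc_stalk]]
    that S_poly[OF f(1)] by blast
  have sub: "fun_vs.subspace {s \<in> V. \<forall>p\<in>F'. loc p s \<in> PIs p f}" if "F' \<subseteq> C" for F'
  proof (rule subspaceI)
    show "(\<lambda>_. 0) \<in> {s \<in> V. \<forall>p\<in>F'. loc p s \<in> PIs p f}"
      using subspace_0'[OF Vsub] subspace_0'[OF PIsub] that by (auto simp: lin_0[OF lin_loc])
  next
    fix s s' assume "s \<in> {s \<in> V. \<forall>p\<in>F'. loc p s \<in> PIs p f}" "s' \<in> {s \<in> V. \<forall>p\<in>F'. loc p s \<in> PIs p f}"
    then show "(\<lambda>y. s y + s' y) \<in> {s \<in> V. \<forall>p\<in>F'. loc p s \<in> PIs p f}"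
      using subspace_add'[OF Vsub] subspace_add'[OF PIsub] that by (auto simp: lin_add[OF lin_loc] subset_iff)
  next
    fix k s assume "s \<in> {s \<in> V. \<forall>p\<in>F'. loc p s \<in> PIs p f}"
    then show "(\<lambda>y. k * s y) \<in> {s \<in> V. \<forall>p\<in>F'. loc p s \<in> PIs p f}"
      using subspace_scale'[OF Vsub] subspace_scale'[OF PIsub] that by (auto simp: lin_scale[OF lin_loc] subset_iff)
  qed
  have "F' \<subseteq> F \<Longrightarrow> (\<Sum>p\<in>F'. ordp p f) \<le> codim V {s \<in> V. \<forall>p\<in>F'. loc p s \<in> PIs p f}" if "finite F'" for F'
    using that
  proof (induction F' rule: finite_induct)
    case empty then show ?case by simp
  next
    case (insert p F')
    let ?V = "\<lambda>F'. {s \<in> V. \<forall>p\<in>F'. loc p s \<in> PIs p f}"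
    have pC: "p \<in> C" and pF: "p \<in> F" and F'C: "F' \<subseteq> C" and F'F: "F' \<subseteq> F" using insert.prems F(2) by auto
    have s1: "?V (insert p F') \<subseteq> ?V F'" and s2: "?V F' \<subseteq> V" by auto
    have fin': "fincod (?V F') J" for J by (rule fincod_subset[OF Vfin s2])
    have "ordp p f \<le> codim (?V F') (?V (insert p F'))"
      unfolding ordp_def colength_eq_codim
    proof (rule codim_map_ge(2)[OF lin_loc _ _ _ fin'])
      show "loc p ` ?V F' \<subseteq> stalk Y p" using loc_stalk[OF pC Vpoly] by auto
      show "loc p ` ?V (insert p F') \<subseteq> PIs p f" by auto
      show "stalk Y p \<subseteq> fun_vs.span (loc p ` ?V F' \<union> PIs p f)" (is "_ \<subseteq> ?S")
      proof
        fix b assume "b \<in> stalk Y p"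
        from surj[OF pF this] obtain s where s: "s \<in> V" "(\<lambda>y. loc p s y - b y) \<in> PIs p f"
          "\<forall>q\<in>F - {p}. loc q s \<in> PIs q f" by blast
        have "s \<in> ?V F'" using s(1,3) F'F insert.hyps(2) by auto
        then have 1: "loc p s \<in> ?S" by (intro fun_vs.span_base) auto
        have 2: "(\<lambda>y. loc p s y - b y) \<in> ?S" using s(2) by (intro fun_vs.span_base) simp
        from subspace_diff'[OF fun_vs.subspace_span 1 2] show "b \<in> ?S" by simp
      qed
    qed
    moreover have "codim V (?V (insert p F')) = codim V (?V F') + codim (?V F') (?V (insert p F'))"
      by (rule codim_trans(2)[OF Vfin fin' s1 s2 sub[OF F'C] sub]) (use pC F'C in auto)
    ultimately show ?case using insert.IH[OF F'F] insert.hyps by simp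
  qed
  from this[OF F(1) order_refl] show ?thesis .
qed

text \<open>A form \<open>E\<close> that is a unit at \<open>p\<close> and lies in the ideal of
  \<open>f\<close> at the other points is multiplied by a lift of \<open>b / E\<close>. The lift
  exists since modulo \<open>f\<close> every germ is a combination of finitely many functions of the
  chart, and these can be homogenised.\<close>

lemma exists_local_section:
  assumes p: "p \<in> C" and F: "finite F" "F \<subseteq> C" and f: "f \<in> S \<beta>" "\<not> zeroC f"
  shows "\<exists>D::nat. \<forall>\<gamma>. (\<forall>i\<in>{1..n}. int D \<le> \<gamma> i) \<longrightarrow> (\<forall>b\<in>stalk Y p.
    \<exists>s\<in>S \<gamma>. (\<lambda>y. loc p s y - b y) \<in> PIs p f \<and> (\<forall>q\<in>F - {p}. loc q s \<in> PIs q f))"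
proof -
  interpret P: local_curve Y p "C \<inter> chart (tc p)" "A (tc p)" by (rule local_curve_p[OF p])
  let ?\<tau> = "tc p"
  have pc: "p \<in> chart ?\<tau>" by (rule tc_C[OF p])
  have fO: "loc p f \<in> stalk Y p" "\<not> germ_eq Y p (loc p f) (\<lambda>_. 0)"
    using loc_stalk[OF p S_poly[OF f(1)]] germ_loc[OF p f(1)] f(2) by auto
  have "finite (F - {p})" "F - {p} \<subseteq> pts X" "p \<notin> F - {p}" using F Z_pts by auto
  from separate_points[OF pc this] obtain D1 where "\<forall>\<gamma>. (\<forall>i\<in>{1..n}. int D1 \<le> \<gamma> i) \<longrightarrow>
      (\<exists>s\<in>S \<gamma>. s (rep ?\<tau> p) \<noteq> 0 \<and> (\<forall>y\<in>F - {p}. \<forall>v\<in>y. s v = 0))" by (elim exE)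
  from spec[OF this, of "\<lambda>_. int D1"]
  have "\<exists>s\<in>S (\<lambda>_. int D1). s (rep ?\<tau> p) \<noteq> 0 \<and> (\<forall>y\<in>F - {p}. \<forall>v\<in>y. s v = 0)" by simp
  then obtain e where
    e: "e \<in> S (\<lambda>_. int D1)" "e (rep ?\<tau> p) \<noteq> 0" "\<forall>y\<in>F - {p}. \<forall>v\<in>y. e v = 0" by (elim bexE conjE)
  have "\<exists>k. (\<lambda>y. loc q e y ^ k) \<in> PIs q f" if q: "q \<in> F - {p}" for q
  proof -
    have qC: "q \<in> C" using q F by blast
    interpret Q: local_curve Y q "C \<inter> chart (tc q)" "A (tc q)" by (rule local_curve_p[OF qC])
    have fq: "loc q f \<in> stalk Y q" "\<not> germ_eq Y q (loc q f) (\<lambda>_. 0)"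
      using loc_stalk[OF qC S_poly[OF f(1)]] germ_loc[OF qC f(1)] f(2) by auto
    have "loc q e q = 0" unfolding loc_def using e(3) q rep_mem[OF tc_C[OF qC]] by blast
    from Q.nilpotent_mod_ideal[OF Q.PI_oideal[OF fq(1)] Q.fincod_PI[OF fq] loc_stalk[OF qC S_poly[OF e(1)]] this]
    obtain k where "(\<lambda>y. loc q e y ^ k) \<in> Q.PI (loc q f)" .
    then show ?thesis unfolding PIs_def by (rule exI)
  qed
  then obtain k where k: "\<And>q. q \<in> F - {p} \<Longrightarrow> (\<lambda>y. loc q e y ^ k q) \<in> PIs q f" by metis
  \<comment> \<open>\<open>e\<close> is nilpotent modulo \<open>f\<close> at each of the other
    points; the sum of the exponents is large enough for all of them.\<close>
  define M where "M = (\<Sum>q\<in>F - {p}. k q)"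
  define E where "E = (\<lambda>u. e u ^ M)"
  have E: "E \<in> S (\<lambda>_. int M * int D1)" unfolding E_def using S_power[OF e(1)] by simp
  have Eq: "loc q E \<in> PIs q f" if q: "q \<in> F - {p}" for q
  proof -
    have qC: "q \<in> C" using q F by blast
    interpret Q: local_curve Y q "C \<inter> chart (tc q)" "A (tc q)" by (rule local_curve_p[OF qC])
    have "k q \<le> M" unfolding M_def using F(1) q by (intro member_le_sum) auto
    then have "loc q E = (\<lambda>y. loc q e y ^ (M - k q) * loc q e y ^ k q)"
      unfolding E_def loc_power by (simp add: power_add[symmetric])
    also have "\<dots> \<in> PIs q f"
      using Q.oideal_mult[OF Q.PI_oideal[OF loc_stalk[OF qC S_poly[OF f(1)]]] Q.O_power[OF loc_stalk[OF qC S_poly[OF e(1)]]]]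
        k[OF q] unfolding PIs_def by blast
    finally show ?thesis .
  qed
  have EO: "loc p E \<in> stalk Y p" by (rule loc_stalk[OF p S_poly[OF E]])
  have "loc p E p \<noteq> 0" using e(2) by (simp add: E_def loc_def)
  from P.O_unit[OF EO this] obtain v where v: "v \<in> stalk Y p" "germ_eq Y p (\<lambda>y. loc p E y * v y) (\<lambda>_. 1)" .
  obtain B where B: "finite B" "B \<subseteq> A ?\<tau>" "stalk Y p \<subseteq> fun_vs.span (B \<union> PIs p f)"
    using P.ex_A_basis[OF fO] unfolding PIs_def by (elim exE conjE)
  have "\<exists>D::nat. \<forall>\<gamma>. (\<forall>i\<in>{1..n}. int D \<le> \<gamma> i) \<longrightarrow> (\<exists>s\<in>S \<gamma>. \<forall>y\<in>chart ?\<tau>. s (rep ?\<tau> y) = b y)" if b: "b \<in> B" for b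
  proof -
    from AE[OF subsetD[OF B(2) b]] obtain R where R: "poly_fun n R" "b = (\<lambda>y. R (rep ?\<tau> y))" by (elim exE conjE)
    obtain D where D: "\<forall>\<gamma>. (\<forall>i\<in>{1..n}. int D \<le> \<gamma> i) \<longrightarrow> (\<exists>s\<in>S \<gamma>. \<forall>u\<in>slice ?\<tau>. s u = R u)"
      using homogenise[OF R(1), of ?\<tau>] by (elim exE)
    show ?thesis unfolding R(2)
    proof (intro exI[of _ D] allI impI)
      fix \<gamma> :: "nat \<Rightarrow> int" assume "\<forall>i\<in>{1..n}. int D \<le> \<gamma> i"
      with D have "\<exists>s\<in>S \<gamma>. \<forall>u\<in>slice ?\<tau>. s u = R u" by (elim allE[of _ \<gamma>] impE)
      then show "\<exists>s\<in>S \<gamma>. \<forall>y\<in>chart ?\<tau>. s (rep ?\<tau> y) = R (rep ?\<tau> y)" using rep_slice by (elim bexE) (rule bexI, auto)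
    qed
  qed
  then have "\<forall>b\<in>B. \<exists>D::nat. \<forall>\<gamma>. (\<forall>i\<in>{1..n}. int D \<le> \<gamma> i) \<longrightarrow> (\<exists>s\<in>S \<gamma>. \<forall>y\<in>chart ?\<tau>. s (rep ?\<tau> y) = b y)" by (intro ballI)
  then obtain Db where Db': "\<forall>b\<in>B. \<forall>\<gamma>. (\<forall>i\<in>{1..n}. int (Db b) \<le> \<gamma> i) \<longrightarrow> (\<exists>s\<in>S \<gamma>. \<forall>y\<in>chart ?\<tau>. s (rep ?\<tau> y) = b y)"
    unfolding bchoice_iff by (elim exE)
  have Db: "\<exists>s\<in>S \<gamma>. \<forall>y\<in>chart ?\<tau>. s (rep ?\<tau> y) = b y" if "b \<in> B" "\<forall>i\<in>{1..n}. int (Db b) \<le> \<gamma> i" for b \<gamma>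
    using Db'[rule_format, OF that(1) that(2)[rule_format]] by simp
  \<comment> \<open>Large enough to homogenise all members of \<open>B\<close> in the same weight,
    hence also their combinations.\<close>
  define D2 where "D2 = (\<Sum>b\<in>B. Db b)"
  have span: "\<exists>s\<in>S \<gamma>. \<forall>y\<in>chart ?\<tau>. s (rep ?\<tau> y) = a y"
    if a: "a \<in> fun_vs.span B" and \<gamma>: "\<forall>i\<in>{1..n}. int D2 \<le> \<gamma> i" for a \<gamma>
  proof -
    have "fun_vs.span B \<subseteq> {a. \<exists>s\<in>S \<gamma>. \<forall>y\<in>chart ?\<tau>. s (rep ?\<tau> y) = a y}"
    proof (rule fun_vs.span_minimal)
      show "B \<subseteq> {a. \<exists>s\<in>S \<gamma>. \<forall>y\<in>chart ?\<tau>. s (rep ?\<tau> y) = a y}"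
      proof
        fix b assume b: "b \<in> B"
        have "Db b \<le> D2" unfolding D2_def using B(1) b by (intro member_le_sum) auto
        then have "\<forall>i\<in>{1..n}. int (Db b) \<le> \<gamma> i" using \<gamma> by force
        from Db[OF b this] show "b \<in> {a. \<exists>s\<in>S \<gamma>. \<forall>y\<in>chart ?\<tau>. s (rep ?\<tau> y) = a y}" by simp
      qed
      show "fun_vs.subspace {a. \<exists>s\<in>S \<gamma>. \<forall>y\<in>chart ?\<tau>. s (rep ?\<tau> y) = a y}" (is "fun_vs.subspace ?W")
      proof (rule subspaceI)
        show "(\<lambda>_. 0) \<in> ?W" using S_0[of \<gamma>] by (auto intro!: bexI[of _ "\<lambda>_. 0"])
      next
        fix a a' assume "a \<in> ?W" "a' \<in> ?W"
        then obtain s s' where "s \<in> S \<gamma>" "\<forall>y\<in>chart ?\<tau>. s (rep ?\<tau> y) = a y" "s' \<in> S \<gamma>" "\<forall>y\<in>chart ?\<tau>. s' (rep ?\<tau> y) = a' y" by auto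
        then show "(\<lambda>y. a y + a' y) \<in> ?W" using S_add[of s \<gamma> s'] by (auto intro!: bexI[of _ "\<lambda>u. s u + s' u"])
      next
        fix k a assume "a \<in> ?W"
        then obtain s where "s \<in> S \<gamma>" "\<forall>y\<in>chart ?\<tau>. s (rep ?\<tau> y) = a y" by auto
        then show "(\<lambda>y. k * a y) \<in> ?W" using S_scale[of s \<gamma> k] by (auto intro!: bexI[of _ "\<lambda>u. k * s u"])
      qed
    qed
    with a show ?thesis by auto
  qed
  show ?thesis
  proof (intro exI[of _ "M * D1 + D2"] allI impI ballI)
    fix \<gamma> :: "nat \<Rightarrow> int" and b assume \<gamma>: "\<forall>i\<in>{1..n}. int (M * D1 + D2) \<le> \<gamma> i" and b: "b \<in> stalk Y p"
    note J = P.PI_oideal[OF fO(1)]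
    \<comment> \<open>\<open>v\<close> inverts \<open>E\<close>, so \<open>b * v\<close> is
      \<open>b / E\<close>; its part \<open>a\<close> in the span of \<open>B\<close> is lifted to
      the form \<open>s'\<close>.\<close>
    have "(\<lambda>y. b y * v y) \<in> fun_vs.span (B \<union> PIs p f)" using P.O_mult[OF b v(1)] B(3) by blast
    then obtain a j where a: "a \<in> fun_vs.span B" "j \<in> PIs p f" "(\<lambda>y. b y * v y) = (\<lambda>y. a y + j y)"
      using P.oideal_subspace[OF J] unfolding PIs_def by (elim span_Un_subspaceE[rotated]) auto
    have "\<forall>i\<in>{1..n}. int D2 \<le> \<gamma> i - int M * int D1" using \<gamma> by force
    from span[OF a(1) this] obtain s' where s': "s' \<in> S (\<lambda>i. \<gamma> i - int M * int D1)" "\<forall>y\<in>chart ?\<tau>. s' (rep ?\<tau> y) = a y" by auto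
    let ?s = "\<lambda>u. E u * s' u"
    have s: "?s \<in> S \<gamma>" using S_mult[OF E s'(1)] by simp
    have "(\<lambda>y. (- loc p E y) * j y) \<in> PIs p f"
      using P.oideal_mult[OF J P.O_scale[OF EO, of "-1"], of j] a(2) unfolding PIs_def by simp
    moreover have "germ_eq Y p (\<lambda>y. (- loc p E y) * j y) (\<lambda>y. loc p ?s y - b y)"
    proof (rule P.germ_combine[OF v(2)])
      show "germ_eq Y p (loc p s') a"
        by (rule P.germI[OF P.A_const[of 1]]) (use s'(2) in \<open>auto simp: loc_def\<close>)
      fix y assume 1: "loc p E y * v y = 1" and 2: "loc p s' y = a y"
      have "b y = loc p E y * (b y * v y)" using 1 by (metis mult.assoc mult.commute mult.right_neutral)
      also have "\<dots> = loc p E y * (a y + j y)" using fun_cong[OF a(3), of y] by simp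
      finally show "(- loc p E y) * j y = loc p ?s y - b y" using 2 by (simp add: loc_mult algebra_simps)
    qed
    ultimately have "(\<lambda>y. loc p ?s y - b y) \<in> PIs p f" unfolding PIs_def by (rule P.oideal_germ[OF J])
    moreover have "loc q ?s \<in> PIs q f" if q: "q \<in> F - {p}" for q
    proof -
      have qC: "q \<in> C" using q F by blast
      interpret Q: local_curve Y q "C \<inter> chart (tc q)" "A (tc q)" by (rule local_curve_p[OF qC])
      have "(\<lambda>y. loc q s' y * loc q E y) \<in> PIs q f"
        using Q.oideal_mult[OF Q.PI_oideal[OF loc_stalk[OF qC S_poly[OF f(1)]]] loc_stalk[OF qC S_poly[OF s'(1)]]]
          Eq[OF q] unfolding PIs_def by blast
      then show ?thesis by (simp add: loc_mult mult.commute)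
    qed
    ultimately show "\<exists>s\<in>S \<gamma>. (\<lambda>y. loc p s y - b y) \<in> PIs p f \<and> (\<forall>q\<in>F - {p}. loc q s \<in> PIs q f)"
      using s by (intro bexI[of _ ?s]) auto
  qed
qed

lemma exists_local_sections:
  assumes F: "finite F" "F \<subseteq> C" and f: "f \<in> S \<beta>" "\<not> zeroC f"
  shows "\<exists>D::nat. \<forall>\<gamma> p b. (\<forall>i\<in>{1..n}. int D \<le> \<gamma> i) \<longrightarrow> p \<in> F \<longrightarrow> b \<in> stalk Y p \<longrightarrow>
    (\<exists>s\<in>S \<gamma>. (\<lambda>y. loc p s y - b y) \<in> PIs p f \<and> (\<forall>q\<in>F - {p}. loc q s \<in> PIs q f))"
proof -
  have "\<forall>p\<in>F. \<exists>D::nat. \<forall>\<gamma>. (\<forall>i\<in>{1..n}. int D \<le> \<gamma> i) \<longrightarrow> (\<forall>b\<in>stalk Y p.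
    \<exists>s\<in>S \<gamma>. (\<lambda>y. loc p s y - b y) \<in> PIs p f \<and> (\<forall>q\<in>F - {p}. loc q s \<in> PIs q f))"
    using exists_local_section[OF _ F f] F(2) by (intro ballI) auto
  then obtain D where D: "\<forall>p\<in>F. \<forall>\<gamma>. (\<forall>i\<in>{1..n}. int (D p) \<le> \<gamma> i) \<longrightarrow> (\<forall>b\<in>stalk Y p.
    \<exists>s\<in>S \<gamma>. (\<lambda>y. loc p s y - b y) \<in> PIs p f \<and> (\<forall>q\<in>F - {p}. loc q s \<in> PIs q f))"
    unfolding bchoice_iff by (elim exE)
  show ?thesis
  proof (intro exI[of _ "\<Sum>p\<in>F. D p"] allI impI)
    fix \<gamma> :: "nat \<Rightarrow> int" and p b
    assume \<gamma>: "\<forall>i\<in>{1..n}. int (\<Sum>p\<in>F. D p) \<le> \<gamma> i" and p: "p \<in> F" and b: "b \<in> stalk Y p"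
    have "D p \<le> (\<Sum>p\<in>F. D p)" using F(1) p by (intro member_le_sum) auto
    then have "int (D p) \<le> int (\<Sum>p\<in>F. D p)" by (simp only: of_nat_le_iff)
    then have "\<forall>i\<in>{1..n}. int (D p) \<le> \<gamma> i" using \<gamma> order_trans by blast
    from D[rule_format, OF p this[rule_format] b]
    show "\<exists>s\<in>S \<gamma>. (\<lambda>y. loc p s y - b y) \<in> PIs p f \<and> (\<forall>q\<in>F - {p}. loc q s \<in> PIs q f)" by simp
  qed
qed

text \<open>The Hilbert function of \<open>C\<close>: the dimension of the space of forms of weight
  \<open>\<beta>\<close> restricted to \<open>C\<close>.\<close>

definition H :: "(nat \<Rightarrow> int) \<Rightarrow> nat" where
  "H \<beta> = codim (S \<beta>) {s \<in> S \<beta>. zeroC s}"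

lemma PIs_zero:
  assumes "p \<in> C" "s \<in> S \<beta>" "zeroC s" "f \<in> S \<alpha>"
  shows "loc p s \<in> PIs p f"
  unfolding PIs_def
  using local_curve.oideal_zero[OF local_curve_p local_curve.PI_oideal[OF local_curve_p loc_stalk]]
    germ_loc S_poly assms by blast

lemma vanishing_subspace:
  assumes "F \<subseteq> C" "poly_fun n f"
  shows "fun_vs.subspace {s \<in> S \<beta>. \<forall>p\<in>F. loc p s \<in> PIs p f}"
proof -
  have PIsub: "fun_vs.subspace (PIs p f)" if "p \<in> C" for p
    unfolding PIs_def using local_curve.oideal_subspace[OF local_curve_p local_curve.PI_oideal[OF local_curve_p loc_stalk]]
    that assms(2) by blast
  show ?thesis
  proof (rule subspaceI)
    show "(\<lambda>_. 0) \<in> {s \<in> S \<beta>. \<forall>p\<in>F. loc p s \<in> PIs p f}"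
      using S_0 subspace_0'[OF PIsub] assms(1) by (auto simp: lin_0[OF lin_loc])
  next
    fix s s' assume "s \<in> {s \<in> S \<beta>. \<forall>p\<in>F. loc p s \<in> PIs p f}" "s' \<in> {s \<in> S \<beta>. \<forall>p\<in>F. loc p s \<in> PIs p f}"
    then show "(\<lambda>y. s y + s' y) \<in> {s \<in> S \<beta>. \<forall>p\<in>F. loc p s \<in> PIs p f}"
      using S_add subspace_add'[OF PIsub] assms(1) by (auto simp: lin_add[OF lin_loc] subset_iff)
  next
    fix k s assume "s \<in> {s \<in> S \<beta>. \<forall>p\<in>F. loc p s \<in> PIs p f}"
    then show "(\<lambda>y. k * s y) \<in> {s \<in> S \<beta>. \<forall>p\<in>F. loc p s \<in> PIs p f}"
      using S_scale subspace_scale'[OF PIsub] assms(1) by (auto simp: lin_scale[OF lin_loc] subset_iff)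
  qed
qed

text \<open>The shift \<open>l\<close> makes the weights large enough for local sections to exist.
  Multiplication by \<open>f\<close> embeds the problem for \<open>k\<close> into the forms
  divisible by \<open>f\<close> for \<open>k + 1\<close>, and passing to these costs
  \<open>N f\<close> dimensions each time.\<close>

lemma H_lower:
  assumes f: "f \<in> S \<alpha>" "\<not> zeroC f" and \<alpha>: "\<forall>i\<in>{1..n}. 1 \<le> \<alpha> i"
  shows "\<exists>l::nat. \<forall>k::nat. k * N f \<le> H (\<lambda>i. int (k + l) * \<alpha> i)"
proof -
  let ?F = "Zs f"
  have F: "finite ?F" "?F \<subseteq> C" using finite_Zs[OF f] Zs_C by auto
  obtain l where l: "\<forall>\<gamma> p b. (\<forall>i\<in>{1..n}. int l \<le> \<gamma> i) \<longrightarrow> p \<in> ?F \<longrightarrow> b \<in> stalk Y p \<longrightarrow>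
    (\<exists>s\<in>S \<gamma>. (\<lambda>y. loc p s y - b y) \<in> PIs p f \<and> (\<forall>q\<in>?F - {p}. loc q s \<in> PIs q f))"
    using exists_local_sections[OF F f] by (elim exE)
  define V where "V = (\<lambda>k::nat. S (\<lambda>i. int (k + l) * \<alpha> i))"
  \<comment> \<open>The forms of \<open>V k\<close> that are locally divisible by \<open>f^k\<close>
    at the zeros of \<open>f\<close>.\<close>
  define W where "W = (\<lambda>k. {s \<in> V k. \<forall>p\<in>?F. loc p s \<in> PIs p (\<lambda>u. f u ^ k)})"
  have fk: "(\<lambda>u. f u ^ k) \<in> S (\<lambda>i. int k * \<alpha> i)" for k by (rule S_power[OF f(1)])
  have Wsub: "fun_vs.subspace (W k)" for k
    unfolding W_def V_def by (rule vanishing_subspace[OF F(2) S_poly[OF fk]])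
  have "k * N f \<le> codim (V k) (W k)" for k
  proof (induction k)
    case 0 then show ?case by simp
  next
    case (Suc k)
    let ?W' = "{s \<in> V (Suc k). \<forall>p\<in>?F. loc p s \<in> PIs p f}"
    have finV: "fincod (V k) J" for k J unfolding V_def by (rule S_finite_dim)
    have "(\<Sum>p\<in>?F. ordp p f) \<le> codim (V (Suc k)) ?W'"
    proof (rule codim_vanishing_ge[OF _ finV _ F f])
      show "fun_vs.subspace (V (Suc k))" unfolding V_def by (rule S_subspace)
      show "poly_fun n s" if "s \<in> V (Suc k)" for s using that S_poly unfolding V_def by blast
      fix p b assume p: "p \<in> ?F" and b: "b \<in> stalk Y p"
      have "\<forall>i\<in>{1..n}. int l \<le> int (Suc k + l) * \<alpha> i"
      proof
        fix i assume "i \<in> {1..n}"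
        then have "int (Suc k + l) * 1 \<le> int (Suc k + l) * \<alpha> i" using \<alpha> by (intro mult_left_mono) auto
        moreover have "int l \<le> int (Suc k + l) * 1" by simp
        ultimately show "int l \<le> int (Suc k + l) * \<alpha> i" by (rule order_trans[rotated])
      qed
      with l p b show "\<exists>s\<in>V (Suc k). (\<lambda>y. loc p s y - b y) \<in> PIs p f \<and> (\<forall>q\<in>?F - {p}. loc q s \<in> PIs q f)"
        unfolding V_def by presburger
    qed
    then have 1: "N f \<le> codim (V (Suc k)) ?W'" by (simp add: N_def)
    have W'sub: "fun_vs.subspace ?W'" unfolding V_def by (rule vanishing_subspace[OF F(2) S_poly[OF f(1)]])
    have WW': "W (Suc k) \<subseteq> ?W'"
    proof
      fix s assume s: "s \<in> W (Suc k)"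
      have "loc p s \<in> PIs p f" if p: "p \<in> ?F" for p
      proof -
        have pC: "p \<in> C" using p F by blast
        interpret P: local_curve Y p "C \<inter> chart (tc p)" "A (tc p)" by (rule local_curve_p[OF pC])
        have fO: "loc p f \<in> stalk Y p" by (rule loc_stalk[OF pC S_poly[OF f(1)]])
        have "(\<lambda>y. loc p f y ^ k * loc p f y) \<in> PIs p f"
          unfolding PIs_def by (rule P.oideal_mult[OF P.PI_oideal[OF fO] P.O_power[OF fO] P.PI_self[OF fO]])
        then have "loc p (\<lambda>u. f u ^ Suc k) \<in> PIs p f" by (simp add: loc_power loc_mult mult.commute)
        then have "PIs p (\<lambda>u. f u ^ Suc k) \<subseteq> PIs p f"
          using P.PI_subset[OF P.PI_oideal[OF fO]] unfolding PIs_def by blast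
        then show ?thesis using s p unfolding W_def by blast
      qed
      then show "s \<in> ?W'" using s by (simp add: W_def)
    qed
    have finW': "fincod ?W' J" for J by (rule fincod_subset[OF finV]) auto
    \<comment> \<open>Cancelling one factor \<open>f\<close> in the local rings shows that
      \<open>f * s\<close> lies in \<open>W (Suc k)\<close> only if \<open>s\<close> lies in
      \<open>W k\<close>.\<close>
    have "codim (V k) (W k) \<le> codim ?W' (W (Suc k))"
    proof (rule codim_le_map(2)[of "\<lambda>s u. f u * s u", OF lin_mult _ _ _ Wsub Wsub finW'])
      show "fun_vs.subspace (V k)" unfolding V_def by (rule S_subspace)
      have V: "(\<lambda>u. f u * s u) \<in> V (Suc k)" if "s \<in> V k" for s
        using S_mult[OF f(1), of s "\<lambda>i. int (k + l) * \<alpha> i"] that unfolding V_def by (simp add: algebra_simps)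
      show "(\<lambda>s u. f u * s u) ` V k \<subseteq> ?W'"
      proof clarify
        fix s assume s: "s \<in> V k"
        have "loc p (\<lambda>u. f u * s u) \<in> PIs p f" if p: "p \<in> ?F" for p
        proof -
          have pC: "p \<in> C" using p F by blast
          interpret P: local_curve Y p "C \<inter> chart (tc p)" "A (tc p)" by (rule local_curve_p[OF pC])
          have "loc p s \<in> stalk Y p" using s unfolding V_def by (intro loc_stalk[OF pC S_poly])
          then show ?thesis unfolding PIs_def loc_mult
            using P.PI_I[OF loc_stalk[OF pC S_poly[OF f(1)]] _ P.germ_refl] by blast
        qed
        with V[OF s] show "(\<lambda>u. f u * s u) \<in> V (Suc k) \<and> (\<forall>p\<in>?F. loc p (\<lambda>u. f u * s u) \<in> PIs p f)" by blast
      qed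
      show "{s \<in> V k. (\<lambda>u. f u * s u) \<in> W (Suc k)} \<subseteq> W k"
      proof clarify
        fix s assume s: "s \<in> V k" "(\<lambda>u. f u * s u) \<in> W (Suc k)"
        have "loc p s \<in> PIs p (\<lambda>u. f u ^ k)" if p: "p \<in> ?F" for p
        proof -
          have pC: "p \<in> C" using p F by blast
          interpret P: local_curve Y p "C \<inter> chart (tc p)" "A (tc p)" by (rule local_curve_p[OF pC])
          have fO: "loc p f \<in> stalk Y p" "\<not> germ_eq Y p (loc p f) (\<lambda>_. 0)"
            using loc_stalk[OF pC S_poly[OF f(1)]] germ_loc[OF pC f(1)] f(2) by auto
          have sO: "loc p s \<in> stalk Y p" using s unfolding V_def by (intro loc_stalk[OF pC S_poly])
          have "loc p (\<lambda>u. f u * s u) \<in> PIs p (\<lambda>u. f u ^ Suc k)" using s(2) p unfolding W_def by blast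
          then obtain h where h: "h \<in> stalk Y p" "germ_eq Y p (\<lambda>y. loc p f y * loc p s y) (\<lambda>y. loc p f y ^ Suc k * h y)"
            unfolding PIs_def P.PI_iff loc_mult loc_power by blast
          have "germ_eq Y p (loc p s) (\<lambda>y. loc p f y ^ k * h y)"
            by (rule P.O_cancel[OF fO sO P.O_mult[OF P.O_power[OF fO(1)] h(1)]]) (use h(2) in \<open>simp add: mult.assoc\<close>)
          then show ?thesis unfolding PIs_def loc_power by (rule P.PI_I[OF P.O_power[OF fO(1)] h(1)])
        qed
        with s(1) show "s \<in> W k" by (simp add: W_def)
      qed
    qed
    moreover have "codim (V (Suc k)) (W (Suc k)) = codim (V (Suc k)) ?W' + codim ?W' (W (Suc k))"
      by (rule codim_trans(2)[OF finV finW' WW' _ W'sub Wsub]) auto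
    ultimately show ?case using 1 Suc by simp
  qed
  moreover have "codim (V k) (W k) \<le> H (\<lambda>i. int (k + l) * \<alpha> i)" for k
    unfolding H_def V_def
  proof (rule codim_antimono[OF S_finite_dim])
    show "{s \<in> S (\<lambda>i. int (k + l) * \<alpha> i). zeroC s} \<subseteq> W k"
      unfolding W_def V_def using PIs_zero[OF _ _ _ fk] F(2) by auto
  qed
  ultimately show ?thesis by (meson order_trans)
qed

end

context bott_curve
begin

subsection \<open>Upper bound for the dimension of the space of forms\<close>

text \<open>Divisibility by \<open>f\<close> at one point is the kernel of a map into a space of
  dimension \<open>ordp p f\<close>.\<close>

lemma codim_vanishing_le:
  assumes f: "f \<in> S \<alpha>" "\<not> zeroC f" and F: "finite F" "F \<subseteq> C"
  shows "codim (S \<beta>) {s \<in> S \<beta>. \<forall>p\<in>F. loc p s \<in> PIs p f} \<le> (\<Sum>p\<in>F. ordp p f)"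
  using F
proof (induction F rule: finite_induct)
  case empty
  show ?case using codim_le_card[of "{}" "S \<beta>" "S \<beta>"] fun_vs.span_superset[of "S \<beta>"] by simp
next
  case (insert p F)
  let ?V = "\<lambda>F. {s \<in> S \<beta>. \<forall>p\<in>F. loc p s \<in> PIs p f}"
  have pC: "p \<in> C" and FC: "F \<subseteq> C" using insert.prems by auto
  interpret P: local_curve Y p "C \<inter> chart (tc p)" "A (tc p)" by (rule local_curve_p[OF pC])
  have fO: "loc p f \<in> stalk Y p" "\<not> germ_eq Y p (loc p f) (\<lambda>_. 0)"
    using loc_stalk[OF pC S_poly[OF f(1)]] germ_loc[OF pC f(1)] f(2) by auto
  note sub = vanishing_subspace[OF _ S_poly[OF f(1)], of _ \<beta>]
  have s1: "?V (insert p F) \<subseteq> ?V F" and s2: "?V F \<subseteq> S \<beta>" by auto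
  have fin': "fincod (?V F) J" for J by (rule fincod_subset[OF S_finite_dim s2])
  have "codim (?V F) (?V (insert p F)) \<le> ordp p f"
    unfolding ordp_def colength_eq_codim
  proof (rule codim_le_map(2)[OF lin_loc _ _ sub[OF FC] _ sub[OF insert.prems]])
    show "loc p ` ?V F \<subseteq> stalk Y p" using loc_stalk[OF pC S_poly] by auto
    show "{x \<in> ?V F. loc p x \<in> PIs p f} \<subseteq> ?V (insert p F)" by auto
    show "fincod (stalk Y p) (PIs p f)" unfolding PIs_def by (rule P.fincod_PI[OF fO])
    show "fun_vs.subspace (PIs p f)" unfolding PIs_def by (rule P.oideal_subspace[OF P.PI_oideal[OF fO(1)]])
  qed
  moreover have "codim (S \<beta>) (?V (insert p F)) = codim (S \<beta>) (?V F) + codim (?V F) (?V (insert p F))"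
    by (rule codim_trans(2)[OF S_finite_dim fin' s1 s2 sub[OF FC] sub[OF insert.prems]])
  ultimately show ?case using insert.IH[OF FC] insert.hyps by simp
qed

text \<open>The polynomials \<open>a\<close> for which \<open>a * s / h\<close> is polynomial on the
  affine piece form an ideal. Near each point of \<open>C\<close> it has a member nonzero there, so
  by the Nullstellensatz it contains 1: a function regular everywhere on an affine curve is a
  polynomial.\<close>

lemma global_quotient_in_chart:
  assumes s: "s \<in> S \<beta>" and h: "h \<in> S \<beta>"
    and div: "\<And>p. p \<in> C \<Longrightarrow> loc p s \<in> PIs p h"
  obtains b where "poly_fun n b" "\<forall>y\<in>C \<inter> chart \<tau>. s (rep \<tau> y) = b (rep \<tau> y) * h (rep \<tau> y)"
proof -
  define J where "J = {a. poly_fun n a \<and> (\<exists>b. poly_fun n b \<and>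
    (\<forall>y\<in>C \<inter> chart \<tau>. a (rep \<tau> y) * s (rep \<tau> y) = b (rep \<tau> y) * h (rep \<tau> y)))}"
  have JI: "a \<in> J" if "poly_fun n a" "poly_fun n b" "\<And>y. y \<in> C \<Longrightarrow> y \<in> chart \<tau> \<Longrightarrow> a (rep \<tau> y) * s (rep \<tau> y) = b (rep \<tau> y) * h (rep \<tau> y)" for a b
    unfolding J_def using that by blast
  have JE: "\<exists>b. poly_fun n a \<and> poly_fun n b \<and> (\<forall>y\<in>C \<inter> chart \<tau>. a (rep \<tau> y) * s (rep \<tau> y) = b (rep \<tau> y) * h (rep \<tau> y))" if "a \<in> J" for a
    using that unfolding J_def by blast
  have J: "pideal n J"
    unfolding pideal_def
  proof (intro conjI allI impI)
    show "fun_vs.subspace J"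
    proof (rule subspaceI)
      show "(\<lambda>_. 0) \<in> J" by (rule JI[OF poly_fun.const[of n 0] poly_fun.const[of n 0]]) simp
    next
      fix f g assume "f \<in> J" "g \<in> J"
      from JE[OF this(1)] JE[OF this(2)] obtain b b' where b: "poly_fun n f" "poly_fun n b"
        "\<forall>y\<in>C \<inter> chart \<tau>. f (rep \<tau> y) * s (rep \<tau> y) = b (rep \<tau> y) * h (rep \<tau> y)"
        "poly_fun n g" "poly_fun n b'"
        "\<forall>y\<in>C \<inter> chart \<tau>. g (rep \<tau> y) * s (rep \<tau> y) = b' (rep \<tau> y) * h (rep \<tau> y)" by (elim exE conjE)
      show "(\<lambda>u. f u + g u) \<in> J"
        by (rule JI[OF poly_fun.add[OF b(1,4)] poly_fun.add[OF b(2,5)]]) (use b(3,6) in \<open>simp add: distrib_right\<close>)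
    next
      fix k f assume "f \<in> J"
      from JE[OF this] obtain b where b: "poly_fun n f" "poly_fun n b"
        "\<forall>y\<in>C \<inter> chart \<tau>. f (rep \<tau> y) * s (rep \<tau> y) = b (rep \<tau> y) * h (rep \<tau> y)" by (elim exE conjE)
      show "(\<lambda>u. k * f u) \<in> J"
        by (rule JI[OF poly_fun_scale[OF b(1)] poly_fun_scale[OF b(2), of k]]) (use b(3) in \<open>simp add: mult.assoc\<close>)
    qed
    show "J \<subseteq> Collect (poly_fun n)" by (auto simp: J_def)
    fix P f assume P: "poly_fun n P" and "f \<in> J"
    from JE[OF this(2)] obtain b where b: "poly_fun n f" "poly_fun n b"
      "\<forall>y\<in>C \<inter> chart \<tau>. f (rep \<tau> y) * s (rep \<tau> y) = b (rep \<tau> y) * h (rep \<tau> y)" by (elim exE conjE)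
    show "(\<lambda>u. P u * f u) \<in> J"
      by (rule JI[OF poly_fun.mult[OF P b(1)] poly_fun.mult[OF P b(2)]]) (use b(3) in \<open>simp add: mult.assoc\<close>)
  qed
  have vJ: "vI \<tau> C \<subseteq> J"
  proof
    fix a assume "a \<in> vI \<tau> C"
    then show "a \<in> J" by (intro JI[OF _ poly_fun.const[of n 0]]) (auto simp: vI_def)
  qed
  have "(\<lambda>_. 1) \<in> J"
  proof (rule ccontr)
    assume "(\<lambda>_. 1) \<notin> J"
    then have "(\<lambda>u. (\<lambda>_. 1) u ^ k) \<notin> J" for k by simp
    then obtain u where u: "\<forall>i. i \<notin> {1..n} \<longrightarrow> u i = (0, 0)" "\<forall>f\<in>J. f u = 0"
      by (rule nullstellensatz[OF J poly_fun.const[of n 1]])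
    have us: "u \<in> slice \<tau>" by (rule slice_of_zero[OF _ _ vJ]) (use u in auto)
    define p where "p = bp u"
    have pC: "p \<in> C" unfolding p_def by (rule in_closed_of_vI[OF Z_closed us]) (use u(2) vJ in auto)
    have p\<tau>: "p \<in> chart \<tau>" "rep \<tau> p = u" unfolding p_def using bp_slice_chart[OF us] rep_of_slice[OF us] by auto
    from div[OF pC] obtain g where g: "g \<in> stalk Y p" "germ_eq Y p (loc p s) (\<lambda>y. loc p h y * g y)"
      unfolding PIs_def principal_ideal_def by blast
    from g(2) obtain U where U: "openin (ftop X) U" "p \<in> U" "\<forall>y\<in>U \<inter> C. loc p s y = loc p h y * g y"
      unfolding germ_eq_def openin_sub by blast
    have "openin (ftop X) (U \<inter> chart (tc p))" "p \<in> U \<inter> chart (tc p)"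
      using U(1,2) openin_chart tc_C[OF pC] by auto
    from open_local[OF this p\<tau>(1)] obtain R where R: "poly_fun n R" "R (rep \<tau> p) \<noteq> 0" "dist_open \<tau> R \<subseteq> U \<inter> chart (tc p)" .
    from g(1)[unfolded stalk_sub_iff[OF p\<tau>(1) pC]]
    obtain P Q where PQ: "poly_fun n P" "poly_fun n Q" "Q (rep \<tau> p) \<noteq> 0"
      "\<forall>y\<in>dist_open \<tau> Q \<inter> C. g y = P (rep \<tau> y) / Q (rep \<tau> y)" by (elim exE conjE)
    \<comment> \<open>\<open>R\<close> restricts to the neighbourhood where the quotient is known,
      and the spare factor \<open>Q\<close> makes both sides vanish where its local expression
      \<open>P / Q\<close> is undefined.\<close>
    have "(\<lambda>u. R u * (Q u * Q u)) \<in> J"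
    proof (rule JI[of _ "\<lambda>u. R u * (Q u * P u)"])
      fix y assume y: "y \<in> C" "y \<in> chart \<tau>"
      show "R (rep \<tau> y) * (Q (rep \<tau> y) * Q (rep \<tau> y)) * s (rep \<tau> y) = R (rep \<tau> y) * (Q (rep \<tau> y) * P (rep \<tau> y)) * h (rep \<tau> y)"
      proof (cases "R (rep \<tau> y) = 0 \<or> Q (rep \<tau> y) = 0")
        case False
        then have "y \<in> dist_open \<tau> R" "y \<in> dist_open \<tau> Q" using y by (auto simp: dist_open_def)
        then have yU: "y \<in> U \<inter> C" "y \<in> chart (tc p)" and gy: "g y = P (rep \<tau> y) / Q (rep \<tau> y)" using R(3) PQ(4) y by auto
        have 1: "s (rep (tc p) y) = h (rep (tc p) y) * g y" using U(3) yU(1) by (simp add: loc_def)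
        have yp: "y \<in> pts X" using y(2) chart_pts by blast
        have 2: "s (rep (tc p) y) * h (rep \<tau> y) = s (rep \<tau> y) * h (rep (tc p) y)"
          by (rule S_ratio[OF s h yp rep_mem[OF yU(2)] rep_mem[OF y(2)]])
        have "s (rep \<tau> y) = h (rep \<tau> y) * g y"
        proof (cases "h (rep (tc p) y) = 0")
          case True
          then have "s (rep (tc p) y) = 0" "h (rep \<tau> y) = 0"
            using 1 S_zero_rep[OF h yU(2) rep_mem[OF y(2)]] by auto
          then have "s (rep \<tau> y) = 0" using S_zero_rep[OF s yU(2) rep_mem[OF y(2)]] by simp
          with \<open>h (rep \<tau> y) = 0\<close> show ?thesis by simp
        next
          case False
          with 1 2 show ?thesis by (simp add: mult_ac)
        qed
        then show ?thesis using gy False by simp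
      qed auto
    qed (intro poly_fun.mult R PQ)+
    from bspec[OF u(2) this] have "R u * (Q u * Q u) = 0" .
    with R(2) PQ(3) p\<tau>(2) show False by simp
  qed
  from JE[OF this] obtain b where "poly_fun n b" "\<forall>y\<in>C \<inter> chart \<tau>. 1 * s (rep \<tau> y) = b (rep \<tau> y) * h (rep \<tau> y)"
    by (elim exE conjE)
  then show ?thesis by (intro that[of b]) auto
qed

text \<open>Forms restricted to \<open>C\<close> have no zero divisors. The factor \<open>h\<close>
  absorbs the points at which the product is not controlled.\<close>

lemma zeroC_prod_eq_0:
  assumes "finite I" "\<And>i. i \<in> I \<Longrightarrow> s i \<in> S \<beta>" "h \<in> S \<gamma>" "\<not> zeroC h"
    and z: "\<And>x u. x \<in> C \<Longrightarrow> u \<in> x \<Longrightarrow> h u * (\<Prod>i\<in>I. s i u) = 0"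
  shows "\<exists>i\<in>I. zeroC (s i)"
proof (rule ccontr)
  assume neg: "\<not> ?thesis"
  have "J \<subseteq> I \<Longrightarrow> \<exists>\<delta>. (\<lambda>u. h u * (\<Prod>i\<in>J. s i u)) \<in> S \<delta> \<and> \<not> zeroC (\<lambda>u. h u * (\<Prod>i\<in>J. s i u))" if "finite J" for J
    using that
  proof (induction J rule: finite_induct)
    case empty then show ?case using assms(3,4) by auto
  next
    case (insert i J)
    then obtain \<delta> where \<delta>: "(\<lambda>u. h u * (\<Prod>i\<in>J. s i u)) \<in> S \<delta>" "\<not> zeroC (\<lambda>u. h u * (\<Prod>i\<in>J. s i u))" by auto
    have i: "s i \<in> S \<beta>" "\<not> zeroC (s i)" using insert.prems assms(2) neg by auto
    have "(\<lambda>u. s i u * (h u * (\<Prod>i\<in>J. s i u))) = (\<lambda>u. h u * (\<Prod>i\<in>insert i J. s i u))"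
      using insert.hyps by (simp add: mult_ac)
    with S_mult[OF i(1) \<delta>(1)] zeroC_mult[OF i(1) \<delta>(1) i(2) \<delta>(2)] show ?case by auto
  qed
  from this[OF assms(1) order_refl] z show False by (auto simp: zeroC_def)
qed

text \<open>Completeness of the curve. Multiplication by \<open>s / h\<close> maps the forms of a
  suitable weight, restricted to \<open>C\<close>, to themselves; by finite dimension
  \<open>s / h\<close> is a root of a polynomial, and since \<open>C\<close> is irreducible it is
  constant.\<close>

lemma global_quotient_constant:
  assumes s: "s \<in> S \<beta>" and h: "h \<in> S \<beta>" "\<not> zeroC h"
    and div: "\<And>p. p \<in> C \<Longrightarrow> loc p s \<in> PIs p h"
  obtains l where "zeroC (\<lambda>u. s u - l * h u)"
proof -
  have "\<forall>\<tau>. \<exists>p q. has_wt p q (\<lambda>_. 1) \<and> (\<forall>i\<in>{1..n}. (if \<tau> i then q i else p i) = 0) \<and>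
    (\<forall>i\<in>{1..n}. 1 \<le> int (if \<tau> i then p i else q i)) \<and> (\<forall>u\<in>slice \<tau>. mono p q u = 1)"
  proof
    fix \<tau> :: "nat \<Rightarrow> bool"
    obtain p q where "has_wt p q (\<lambda>_. 1)" "\<forall>i\<in>{1..n}. (if \<tau> i then q i else p i) = 0"
      "\<forall>i\<in>{1..n}. 1 \<le> int (if \<tau> i then p i else q i)" "\<forall>u\<in>slice \<tau>. mono p q u = 1"
      by (rule unit_section[of "\<lambda>_. 1" \<tau>]) auto
    then show "\<exists>p q. has_wt p q (\<lambda>_. 1) \<and> (\<forall>i\<in>{1..n}. (if \<tau> i then q i else p i) = 0) \<and>
      (\<forall>i\<in>{1..n}. 1 \<le> int (if \<tau> i then p i else q i)) \<and> (\<forall>u\<in>slice \<tau>. mono p q u = 1)"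
      by (intro exI[of _ p] exI[of _ q] conjI)
  qed
  then obtain pt qt where pq: "\<And>\<tau>. has_wt (pt \<tau>) (qt \<tau>) (\<lambda>_. 1)"
    "\<And>\<tau>. \<forall>i\<in>{1..n}. (if \<tau> i then qt \<tau> i else pt \<tau> i) = 0"
    "\<And>\<tau>. \<forall>i\<in>{1..n}. 1 \<le> int (if \<tau> i then pt \<tau> i else qt \<tau> i)"
    "\<And>\<tau>. \<forall>u\<in>slice \<tau>. mono (pt \<tau>) (qt \<tau>) u = 1"
    unfolding choice_iff by blast
  define um where "um = (\<lambda>\<tau>. mono (pt \<tau>) (qt \<tau>))"
  have um: "um \<tau> \<in> S (\<lambda>_. 1)" for \<tau> unfolding um_def by (rule mono_S[OF pq(1)])
  \<comment> \<open>In each chart \<open>s / h\<close> is polynomial, hence becomes a form after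
    multiplication with a power of \<open>um \<tau>\<close>, which is 1 on the slice. If the chart
    misses \<open>C\<close>, then \<open>um \<tau>\<close> vanishes on \<open>C\<close> and any
    positive power will do.\<close>
  have "\<exists>D::nat. \<forall>K\<ge>D. \<exists>s'\<in>S (\<lambda>_. int K). zeroC (\<lambda>u. s u * um \<tau> u ^ K - h u * s' u)" for \<tau>
  proof (cases "C \<inter> chart \<tau> = {}")
    case True
    show ?thesis
    proof (intro exI[of _ 1] allI impI)
      fix K :: nat assume K: "1 \<le> K"
      have "um \<tau> u = 0" if "x \<in> C" "u \<in> x" for x u
      proof -
        have "u \<in> cox_points n" "x = bp u" using pts_mem that Z_pts by blast+
        moreover have "x \<notin> chart \<tau>" using True that by blast
        ultimately have "u \<in> cox_points n" "\<not> inU \<tau> u" using chart_bp by auto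
        then show ?thesis unfolding um_def by (rule mono_outside[OF _ _ pq(3)])
      qed
      then have "zeroC (\<lambda>u. s u * um \<tau> u ^ K - h u * 0)" using K by (auto simp: zeroC_def)
      then show "\<exists>s'\<in>S (\<lambda>_. int K). zeroC (\<lambda>u. s u * um \<tau> u ^ K - h u * s' u)"
        using S_0 by (rule bexI[of _ "\<lambda>_. 0"])
    qed
  next
    case False
    obtain b where b: "poly_fun n b" "\<forall>y\<in>C \<inter> chart \<tau>. s (rep \<tau> y) = b (rep \<tau> y) * h (rep \<tau> y)"
      by (rule global_quotient_in_chart[OF s h(1) div])
    from homogenise[OF b(1), of \<tau>] obtain D where
      D: "\<forall>\<beta>. (\<forall>i\<in>{1..n}. int D \<le> \<beta> i) \<longrightarrow> (\<exists>s\<in>S \<beta>. \<forall>u\<in>slice \<tau>. s u = b u)" by (elim exE)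
    show ?thesis
    proof (intro exI[of _ D] allI impI)
      fix K :: nat assume K: "D \<le> K"
      then have "\<exists>s\<in>S (\<lambda>_. int K). \<forall>u\<in>slice \<tau>. s u = b u" using spec[OF D, of "\<lambda>_. int K"] by simp
      then obtain s' where s': "s' \<in> S (\<lambda>_. int K)" "\<forall>u\<in>slice \<tau>. s' u = b u" by (elim bexE)
      have e: "(\<lambda>u. s u * um \<tau> u ^ K) \<in> S (\<lambda>i. \<beta> i + int K)" "(\<lambda>u. h u * s' u) \<in> S (\<lambda>i. \<beta> i + int K)"
        using S_mult[OF s S_power[OF um]] S_mult[OF h(1) s'(1)] by auto
      have "(\<lambda>u. s u * um \<tau> u ^ K - h u * s' u) \<in> vI \<tau> C"
        unfolding vI_def
      proof (intro CollectI conjI ballI)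
        show "poly_fun n (\<lambda>u. s u * um \<tau> u ^ K - h u * s' u)" by (rule S_poly[OF S_diff[OF e]])
        fix y assume y: "y \<in> C \<inter> chart \<tau>"
        then have "um \<tau> (rep \<tau> y) = 1" "s' (rep \<tau> y) = b (rep \<tau> y)"
          using rep_slice pq(4) s'(2) by (auto simp: um_def)
        then show "s (rep \<tau> y) * um \<tau> (rep \<tau> y) ^ K - h (rep \<tau> y) * s' (rep \<tau> y) = 0"
          using b(2) y by simp
      qed
      then have "zeroC (\<lambda>u. s u * um \<tau> u ^ K - h u * s' u)" using zeroC_vI[OF S_diff[OF e] False] by blast
      then show "\<exists>s'\<in>S (\<lambda>_. int K). zeroC (\<lambda>u. s u * um \<tau> u ^ K - h u * s' u)" using s'(1) by (rule bexI)
    qed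
  qed
  then have "\<forall>\<tau>. \<exists>D::nat. \<forall>K\<ge>D. \<exists>s'\<in>S (\<lambda>_. int K). zeroC (\<lambda>u. s u * um \<tau> u ^ K - h u * s' u)" by (rule allI)
  then obtain D where D: "\<forall>\<tau>. \<forall>K\<ge>D \<tau>. \<exists>s'\<in>S (\<lambda>_. int K). zeroC (\<lambda>u. s u * um \<tau> u ^ K - h u * s' u)"
    unfolding choice_iff by (elim exE)
  define K where "K = (\<Sum>\<tau>\<in>Charts. D \<tau>)"
  have K: "\<exists>s'\<in>S (\<lambda>_. int K). zeroC (\<lambda>u. s u * um \<tau> u ^ K - h u * s' u)" if "\<tau> \<in> Charts" for \<tau>
  proof -
    have "D \<tau> \<le> K" unfolding K_def using that finite_Charts by (intro member_le_sum) auto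
    then show ?thesis using D by simp
  qed
  have ex: "has_wt (pt \<tau>) (qt \<tau>) (\<lambda>_. 1) \<and> (\<forall>i\<in>{1..n}. (if \<tau> i then qt \<tau> i else pt \<tau> i) = 0)" for \<tau>
    using pq(1,2) by blast
  obtain M :: nat where M1: "1 \<le> M" and
    M: "\<And>p q. has_wt p q (\<lambda>_. int M) \<Longrightarrow> \<exists>\<tau>\<in>Charts. \<exists>p' q'. has_wt p' q' (\<lambda>_. int M - int K) \<and>
      (\<forall>u. mono p q u = mono (pt \<tau>) (qt \<tau>) u ^ K * mono p' q' u)"
    using large_monomials[OF ex, where K = K] by blast
  let ?\<gamma> = "\<lambda>_::nat. int M"
  \<comment> \<open>Every monomial of weight \<open>M\<close> contains the \<open>K\<close>-th power
    of some \<open>um \<tau>\<close>, and that power absorbs the denominator.\<close>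
  have stable: "\<exists>m'\<in>S ?\<gamma>. zeroC (\<lambda>u. s u * m u - h u * m' u)" if m: "m \<in> S ?\<gamma>" for m
  proof -
    let ?W = "{m. \<exists>m'\<in>S ?\<gamma>. zeroC (\<lambda>u. s u * m u - h u * m' u)}"
    have "S ?\<gamma> \<subseteq> ?W"
      unfolding S_def[of ?\<gamma>]
    proof (rule fun_vs.span_minimal)
      show "{mono p q |p q. has_wt p q ?\<gamma>} \<subseteq> {m. \<exists>m'\<in>fun_vs.span {mono p q |p q. has_wt p q ?\<gamma>}. zeroC (\<lambda>u. s u * m u - h u * m' u)}"
        unfolding S_def[symmetric]
      proof clarify
        fix p q assume "has_wt p q ?\<gamma>"
        from M[OF this] obtain \<tau> p' q' where t: "\<tau> \<in> Charts" "has_wt p' q' (\<lambda>_. int M - int K)"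
          "\<forall>u. mono p q u = um \<tau> u ^ K * mono p' q' u" unfolding um_def by (elim bexE exE conjE)
        from K[OF t(1)] obtain s' where s': "s' \<in> S (\<lambda>_. int K)" "zeroC (\<lambda>u. s u * um \<tau> u ^ K - h u * s' u)" by (elim bexE)
        have "(\<lambda>u. s' u * mono p' q' u) \<in> S ?\<gamma>" using S_mult[OF s'(1) mono_S[OF t(2)]] by simp
        moreover have "zeroC (\<lambda>u. s u * mono p q u - h u * (s' u * mono p' q' u))"
          unfolding zeroC_def
        proof (intro ballI)
          fix x u assume "x \<in> C" "u \<in> x"
          then have "s u * um \<tau> u ^ K - h u * s' u = 0" using s'(2) by (auto simp: zeroC_def)
          then have "(s u * um \<tau> u ^ K) * mono p' q' u = (h u * s' u) * mono p' q' u" by simp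
          then show "s u * mono p q u - h u * (s' u * mono p' q' u) = 0" using t(3) by (simp add: mult.assoc)
        qed
        ultimately show "\<exists>m'\<in>S ?\<gamma>. zeroC (\<lambda>u. s u * mono p q u - h u * m' u)"
          by (intro bexI[of _ "\<lambda>u. s' u * mono p' q' u"])
      qed
      show "fun_vs.subspace {m. \<exists>m'\<in>fun_vs.span {mono p q |p q. has_wt p q ?\<gamma>}. zeroC (\<lambda>u. s u * m u - h u * m' u)}"
        unfolding S_def[symmetric]
      proof (rule subspaceI)
        show "(\<lambda>_. 0) \<in> ?W" using S_0[of ?\<gamma>] by (auto simp: zeroC_def intro!: bexI[of _ "\<lambda>_. 0"])
      next
        fix m1 m2 assume "m1 \<in> ?W" "m2 \<in> ?W"
        then obtain m1' m2' where *: "m1' \<in> S ?\<gamma>" "zeroC (\<lambda>u. s u * m1 u - h u * m1' u)"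
          "m2' \<in> S ?\<gamma>" "zeroC (\<lambda>u. s u * m2 u - h u * m2' u)" by auto
        have "zeroC (\<lambda>u. s u * (m1 u + m2 u) - h u * (m1' u + m2' u))"
          using *(2,4) by (simp add: zeroC_def algebra_simps)
        then show "(\<lambda>u. m1 u + m2 u) \<in> ?W" using S_add[OF *(1,3)] by (auto intro!: bexI[of _ "\<lambda>u. m1' u + m2' u"])
      next
        fix k m1 assume "m1 \<in> ?W"
        then obtain m1' where *: "m1' \<in> S ?\<gamma>" "zeroC (\<lambda>u. s u * m1 u - h u * m1' u)" by auto
        have "zeroC (\<lambda>u. s u * (k * m1 u) - h u * (k * m1' u))"
          unfolding zeroC_def
        proof (intro ballI)
          fix x u assume "x \<in> C" "u \<in> x"
          then have "s u * m1 u - h u * m1' u = 0" using *(2) by (auto simp: zeroC_def)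
          then have "k * (s u * m1 u - h u * m1' u) = 0" by simp
          then show "s u * (k * m1 u) - h u * (k * m1' u) = 0" by (simp add: algebra_simps)
        qed
        then show "(\<lambda>u. k * m1 u) \<in> ?W" using S_scale[OF *(1)] by (auto intro!: bexI[of _ "\<lambda>u. k * m1' u"])
      qed
    qed
    with m show ?thesis by auto
  qed
  then have "\<forall>m\<in>S ?\<gamma>. \<exists>m'. m' \<in> S ?\<gamma> \<and> zeroC (\<lambda>u. s u * m u - h u * m' u)" by (auto simp: Bex_def)
  then obtain \<Phi> where \<Phi>: "\<forall>m\<in>S ?\<gamma>. \<Phi> m \<in> S ?\<gamma> \<and> zeroC (\<lambda>u. s u * m u - h u * \<Phi> m u)"
    unfolding bchoice_iff by (elim exE)
  obtain x0 where x0: "x0 \<in> C" using Z_ne by blast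
  define m0 where "m0 = (\<lambda>u. um (tc x0) u ^ M)"
  have m0: "m0 \<in> S ?\<gamma>" unfolding m0_def using S_power[OF um] by simp
  have "m0 (rep (tc x0) x0) = 1" using pq(4) rep_slice[OF tc_C[OF x0]] by (simp add: m0_def um_def)
  then have m0z: "\<not> zeroC m0" using x0 rep_mem[OF tc_C[OF x0]] by (force simp: zeroC_def)
  \<comment> \<open>On \<open>C\<close> the form \<open>m j\<close> represents
    \<open>(s / h)^j * m0\<close>; all of them have the same weight, so they are dependent modulo
    forms vanishing on \<open>C\<close>.\<close>
  define m where "m = (\<lambda>j. (\<Phi> ^^ j) m0)"
  have mS: "m j \<in> S ?\<gamma>" for j unfolding m_def by (induction j) (use m0 \<Phi> in auto)
  have mpow: "s u ^ j * m0 u = h u ^ j * m j u" if xu: "x \<in> C" "u \<in> x" for j x u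
  proof (induction j)
    case 0 then show ?case by (simp add: m_def)
  next
    case (Suc j)
    have "zeroC (\<lambda>u. s u * m j u - h u * \<Phi> (m j) u)" using bspec[OF \<Phi> mS[of j]] by simp
    then have "s u * m j u = h u * m (Suc j) u" using xu by (auto simp: zeroC_def m_def)
    then have 1: "h u ^ j * (s u * m j u) = h u ^ Suc j * m (Suc j) u" by (simp add: mult.left_commute)
    have "s u ^ Suc j * m0 u = s u * (s u ^ j * m0 u)" by (simp add: mult.assoc)
    also have "\<dots> = s u * (h u ^ j * m j u)" unfolding Suc ..
    also have "\<dots> = h u ^ j * (s u * m j u)" by (rule mult.left_commute)
    finally show ?case unfolding 1 .
  qed
  have subz: "fun_vs.subspace {s \<in> S ?\<gamma>. zeroC s}"
    using fun_vs.subspace_inter[OF S_subspace[of ?\<gamma>] zeroC_subspace] by (simp add: Int_def)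
  show ?thesis
  proof (rule fincod_dependent[OF S_finite_dim subz infinite_UNIV_nat mS])
    fix F :: "nat set" and k assume F: "finite F" "F \<noteq> {}" "\<And>i. i \<in> F \<Longrightarrow> k i \<noteq> 0"
      "(\<lambda>y. \<Sum>i\<in>F. k i * m i y) \<in> {s \<in> S ?\<gamma>. zeroC s}"
    define R where "R = (\<Sum>i\<in>F. monom (k i) i)"
    have R: "poly R z = (\<Sum>i\<in>F. k i * z ^ i)" for z by (simp add: R_def poly_sum poly_monom)
    obtain i where i: "i \<in> F" using F(2) by blast
    have "coeff R i = k i" using F(1) i by (simp add: R_def coeff_sum)
    then have R0: "R \<noteq> 0" using F(3)[OF i] by auto
    define roots where "roots = {z. poly R z = 0}"
    have fr: "finite roots" unfolding roots_def by (rule poly_roots_finite[OF R0])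
    \<comment> \<open>Pointwise \<open>s / h\<close> is one of finitely many roots; that it is the
      same root everywhere on \<open>C\<close> follows from the absence of zero divisors.\<close>
    have "\<exists>l\<in>roots. zeroC (\<lambda>u. s u - l * h u)"
    proof (rule zeroC_prod_eq_0[OF fr])
      show "(\<lambda>u. s u - l * h u) \<in> S \<beta>" for l by (rule S_diff[OF s S_scale[OF h(1)]])
      show "(\<lambda>u. h u * m0 u) \<in> S (\<lambda>i. \<beta> i + int M)" by (rule S_mult[OF h(1) m0])
      show "\<not> zeroC (\<lambda>u. h u * m0 u)" by (rule zeroC_mult[OF h(1) m0 h(2) m0z])
      fix x u assume xu: "x \<in> C" "u \<in> x"
      show "h u * m0 u * (\<Prod>l\<in>roots. s u - l * h u) = 0"
      proof (cases "h u * m0 u = 0")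
        case False
        have "poly R (s u / h u) * m0 u = (\<Sum>i\<in>F. k i * ((s u / h u) ^ i * m0 u))"
          unfolding R by (simp add: sum_distrib_right mult.assoc)
        also have "\<dots> = (\<Sum>i\<in>F. k i * m i u)"
        proof (rule sum.cong[OF refl])
          fix i
          have "(s u / h u) ^ i * m0 u = m i u" using mpow[OF xu, of i] False by (simp add: power_divide field_simps)
          then show "k i * ((s u / h u) ^ i * m0 u) = k i * m i u" by simp
        qed
        also have "\<dots> = 0" using F(4) xu by (auto simp: zeroC_def)
        finally have "s u / h u \<in> roots" using False by (simp add: roots_def)
        moreover have "s u - (s u / h u) * h u = 0" using False by simp
        ultimately have "(\<Prod>l\<in>roots. s u - l * h u) = 0" by (intro prod_zero[OF fr] bexI)
        then show ?thesis by simp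
      qed simp
    qed
    then show thesis using that by blast
  qed
qed

text \<open>Divisibility by \<open>g^k\<close> at all zeros of \<open>g\<close> costs at most
  \<open>k * N g\<close> conditions. A form satisfying them is a constant multiple of
  \<open>g^k\<close> on \<open>C\<close>, which accounts for the summand 1.\<close>

lemma H_upper:
  assumes g: "g \<in> S \<alpha>" "\<not> zeroC g"
  shows "H (\<lambda>i. int k * \<alpha> i) \<le> k * N g + 1"
proof -
  let ?\<beta> = "\<lambda>i. int k * \<alpha> i"
  let ?h = "\<lambda>u. g u ^ k"
  have h: "?h \<in> S ?\<beta>" "\<not> zeroC ?h" by (rule S_power[OF g(1)], rule zeroC_power[OF g])
  let ?F = "Zs g"
  have F: "finite ?F" "?F \<subseteq> C" using finite_Zs[OF g] Zs_C by auto
  define K where "K = {s \<in> S ?\<beta>. \<forall>p\<in>?F. loc p s \<in> PIs p ?h}"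
  have Ksub: "fun_vs.subspace K" unfolding K_def by (rule vanishing_subspace[OF F(2) S_poly[OF h(1)]])
  have zsub: "fun_vs.subspace {s \<in> S ?\<beta>. zeroC s}"
    using fun_vs.subspace_inter[OF S_subspace[of ?\<beta>] zeroC_subspace] by (simp add: Int_def)
  have KS: "K \<subseteq> S ?\<beta>" by (auto simp: K_def)
  have zK: "{s \<in> S ?\<beta>. zeroC s} \<subseteq> K" unfolding K_def using PIs_zero[OF _ _ _ h(1)] F(2) by auto
  have "codim (S ?\<beta>) K \<le> (\<Sum>p\<in>?F. ordp p ?h)"
    unfolding K_def by (rule codim_vanishing_le[OF h F])
  also have "\<dots> = (\<Sum>p\<in>?F. k * ordp p g)"
    by (intro sum.cong refl ordp_power[OF _ g]) (use F in auto)
  finally have 1: "codim (S ?\<beta>) K \<le> k * N g" by (simp add: N_def sum_distrib_left)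
  have hK: "?h \<in> K"
    unfolding K_def PIs_def
    using h(1) local_curve.PI_self[OF local_curve_p loc_stalk[OF _ S_poly[OF h(1)]]] F(2) by blast
  have "K \<subseteq> fun_vs.span ({?h} \<union> {s \<in> S ?\<beta>. zeroC s})" (is "_ \<subseteq> ?T")
  proof
    fix s assume s: "s \<in> K"
    then have sS: "s \<in> S ?\<beta>" by (simp add: K_def)
    have "loc p s \<in> PIs p ?h" if p: "p \<in> C" for p
    proof (cases "p \<in> ?F")
      case True with s show ?thesis by (simp add: K_def)
    next
      case False
      then have "loc p ?h p \<noteq> 0" using Zs_iff[OF g(1) p] by (simp add: loc_power)
      from local_curve.PI_unit[OF local_curve_p[OF p] loc_stalk[OF p S_poly[OF h(1)]] this]
      show ?thesis unfolding PIs_def using loc_stalk[OF p S_poly[OF sS]] by simp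
    qed
    from global_quotient_constant[OF sS h this] obtain l where l: "zeroC (\<lambda>u. s u - l * ?h u)" .
    have 1: "(\<lambda>u. s u - l * ?h u) \<in> ?T"
      using l S_diff[OF sS S_scale[OF h(1)]] by (intro fun_vs.span_base) simp
    have 2: "(\<lambda>u. l * ?h u) \<in> ?T" by (intro subspace_scale' fun_vs.subspace_span fun_vs.span_base) simp
    from subspace_add'[OF fun_vs.subspace_span 1 2] show "s \<in> ?T" by simp
  qed
  then have "codim K {s \<in> S ?\<beta>. zeroC s} \<le> card {?h}" using hK by (intro codim_le_card) auto
  moreover have "H ?\<beta> = codim (S ?\<beta>) K + codim K {s \<in> S ?\<beta>. zeroC s}"
    unfolding H_def by (rule codim_trans(2)[OF S_finite_dim fincod_subset[OF S_finite_dim KS] zK KS Ksub zsub])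
  ultimately show ?thesis using 1 by simp
qed

lemma N_le_of_ample:
  assumes "f \<in> S \<alpha>" "\<not> zeroC f" "g \<in> S \<alpha>" "\<not> zeroC g" "\<forall>i\<in>{1..n}. 1 \<le> \<alpha> i"
  shows "N f \<le> N g"
proof (rule ccontr)
  assume "\<not> N f \<le> N g"
  then have gf: "N g + 1 \<le> N f" by simp
  obtain l :: nat where l: "\<And>k::nat. k * N f \<le> H (\<lambda>i. int (k + l) * \<alpha> i)" using H_lower[OF assms(1,2,5)] by blast
  have le: "k * N f \<le> (k + l) * N g + 1" for k
    using l[of k] H_upper[OF assms(3,4), of "k + l"] by (rule order_trans)
  \<comment> \<open>Chosen just large enough: \<open>k * (N g + 1) \<le> (k + l) * N g + 1\<close>
    amounts to \<open>k \<le> l * N g + 1\<close>.\<close>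
  define k where "k = l * N g + 2"
  have "k * (N g + 1) \<le> k * N f" using gf by (intro mult_left_mono) auto
  with le[of k] have "k * (N g + 1) \<le> (k + l) * N g + 1" by (rule order_trans[rotated])
  then show False by (simp add: k_def algebra_simps)
qed

text \<open>In other words, a principal divisor on the complete curve \<open>C\<close> has degree zero.\<close>

theorem N_weight:
  assumes f: "f \<in> S \<alpha>" "\<not> zeroC f" and g: "g \<in> S \<alpha>" "\<not> zeroC g"
  shows "N f = N g"
proof -
  \<comment> \<open>Multiplying both forms by one form of the constant weight \<open>W\<close> makes
    the weight positive, as the growth comparison requires, and adds the same number to both
    sides.\<close>
  define W where "W = (\<Sum>i\<in>{1..n}. \<bar>\<alpha> i\<bar>) + 1"
  have W: "\<bar>\<alpha> i\<bar> + 1 \<le> W" if "i \<in> {1..n}" for i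
    unfolding W_def using member_le_sum[of i "{1..n}" "\<lambda>i. \<bar>\<alpha> i\<bar>"] that by auto
  obtain x0 where x0: "x0 \<in> C" using Z_ne by blast
  obtain p q where pq: "has_wt p q (\<lambda>_. W)" "\<forall>u\<in>slice (tc x0). mono p q u = 1"
    by (rule unit_section[of "\<lambda>_. W" "tc x0"]) (use W in force)+
  let ?m = "mono p q"
  have m: "?m \<in> S (\<lambda>_. W)" by (rule mono_S[OF pq(1)])
  have mz: "\<not> zeroC ?m" using x0 rep_mem[OF tc_C[OF x0]] rep_slice[OF tc_C[OF x0]] pq(2) by (force simp: zeroC_def)
  have ge: "\<forall>i\<in>{1..n}. 1 \<le> \<alpha> i + W" using W by force
  have le: "N f \<le> N g" if f: "f \<in> S \<alpha>" "\<not> zeroC f" and g: "g \<in> S \<alpha>" "\<not> zeroC g" for f g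
  proof -
    have "N (\<lambda>u. f u * ?m u) \<le> N (\<lambda>u. g u * ?m u)"
      by (rule N_le_of_ample[OF S_mult[OF f(1) m] zeroC_mult[OF f(1) m f(2) mz]
            S_mult[OF g(1) m] zeroC_mult[OF g(1) m g(2) mz] ge])
    then show ?thesis using N_mult[OF f(1) m f(2) mz] N_mult[OF g(1) m g(2) mz] by simp
  qed
  from le[OF f g] le[OF g f] show ?thesis by simp
qed

end

section \<open>The line bundles of the boundary divisors\<close>

text \<open>Division by \<open>w_i\<close> with remainder the value at
  \<open>w_i = 0\<close>.\<close>

lemma poly_fun_split_coord:
  assumes i: "i \<in> {1..n}" and P: "poly_fun n P"
  shows "\<exists>P1. poly_fun n P1 \<and> (\<forall>u. P u = P (u(i := (fst (u i), 0))) + snd (u i) * P1 u)"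
  using P
proof induction
  case (const k)
  show ?case by (intro exI[of _ "\<lambda>_. 0"]) (auto intro: poly_fun.const)
next
  case (z_coord j)
  show ?case by (intro exI[of _ "\<lambda>_. 0"]) (auto intro: poly_fun.const)
next
  case (w_coord j)
  show ?case
    by (intro exI[of _ "\<lambda>_. if j = i then 1 else 0"]) (auto intro: poly_fun.const)
next
  case (add P Q)
  then obtain P1 Q1 where 1: "poly_fun n P1" "\<forall>u. P u = P (u(i := (fst (u i), 0))) + snd (u i) * P1 u"
    "poly_fun n Q1" "\<forall>u. Q u = Q (u(i := (fst (u i), 0))) + snd (u i) * Q1 u" by (elim exE conjE)
  have "P u + Q u = (P (u(i := (fst (u i), 0))) + Q (u(i := (fst (u i), 0)))) + snd (u i) * (P1 u + Q1 u)" for u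
    using spec[OF 1(2), of u] spec[OF 1(4), of u] by (simp only: distrib_left) (simp only: add_ac)
  then show ?case by (intro exI[of _ "\<lambda>u. P1 u + Q1 u"] conjI allI poly_fun.add 1)
next
  case (mult P Q)
  then obtain P1 Q1 where 1: "poly_fun n P1" "\<forall>u. P u = P (u(i := (fst (u i), 0))) + snd (u i) * P1 u"
    "poly_fun n Q1" "\<forall>u. Q u = Q (u(i := (fst (u i), 0))) + snd (u i) * Q1 u" by (elim exE conjE)
  have "P u * Q u = P (u(i := (fst (u i), 0))) * Q (u(i := (fst (u i), 0))) +
      snd (u i) * (P1 u * Q u + (P u - snd (u i) * P1 u) * Q1 u)" for u
  proof -
    have p: "P (u(i := (fst (u i), 0))) = P u - snd (u i) * P1 u" using spec[OF 1(2), of u] by (simp only: eq_diff_eq)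
    have q: "Q (u(i := (fst (u i), 0))) = Q u - snd (u i) * Q1 u" using spec[OF 1(4), of u] by (simp only: eq_diff_eq)
    show ?thesis unfolding p q by (simp add: algebra_simps)
  qed
  moreover have "poly_fun n (\<lambda>u. P1 u * Q u + (P u - snd (u i) * P1 u) * Q1 u)"
    by (intro poly_fun.add poly_fun.mult poly_fun_diff poly_fun.w_coord 1 mult.hyps i)
  ultimately show ?case by (intro exI[of _ "\<lambda>u. P1 u * Q u + (P u - snd (u i) * P1 u) * Q1 u"] conjI allI)
qed


context bott
begin

text \<open>The weight of \<open>w_i\<close>, that is, the class of the divisor
  \<open>D_i\<close>.\<close>

definition ew :: "nat \<Rightarrow> nat \<Rightarrow> int" where
  "ew i = (\<lambda>j. if j = i then 1 else 0)"

lemma w_section: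
  assumes "i \<in> {1..n}"
  shows "(\<lambda>u. snd (u i)) \<in> S (ew i)"
proof -
  let ?q = "\<lambda>j. if j = i then 1 else 0 :: nat"
  have "mono (\<lambda>_. 0) ?q u = (\<Prod>j\<in>{1..n}. if j = i then snd (u j) else 1)" for u
    unfolding mono_def by (rule prod.cong) auto
  then have "mono (\<lambda>_. 0) ?q = (\<lambda>u. snd (u i))" using assms by (auto simp: fun_eq_iff)
  moreover have "has_wt (\<lambda>_. 0) ?q (ew i)" by (simp add: has_wt_def wt_def ew_def)
  ultimately show ?thesis using mono_S by metis
qed

lemma chi_ew: "i \<in> {1..n} \<Longrightarrow> chi (ew i) t = t i"
proof -
  assume i: "i \<in> {1..n}"
  have "chi (ew i) t = (\<Prod>j\<in>{1..n}. if j = i then t j else 1)"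
    unfolding chi_def ew_def by (rule prod.cong) auto
  with i show ?thesis by simp
qed

lemma divisor_iff:
  assumes i: "i \<in> {1..n}" and y: "y \<in> chart \<tau>"
  shows "y \<in> bott_divisor c n i \<longleftrightarrow> snd (rep \<tau> y i) = 0"
proof
  assume "y \<in> bott_divisor c n i"
  then obtain u where u: "u \<in> cox_points n" "snd (u i) = 0" "y = bp u" unfolding bott_divisor_def by blast
  then show "snd (rep \<tau> y i) = 0" using S_zero_rep[OF w_section[OF i] y] bp_self by blast
next
  assume "snd (rep \<tau> y i) = 0"
  then show "y \<in> bott_divisor c n i"
    unfolding bott_divisor_def using rep_cox[OF y] bp_rep[OF y] by blast
qed

lemma rep_nrm:
  assumes "y \<in> chart \<sigma>" "y \<in> chart \<tau>"
  shows "inU \<tau> (rep \<sigma> y)" "rep \<tau> y = act (nt c \<tau> (rep \<sigma> y)) (rep \<sigma> y)"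
proof -
  show u: "inU \<tau> (rep \<sigma> y)" using chart_bp[OF rep_cox[OF assms(1)], of \<tau>] bp_rep[OF assms(1)] assms(2) by simp
  show "rep \<tau> y = act (nt c \<tau> (rep \<sigma> y)) (rep \<sigma> y)"
    using rep_bp[OF u] bp_rep[OF assms(1)] by (simp add: nrm_def)
qed

lemma reg_mult:
  assumes "f \<in> reg X V" "g \<in> reg X V"
  shows "(\<lambda>y. f y * g y) \<in> reg X V"
  unfolding reg_X
proof
  fix u assume u: "u \<in> {u \<in> cox_points n. bp u \<in> V}"
  from bspec[OF assms(1)[unfolded reg_X] u] bspec[OF assms(2)[unfolded reg_X] u]
  obtain P Q P' Q' where *: "poly_fun n P" "poly_fun n Q" "Q u \<noteq> 0"
    "\<forall>v\<in>{u \<in> cox_points n. bp u \<in> V}. Q v \<noteq> 0 \<longrightarrow> f (bp v) = P v / Q v"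
    "poly_fun n P'" "poly_fun n Q'" "Q' u \<noteq> 0"
    "\<forall>v\<in>{u \<in> cox_points n. bp u \<in> V}. Q' v \<noteq> 0 \<longrightarrow> g (bp v) = P' v / Q' v" by (elim exE conjE)
  show "\<exists>P Q. poly_fun n P \<and> poly_fun n Q \<and> Q u \<noteq> 0 \<and>
    (\<forall>v\<in>{u \<in> cox_points n. bp u \<in> V}. Q v \<noteq> 0 \<longrightarrow> f (bp v) * g (bp v) = P v / Q v)"
    by (intro exI[of _ "\<lambda>v. P v * P' v"] exI[of _ "\<lambda>v. Q v * Q' v"] conjI poly_fun.mult *) (use * in auto)
qed

lemma reg_poly: "poly_fun n P \<Longrightarrow> V \<subseteq> chart \<tau> \<Longrightarrow> (\<lambda>y. P (rep \<tau> y)) \<in> reg X V"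
  by (rule reg_frac[OF _ poly_fun.const[of n 1]]) (auto simp: dist_open_def)

lemma reg_transition:
  assumes i: "i \<in> {1..n}"
  shows "(\<lambda>y. nt c \<tau> (rep \<sigma> y) i) \<in> reg X (chart \<tau> \<inter> chart \<sigma>)"
  unfolding reg_X
proof
  fix u assume u: "u \<in> {u \<in> cox_points n. bp u \<in> chart \<tau> \<inter> chart \<sigma>}"
  obtain P Q where PQ: "poly_fun n P" "poly_fun n Q" "\<forall>u. inU \<tau> u \<longrightarrow> Q u \<noteq> 0 \<and> nt c \<tau> u i = P u / Q u"
    using rfun_nt[OF i, of \<tau>] unfolding rfun_def by (elim exE conjE)
  obtain P' Q' where PQ': "poly_fun n P'" "poly_fun n Q'" "\<forall>u. inU \<sigma> u \<longrightarrow> Q' u \<noteq> 0 \<and> nt c \<sigma> u i = P' u / Q' u"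
    using rfun_nt[OF i, of \<sigma>] unfolding rfun_def by (elim exE conjE)
  have v: "Q v * P' v \<noteq> 0 \<and> nt c \<tau> (rep \<sigma> (bp v)) i = (P v * Q' v) / (Q v * P' v)"
    if "v \<in> {u \<in> cox_points n. bp u \<in> chart \<tau> \<inter> chart \<sigma>}" for v
  proof -
    have v: "inU \<tau> v" "inU \<sigma> v" using that chart_bp by auto
    have nz: "nt c \<sigma> v i \<noteq> 0" using nzD[OF nt_nz[OF v(2)]] i by auto
    have "nt c \<tau> (rep \<sigma> (bp v)) i = nt c \<tau> v i / nt c \<sigma> v i"
      unfolding rep_bp[OF v(2)] nrm_def by (rule nt_act[OF v(1) nt_nz[OF v(2)] i])
    with PQ(3) PQ'(3) v nz show ?thesis by (auto simp: field_simps)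
  qed
  then show "\<exists>P Q. poly_fun n P \<and> poly_fun n Q \<and> Q u \<noteq> 0 \<and>
    (\<forall>v\<in>{u \<in> cox_points n. bp u \<in> chart \<tau> \<inter> chart \<sigma>}. Q v \<noteq> 0 \<longrightarrow> nt c \<tau> (rep \<sigma> (bp v)) i = P v / Q v)"
    using u by (intro exI[of _ "\<lambda>v. P v * Q' v"] exI[of _ "\<lambda>v. Q v * P' v"] conjI poly_fun.mult PQ PQ') auto
qed

section \<open>Local equations and the line bundle of a boundary divisor\<close>

definition wsec :: "nat \<Rightarrow> coords set \<Rightarrow> coords set \<Rightarrow> complex" where
  "wsec i p y = snd (rep (tc p) y i)"

text \<open>\<open>w_i\<close> is an equation of \<open>D_i\<close> without multiplicity. The point
  is to show that a numerator vanishing on \<open>D_i\<close> only near \<open>p\<close> vanishes on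
  the whole hyperplane \<open>w_i = 0\<close> of the slice and is therefore divisible by
  \<open>w_i\<close>.\<close>

lemma vanishing_ideal_eq:
  assumes i: "i \<in> {1..n}" and p: "p \<in> pts X"
  shows "vanishing_ideal X (bott_divisor c n i) p = principal_ideal X p (wsec i p)"
proof
  let ?\<tau> = "tc p" and ?D = "bott_divisor c n i"
  have pc: "p \<in> chart ?\<tau>" by (rule tc_chart[OF p])
  have w: "poly_fun n (\<lambda>u. snd (u i))" using i by (rule poly_fun.w_coord)
  show "principal_ideal X p (wsec i p) \<subseteq> vanishing_ideal X ?D p"
  proof
    fix f assume "f \<in> principal_ideal X p (wsec i p)"
    then obtain h where f: "f \<in> stalk X p" "germ_eq X p f (\<lambda>y. wsec i p y * h y)"
      unfolding principal_ideal_def by blast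
    obtain R where R: "poly_fun n R" "R (rep ?\<tau> p) \<noteq> 0" "\<forall>y\<in>dist_open ?\<tau> R. f y = wsec i p y * h y"
      using f(2) unfolding germ_X_iff[OF pc] by (elim exE conjE)
    have "f y = 0" if "y \<in> dist_open ?\<tau> R \<inter> ?D" for y
    proof -
      have "y \<in> chart ?\<tau>" using that by (simp add: dist_open_def)
      then have "wsec i p y = 0" using divisor_iff[OF i] that by (simp add: wsec_def)
      then show ?thesis using R(3) that by simp
    qed
    then show "f \<in> vanishing_ideal X ?D p"
      unfolding vanishing_ideal_def using f(1) openin_dist_open[OF R(1), of ?\<tau>] pc R(2)
      by (auto simp: dist_open_def intro!: exI[of _ "dist_open ?\<tau> R"])
  qed
  show "vanishing_ideal X ?D p \<subseteq> principal_ideal X p (wsec i p)"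
  proof
    fix f assume f: "f \<in> vanishing_ideal X ?D p"
    then have fs: "f \<in> stalk X p" by (simp add: vanishing_ideal_def)
    from f obtain U where U: "openin (ftop X) U" "p \<in> U" "\<forall>y\<in>U \<inter> ?D. f y = 0"
      unfolding vanishing_ideal_def by blast
    from open_local[OF U(1,2) pc] obtain R where R: "poly_fun n R" "R (rep ?\<tau> p) \<noteq> 0" "dist_open ?\<tau> R \<subseteq> U" .
    from fs[unfolded stalk_X_iff[OF pc]] obtain P Q where PQ: "poly_fun n P" "poly_fun n Q" "Q (rep ?\<tau> p) \<noteq> 0"
      "\<forall>y\<in>dist_open ?\<tau> Q. f y = P (rep ?\<tau> y) / Q (rep ?\<tau> y)" by (elim exE conjE)
    have goal: "f \<in> principal_ideal X p (wsec i p)"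
      if "poly_fun n P1" "poly_fun n Q1" "Q1 (rep ?\<tau> p) \<noteq> 0"
        "\<And>u. u \<in> slice ?\<tau> \<Longrightarrow> Q u \<noteq> 0 \<Longrightarrow> Q1 u \<noteq> 0 \<Longrightarrow> P u / Q u = snd (u i) * (P1 u / Q1 u)" for P1 Q1
    proof -
      have "(\<lambda>y. P1 (rep ?\<tau> y) / Q1 (rep ?\<tau> y)) \<in> stalk X p"
        unfolding stalk_X_iff[OF pc] by (intro exI[of _ P1] exI[of _ Q1] conjI that ballI refl)
      moreover have "germ_eq X p f (\<lambda>y. wsec i p y * (P1 (rep ?\<tau> y) / Q1 (rep ?\<tau> y)))"
        unfolding germ_X_iff[OF pc]
      proof (intro exI[of _ "\<lambda>u. Q u * Q1 u"] conjI ballI poly_fun.mult that PQ)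
        show "Q (rep ?\<tau> p) * Q1 (rep ?\<tau> p) \<noteq> 0" using PQ(3) that(3) by simp
        fix y assume "y \<in> dist_open ?\<tau> (\<lambda>u. Q u * Q1 u)"
        then have y: "y \<in> dist_open ?\<tau> Q" "y \<in> chart ?\<tau>" "Q (rep ?\<tau> y) \<noteq> 0" "Q1 (rep ?\<tau> y) \<noteq> 0" by (auto simp: dist_open_def)
        show "f y = wsec i p y * (P1 (rep ?\<tau> y) / Q1 (rep ?\<tau> y))"
          using bspec[OF PQ(4) y(1)] that(4)[OF rep_slice[OF y(2)] y(3,4)] by (simp add: wsec_def)
      qed
      ultimately show ?thesis unfolding principal_ideal_def
        using fs by (intro CollectI conjI bexI[of _ "\<lambda>y. P1 (rep ?\<tau> y) / Q1 (rep ?\<tau> y)"])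
    qed
    show "f \<in> principal_ideal X p (wsec i p)"
    proof (cases "snd (rep ?\<tau> p i) = 0")
      case False
      show ?thesis
        by (rule goal[OF PQ(1) poly_fun.mult[OF PQ(2) w]]) (use False PQ(3) in auto)
    next
      case True
      have \<tau>i: "?\<tau> i"
      proof (rule ccontr)
        assume "\<not> ?\<tau> i"
        moreover have "cc ?\<tau> i (rep ?\<tau> p) = 1" using rep_slice[OF pc] i unfolding slice_def by blast
        ultimately show False using True by (simp add: cc_def)
      qed
      obtain P1 where P1: "poly_fun n P1" "\<forall>u. P u = P (u(i := (fst (u i), 0))) + snd (u i) * P1 u"
        using poly_fun_split_coord[OF i PQ(1)] by (elim exE conjE)
      \<comment> \<open>The line from the representative of \<open>p\<close> to a point of the
        hyperplane stays in the slice and in \<open>w_i = 0\<close>. A nonzero value of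
        \<open>P\<close> at its end would persist at points of the line close enough to
        \<open>p\<close> in the Zariski sense.\<close>
      have "P (u(i := (fst (u i), 0))) = 0" if u: "u \<in> slice ?\<tau>" for u
      proof (rule ccontr)
        let ?u = "u(i := (fst (u i), 0))"
        assume "P ?u \<noteq> 0"
        moreover have "Q (rep ?\<tau> p) * R (rep ?\<tau> p) \<noteq> 0" using PQ(3) R(2) by simp
        ultimately obtain s where s: "Q (line (rep ?\<tau> p) ?u s) * R (line (rep ?\<tau> p) ?u s) \<noteq> 0" "P (line (rep ?\<tau> p) ?u s) \<noteq> 0"
          using poly_fun_line_nonzero[OF poly_fun.mult[OF PQ(2) R(1)] PQ(1)] by blast
        let ?v = "line (rep ?\<tau> p) ?u s"
        have u': "?u \<in> slice ?\<tau>" using u \<tau>i by (auto simp: slice_def cc_def)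
        have v: "?v \<in> slice ?\<tau>"
        proof -
          have "cc ?\<tau> j ?v = cc ?\<tau> j (rep ?\<tau> p) + s * (cc ?\<tau> j ?u - cc ?\<tau> j (rep ?\<tau> p))" for j
            by (simp add: cc_def line_def)
          then show ?thesis using u' rep_slice[OF pc] by (auto simp: slice_def line_def)
        qed
        have "snd (?v i) = 0" using True by (simp add: line_def)
        then have D: "bp ?v \<in> ?D" using divisor_iff[OF i bp_slice_chart[OF v]] rep_of_slice[OF v] by simp
        have RQ: "bp ?v \<in> dist_open ?\<tau> R" "bp ?v \<in> dist_open ?\<tau> Q"
          using bp_slice_chart[OF v] rep_of_slice[OF v] s(1) by (auto simp: dist_open_def)
        have "f (bp ?v) = 0" using bspec[OF U(3)] D subsetD[OF R(3) RQ(1)] by blast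
        moreover have "f (bp ?v) = P ?v / Q ?v" using bspec[OF PQ(4) RQ(2)] unfolding rep_of_slice[OF v] .
        ultimately show False using s by simp
      qed
      then have "P u = snd (u i) * P1 u" if "u \<in> slice ?\<tau>" for u
        using spec[OF P1(2), of u] that by (simp only: add_0)
      then show ?thesis by (intro goal[OF P1(1) PQ(2,3)]) simp
    qed
  qed
qed

text \<open>The transition functions are the torus entries at \<open>i\<close> that carry one normal
  form to another; \<open>w_i\<close> scales by just this entry, and \<open>nt_act\<close> is the
  cocycle rule.\<close>

lemma ex_divisor_bundle:
  assumes i: "i \<in> {1..n}"
  shows "\<exists>L. is_divisor_bundle X (bott_divisor c n i) L"
proof -
  define L :: "coords set line_bundle_data" where
    "L = \<lparr>nbh = (\<lambda>p. chart (tc p)), trans_fun = (\<lambda>p q y. nt c (tc p) (rep (tc q) y) i)\<rparr>"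
  have nbh: "nbh L p = chart (tc p)" and tr: "trans_fun L p q y = nt c (tc p) (rep (tc q) y) i" for p q y
    by (simp_all add: L_def)
  have "line_bundle X L"
    unfolding line_bundle_def
  proof (intro conjI ballI)
    fix p assume p: "p \<in> pts X"
    show "openin (ftop X) (nbh L p)" unfolding nbh by (rule openin_chart)
    show "p \<in> nbh L p" unfolding nbh by (rule tc_chart[OF p])
    show "trans_fun L p p y = 1" if "y \<in> nbh L p" for y
      unfolding tr by (rule nt_slice[OF rep_slice i]) (use that nbh in simp)
    fix q assume q: "q \<in> pts X"
    show "trans_fun L p q \<in> reg X (nbh L p \<inter> nbh L q)"
      unfolding nbh using reg_transition[OF i, of "tc p" "tc q"] by (simp add: tr[abs_def])
    fix r y assume "r \<in> pts X" and y: "y \<in> nbh L p \<inter> nbh L q \<inter> nbh L r"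
    then have y: "y \<in> chart (tc p)" "y \<in> chart (tc q)" "y \<in> chart (tc r)" by (auto simp: nbh)
    note r = rep_nrm[OF y(3) y(2)] and r' = rep_nrm[OF y(3) y(1)]
    have nz: "nz (nt c (tc q) (rep (tc r) y))" by (rule nt_nz[OF r(1)])
    have "nt c (tc p) (rep (tc q) y) i = nt c (tc p) (rep (tc r) y) i / nt c (tc q) (rep (tc r) y) i"
      by (subst r(2)) (rule nt_act[OF r'(1) nz i])
    then show "trans_fun L p q y * trans_fun L q r y = trans_fun L p r y"
      unfolding tr using nz i by (simp add: nz_def)
  qed
  moreover have "wsec i p \<in> reg X (nbh L p)" for p
    unfolding nbh using reg_poly[OF poly_fun.w_coord[OF i] order_refl] by (simp add: wsec_def[abs_def])
  moreover have "wsec i p y = trans_fun L p q y * wsec i q y" if "y \<in> nbh L p \<inter> nbh L q" for p q y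
  proof -
    have y: "y \<in> chart (tc q)" "y \<in> chart (tc p)" using that by (auto simp: nbh)
    have "wsec i p y = snd (act (nt c (tc p) (rep (tc q) y)) (rep (tc q) y) i)"
      unfolding wsec_def using rep_nrm(2)[OF y] by simp
    then show ?thesis unfolding snd_act[OF i] tr wsec_def .
  qed
  ultimately have "is_divisor_bundle X (bott_divisor c n i) L"
    unfolding is_divisor_bundle_def using vanishing_ideal_eq[OF i] by (intro conjI exI[of _ "wsec i"]) auto
  then show ?thesis by (rule exI)
qed

lemma bott_irr_X: "bott_irr n c (pts X)"
  by unfold_locales (rule X_irreducible)

lemma w_not_vanishing:
  assumes i: "i \<in> {1..n}"
  shows "(\<lambda>u. snd (u i)) \<notin> vI \<tau> (pts X)"
proof -
  define u :: coords where "u = (\<lambda>j. if j \<in> {1..n} then (1, 1) else (0, 0))"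
  have u: "u \<in> slice \<tau>" by (auto simp: slice_def u_def cc_def)
  have "snd (u i) \<noteq> 0" using i by (simp add: u_def)
  moreover have "bp u \<in> pts X \<inter> chart \<tau>" using bp_slice_chart[OF u] chart_pts by blast
  ultimately show ?thesis using rep_of_slice[OF u] by (force simp: vI_def)
qed

text \<open>The complement of a boundary divisor is dense.\<close>

lemma eq_off_divisor:
  assumes i: "i \<in> {1..n}" and U: "openin (ftop X) U" and ab: "a \<in> reg X U" "b \<in> reg X U"
    and eq: "\<And>y. y \<in> U \<Longrightarrow> y \<notin> bott_divisor c n i \<Longrightarrow> a y = b y" and y: "y \<in> U"
  shows "a y = b y"
proof -
  interpret X: bott_irr n c "pts X" by (rule bott_irr_X)
  have yX: "y \<in> pts X" using U y openin_subset by blast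
  obtain \<tau> where \<tau>: "y \<in> chart \<tau>" using ex_chart[OF yX] .
  from reg_local[OF ab(1) y \<tau>] obtain P Q where PQ: "poly_fun n P" "poly_fun n Q" "Q (rep \<tau> y) \<noteq> 0"
    "\<forall>y\<in>U \<inter> chart \<tau>. Q (rep \<tau> y) \<noteq> 0 \<longrightarrow> a y = P (rep \<tau> y) / Q (rep \<tau> y)" .
  from reg_local[OF ab(2) y \<tau>] obtain P' Q' where PQ': "poly_fun n P'" "poly_fun n Q'" "Q' (rep \<tau> y) \<noteq> 0"
    "\<forall>y\<in>U \<inter> chart \<tau>. Q' (rep \<tau> y) \<noteq> 0 \<longrightarrow> b y = P' (rep \<tau> y) / Q' (rep \<tau> y)" .
  from open_local[OF U y \<tau>] obtain R where R: "poly_fun n R" "R (rep \<tau> y) \<noteq> 0" "dist_open \<tau> R \<subseteq> U" .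
  let ?w = "\<lambda>u::coords. snd (u i)" and ?d = "\<lambda>u. P u * Q' u - P' u * Q u" and ?R = "\<lambda>u. R u * (Q u * Q' u)"
  have d: "poly_fun n ?d" by (intro poly_fun_diff poly_fun.mult PQ PQ')
  have w: "poly_fun n ?w" using i by (rule poly_fun.w_coord)
  have R': "poly_fun n ?R" by (intro poly_fun.mult PQ PQ' R)
  have "(\<lambda>u. ?w u * ?d u) \<in> vI \<tau> (pts X)"
  proof (rule X.vI_local[OF poly_fun.mult[OF w d] R' yX \<tau>])
    show "?R (rep \<tau> y) \<noteq> 0" using R(2) PQ(3) PQ'(3) by simp
    fix z assume z: "z \<in> dist_open \<tau> ?R \<inter> pts X"
    then have zc: "z \<in> chart \<tau>" "Q (rep \<tau> z) \<noteq> 0" "Q' (rep \<tau> z) \<noteq> 0" "z \<in> U"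
      using R(3) by (auto simp: dist_open_def)
    show "?w (rep \<tau> z) * ?d (rep \<tau> z) = 0"
    proof (cases "?w (rep \<tau> z) = 0")
      case False
      then have "a z = b z" using eq[OF zc(4)] divisor_iff[OF i zc(1)] by simp
      moreover have "a z = P (rep \<tau> z) / Q (rep \<tau> z)" "b z = P' (rep \<tau> z) / Q' (rep \<tau> z)"
        using PQ(4) PQ'(4) zc by auto
      ultimately have "P (rep \<tau> z) / Q (rep \<tau> z) = P' (rep \<tau> z) / Q' (rep \<tau> z)" by simp
      then have "?d (rep \<tau> z) = 0" using zc by (simp add: field_simps)
      then show ?thesis by simp
    qed simp
  qed
  then have "?d \<in> vI \<tau> (pts X)" using X.vI_prime[OF w d] w_not_vanishing[OF i] by blast
  then have "?d (rep \<tau> y) = 0" using \<tau> yX by (auto simp: vI_def)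
  then have "P (rep \<tau> y) / Q (rep \<tau> y) = P' (rep \<tau> y) / Q' (rep \<tau> y)" using PQ(3) PQ'(3) by (simp add: field_simps)
  moreover have "a y = P (rep \<tau> y) / Q (rep \<tau> y)" "b y = P' (rep \<tau> y) / Q' (rep \<tau> y)"
    using PQ PQ' y \<tau> by auto
  ultimately show ?thesis by simp
qed

text \<open>Two generators of one principal ideal differ by a unit, as \<open>w_i\<close> can be
  cancelled on the irreducible \<open>X\<close>. The unit is spread out to a neighbourhood, so that
  an arbitrary bundle of \<open>D_i\<close> can be compared with the explicit sections
  \<open>wsec\<close>.\<close>

lemma divisor_section_unit:
  assumes i: "i \<in> {1..n}" and p: "p \<in> pts X"
    and N: "openin (ftop X) N" "p \<in> N"
    and s0: "vanishing_ideal X (bott_divisor c n i) p = principal_ideal X p s0" "s0 \<in> stalk X p"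
  shows "\<exists>U h. openin (ftop X) U \<and> p \<in> U \<and> U \<subseteq> chart (tc p) \<inter> N \<and> h \<in> reg X U \<and>
    (\<forall>y\<in>U. h y \<noteq> 0) \<and> (\<forall>y\<in>U. s0 y = wsec i p y * h y)"
proof -
  let ?\<tau> = "tc p"
  interpret X: bott_irr n c "pts X" by (rule bott_irr_X)
  have pc: "p \<in> chart ?\<tau>" by (rule tc_chart[OF p])
  have w: "poly_fun n (\<lambda>u. snd (u i))" using i by (rule poly_fun.w_coord)
  have eqI: "principal_ideal X p s0 = principal_ideal X p (wsec i p)"
    using s0(1) vanishing_ideal_eq[OF i p] by simp
  have one: "(\<lambda>_. 1) \<in> stalk X p"
    unfolding stalk_X_iff[OF pc] by (intro exI[of _ "\<lambda>_. 1"]) (auto intro: poly_fun.const)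
  have refl: "germ_eq X p f f" for f
    unfolding germ_X_iff[OF pc] by (intro exI[of _ "\<lambda>_. 1"]) (auto intro: poly_fun.const)
  have "wsec i p \<in> stalk X p"
    unfolding stalk_X_iff[OF pc] using w
    by (intro exI[of _ "\<lambda>u. snd (u i)"] exI[of _ "\<lambda>_. 1"]) (auto simp: wsec_def intro: poly_fun.const)
  then have "wsec i p \<in> principal_ideal X p (wsec i p)"
    unfolding principal_ideal_def using one refl[of "wsec i p"] by (auto intro!: bexI[of _ "\<lambda>_. 1"])
  then have "wsec i p \<in> principal_ideal X p s0" using eqI by simp
  then obtain h' where h': "h' \<in> stalk X p" "germ_eq X p (wsec i p) (\<lambda>y. s0 y * h' y)"
    unfolding principal_ideal_def by blast
  have "s0 \<in> principal_ideal X p s0"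
    unfolding principal_ideal_def using one s0(2) refl[of s0] by (auto intro!: bexI[of _ "\<lambda>_. 1"])
  then have "s0 \<in> principal_ideal X p (wsec i p)" using eqI by simp
  then obtain h where h: "h \<in> stalk X p" "germ_eq X p s0 (\<lambda>y. wsec i p y * h y)"
    unfolding principal_ideal_def by blast
  from h(1)[unfolded stalk_X_iff[OF pc]] obtain P Q where PQ: "poly_fun n P" "poly_fun n Q" "Q (rep ?\<tau> p) \<noteq> 0"
    "\<forall>y\<in>dist_open ?\<tau> Q. h y = P (rep ?\<tau> y) / Q (rep ?\<tau> y)" by (elim exE conjE)
  from h'(1)[unfolded stalk_X_iff[OF pc]] obtain P' Q' where PQ': "poly_fun n P'" "poly_fun n Q'" "Q' (rep ?\<tau> p) \<noteq> 0"
    "\<forall>y\<in>dist_open ?\<tau> Q'. h' y = P' (rep ?\<tau> y) / Q' (rep ?\<tau> y)" by (elim exE conjE)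
  from h(2)[unfolded germ_X_iff[OF pc]] obtain R where R: "poly_fun n R" "R (rep ?\<tau> p) \<noteq> 0"
    "\<forall>y\<in>dist_open ?\<tau> R. s0 y = wsec i p y * h y" by (elim exE conjE)
  from h'(2)[unfolded germ_X_iff[OF pc]] obtain R' where R': "poly_fun n R'" "R' (rep ?\<tau> p) \<noteq> 0"
    "\<forall>y\<in>dist_open ?\<tau> R'. wsec i p y = s0 y * h' y" by (elim exE conjE)
  let ?w = "\<lambda>u::coords. snd (u i)" and ?d = "\<lambda>u. Q u * Q' u - P u * P' u" and ?E = "\<lambda>u. (R u * R' u) * (Q u * Q' u)"
  have d: "poly_fun n ?d" by (intro poly_fun_diff poly_fun.mult PQ PQ')
  have E: "poly_fun n ?E" by (intro poly_fun.mult PQ PQ' R R')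
  \<comment> \<open>From \<open>s0 = w * h\<close> and \<open>w = s0 * h'\<close> one has
    \<open>w * (1 - h * h') = 0\<close>; \<open>?d\<close> is \<open>1 - h * h'\<close> with
    denominators cleared.\<close>
  have "(\<lambda>u. ?w u * ?d u) \<in> vI ?\<tau> (pts X)"
  proof (rule X.vI_local[OF poly_fun.mult[OF w d] E p pc])
    show "?E (rep ?\<tau> p) \<noteq> 0" using R(2) R'(2) PQ(3) PQ'(3) by simp
    fix z assume "z \<in> dist_open ?\<tau> ?E \<inter> pts X"
    then have z: "z \<in> dist_open ?\<tau> R" "z \<in> dist_open ?\<tau> R'" "z \<in> dist_open ?\<tau> Q" "z \<in> dist_open ?\<tau> Q'"
      "Q (rep ?\<tau> z) \<noteq> 0" "Q' (rep ?\<tau> z) \<noteq> 0" by (auto simp: dist_open_def)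
    have "wsec i p z = wsec i p z * h z * h' z" using bspec[OF R(3) z(1)] bspec[OF R'(3) z(2)] by simp
    then have "wsec i p z * (Q (rep ?\<tau> z) * Q' (rep ?\<tau> z)) = wsec i p z * (P (rep ?\<tau> z) * P' (rep ?\<tau> z))"
      unfolding bspec[OF PQ(4) z(3)] bspec[OF PQ'(4) z(4)] using z(5,6) by (simp add: field_simps)
    then show "?w (rep ?\<tau> z) * ?d (rep ?\<tau> z) = 0" by (simp add: wsec_def algebra_simps)
  qed
  then have "?d \<in> vI ?\<tau> (pts X)" using X.vI_prime[OF w d] w_not_vanishing[OF i] by blast
  then have "Q (rep ?\<tau> p) * Q' (rep ?\<tau> p) = P (rep ?\<tau> p) * P' (rep ?\<tau> p)" using pc p by (auto simp: vI_def)
  then have Pp: "P (rep ?\<tau> p) \<noteq> 0" using PQ(3) PQ'(3) by auto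
  define U where "U = dist_open ?\<tau> (\<lambda>u. (P u * Q u) * R u) \<inter> N"
  have "openin (ftop X) U" unfolding U_def using N(1) by (intro openin_Int openin_dist_open poly_fun.mult PQ R)
  moreover have "p \<in> U" using pc Pp PQ(3) R(2) N(2) by (simp add: U_def dist_open_def)
  moreover have "U \<subseteq> chart ?\<tau> \<inter> N" by (auto simp: U_def dist_open_def)
  moreover have "(\<lambda>y. P (rep ?\<tau> y) / Q (rep ?\<tau> y)) \<in> reg X U"
    by (rule reg_frac[OF PQ(1,2)]) (auto simp: U_def dist_open_def)
  moreover have "\<forall>y\<in>U. P (rep ?\<tau> y) / Q (rep ?\<tau> y) \<noteq> 0" by (auto simp: U_def dist_open_def)
  moreover have "\<forall>y\<in>U. s0 y = wsec i p y * (P (rep ?\<tau> y) / Q (rep ?\<tau> y))"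
  proof
    fix y assume "y \<in> U"
    then have "y \<in> dist_open ?\<tau> R" "y \<in> dist_open ?\<tau> Q" by (auto simp: U_def dist_open_def)
    with R(3) PQ(4) show "s0 y = wsec i p y * (P (rep ?\<tau> y) / Q (rep ?\<tau> y))" by simp
  qed
  ultimately show ?thesis
    by (intro exI[of _ U] exI[of _ "\<lambda>y. P (rep ?\<tau> y) / Q (rep ?\<tau> y)"] conjI)
qed

end

section \<open>Intersection numbers with the boundary divisors\<close>

context bott_irr
begin

lemma irr_openY:
  assumes "openin (ftop Y) A" "openin (ftop Y) B" "A \<noteq> {}" "B \<noteq> {}"
  shows "A \<inter> B \<noteq> {}"
proof -
  obtain S T where "openin (ftop X) S" "A = S \<inter> Z" "openin (ftop X) T" "B = T \<inter> Z"
    using assms(1,2) unfolding openin_sub by blast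
  with irr_open[of S T] assms(3,4) show ?thesis by blast
qed

text \<open>Identity theorem for germs on an irreducible set: agreement on any nonempty open part,
  even far from \<open>p\<close>, gives agreement near \<open>p\<close>.\<close>

lemma stalk_identity:
  assumes p: "p \<in> Z" and f: "f \<in> stalk Y p" and g: "g \<in> stalk Y p"
    and W: "openin (ftop Y) W" "W \<noteq> {}" "\<And>y. y \<in> W \<Longrightarrow> f y = g y"
  shows "germ_eq Y p f g"
proof -
  obtain \<tau> where \<tau>: "p \<in> chart \<tau>" using ex_chart p Z_pts by blast
  from f[unfolded stalk_sub_iff[OF \<tau> p]] obtain P Q where PQ: "poly_fun n P" "poly_fun n Q" "Q (rep \<tau> p) \<noteq> 0"
    "\<forall>y\<in>dist_open \<tau> Q \<inter> Z. f y = P (rep \<tau> y) / Q (rep \<tau> y)" by (elim exE conjE)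
  from g[unfolded stalk_sub_iff[OF \<tau> p]] obtain P' Q' where PQ': "poly_fun n P'" "poly_fun n Q'" "Q' (rep \<tau> p) \<noteq> 0"
    "\<forall>y\<in>dist_open \<tau> Q' \<inter> Z. g y = P' (rep \<tau> y) / Q' (rep \<tau> y)" by (elim exE conjE)
  obtain T where T: "openin (ftop X) T" "W = T \<inter> Z" using W(1) unfolding openin_sub by blast
  let ?Q = "\<lambda>u. Q u * Q' u" and ?d = "\<lambda>u. P u * Q' u - P' u * Q u"
  have Q: "poly_fun n ?Q" by (intro poly_fun.mult PQ PQ')
  have "p \<in> dist_open \<tau> ?Q \<inter> Z" using PQ(3) PQ'(3) \<tau> p by (simp add: dist_open_def)
  then have ne: "T \<inter> dist_open \<tau> ?Q \<inter> Z \<noteq> {}"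
    using irr_open[OF T(1) openin_dist_open[OF Q]] T(2) W(2) by blast
  then obtain w where w: "w \<in> T \<inter> dist_open \<tau> ?Q" "w \<in> Z" by blast
  have o: "openin (ftop X) (T \<inter> dist_open \<tau> ?Q)" using T(1) openin_dist_open[OF Q] by blast
  have wc: "w \<in> chart \<tau>" using w by (simp add: dist_open_def)
  from open_local[OF o w(1) wc] obtain R where R: "poly_fun n R" "R (rep \<tau> w) \<noteq> 0" "dist_open \<tau> R \<subseteq> T \<inter> dist_open \<tau> ?Q" .
  have d: "?d \<in> vI \<tau> Z"
  proof (rule vI_local[OF _ R(1) w(2) wc R(2)])
    show "poly_fun n ?d" by (intro poly_fun_diff poly_fun.mult PQ PQ')
    fix z assume z: "z \<in> dist_open \<tau> R \<inter> Z"
    then have zd: "z \<in> dist_open \<tau> Q \<inter> Z" "z \<in> dist_open \<tau> Q' \<inter> Z" using R(3) by (auto simp: dist_open_def)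
    have "f z = g z" using W(3)[of z] z R(3) T(2) by blast
    then have "P (rep \<tau> z) / Q (rep \<tau> z) = P' (rep \<tau> z) / Q' (rep \<tau> z)"
      using bspec[OF PQ(4) zd(1)] bspec[OF PQ'(4) zd(2)] by simp
    then show "?d (rep \<tau> z) = 0" using zd by (auto simp: dist_open_def field_simps)
  qed
  show ?thesis
    unfolding germ_sub_iff[OF \<tau> p]
  proof (intro exI[of _ ?Q] conjI ballI Q)
    show "Q (rep \<tau> p) * Q' (rep \<tau> p) \<noteq> 0" using PQ(3) PQ'(3) by simp
    fix y assume "y \<in> dist_open \<tau> ?Q \<inter> Z"
    then have y: "y \<in> dist_open \<tau> Q \<inter> Z" "y \<in> dist_open \<tau> Q' \<inter> Z" "Q (rep \<tau> y) \<noteq> 0" "Q' (rep \<tau> y) \<noteq> 0" "y \<in> Z \<inter> chart \<tau>"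
      by (auto simp: dist_open_def)
    have "?d (rep \<tau> y) = 0" using d y(5) by (auto simp: vI_def)
    then have "P (rep \<tau> y) / Q (rep \<tau> y) = P' (rep \<tau> y) / Q' (rep \<tau> y)" using y(3,4) by (simp add: field_simps)
    then show "f y = g y" using bspec[OF PQ(4) y(1)] bspec[OF PQ'(4) y(2)] by simp
  qed
qed

lemma reg_of_X:
  assumes "openin (ftop X) T" "f \<in> reg X T"
  shows "f \<in> reg Y (T \<inter> Z)"
  unfolding reg_sub using assms by blast

lemma openin_of_X: "openin (ftop X) T \<Longrightarrow> openin (ftop Y) (T \<inter> Z)"
  unfolding openin_sub by blast

lemma stalk_of_X: "openin (ftop X) T \<Longrightarrow> f \<in> reg X T \<Longrightarrow> p \<in> T \<Longrightarrow> p \<in> Z \<Longrightarrow> f \<in> stalk Y p"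
  by (rule reg_sub_stalk[OF openin_of_X reg_of_X]) auto

end

context bott_curve
begin

text \<open>Cross-multiplying two fractional representations and using additivity of lengths shows
  that the order does not depend on the fraction, so the \<open>THE\<close> in its definition is
  justified.\<close>

lemma order_at_eq:
  assumes p: "p \<in> C" and V: "openin (ftop Y) V" "V \<noteq> {}" and U: "openin (ftop Y) U" "p \<in> U"
    and ab: "a \<in> reg Y U" "b \<in> reg Y U" "\<not> germ_eq Y p a (\<lambda>_. 0)" "\<not> germ_eq Y p b (\<lambda>_. 0)"
    and eq: "\<forall>y\<in>U \<inter> V. b y * h y = a y"
  shows "order_at Y p V h = int (colength Y p (principal_ideal Y p a)) - int (colength Y p (principal_ideal Y p b))"
  unfolding order_at_def
proof (rule the_equality)
  interpret P: local_curve Y p "C \<inter> chart (tc p)" "A (tc p)" by (rule local_curve_p[OF p])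
  let ?l = "\<lambda>a. colength Y p (principal_ideal Y p a)"
  show "\<exists>U a' b'. openin (ftop Y) U \<and> p \<in> U \<and> a' \<in> reg Y U \<and> b' \<in> reg Y U \<and>
     \<not> germ_eq Y p a' (\<lambda>_. 0) \<and> \<not> germ_eq Y p b' (\<lambda>_. 0) \<and> (\<forall>y\<in>U \<inter> V. b' y * h y = a' y) \<and>
     int (?l a) - int (?l b) = int (?l a') - int (?l b')"
    by (intro exI[of _ U] exI[of _ a] exI[of _ b] conjI U ab eq refl)
  fix d assume "\<exists>U a b. openin (ftop Y) U \<and> p \<in> U \<and> a \<in> reg Y U \<and> b \<in> reg Y U \<and>
     \<not> germ_eq Y p a (\<lambda>_. 0) \<and> \<not> germ_eq Y p b (\<lambda>_. 0) \<and> (\<forall>y\<in>U \<inter> V. b y * h y = a y) \<and>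
     d = int (?l a) - int (?l b)"
  then obtain U' a' b' where *: "openin (ftop Y) U'" "p \<in> U'" "a' \<in> reg Y U'" "b' \<in> reg Y U'"
     "\<not> germ_eq Y p a' (\<lambda>_. 0)" "\<not> germ_eq Y p b' (\<lambda>_. 0)" "\<forall>y\<in>U' \<inter> V. b' y * h y = a' y"
     and d: "d = int (?l a') - int (?l b')" by (elim exE conjE)
  have st: "a \<in> stalk Y p" "b \<in> stalk Y p" "a' \<in> stalk Y p" "b' \<in> stalk Y p"
    using reg_sub_stalk U ab * by blast+
  have o: "openin (ftop Y) (U \<inter> U')" using U(1) *(1) by blast
  then have "(U \<inter> U') \<inter> V \<noteq> {}" using irr_openY[OF o V(1)] U(2) *(2) V(2) by blast
  moreover have "openin (ftop Y) ((U \<inter> U') \<inter> V)" using o V(1) by blast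
  moreover have "a y * b' y = a' y * b y" if "y \<in> (U \<inter> U') \<inter> V" for y
  proof -
    have "b y * h y = a y" "b' y * h y = a' y" using eq *(7) that by auto
    then show ?thesis by (metis mult.assoc mult.commute)
  qed
  ultimately have "germ_eq Y p (\<lambda>y. a y * b' y) (\<lambda>y. a' y * b y)"
    by (intro stalk_identity[OF p P.O_mult[OF st(1,4)] P.O_mult[OF st(3,2)]]) auto
  then have "?l (\<lambda>y. a y * b' y) = ?l (\<lambda>y. a' y * b y)" by (rule P.len_cong)
  then have "?l a + ?l b' = ?l a' + ?l b"
    using P.len_mult[OF st(1) ab(3) st(4) *(6)] P.len_mult[OF st(3) *(5) st(2) ab(4)] by simp
  then show "d = int (?l a) - int (?l b)" using d by linarith
qed

text \<open>The bundle is known only up to the choice in \<open>divisor_bundle\<close>, and the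
  section is arbitrary. Up to units the section is a quotient of forms \<open>f / g\<close> whose
  weights differ by that of \<open>w_i\<close>, and \<open>N_weight\<close> evaluates the difference
  of their zero counts.\<close>

theorem degree_rational_section:
  assumes i: "i \<in> {1..n}" and L: "is_divisor_bundle X (bott_divisor c n i) L"
    and s: "rational_section Y (restrict_bundle L C) W s" and f0: "f0 \<in> S (ew i)" "\<not> zeroC f0"
  shows "(\<Sum>p | p \<in> pts Y \<and> order_at Y p (W \<inter> nbh (restrict_bundle L C) p) (s p) \<noteq> 0.
    order_at Y p (W \<inter> nbh (restrict_bundle L C) p) (s p)) = int (N f0)"
proof -
  let ?tr = "trans_fun L"
  have nb: "nbh (restrict_bundle L C) p = nbh L p \<inter> C" and tr: "trans_fun (restrict_bundle L C) = ?tr" for p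
    by (simp_all add: restrict_bundle_def)
  have ptsY: "pts Y = C" using pts_sub Z_pts by blast
  from L have lb: "line_bundle X L" by (simp add: is_divisor_bundle_def)
  from L obtain s0 where s0: "\<forall>p\<in>pts X. s0 p \<in> reg X (nbh L p)"
    "\<forall>p\<in>pts X. \<forall>q\<in>pts X. \<forall>y\<in>nbh L p \<inter> nbh L q. s0 p y = ?tr p q y * s0 q y"
    "\<forall>p\<in>pts X. vanishing_ideal X (bott_divisor c n i) p = principal_ideal X p (s0 p)"
    unfolding is_divisor_bundle_def by (elim conjE exE)
  have nbh: "openin (ftop X) (nbh L p)" "p \<in> nbh L p" if "p \<in> pts X" for p
    using lb that by (auto simp: line_bundle_def)
  have trreg: "?tr p q \<in> reg X (nbh L p \<inter> nbh L q)" if "p \<in> pts X" "q \<in> pts X" for p q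
    using lb that by (auto simp: line_bundle_def)
  have trpp: "?tr p p y = 1" if "p \<in> pts X" "y \<in> nbh L p" for p y
    using lb that by (auto simp: line_bundle_def)
  have trc: "?tr p q y * ?tr q r y = ?tr p r y" if "p \<in> pts X" "q \<in> pts X" "r \<in> pts X" "y \<in> nbh L p \<inter> nbh L q \<inter> nbh L r" for p q r y
    using lb that unfolding line_bundle_def by blast
  note rs = s[unfolded rational_section_def nb tr ptsY]
  note W = rs[THEN conjunct1] rs[THEN conjunct2, THEN conjunct1] rs[THEN conjunct2, THEN conjunct2, THEN conjunct1]
    rs[THEN conjunct2, THEN conjunct2, THEN conjunct2, THEN conjunct1]
    rs[THEN conjunct2, THEN conjunct2, THEN conjunct2, THEN conjunct2]
  have WC: "W \<subseteq> C" using W(1) unfolding openin_sub by blast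
  have CX: "p \<in> pts X" if "p \<in> C" for p using that Z_pts by blast
  have unit: "\<forall>p\<in>C. \<exists>U h. openin (ftop X) U \<and> p \<in> U \<and> U \<subseteq> chart (tc p) \<inter> nbh L p \<and> h \<in> reg X U \<and>
    (\<forall>y\<in>U. h y \<noteq> 0) \<and> (\<forall>y\<in>U. s0 p y = wsec i p y * h y)"
  proof
    fix p assume "p \<in> C"
    then have p: "p \<in> pts X" by (rule CX)
    have "s0 p \<in> stalk X p" unfolding stalk_def using nbh[OF p] s0(1) p by blast
    then show "\<exists>U h. openin (ftop X) U \<and> p \<in> U \<and> U \<subseteq> chart (tc p) \<inter> nbh L p \<and> h \<in> reg X U \<and>
      (\<forall>y\<in>U. h y \<noteq> 0) \<and> (\<forall>y\<in>U. s0 p y = wsec i p y * h y)"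
      using divisor_section_unit[OF i p nbh[OF p] bspec[OF s0(3) p]] by simp
  qed
  obtain U hh where hh: "\<forall>p\<in>C. openin (ftop X) (U p) \<and> p \<in> U p \<and> U p \<subseteq> chart (tc p) \<inter> nbh L p \<and> hh p \<in> reg X (U p) \<and>
    (\<forall>y\<in>U p. hh p y \<noteq> 0) \<and> (\<forall>y\<in>U p. s0 p y = wsec i p y * hh p y)"
    using unit unfolding bchoice_iff by (elim exE)
  have U: "openin (ftop X) (U p)" "p \<in> U p" "U p \<subseteq> chart (tc p)" "U p \<subseteq> nbh L p" "hh p \<in> reg X (U p)"
    "\<And>y. y \<in> U p \<Longrightarrow> hh p y \<noteq> 0" "\<And>y. y \<in> U p \<Longrightarrow> s0 p y = wsec i p y * hh p y" if "p \<in> C" for p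
    using bspec[OF hh that] by auto
  \<comment> \<open>The units \<open>hh\<close> translate the transition functions of
    \<open>L\<close> into the explicit ones. Off the divisor this follows by cancelling
    \<open>w_i\<close>, and regularity extends it across.\<close>
  have cocycle: "hh p y * nt c (tc p) (rep (tc q) y) i = ?tr p q y * hh q y"
    if p: "p \<in> C" and q: "q \<in> C" and y: "y \<in> U p \<inter> U q" for p q y
  proof (rule eq_off_divisor[OF i _ _ _ _ y])
    show "openin (ftop X) (U p \<inter> U q)" using U(1) p q by blast
    have r1: "(\<lambda>y. nt c (tc p) (rep (tc q) y) i) \<in> reg X (U p \<inter> U q)"
      by (rule reg_cong[OF reg_transition[OF i]]) (use U(3)[OF p] U(3)[OF q] in auto)
    have r2: "hh p \<in> reg X (U p \<inter> U q)" and r3: "hh q \<in> reg X (U p \<inter> U q)"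
      using reg_cong[OF U(5)[OF p]] reg_cong[OF U(5)[OF q]] by auto
    have r4: "?tr p q \<in> reg X (U p \<inter> U q)"
      by (rule reg_cong[OF trreg[OF CX[OF p] CX[OF q]]]) (use U(4)[OF p] U(4)[OF q] in auto)
    show "(\<lambda>y. hh p y * nt c (tc p) (rep (tc q) y) i) \<in> reg X (U p \<inter> U q)" by (rule reg_mult[OF r2 r1])
    show "(\<lambda>y. ?tr p q y * hh q y) \<in> reg X (U p \<inter> U q)" by (rule reg_mult[OF r4 r3])
    fix y assume y: "y \<in> U p \<inter> U q" "y \<notin> bott_divisor c n i"
    have yc: "y \<in> chart (tc q)" "y \<in> chart (tc p)" "y \<in> nbh L p" "y \<in> nbh L q"
      using y(1) U(3,4)[OF p] U(3,4)[OF q] by auto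
    have w: "wsec i q y \<noteq> 0" using divisor_iff[OF i yc(1)] y(2) by (simp add: wsec_def)
    have 1: "wsec i p y = nt c (tc p) (rep (tc q) y) i * wsec i q y"
      unfolding wsec_def using rep_nrm(2)[OF yc(1,2)] snd_act[OF i] by simp
    have "s0 p y = ?tr p q y * s0 q y" using s0(2) CX[OF p] CX[OF q] yc by blast
    moreover have "s0 p y = wsec i p y * hh p y" using U(7)[OF p, of y] y(1) by simp
    moreover have "s0 q y = wsec i q y * hh q y" using U(7)[OF q, of y] y(1) by simp
    ultimately have "wsec i p y * hh p y = ?tr p q y * (wsec i q y * hh q y)" by simp
    then have "(nt c (tc p) (rep (tc q) y) i * wsec i q y) * hh p y = ?tr p q y * (wsec i q y * hh q y)" unfolding 1 .
    then have "wsec i q y * (hh p y * nt c (tc p) (rep (tc q) y) i) = wsec i q y * (?tr p q y * hh q y)"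
      by (simp add: mult_ac)
    with w show "hh p y * nt c (tc p) (rep (tc q) y) i = ?tr p q y * hh q y" by simp
  qed
  obtain p1 q where p1: "p1 \<in> C" "q \<in> W" "q \<in> nbh L p1" "s p1 q \<noteq> 0" using W(5) by auto
  have q: "q \<in> C" using p1 WC by blast
  have qn: "q \<in> nbh L q" by (rule nbh(2)[OF CX[OF q]])
  have "?tr q p1 q * ?tr p1 q q = ?tr q q q"
    by (rule trc) (use CX q p1 qn in auto)
  then have "?tr q p1 q \<noteq> 0" using trpp[OF CX[OF q] qn] by auto
  moreover have "s q q = ?tr q p1 q * s p1 q" using W(4) q p1 qn by blast
  \<comment> \<open>The nonzero value was found in the trivialisation at some \<open>p1\<close>; it
    is moved to the one at the point \<open>q\<close> itself.\<close>
  ultimately have sqq: "s q q \<noteq> 0" using p1(4) by simp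
  interpret Q: local_curve Y q "C \<inter> chart (tc q)" "A (tc q)" by (rule local_curve_p[OF q])
  have oW: "openin (ftop Y) (W \<inter> (nbh L p \<inter> C))" if "p \<in> C" for p
    using W(1) openin_of_X[OF nbh(1)[OF CX[OF that]]] by blast
  have sq: "s q \<in> stalk Y q" by (rule reg_sub_stalk[OF oW[OF q]]) (use W(3) q p1 qn in auto)
  have hq: "hh q \<in> stalk Y q" by (rule stalk_of_X[OF U(1,5,2)[OF q] q])
  from Q.O_unit[OF hq U(6)[OF q U(2)[OF q]]] obtain v where v: "v \<in> stalk Y q" "germ_eq Y q (\<lambda>y. hh q y * v y) (\<lambda>_. 1)" .
  have qc: "q \<in> chart (tc q)" by (rule tc_C[OF q])
  from Q.O_mult[OF sq v(1), unfolded stalk_sub_iff[OF qc q]] obtain P R where PR: "poly_fun n P" "poly_fun n R" "R (rep (tc q) q) \<noteq> 0"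
    "\<forall>y\<in>dist_open (tc q) R \<inter> C. s q y * v y = P (rep (tc q) y) / R (rep (tc q) y)" by (elim exE conjE)
  from homogenise[OF PR(1), of "tc q"] obtain D1 where
    D1: "\<forall>\<beta>. (\<forall>i\<in>{1..n}. int D1 \<le> \<beta> i) \<longrightarrow> (\<exists>s\<in>S \<beta>. \<forall>u\<in>slice (tc q). s u = P u)" by (elim exE)
  from homogenise[OF PR(2), of "tc q"] obtain D2 where
    D2: "\<forall>\<beta>. (\<forall>i\<in>{1..n}. int D2 \<le> \<beta> i) \<longrightarrow> (\<exists>s\<in>S \<beta>. \<forall>u\<in>slice (tc q). s u = R u)" by (elim exE)
  \<comment> \<open>Large enough for both homogenisations, numerator and denominator having weights
    that differ by \<open>ew i\<close>.\<close>
  define \<beta> :: "nat \<Rightarrow> int" where "\<beta> = (\<lambda>_. int (D1 + D2))"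
  have "\<forall>j\<in>{1..n}. int D2 \<le> \<beta> j" by (simp add: \<beta>_def)
  with D2 have "\<exists>s\<in>S \<beta>. \<forall>u\<in>slice (tc q). s u = R u" by (elim allE[of _ \<beta>] impE)
  then obtain g where g: "g \<in> S \<beta>" "\<forall>u\<in>slice (tc q). g u = R u" by (elim bexE)
  have "\<forall>j\<in>{1..n}. int D1 \<le> \<beta> j + ew i j" by (auto simp: \<beta>_def ew_def)
  with D1 have "\<exists>s\<in>S (\<lambda>j. \<beta> j + ew i j). \<forall>u\<in>slice (tc q). s u = P u" by (elim allE[of _ "\<lambda>j. \<beta> j + ew i j"] impE)
  then obtain f where f: "f \<in> S (\<lambda>j. \<beta> j + ew i j)" "\<forall>u\<in>slice (tc q). f u = P u" by (elim bexE)
  obtain B where B: "poly_fun n B" "B (rep (tc q) q) \<noteq> 0" "\<forall>y\<in>dist_open (tc q) B \<inter> C. hh q y * v y = 1"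
    using v(2) unfolding germ_sub_iff[OF qc q] by (elim exE conjE)
  define V0 where "V0 = (dist_open (tc q) (\<lambda>u. B u * R u) \<inter> U q \<inter> C) \<inter> W"
  have "openin (ftop X) (dist_open (tc q) (\<lambda>u. B u * R u) \<inter> U q)"
    using U(1)[OF q] openin_dist_open[OF poly_fun.mult[OF B(1) PR(2)]] by blast
  then have V0o: "openin (ftop Y) V0" unfolding V0_def using openin_of_X W(1) by blast
  have qV0: "q \<in> V0" using q qc B(2) PR(3) U(2)[OF q] p1(2) by (simp add: V0_def dist_open_def)
  have V0eq: "g (rep (tc q) y) * s q y = hh q y * f (rep (tc q) y)" if y: "y \<in> V0" for y
  proof -
    have y': "y \<in> dist_open (tc q) B \<inter> C" "y \<in> dist_open (tc q) R \<inter> C" "y \<in> chart (tc q)" "R (rep (tc q) y) \<noteq> 0"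
      using y by (auto simp: V0_def dist_open_def)
    have 1: "hh q y * v y = 1" by (rule bspec[OF B(3) y'(1)])
    have 2: "s q y * v y = P (rep (tc q) y) / R (rep (tc q) y)" by (rule bspec[OF PR(4) y'(2)])
    have 3: "g (rep (tc q) y) = R (rep (tc q) y)" "f (rep (tc q) y) = P (rep (tc q) y)"
      using g(2) f(2) rep_slice[OF y'(3)] by auto
    have "P (rep (tc q) y) = R (rep (tc q) y) * (s q y * v y)" using 2 y'(4) by simp
    then have "hh q y * P (rep (tc q) y) = R (rep (tc q) y) * s q y * (hh q y * v y)" by (simp add: mult_ac)
    then show ?thesis using 1 3 by simp
  qed
  have gz: "\<not> zeroC g"
    using g(2) rep_slice[OF qc] PR(3) rep_mem[OF qc] q by (force simp: zeroC_def)
  have "f (rep (tc q) q) \<noteq> 0"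
  proof
    assume "f (rep (tc q) q) = 0"
    then have "g (rep (tc q) q) * s q q = 0" using V0eq[OF qV0] by simp
    then show False using g(2) rep_slice[OF qc] PR(3) sqq by simp
  qed
  then have fz: "\<not> zeroC f" using rep_mem[OF qc] q by (force simp: zeroC_def)
  \<comment> \<open>The relation, so far known near \<open>q\<close>, is transported to any
    trivialisation by the cocycle and then to all points by the identity theorem.\<close>
  have glob: "g (rep (tc p) y) * s p y = hh p y * f (rep (tc p) y)"
    if p: "p \<in> C" and y: "y \<in> U p" "y \<in> W" for p y
  proof -
    have yC: "y \<in> C" using y WC by blast
    interpret Py: local_curve Y y "C \<inter> chart (tc y)" "A (tc y)" by (rule local_curve_p[OF yC])
    have st: "s p \<in> stalk Y y" by (rule reg_sub_stalk[OF oW[OF p]]) (use W(3) p y yC U(4)[OF p] in auto)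
    have ht: "hh p \<in> stalk Y y" by (rule stalk_of_X[OF U(1,5)[OF p] y(1) yC])
    have ft: "(\<lambda>y. f (rep (tc p) y)) \<in> stalk Y y" "(\<lambda>y. g (rep (tc p) y)) \<in> stalk Y y"
      using stalk_of_X[OF openin_chart reg_poly[OF S_poly[OF f(1)] order_refl] _ yC]
        stalk_of_X[OF openin_chart reg_poly[OF S_poly[OF g(1)] order_refl] _ yC] y(1) U(3)[OF p] by auto
    have o: "openin (ftop Y) (U p \<inter> C)" by (rule openin_of_X[OF U(1)[OF p]])
    have "V0 \<inter> (U p \<inter> C) \<noteq> {}" by (rule irr_openY[OF V0o o]) (use qV0 y yC in auto)
    moreover have "openin (ftop Y) (V0 \<inter> (U p \<inter> C))" using V0o o by blast
    moreover have "g (rep (tc p) z) * s p z = hh p z * f (rep (tc p) z)" if z: "z \<in> V0 \<inter> (U p \<inter> C)" for z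
    proof -
      have zU: "z \<in> U p \<inter> U q" "z \<in> W" "z \<in> C" using z by (auto simp: V0_def)
      have zc: "z \<in> chart (tc q)" "z \<in> chart (tc p)" using zU U(3)[OF p] U(3)[OF q] by auto
      let ?t = "nt c (tc p) (rep (tc q) z)"
      note t = rep_nrm[OF zc]
      have nz: "nz ?t" by (rule nt_nz[OF t(1)])
      have sp: "s p z = ?tr p q z * s q z"
        using W(4) p q zU U(4)[OF p] U(4)[OF q] by blast
      have gz: "g (rep (tc p) z) = chi \<beta> ?t * g (rep (tc q) z)"
        by (subst t(2)) (rule S_act[OF g(1) nz])
      have fz: "f (rep (tc p) z) = chi \<beta> ?t * ?t i * f (rep (tc q) z)"
        by (subst t(2)) (simp add: S_act[OF f(1) nz] chi_add[OF nz] chi_ew[OF i])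
      have "g (rep (tc p) z) * s p z = chi \<beta> ?t * ?tr p q z * (g (rep (tc q) z) * s q z)"
        unfolding gz sp by (simp add: mult_ac)
      also have "\<dots> = chi \<beta> ?t * (?tr p q z * hh q z) * f (rep (tc q) z)"
        using V0eq[of z] z by (simp add: mult_ac)
      also have "?tr p q z * hh q z = hh p z * ?t i" using cocycle[OF p q zU(1)] by simp
      finally show ?thesis unfolding fz by (simp add: mult_ac)
    qed
    ultimately have "germ_eq Y y (\<lambda>y. g (rep (tc p) y) * s p y) (\<lambda>y. hh p y * f (rep (tc p) y))"
      by (intro stalk_identity[OF yC Py.O_mult[OF ft(2) st] Py.O_mult[OF ht ft(1)]])
    from Py.germ_at[OF this] show ?thesis .
  qed
  have ord: "order_at Y p (W \<inter> (nbh L p \<inter> C)) (s p) = int (ordp p f) - int (ordp p g)" if p: "p \<in> C" for p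
  proof -
    interpret P: local_curve Y p "C \<inter> chart (tc p)" "A (tc p)" by (rule local_curve_p[OF p])
    have hp: "hh p \<in> stalk Y p" by (rule stalk_of_X[OF U(1,5,2)[OF p] p])
    have hp0: "\<not> germ_eq Y p (hh p) (\<lambda>_. 0)" using P.germ_at[of "hh p" "\<lambda>_. 0"] U(6)[OF p U(2)[OF p]] by auto
    have lf: "loc p f \<in> stalk Y p" "\<not> germ_eq Y p (loc p f) (\<lambda>_. 0)"
      using loc_stalk[OF p S_poly[OF f(1)]] germ_loc[OF p f(1)] fz by auto
    have lg: "\<not> germ_eq Y p (loc p g) (\<lambda>_. 0)" using germ_loc[OF p g(1)] gz by auto
    have rf: "loc p f \<in> reg X (U p)" "loc p g \<in> reg X (U p)"
      unfolding loc_def using reg_poly[OF S_poly[OF f(1)] U(3)[OF p]] reg_poly[OF S_poly[OF g(1)] U(3)[OF p]] by auto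
    have ne: "W \<inter> (nbh L p \<inter> C) \<noteq> {}"
      using irr_openY[OF W(1) openin_of_X[OF nbh(1)[OF CX[OF p]]] W(2)] nbh(2)[OF CX[OF p]] p by blast
    have "order_at Y p (W \<inter> (nbh L p \<inter> C)) (s p) =
      int (colength Y p (principal_ideal Y p (\<lambda>y. hh p y * loc p f y))) - int (colength Y p (principal_ideal Y p (loc p g)))"
    proof (rule order_at_eq[OF p oW[OF p] ne openin_of_X[OF U(1)[OF p]]])
      show "p \<in> U p \<inter> C" using U(2)[OF p] p by simp
      show "(\<lambda>y. hh p y * loc p f y) \<in> reg Y (U p \<inter> C)" by (rule reg_of_X[OF U(1)[OF p] reg_mult[OF U(5)[OF p] rf(1)]])
      show "loc p g \<in> reg Y (U p \<inter> C)" by (rule reg_of_X[OF U(1)[OF p] rf(2)])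
      show "\<not> germ_eq Y p (\<lambda>y. hh p y * loc p f y) (\<lambda>_. 0)" using P.O_domain[OF hp lf(1)] hp0 lf(2) by blast
      show "\<not> germ_eq Y p (loc p g) (\<lambda>_. 0)" by (rule lg)
      show "\<forall>y\<in>U p \<inter> C \<inter> (W \<inter> (nbh L p \<inter> C)). loc p g y * s p y = hh p y * loc p f y"
        using glob[OF p] by (auto simp: loc_def)
    qed
    also have "colength Y p (principal_ideal Y p (\<lambda>y. hh p y * loc p f y)) = ordp p f"
      using P.len_mult[OF hp hp0 lf] P.len_unit[OF hp U(6)[OF p U(2)[OF p]]] by (simp add: ordp_def PIs_def)
    finally show ?thesis by (simp add: ordp_def PIs_def)
  qed
  let ?o = "\<lambda>p. int (ordp p f) - int (ordp p g)"
  let ?F = "Zs f \<union> Zs g"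
  have F: "finite ?F" "?F \<subseteq> C" using finite_Zs[OF f(1) fz] finite_Zs[OF g(1) gz] Zs_C by auto
  have "(\<Sum>p | p \<in> pts Y \<and> order_at Y p (W \<inter> nbh (restrict_bundle L C) p) (s p) \<noteq> 0.
      order_at Y p (W \<inter> nbh (restrict_bundle L C) p) (s p)) = (\<Sum>p | p \<in> C \<and> ?o p \<noteq> 0. ?o p)"
    unfolding ptsY nb using ord by (intro sum.cong) auto
  also have "\<dots> = (\<Sum>p\<in>?F. ?o p)"
  proof (rule sum.mono_neutral_left[OF F(1)])
    show "{p \<in> C. ?o p \<noteq> 0} \<subseteq> ?F" using ordp_0[OF f(1)] ordp_0[OF g(1)] by fastforce
  qed (use F(2) in auto)
  also have "\<dots> = int (N f) - int (N g)"
    unfolding sum_subtractf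
    using N_superset[OF f(1) F(1) _ F(2)] N_superset[OF g(1) F(1) _ F(2)] by simp
  \<comment> \<open>\<open>f\<close> and \<open>g * f0\<close> have the same weight.\<close>
  also have "N f = N (\<lambda>u. g u * f0 u)"
    by (rule N_weight[OF f(1) fz S_mult[OF g(1) f0(1)] zeroC_mult[OF g(1) f0(1) gz f0(2)]])
  also have "\<dots> = N g + N f0" by (rule N_mult[OF g(1) f0(1) gz f0(2)])
  finally show ?thesis by simp
qed

text \<open>The local frame at a point \<open>q\<close> is a rational section of the restricted
  bundle; in the other trivialisations it is the transition function.\<close>

lemma ex_rational_section:
  assumes L: "line_bundle X L"
  shows "\<exists>W s. rational_section Y (restrict_bundle L C) W s"
proof -
  obtain q where q: "q \<in> C" using Z_ne by blast
  have CX: "p \<in> pts X" if "p \<in> C" for p using that Z_pts by blast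
  have ptsY: "pts Y = C" using pts_sub Z_pts by blast
  have nbh: "openin (ftop X) (nbh L p)" "p \<in> nbh L p" if "p \<in> C" for p
    using L CX[OF that] by (auto simp: line_bundle_def)
  have trreg: "trans_fun L p r \<in> reg X (nbh L p \<inter> nbh L r)" if "p \<in> C" "r \<in> C" for p r
    using L CX[OF that(1)] CX[OF that(2)] by (auto simp: line_bundle_def)
  have "rational_section Y (restrict_bundle L C) (nbh L q \<inter> C) (\<lambda>p. trans_fun L p q)"
    unfolding rational_section_def ptsY restrict_bundle_def line_bundle_data.simps
  proof (intro conjI ballI)
    show "openin (ftop Y) (nbh L q \<inter> C)" by (rule openin_of_X[OF nbh(1)[OF q]])
    show "nbh L q \<inter> C \<noteq> {}" using nbh(2)[OF q] q by blast
    show "\<exists>p\<in>C. \<exists>y\<in>nbh L q \<inter> C \<inter> (nbh L p \<inter> C). trans_fun L p q y \<noteq> 0"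
      using nbh(2)[OF q] q CX[OF q] L by (intro bexI[of _ q]) (auto simp: line_bundle_def)
    fix p assume p: "p \<in> C"
    have "trans_fun L p q \<in> reg Y ((nbh L p \<inter> nbh L q) \<inter> C)"
      by (rule reg_of_X[OF _ trreg[OF p q]]) (use nbh(1) p q in blast)
    moreover have "(nbh L p \<inter> nbh L q) \<inter> C = nbh L q \<inter> C \<inter> (nbh L p \<inter> C)" by blast
    ultimately show "trans_fun L p q \<in> reg Y (nbh L q \<inter> C \<inter> (nbh L p \<inter> C))" by simp
    fix r y assume r: "r \<in> C" and y: "y \<in> nbh L q \<inter> C \<inter> (nbh L p \<inter> C) \<inter> (nbh L r \<inter> C)"
    then have "trans_fun L p r y * trans_fun L r q y = trans_fun L p q y"
      using L CX[OF p] CX[OF q] CX[OF r] unfolding line_bundle_def by blast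
    then show "trans_fun L p q y = trans_fun L p r y * trans_fun L r q y" by simp
  qed
  then show ?thesis by blast
qed

theorem intersection_divisor:
  assumes i: "i \<in> {1..n}" and f0: "f0 \<in> S (ew i)" "\<not> zeroC f0"
  shows "intersection_number X (divisor_bundle X (bott_divisor c n i)) C = int (N f0)"
proof -
  let ?L = "divisor_bundle X (bott_divisor c n i)"
  have L: "is_divisor_bundle X (bott_divisor c n i) ?L"
    unfolding divisor_bundle_def by (rule someI_ex[OF ex_divisor_bundle[OF i]])
  then have lb: "line_bundle X ?L" by (simp add: is_divisor_bundle_def)
  obtain W s where s: "rational_section Y (restrict_bundle ?L C) W s" using ex_rational_section[OF lb] by blast
  show ?thesis
    unfolding intersection_number_def degree_of_def
  proof (rule the_equality)
    show "\<exists>W s. rational_section Y (restrict_bundle ?L C) W s \<and>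
      int (N f0) = (\<Sum>p | p \<in> pts Y \<and> order_at Y p (W \<inter> nbh (restrict_bundle ?L C) p) (s p) \<noteq> 0.
        order_at Y p (W \<inter> nbh (restrict_bundle ?L C) p) (s p))"
      using s degree_rational_section[OF i L s f0] by (intro exI[of _ W] exI[of _ s] conjI) simp_all
  next
    fix d assume "\<exists>W s. rational_section Y (restrict_bundle ?L C) W s \<and>
      d = (\<Sum>p | p \<in> pts Y \<and> order_at Y p (W \<inter> nbh (restrict_bundle ?L C) p) (s p) \<noteq> 0.
        order_at Y p (W \<inter> nbh (restrict_bundle ?L C) p) (s p))"
    then show "d = int (N f0)" using degree_rational_section[OF i L _ f0] by (elim exE conjE) simp
  qed
qed

end

section \<open>Fibres of the tower embedded by its sections\<close>

lemma irreducible_closed_of_subtopology: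
  assumes "irreducible_closed (subtopology T Z) A" "closedin T Z"
  shows "irreducible_closed T A" "A \<subseteq> Z"
proof -
  have A: "closedin T A" "A \<subseteq> Z" "A \<noteq> {}"
    using assms(1) unfolding irreducible_closed_def closedin_closed_subtopology[OF assms(2)] by blast+
  have "A \<subseteq> B \<or> A \<subseteq> B'" if B: "closedin T B" "closedin T B'" "A \<subseteq> B \<union> B'" for B B'
  proof -
    have "closedin (subtopology T Z) (B \<inter> Z)" "closedin (subtopology T Z) (B' \<inter> Z)"
      unfolding closedin_closed_subtopology[OF assms(2)] using B assms(2) by auto
    moreover have "A \<subseteq> (B \<inter> Z) \<union> (B' \<inter> Z)" using B(3) A(2) by blast
    ultimately have "A \<subseteq> B \<inter> Z \<or> A \<subseteq> B' \<inter> Z" using assms(1) unfolding irreducible_closed_def by blast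
    then show ?thesis by blast
  qed
  with A show "irreducible_closed T A" "A \<subseteq> Z" unfolding irreducible_closed_def by blast+
qed

text \<open>The curve \<open>gc\<close> is a fibre of \<open>X\<^sub>k \<rightarrow> X\<^sub>k\<^sub>-\<^sub>1\<close>, embedded in \<open>X\<^sub>n\<close> by the sections \<open>z\<^sub>i = 0\<close>, \<open>i > k\<close>.\<close>

locale bott_gc = bott +
  fixes u :: coords and k :: nat
  assumes u_cox: "u \<in> cox_points n" and k: "k \<in> {1..n}" and u_gt: "\<And>i. i \<in> {k<..n} \<Longrightarrow> u i = (0, 1)"
begin

section \<open>Parametrisation of the coordinate curve\<close>

definition gc :: "coords set set" where
  "gc = {bp (u(k := a)) |a. a \<noteq> (0, 0)}"

abbreviation "u1 \<equiv> u(k := (1, 1))"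

text \<open>The affine part of the curve in a chart as a line in the slice: only the
  \<open>k\<close>-th pair moves, with parameter \<open>s\<close>, while the others are frozen at
  the values they have for \<open>u1\<close>.\<close>

definition gam :: "(nat \<Rightarrow> bool) \<Rightarrow> complex \<Rightarrow> coords" where
  "gam \<tau> s = (nrm \<tau> u1)(k := (if \<tau> k then (1, s) else (s, 1)))"

definition co :: "(nat \<Rightarrow> bool) \<Rightarrow> coords \<Rightarrow> complex" where
  "co \<tau> v = (if \<tau> k then snd (v k) else fst (v k))"

text \<open>A chart containing all of the curve except the point with \<open>w_k = 0\<close>; it
  selects \<open>w_i\<close> for all \<open>i \<ge> k\<close>.\<close>

definition \<sigma> :: "nat \<Rightarrow> bool" where
  "\<sigma> = (\<lambda>i. i < k \<and> fst (u i) \<noteq> 0)"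

lemma upd_cox: "a \<noteq> (0, 0) \<Longrightarrow> u(k := a) \<in> cox_points n"
  using u_cox k by (auto simp: cox_points_def)

lemma u1_cox: "u1 \<in> cox_points n" by (rule upd_cox) simp

lemma co_gam [simp]: "co \<tau> (gam \<tau> s) = s"
  by (simp add: co_def gam_def)

lemma good_gt:
  assumes "inU \<tau> u1" and i: "i \<in> {k<..n}"
  shows "\<not> \<tau> i"
proof -
  have "i \<in> {1..n}" "i \<noteq> k" using i by auto
  moreover from this have "cc \<tau> i u1 \<noteq> 0" using assms(1) unfolding inU_def by blast
  ultimately show ?thesis using u_gt[OF i] by (auto simp: cc_def)
qed

lemma base_gt:
  assumes \<tau>: "inU \<tau> u1" and i: "i \<in> {k<..n}"
  shows "nrm \<tau> u1 i = (0, 1)"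
proof -
  have i': "i \<in> {1..n}" "i \<noteq> k" using i by auto
  have "fst (u1 i) = 0" using u_gt[OF i] i' by simp
  then have "fst (nrm \<tau> u1 i) = 0" unfolding nrm_def using fst_act_eq_0[OF nt_nz[OF \<tau>] i'(1), of u1] by simp
  moreover have "cc \<tau> i (nrm \<tau> u1) = 1" using nrm_slice[OF \<tau>] i'(1) unfolding slice_def by blast
  then have "snd (nrm \<tau> u1 i) = 1" using good_gt[OF \<tau> i] by (simp add: cc_def)
  ultimately show ?thesis by (simp add: prod_eq_iff)
qed

lemma gam_slice: "inU \<tau> u1 \<Longrightarrow> gam \<tau> s \<in> slice \<tau>"
  using nrm_slice[of \<tau> u1] k by (auto simp: slice_def gam_def cc_def)

lemma nt_indep: "i < k \<Longrightarrow> nt c \<tau> (u(k := a)) i = nt c \<tau> u1 i"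
proof (induction i rule: less_induct)
  case (less i)
  have "(\<Prod>l\<in>{1..<i}. nt c \<tau> (u(k := a)) l powi (c l i)) = (\<Prod>l\<in>{1..<i}. nt c \<tau> u1 l powi (c l i))"
  proof (rule prod.cong[OF refl])
    fix l assume "l \<in> {1..<i}"
    then have "l < i" "l < k" using less.prems by auto
    from less.IH[OF this] show "nt c \<tau> (u(k := a)) l powi (c l i) = nt c \<tau> u1 l powi (c l i)" by (rule arg_cong)
  qed
  moreover have "(u(k := a)) i = u1 i" using less.prems by simp
  ultimately show ?case by (simp only: nt.simps[of c \<tau> _ i])
qed

lemma gam_mem:
  assumes \<tau>: "inU \<tau> u1"
  shows "bp (gam \<tau> s) \<in> gc"
proof -
  let ?t = "nt c \<tau> u1" and ?g = "if \<tau> k then (1, s) else (s, 1)"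
  let ?p = "\<Prod>l\<in>{1..<k}. ?t l powi (c l k)"
  have nz: "nz ?t" by (rule nt_nz[OF \<tau>])
  have tk: "?t k \<noteq> 0" using nz k by (auto simp: nz_def)
  have p: "?p \<noteq> 0" by (rule nz_prod[OF nz]) (use k in auto)
  \<comment> \<open>The pair that the torus element normalising \<open>u1\<close> turns into the
    \<open>k\<close>-th pair of \<open>gam \<tau> s\<close>.\<close>
  define a where "a = (fst ?g * ?p / ?t k, snd ?g / ?t k)"
  have a: "a \<noteq> (0, 0)" using tk p by (auto simp: a_def split: if_splits)
  have "act ?t (u(k := a)) = gam \<tau> s"
  proof
    fix i
    show "act ?t (u(k := a)) i = gam \<tau> s i"
    proof (cases "i = k")
      case True
      have "fst (act ?t (u(k := a)) k) = fst ?g" unfolding fst_act[OF k] using tk p by (simp add: a_def del: prod_zero_iff)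
      moreover have "snd (act ?t (u(k := a)) k) = snd ?g" unfolding snd_act[OF k] using tk by (simp add: a_def)
      ultimately show ?thesis using True by (simp add: gam_def prod_eq_iff)
    next
      case False
      then show ?thesis by (simp add: gam_def nrm_def torus_act_def)
    qed
  qed
  then have "bp (gam \<tau> s) = bp (u(k := a))" using bp_act[OF nz, of "u(k := a)"] by simp
  with a show ?thesis unfolding gc_def by blast
qed

text \<open>Below \<open>k\<close> the normalisation does not see the \<open>k\<close>-th pair;
  above \<open>k\<close> the first entries are zero, so that the changed torus entry at
  \<open>k\<close> has no effect there either.\<close>

lemma chart_gc:
  assumes y: "y \<in> gc" "y \<in> chart \<tau>"
  shows "inU \<tau> u1" "rep \<tau> y = gam \<tau> (co \<tau> (rep \<tau> y))"
proof -
  obtain a where a: "a \<noteq> (0, 0)" "y = bp (u(k := a))" using y(1) unfolding gc_def by blast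
  have inU: "inU \<tau> (u(k := a))" using chart_bp[OF upd_cox[OF a(1)], of \<tau>] y(2) a(2) by simp
  have "cc \<tau> i u1 \<noteq> 0" if i: "i \<in> {1..n}" for i
  proof (cases "i = k")
    case False
    then have "cc \<tau> i u1 = cc \<tau> i (u(k := a))" by (simp add: cc_def)
    then show ?thesis using inU i unfolding inU_def by simp
  qed (simp add: cc_def)
  then show \<tau>: "inU \<tau> u1" using u1_cox by (simp add: inU_def)
  let ?r = "rep \<tau> y"
  have r: "?r = act (nt c \<tau> (u(k := a))) (u(k := a))" using rep_bp[OF inU] a(2) by (simp add: nrm_def)
  have rs: "?r \<in> slice \<tau>" by (rule rep_slice[OF y(2)])
  have nz: "nz (nt c \<tau> (u(k := a)))" by (rule nt_nz[OF inU])
  have "?r i = gam \<tau> (co \<tau> ?r) i" for i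
  proof -
    consider "i \<notin> {1..n}" | "i = k" | "i \<in> {1..n}" "i < k" | "i \<in> {k<..n}" using k by force
    then show ?thesis
    proof cases
      case 1
      then show ?thesis using rs gam_slice[OF \<tau>] by (simp add: slice_def)
    next
      case 2
      have "cc \<tau> k ?r = 1" using rs k unfolding slice_def by blast
      with 2 show ?thesis by (auto simp: gam_def co_def cc_def prod_eq_iff split: if_splits)
    next
      case 3
      have "act (nt c \<tau> (u(k := a))) (u(k := a)) i = act (nt c \<tau> u1) u1 i"
      proof -
        have "(\<Prod>l\<in>{1..<i}. nt c \<tau> (u(k := a)) l powi (- c l i)) = (\<Prod>l\<in>{1..<i}. nt c \<tau> u1 l powi (- c l i))"
        proof (rule prod.cong[OF refl])
          fix l assume "l \<in> {1..<i}"
          then have "l < k" using 3 by simp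
          from nt_indep[OF this, of \<tau> a] show "nt c \<tau> (u(k := a)) l powi (- c l i) = nt c \<tau> u1 l powi (- c l i)"
            by (rule arg_cong)
        qed
        moreover have "nt c \<tau> (u(k := a)) i = nt c \<tau> u1 i" by (rule nt_indep[OF 3(2)])
        moreover have "(u(k := a)) i = u1 i" using 3 by simp
        ultimately show ?thesis unfolding torus_act_def by (simp only:)
      qed
      then show ?thesis using 3 r by (simp add: gam_def nrm_def)
    next
      case 4
      then have i: "i \<in> {1..n}" "i \<noteq> k" by auto
      have "fst (?r i) = 0" unfolding r using fst_act_eq_0[OF nz i(1)] u_gt[OF 4] i by simp
      moreover have "cc \<tau> i ?r = 1" using rs i unfolding slice_def by blast
      then have "snd (?r i) = 1" using good_gt[OF \<tau> 4] by (simp add: cc_def)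
      ultimately show ?thesis using base_gt[OF \<tau> 4] i by (simp add: gam_def prod_eq_iff)
    qed
  qed
  then show "?r = gam \<tau> (co \<tau> ?r)" by (rule ext)
qed

lemma gam_chart: "inU \<tau> u1 \<Longrightarrow> bp (gam \<tau> s) \<in> chart \<tau>" "inU \<tau> u1 \<Longrightarrow> rep \<tau> (bp (gam \<tau> s)) = gam \<tau> s"
  using bp_slice_chart[OF gam_slice] rep_of_slice[OF gam_slice] by auto

lemma gam_line: "gam \<tau> s = line (gam \<tau> 0) (gam \<tau> 1) s"
  by (auto simp: gam_def line_def fun_eq_iff)

lemma poly_gam:
  assumes "poly_fun n P"
  obtains q where "\<forall>s. P (gam \<tau> s) = poly q s"
  using poly_fun_line[OF assms, of "gam \<tau> 0" "gam \<tau> 1"] unfolding gam_line[symmetric] by blast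

lemma gc_pts: "gc \<subseteq> pts X"
  unfolding gc_def using bp_pts[OF upd_cox] by auto

lemma gc_finite_zeros:
  assumes P: "poly_fun n P" and y0: "y0 \<in> gc" "y0 \<in> chart \<tau>" "P (rep \<tau> y0) \<noteq> 0"
  shows "finite {y \<in> gc \<inter> chart \<tau>. P (rep \<tau> y) = 0}"
proof -
  obtain q where q: "\<forall>s. P (gam \<tau> s) = poly q s" using poly_gam[OF P] .
  have "q \<noteq> 0" using y0(3) chart_gc(2)[OF y0(1,2)] q by (metis poly_0)
  then have "finite {s. poly q s = 0}" by (rule poly_roots_finite)
  moreover have "{y \<in> gc \<inter> chart \<tau>. P (rep \<tau> y) = 0} \<subseteq> (\<lambda>s. bp (gam \<tau> s)) ` {s. poly q s = 0}"
  proof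
    fix y assume y: "y \<in> {y \<in> gc \<inter> chart \<tau>. P (rep \<tau> y) = 0}"
    let ?s = "co \<tau> (rep \<tau> y)"
    have g: "rep \<tau> y = gam \<tau> ?s" using chart_gc(2) y by blast
    then have "poly q ?s = 0" using y q by (metis (mono_tags, lifting) mem_Collect_eq)
    moreover have "y = bp (gam \<tau> ?s)" using g bp_rep[of y \<tau>] y by simp
    ultimately show "y \<in> (\<lambda>s. bp (gam \<tau> s)) ` {s. poly q s = 0}" by blast
  qed
  ultimately show ?thesis by (meson finite_imageI finite_subset)
qed

text \<open>A point of the chart off the curve differs from it in a pair other than the
  \<open>k\<close>-th, and that pair is constant along the curve.\<close>

lemma gc_closed: "closedin (ftop X) gc"
proof -
  have "openin (ftop X) (pts X - gc)"
  proof (subst openin_subopen, intro ballI)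
    fix y assume y: "y \<in> pts X - gc"
    then obtain \<tau> where \<tau>: "y \<in> chart \<tau>" using ex_chart by blast
    show "\<exists>T. openin (ftop X) T \<and> y \<in> T \<and> T \<subseteq> pts X - gc"
    proof (cases "inU \<tau> u1")
      case False
      then have "chart \<tau> \<subseteq> pts X - gc" using chart_gc(1) chart_pts by blast
      then show ?thesis using \<tau> openin_chart by blast
    next
      case True
      let ?r = "rep \<tau> y" and ?g = "gam \<tau> (co \<tau> (rep \<tau> y))"
      have "?r \<noteq> ?g"
      proof
        assume "?r = ?g"
        then have "y = bp ?g" using bp_rep[OF \<tau>] by simp
        moreover have "bp ?g \<in> gc" by (rule gam_mem[OF True])
        ultimately show False using y by (metis DiffD2)
      qed
      then obtain i where i: "?r i \<noteq> ?g i" by blast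
      have rs: "?r \<in> slice \<tau>" and gs: "?g \<in> slice \<tau>" using rep_slice[OF \<tau>] gam_slice[OF True] by auto
      have i1: "i \<in> {1..n}"
      proof (rule ccontr)
        assume "i \<notin> {1..n}"
        then have "?r i = (0, 0)" "?g i = (0, 0)" using rs gs unfolding slice_def by blast+
        then show False using i by simp
      qed
      have ik: "i \<noteq> k"
      proof
        assume "i = k"
        moreover have "cc \<tau> k ?r = 1" using rs k unfolding slice_def by blast
        ultimately show False using i by (auto simp: gam_def co_def cc_def prod_eq_iff split: if_splits)
      qed
      define d where "d = ?g i"
      have i: "?r i \<noteq> d" using i by (simp add: d_def)
      have const: "gam \<tau> s i = d" for s using ik by (simp add: gam_def d_def)
      have "\<exists>P. poly_fun n P \<and> P ?r \<noteq> 0 \<and> (\<forall>s. P (gam \<tau> s) = 0)"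
      proof (cases "fst (?r i) = fst d")
        case True
        then have "snd (?r i) \<noteq> snd d" using i by (simp add: prod_eq_iff)
        then show ?thesis using i1 const
          by (intro exI[of _ "\<lambda>u. snd (u i) - snd d"]) (auto intro!: poly_fun_diff poly_fun.w_coord poly_fun.const)
      next
        case False
        then show ?thesis using i1 const
          by (intro exI[of _ "\<lambda>u. fst (u i) - fst d"]) (auto intro!: poly_fun_diff poly_fun.z_coord poly_fun.const)
      qed
      then obtain P where P: "poly_fun n P" "P ?r \<noteq> 0" "\<forall>s. P (gam \<tau> s) = 0" by blast
      have "dist_open \<tau> P \<subseteq> pts X - gc"
      proof
        fix z assume z: "z \<in> dist_open \<tau> P"
        then have zc: "z \<in> chart \<tau>" "P (rep \<tau> z) \<noteq> 0" by (auto simp: dist_open_def)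
        have "z \<notin> gc"
        proof
          assume "z \<in> gc"
          from chart_gc(2)[OF this zc(1)] P(3) zc(2) show False by metis
        qed
        with chart_pts[OF zc(1)] show "z \<in> pts X - gc" by blast
      qed
      moreover have "y \<in> dist_open \<tau> P" using P(2) \<tau> by (simp add: dist_open_def)
      ultimately show ?thesis using openin_dist_open[OF P(1)] by blast
    qed
  qed
  with gc_pts show ?thesis by (simp add: closedin_def)
qed

lemma \<sigma>_good: "inU \<sigma> u1"
proof -
  have "cc \<sigma> i u1 \<noteq> 0" if i: "i \<in> {1..n}" for i
  proof -
    consider "i < k" | "i = k" | "i \<in> {k<..n}" using i by force
    then show ?thesis
    proof cases
      case 1
      then have "u i \<noteq> (0, 0)" using u_cox i by (auto simp: cox_points_def)
      with 1 show ?thesis by (auto simp: cc_def \<sigma>_def prod_eq_iff)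
    next
      case 3
      then show ?thesis using u_gt[OF 3] by (auto simp: cc_def \<sigma>_def)
    qed (simp add: cc_def)
  qed
  then show ?thesis using u1_cox by (simp add: inU_def)
qed

lemma gam_in_\<sigma>:
  assumes \<tau>: "inU \<tau> u1" and s: "s \<noteq> 0"
  shows "bp (gam \<tau> s) \<in> chart \<sigma>"
proof -
  have "cc \<sigma> i (gam \<tau> s) \<noteq> 0" if i: "i \<in> {1..n}" for i
  proof -
    consider "i < k" | "i = k" | "i \<in> {k<..n}" using i by force
    then show ?thesis
    proof cases
      case 1
      have "cc \<sigma> i u1 \<noteq> 0" using \<sigma>_good i unfolding inU_def by blast
      then have "cc \<sigma> i (nrm \<tau> u1) \<noteq> 0"
        unfolding nrm_def cc_def using fst_act_eq_0[OF nt_nz[OF \<tau>] i, of u1] snd_act_eq_0[OF nt_nz[OF \<tau>] i, of u1]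
        by (auto split: if_splits)
      then show ?thesis using 1 by (simp add: gam_def cc_def split: if_splits)
    next
      case 2
      then show ?thesis using s by (simp add: gam_def cc_def \<sigma>_def)
    next
      case 3
      then show ?thesis using base_gt[OF \<tau> 3] by (auto simp: gam_def cc_def \<sigma>_def)
    qed
  qed
  then show ?thesis using chart_bp[OF slice_cox[OF gam_slice[OF \<tau>]], of s \<sigma>] slice_cox[OF gam_slice[OF \<tau>]]
    by (simp add: inU_def)
qed

text \<open>An open set meeting the curve contains all but finitely many points of the one affine
  line in the chart \<open>\<sigma>\<close>; thus two such sets always intersect.\<close>

lemma gc_meets:
  assumes V: "openin (ftop X) V" "V \<inter> gc \<noteq> {}"
  obtains q where "q \<noteq> 0" "\<forall>s. poly q s \<noteq> 0 \<longrightarrow> bp (gam \<sigma> s) \<in> V"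
proof -
  obtain y where y: "y \<in> V" "y \<in> gc" using V(2) by blast
  then obtain \<tau> where \<tau>: "y \<in> chart \<tau>" using ex_chart gc_pts by blast
  obtain P where P: "poly_fun n P" "P (rep \<tau> y) \<noteq> 0" "dist_open \<tau> P \<subseteq> V" using open_local[OF V(1) y(1) \<tau>] .
  obtain q where q: "\<forall>s. P (gam \<tau> s) = poly q s" using poly_gam[OF P(1)] .
  have "q \<noteq> 0" using P(2) chart_gc(2)[OF y(2) \<tau>] q by (metis poly_0)
  then have "finite ({s. poly q s = 0} \<union> {0})" using poly_roots_finite by blast
  then obtain s where s: "s \<notin> {s. poly q s = 0} \<union> {0}" using ex_new_if_finite[OF infinite_UNIV_char_0] by blast
  note good = chart_gc(1)[OF y(2) \<tau>]
  let ?z = "bp (gam \<tau> s)"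
  have "?z \<in> dist_open \<tau> P" using gam_chart[OF good, of s] s q by (simp add: dist_open_def)
  then have zV: "?z \<in> V" using P(3) by blast
  have z: "?z \<in> gc" "?z \<in> chart \<sigma>" using gam_mem[OF good] gam_in_\<sigma>[OF good] s by auto
  obtain R where R: "poly_fun n R" "R (rep \<sigma> ?z) \<noteq> 0" "dist_open \<sigma> R \<subseteq> V" using open_local[OF V(1) zV z(2)] .
  obtain r where r: "\<forall>s. R (gam \<sigma> s) = poly r s" using poly_gam[OF R(1)] .
  have "r \<noteq> 0" using R(2) chart_gc(2)[OF z] r by (metis poly_0)
  moreover have "bp (gam \<sigma> s) \<in> V" if "poly r s \<noteq> 0" for s
    using gam_chart[OF \<sigma>_good, of s] r that R(3) by (auto simp: dist_open_def)
  ultimately show ?thesis using that by blast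
qed

lemma gc_irreducible: "irreducible_closed (ftop X) gc"
proof -
  have "irreducible_closed (ftop X) ((ftop X) closure_of gc)"
  proof (rule irreducible_closure[OF _ gc_pts])
    show "gc \<noteq> {}" using gam_mem[OF \<sigma>_good] by blast
    fix V V' assume V: "openin (ftop X) V" "openin (ftop X) V'" "V \<inter> gc \<noteq> {}" "V' \<inter> gc \<noteq> {}"
    obtain q where q: "q \<noteq> 0" "\<forall>s. poly q s \<noteq> 0 \<longrightarrow> bp (gam \<sigma> s) \<in> V" using gc_meets[OF V(1,3)] .
    obtain q' where q': "q' \<noteq> 0" "\<forall>s. poly q' s \<noteq> 0 \<longrightarrow> bp (gam \<sigma> s) \<in> V'" using gc_meets[OF V(2,4)] .
    have "q * q' \<noteq> 0" using q q' by simp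
    then obtain s where "poly (q * q') s \<noteq> 0" using poly_all_0_iff_0 by blast
    then have "bp (gam \<sigma> s) \<in> V \<inter> V'" using q(2) q'(2) by simp
    with gam_mem[OF \<sigma>_good] show "V \<inter> V' \<inter> gc \<noteq> {}" by blast
  qed
  then show ?thesis using closure_of_closedin[OF gc_closed] by simp
qed

text \<open>Proper closed subsets are finite, and finite irreducible sets are points, so chains have
  length at most 1; a point inside the curve gives length 1.\<close>

lemma gc_curve: "is_curve X gc"
proof -
  interpret I: bott_irr n c gc by unfold_locales (rule gc_irreducible)
  have fin: "finite B" if B: "closedin (ftop X) B" "B \<subseteq> gc" "B \<noteq> gc" for B
  proof (rule I.finite_closed_subset[OF _ B])
    fix P \<tau> assume P: "poly_fun n P" "P \<notin> vI \<tau> gc"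
    then obtain y where "y \<in> gc" "y \<in> chart \<tau>" "P (rep \<tau> y) \<noteq> 0" by (auto simp: vI_def)
    then show "finite {y \<in> gc \<inter> chart \<tau>. P (rep \<tau> y) = 0}" by (rule gc_finite_zeros[OF P(1)])
  qed
  have g: "bp (gam \<sigma> 0) \<in> gc" "bp (gam \<sigma> 1) \<in> gc" "bp (gam \<sigma> 0) \<noteq> bp (gam \<sigma> 1)"
    using gam_mem[OF \<sigma>_good] gam_chart(2)[OF \<sigma>_good] co_gam by (metis, metis, metis zero_neq_one)
  let ?F = "\<lambda>i::nat. if i = 0 then {bp (gam \<sigma> 0)} else gc"
  have "enat 1 \<le> krull_dim (subtopology (ftop X) gc)"
  proof (rule krull_dim_ge[of 1 _ ?F])
    fix i :: nat
    have "irreducible_closed (ftop X) (?F i)" "?F i \<subseteq> gc"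
      using irreducible_closed_point[OF closedin_point] gc_irreducible g(1) gc_pts by auto
    then show "irreducible_closed (subtopology (ftop X) gc) (?F i)"
      by (rule irreducible_closed_subtopology[OF _ _ gc_closed])
    show "?F i \<subset> ?F (Suc i)" if "i < 1" using that g by auto
  qed
  moreover have "krull_dim (subtopology (ftop X) gc) \<le> enat 1"
    unfolding krull_dim_def
  proof (rule Sup_least, clarify)
    fix m F assume F: "\<forall>i\<le>m. irreducible_closed (subtopology (ftop X) gc) (F i)" "\<forall>i<m. F i \<subset> F (Suc i)"
    show "enat m \<le> enat 1"
    proof (rule ccontr)
      assume "\<not> enat m \<le> enat 1"
      then have m: "2 \<le> m" by simp
      have Fi: "irreducible_closed (ftop X) (F i)" "F i \<subseteq> gc" if "i \<le> m" for i
        using irreducible_closed_of_subtopology[OF _ gc_closed] F(1) that by blast+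
      have "F 1 \<subset> F (Suc 1)" "F 0 \<subset> F (Suc 0)" using F(2) m by auto
      then have F01: "F 1 \<noteq> gc" "F 0 \<subset> F 1" using Fi(2)[of "Suc 1"] m by auto
      have "finite (F 1)" using fin Fi[of 1] F01(1) m unfolding irreducible_closed_def by auto
      moreover have "bott_irr n c (F 1)" by unfold_locales (rule Fi(1), use m in simp)
      ultimately obtain x where "F 1 = {x}" by (elim exE[OF bott_irr.finite_singleton, rotated 2])
      with F01(2) have "F 0 = {}" by (metis psubsetE subset_singletonD)
      with Fi(1)[of 0] show False by (simp add: irreducible_closed_def)
    qed
  qed
  ultimately show ?thesis
    unfolding is_curve_def using gc_irreducible by (simp add: one_enat_def)
qed

sublocale bott_curve n c gc by unfold_locales (rule gc_curve)

lemma poly_co: "poly_fun n (co \<tau>)"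
  unfolding co_def[abs_def] by (cases "\<tau> k") (use k in \<open>auto intro: poly_fun.intros\<close>)

text \<open>On the affine line, a polynomial vanishing at \<open>s0\<close> is divisible by the
  parameter minus \<open>s0\<close>. So this difference generates the maximal ideal and the curve is
  smooth.\<close>

lemma local_parameter:
  assumes p: "p \<in> gc"
  defines "t \<equiv> \<lambda>y. co (tc p) (rep (tc p) y) - co (tc p) (rep (tc p) p)"
  shows "t \<in> max_ideal Y p" "\<not> germ_eq Y p t (\<lambda>_. 0)" "colength Y p (principal_ideal Y p t) = 1"
proof -
  interpret P: local_curve Y p "gc \<inter> chart (tc p)" "A (tc p)" by (rule local_curve_p[OF p])
  let ?\<tau> = "tc p"
  have pc: "p \<in> chart ?\<tau>" by (rule tc_C[OF p])
  note good = chart_gc(1)[OF p pc]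
  define s0 where "s0 = co ?\<tau> (rep ?\<tau> p)"
  have ps: "rep ?\<tau> p = gam ?\<tau> s0" using chart_gc(2)[OF p pc] by (simp add: s0_def)
  have t: "t = (\<lambda>y. (\<lambda>v. co ?\<tau> v - s0) (rep ?\<tau> y))" by (simp add: t_def s0_def)
  have tA: "t \<in> A ?\<tau>" unfolding t A_def
    by (rule CollectI, rule exI[of _ "\<lambda>v. co ?\<tau> v - s0"], intro conjI refl poly_fun_diff poly_co poly_fun.const)
  have tO: "t \<in> stalk Y p" by (rule P.A_in[OF tA])
  have tp: "t p = 0" by (simp add: t_def)
  show "t \<in> max_ideal Y p" using tO tp by (simp add: P.mm_iff)
  show nz: "\<not> germ_eq Y p t (\<lambda>_. 0)"
  proof
    assume "germ_eq Y p t (\<lambda>_. 0)"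
    then obtain R where R: "poly_fun n R" "R (rep ?\<tau> p) \<noteq> 0" "\<forall>y\<in>dist_open ?\<tau> R \<inter> gc. t y = 0"
      unfolding germ_sub_iff[OF pc p] by blast
    obtain r where r: "\<forall>s. R (gam ?\<tau> s) = poly r s" using poly_gam[OF R(1)] .
    have "r \<noteq> 0" using R(2) ps r by (metis poly_0)
    then have "finite ({s. poly r s = 0} \<union> {s0})" using poly_roots_finite by blast
    then obtain s where s: "s \<notin> {s. poly r s = 0} \<union> {s0}" using ex_new_if_finite[OF infinite_UNIV_char_0] by blast
    have "bp (gam ?\<tau> s) \<in> dist_open ?\<tau> R \<inter> gc"
      using gam_chart[OF good, of s] gam_mem[OF good] r s by (simp add: dist_open_def)
    then have "t (bp (gam ?\<tau> s)) = 0" using R(3) by blast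
    then show False using s gam_chart(2)[OF good] by (simp add: t)
  qed
  show "colength Y p (principal_ideal Y p t) = 1"
  proof (rule P.len_eq_1[OF tO tp])
    fix x assume x: "x \<in> stalk Y p" "x p = 0"
    from x(1)[unfolded stalk_sub_iff[OF pc p]] obtain P Q where PQ: "poly_fun n P" "poly_fun n Q" "Q (rep ?\<tau> p) \<noteq> 0"
      "\<forall>y\<in>dist_open ?\<tau> Q \<inter> gc. x y = P (rep ?\<tau> y) / Q (rep ?\<tau> y)" by (elim exE conjE)
    obtain q where q: "\<forall>s. P (gam ?\<tau> s) = poly q s" using poly_gam[OF PQ(1)] .
    have "p \<in> dist_open ?\<tau> Q \<inter> gc" using PQ(3) pc p by (simp add: dist_open_def)
    then have "x p = P (rep ?\<tau> p) / Q (rep ?\<tau> p)" using PQ(4) by blast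
    then have "P (rep ?\<tau> p) = 0" using x(2) PQ(3) by simp
    then have "poly q s0 = 0" using q ps by simp
    then obtain q1 where q1: "q = [:- s0, 1:] * q1" using poly_eq_0_iff_dvd by (metis dvdE)
    let ?P1 = "\<lambda>v. poly q1 (co ?\<tau> v)"
    have P1: "poly_fun n ?P1" by (rule poly_fun_poly[OF poly_co])
    show "x \<in> principal_ideal Y p t"
    proof (rule P.PI_I[OF tO])
      show "(\<lambda>y. ?P1 (rep ?\<tau> y) / Q (rep ?\<tau> y)) \<in> stalk Y p"
        unfolding stalk_sub_iff[OF pc p] by (intro exI[of _ ?P1] exI[of _ Q] conjI P1 PQ ballI refl)
      show "germ_eq Y p x (\<lambda>y. t y * (?P1 (rep ?\<tau> y) / Q (rep ?\<tau> y)))"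
        unfolding germ_sub_iff[OF pc p]
      proof (intro exI[of _ Q] conjI PQ ballI)
        fix y assume y: "y \<in> dist_open ?\<tau> Q \<inter> gc"
        then have yc: "y \<in> gc" "y \<in> chart ?\<tau>" by (auto simp: dist_open_def)
        have "P (rep ?\<tau> y) = poly q (co ?\<tau> (rep ?\<tau> y))" using chart_gc(2)[OF yc] q by metis
        then have "P (rep ?\<tau> y) = t y * ?P1 (rep ?\<tau> y)" by (simp add: q1 t algebra_simps)
        with bspec[OF PQ(4) y] show "x y = t y * (?P1 (rep ?\<tau> y) / Q (rep ?\<tau> y))" by simp
      qed
    qed
  qed
qed

lemma mult_gc:
  assumes p: "p \<in> gc"
  shows "mult_at X gc p = 1"
proof -
  interpret P: local_curve Y p "gc \<inter> chart (tc p)" "A (tc p)" by (rule local_curve_p[OF p])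
  note t = local_parameter[OF p]
  have "\<And>k. k \<le> colength Y p (P.MP k)" "\<And>k. colength Y p (P.MP k) \<le> k * 1"
    using P.colength_MP_ge[OF t(1,2)] P.colength_MP_le[OF t(1,2)] t(3) by auto
  from limsup_ratio_bounds[OF this] show ?thesis unfolding mult_at_def by simp
qed

end

context bott
begin

section \<open>Forms of the weights of the boundary divisors\<close>

lemma z_section:
  assumes i: "i \<in> {1..n}"
  shows "(\<lambda>u. fst (u i)) \<in> S (\<lambda>j. ew i j - (if j < i then c j i else 0))"
proof -
  let ?p = "\<lambda>j. if j = i then 1 else 0 :: nat"
  have "mono ?p (\<lambda>_. 0) u = (\<Prod>j\<in>{1..n}. if j = i then fst (u j) else 1)" for u
    unfolding mono_def by (rule prod.cong) auto
  then have m: "mono ?p (\<lambda>_. 0) = (\<lambda>u. fst (u i))" using i by (auto simp: fun_eq_iff)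
  have "has_wt ?p (\<lambda>_. 0) (\<lambda>j. ew i j - (if j < i then c j i else 0))"
    unfolding has_wt_def
  proof
    fix j assume j: "j \<in> {1..n}"
    have "(\<Sum>l\<in>{j<..n}. c j l * int (?p l)) = (\<Sum>l\<in>{j<..n}. if l = i then c j l else 0)"
      by (rule sum.cong) auto
    also have "\<dots> = (if j < i then c j i else 0)" using i by simp
    finally show "wt ?p (\<lambda>_. 0) j = ew i j - (if j < i then c j i else 0)" unfolding wt_def ew_def by simp
  qed
  from mono_S[OF this] show ?thesis unfolding m .
qed

lemma S_prod:
  assumes "finite I" "\<And>i. i \<in> I \<Longrightarrow> f i \<in> S (\<alpha> i)"
  shows "(\<lambda>u. \<Prod>i\<in>I. f i u) \<in> S (\<lambda>j. \<Sum>i\<in>I. \<alpha> i j)"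
  using assms
proof (induction I rule: finite_induct)
  case empty then show ?case using S_one by simp
next
  case (insert i I)
  from S_mult[OF insert.prems[of i] insert.IH] insert.prems insert.hyps show ?case by simp
qed

text \<open>This is where the Bott numbers have to be nonnegative.\<close>

lemma z_times_section:
  assumes i: "i \<in> {1..n}" and f: "\<And>l. l \<in> {1..<i} \<Longrightarrow> f l \<in> S (ew l)"
  shows "(\<lambda>u. fst (u i) * (\<Prod>l\<in>{1..<i}. f l u ^ nat (c l i))) \<in> S (ew i)"
proof -
  have "(\<lambda>u. \<Prod>l\<in>{1..<i}. f l u ^ nat (c l i)) \<in> S (\<lambda>j. \<Sum>l\<in>{1..<i}. int (nat (c l i)) * ew l j)"
    by (rule S_prod[where \<alpha> = "\<lambda>l j. int (nat (c l i)) * ew l j"]) (rule finite_atLeastLessThan, rule S_power[OF f])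
  from S_mult[OF z_section[OF i] this]
  have 1: "(\<lambda>u. fst (u i) * (\<Prod>l\<in>{1..<i}. f l u ^ nat (c l i))) \<in>
    S (\<lambda>j. ew i j - (if j < i then c j i else 0) + (\<Sum>l\<in>{1..<i}. int (nat (c l i)) * ew l j))" .
  have "ew i j - (if j < i then c j i else 0) + (\<Sum>l\<in>{1..<i}. int (nat (c l i)) * ew l j) = ew i j"
    if j: "j \<in> {1..n}" for j
  proof -
    have "(\<Sum>l\<in>{1..<i}. int (nat (c l i)) * ew l j) = (\<Sum>l\<in>{1..<i}. if l = j then c l i else 0)"
    proof (rule sum.cong[OF refl])
      fix l assume l: "l \<in> {1..<i}"
      then have "0 < c l i" using i by (intro c_pos) auto
      then show "int (nat (c l i)) * ew l j = (if l = j then c l i else 0)" by (simp add: ew_def)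
    qed
    also have "\<dots> = (if j < i then c j i else 0)" using j by simp
    finally show ?thesis by simp
  qed
  with 1 show ?thesis using S_cong by (metis (no_types, lifting))
qed

text \<open>If \<open>w_i\<close> vanishes at \<open>u\<close>, then \<open>z_i\<close> does not,
  and nonvanishing forms of lower weights complete it to the right weight. That the form involves
  only the first \<open>i\<close> pairs makes it constant on curves along which a later pair
  moves.\<close>

lemma base_point_free:
  assumes u: "u \<in> cox_points n"
  shows "i \<in> {1..n} \<Longrightarrow> \<exists>f\<in>S (ew i). f u \<noteq> 0 \<and> (\<forall>v. (\<forall>j\<le>i. v j = u j) \<longrightarrow> f v = f u)"
proof (induction i rule: less_induct)
  case (less i)
  show ?case
  proof (cases "snd (u i) = 0")
    case False
    then show ?thesis using w_section[OF less.prems] by (intro bexI[of _ "\<lambda>u. snd (u i)"]) auto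
  next
    case True
    have "\<forall>l\<in>{1..<i}. \<exists>f. f \<in> S (ew l) \<and> f u \<noteq> 0 \<and> (\<forall>v. (\<forall>j\<le>l. v j = u j) \<longrightarrow> f v = f u)"
      using less by (auto simp: Bex_def)
    then obtain f where f: "\<forall>l\<in>{1..<i}. f l \<in> S (ew l) \<and> f l u \<noteq> 0 \<and> (\<forall>v. (\<forall>j\<le>l. v j = u j) \<longrightarrow> f l v = f l u)"
      unfolding bchoice_iff by (elim exE)
    let ?g = "\<lambda>u. fst (u i) * (\<Prod>l\<in>{1..<i}. f l u ^ nat (c l i))"
    have gS: "?g \<in> S (ew i)" by (rule z_times_section[OF less.prems]) (rule bspec[OF f, THEN conjunct1])
    have "fst (u i) \<noteq> 0" using u less.prems True by (auto simp: cox_points_def prod_eq_iff)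
    moreover have "(\<Prod>l\<in>{1..<i}. f l u ^ nat (c l i)) \<noteq> 0"
      using bspec[OF f, THEN conjunct2, THEN conjunct1] by simp
    ultimately have "?g u \<noteq> 0" by simp
    moreover have "?g v = ?g u" if v: "\<forall>j\<le>i. v j = u j" for v
    proof -
      have "(\<Prod>l\<in>{1..<i}. f l v ^ nat (c l i)) = (\<Prod>l\<in>{1..<i}. f l u ^ nat (c l i))"
      proof (rule prod.cong[OF refl])
        fix l assume l: "l \<in> {1..<i}"
        have "\<forall>j\<le>l. v j = u j" using v l by simp
        from bspec[OF f l, THEN conjunct2, THEN conjunct2, THEN spec, of v] this have "f l v = f l u" by (rule mp)
        then show "f l v ^ nat (c l i) = f l u ^ nat (c l i)" by (rule arg_cong)
      qed
      moreover have "v i = u i" using v by simp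
      ultimately show ?thesis by (simp only:)
    qed
    ultimately show ?thesis using gS by (intro bexI[of _ ?g] conjI allI impI)
  qed
qed

end

context bott_gc
begin

lemma Zs_empty_N: "Zs f = {} \<Longrightarrow> N f = 0"
  by (simp add: N_def)

lemma N_of_nonvanishing:
  assumes f: "f \<in> S \<beta>" and nz: "\<And>a. a \<noteq> (0, 0) \<Longrightarrow> f (u(k := a)) \<noteq> 0"
  shows "\<not> zeroC f" "N f = 0"
proof -
  have *: "f v \<noteq> 0" if "x \<in> gc" "v \<in> x" for x v
  proof -
    from that(1)[unfolded gc_def mem_Collect_eq] obtain a where "x = bp (u(k := a))" "a \<noteq> (0, 0)"
      by (elim exE conjE)
    then show ?thesis using S_zero_bp[OF f, of v "u(k := a)"] that(2) nz by simp
  qed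
  obtain x where x: "x \<in> gc" using Z_ne by blast
  show "\<not> zeroC f" using * x rep_mem[OF tc_C[OF x]] unfolding zeroC_def by blast
  have "Zs f = {}" unfolding Zs_def using *[OF _ rep_mem[OF tc_C]] rep_mem[OF tc_C] by (auto dest: *)
  then show "N f = 0" by (rule Zs_empty_N)
qed

text \<open>For \<open>i < k\<close> the form from \<open>base_point_free\<close> does not involve
  the moving pair; for \<open>i > k\<close> the coordinate \<open>w_i\<close> is 1 along the
  curve.\<close>

lemma intersection_gc_other:
  assumes i: "i \<in> {1..n}" "i \<noteq> k"
  shows "intersection_number X (divisor_bundle X (bott_divisor c n i)) gc = 0"
proof -
  have "\<exists>f\<in>S (ew i). \<forall>a. a \<noteq> (0, 0) \<longrightarrow> f (u(k := a)) \<noteq> 0"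
  proof (cases "i < k")
    case True
    obtain f where f: "f \<in> S (ew i)" "f u \<noteq> 0" "\<forall>v. (\<forall>j\<le>i. v j = u j) \<longrightarrow> f v = f u"
      using base_point_free[OF u_cox i(1)] by (elim bexE conjE)
    have "f (u(k := a)) = f u" for a
      by (rule f(3)[rule_format]) (use True in simp)
    then show ?thesis using f(1,2) by (intro bexI[of _ f]) auto
  next
    case False
    then have "u i = (0, 1)" using i by (intro u_gt) auto
    then show ?thesis using w_section[OF i(1)] i(2) by (intro bexI[of _ "\<lambda>u. snd (u i)"]) auto
  qed
  then obtain f where f: "f \<in> S (ew i)" "\<forall>a. a \<noteq> (0, 0) \<longrightarrow> f (u(k := a)) \<noteq> 0" by (elim bexE)
  note N = N_of_nonvanishing[OF f(1) f(2)[rule_format]]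
  from intersection_divisor[OF i(1) f(1) N(1)] N(2) show ?thesis by simp
qed

text \<open>\<open>w_k\<close> vanishes at a single point of the curve and is a local parameter
  there.\<close>

lemma intersection_gc_self:
  "intersection_number X (divisor_bundle X (bott_divisor c n k)) gc = 1"
proof -
  let ?w = "\<lambda>u::coords. snd (u k)"
  have w: "?w \<in> S (ew k)" by (rule w_section[OF k])
  define p where "p = bp (u(k := (1, 0)))"
  have p: "p \<in> gc" unfolding p_def gc_def by (rule CollectI, rule exI[of _ "(1, 0)"]) simp
  have mem: "bp (u(k := a)) = p" if "a \<noteq> (0, 0)" "snd a = 0" for a
  proof -
    \<comment> \<open>Scaling by \<open>t\<close> at \<open>k\<close> alone identifies all pairs
      \<open>(z, 0)\<close>; the twist it causes in the later \<open>z_i\<close> is invisible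
      because these are zero.\<close>
    define t where "t = (\<lambda>i. if i = k then fst a else 1 :: complex)"
    have fa: "fst a \<noteq> 0" using that by (auto simp: prod_eq_iff)
    then have nz: "nz t" by (simp add: nz_def t_def)
    have "act t (u(k := (1, 0))) i = (u(k := a)) i" if "i \<le> k" for i
    proof (cases "i \<in> {1..n}")
      case True
      have "(\<Prod>l\<in>{1..<i}. t l powi (c l i)) = 1" by (rule prod.neutral) (use that in \<open>auto simp: t_def\<close>)
      then have "fst (act t (u(k := (1, 0))) i) = fst ((u(k := a)) i)" "snd (act t (u(k := (1, 0))) i) = snd ((u(k := a)) i)"
        unfolding fst_act[OF True] snd_act[OF True] using \<open>snd a = 0\<close> by (auto simp: t_def)
      then show ?thesis by (simp add: prod_eq_iff)
    next
      case False
      then show ?thesis using cox_outside[OF u_cox False] k by (auto simp: torus_act_def)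
    qed
    moreover have "act t (u(k := (1, 0))) i = (u(k := a)) i" if "\<not> i \<le> k" for i
    proof (cases "i \<in> {1..n}")
      case True
      then have ui: "u i = (0, 1)" using that by (intro u_gt) auto
      have "fst (act t (u(k := (1, 0))) i) = 0" "snd (act t (u(k := (1, 0))) i) = 1"
        unfolding fst_act[OF True] snd_act[OF True] using ui that by (auto simp: t_def)
      then show ?thesis using ui that by (simp add: prod_eq_iff)
    next
      case False
      then show ?thesis using cox_outside[OF u_cox False] k that by (auto simp: torus_act_def)
    qed
    ultimately have "act t (u(k := (1, 0))) = u(k := a)" by (intro ext) blast
    then show ?thesis unfolding p_def using bp_act[OF nz, of "u(k := (1, 0))"] by simp
  qed
  have pw: "?w v = 0" if "v \<in> p" for v
    using S_zero_bp[OF w, of v "u(k := (1, 0))"] that unfolding p_def by simp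
  have Zw: "Zs ?w = {p}"
  proof (intro equalityI subsetI)
    fix x assume x: "x \<in> Zs ?w"
    then have "x \<in> gc" by (simp add: Zs_def)
    then obtain a where a: "a \<noteq> (0, 0)" "x = bp (u(k := a))" unfolding gc_def by blast
    have "u(k := a) \<in> x" unfolding a(2) by (rule bp_self[OF upd_cox[OF a(1)]])
    then have "?w (u(k := a)) = 0" using x unfolding Zs_def by blast
    then show "x \<in> {p}" using mem[OF a(1)] a(2) by simp
  next
    fix x assume "x \<in> {p}"
    then show "x \<in> Zs ?w" using p pw by (auto simp: Zs_def)
  qed
  have wz: "\<not> zeroC ?w"
  proof
    assume "zeroC ?w"
    moreover have "bp (gam \<sigma> 1) \<in> gc" by (rule gam_mem[OF \<sigma>_good])
    moreover have "gam \<sigma> 1 \<in> bp (gam \<sigma> 1)" by (rule bp_self[OF slice_cox[OF gam_slice[OF \<sigma>_good]]])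
    ultimately have "?w (gam \<sigma> 1) = 0" unfolding zeroC_def by blast
    then show False by (simp add: gam_def split: if_splits)
  qed
  have pc: "p \<in> chart (tc p)" by (rule tc_C[OF p])
  have wp: "?w (rep (tc p) p) = 0" by (rule pw[OF rep_mem[OF pc]])
  have "tc p k"
  proof (rule ccontr)
    assume "\<not> tc p k"
    moreover have "cc (tc p) k (rep (tc p) p) = 1" using rep_slice[OF pc] k unfolding slice_def by blast
    ultimately show False using wp by (simp add: cc_def)
  qed
  then have "loc p ?w = (\<lambda>y. co (tc p) (rep (tc p) y) - co (tc p) (rep (tc p) p))"
    using wp by (simp add: loc_def co_def)
  then have "ordp p ?w = 1" using local_parameter(3)[OF p] by (simp add: ordp_def PIs_def)
  then have "N ?w = 1" by (simp add: N_def Zw)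
  with intersection_divisor[OF k w wz] show ?thesis by simp
qed

end

section \<open>Curves not contained in the fibre\<close>

context bott
begin

text \<open>The equation of the fibre over the first pair of \<open>u0\<close>. It is homogeneous
  because \<open>z_1\<close> and \<open>w_1\<close> have the same weight.\<close>

definition fibre_form :: "coords \<Rightarrow> coords \<Rightarrow> complex" where
  "fibre_form u0 = (\<lambda>u. snd (u0 1) * fst (u 1) - fst (u0 1) * snd (u 1))"

lemma fibre_form_S: "fibre_form u0 \<in> S (ew 1)"
proof -
  have i: "1 \<in> {1..n}" using n_pos by simp
  have "S (\<lambda>j. ew 1 j - (if j < 1 then c j 1 else 0)) = S (ew 1)" by (rule S_cong) auto
  with z_section[OF i] have "(\<lambda>u. fst (u 1)) \<in> S (ew 1)" by simp
  from S_diff[OF S_scale[OF this] S_scale[OF w_section[OF i]]] show ?thesis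
    unfolding fibre_form_def .
qed

lemma closedin_zeros:
  assumes f: "f \<in> S \<beta>"
  shows "closedin (ftop X) {y \<in> pts X. \<forall>v\<in>y. f v = 0}" (is "closedin _ ?F")
proof -
  have "bp u \<in> pts X - ?F \<longleftrightarrow> f u \<noteq> 0" if u: "u \<in> cox_points n" for u
  proof
    show "f u \<noteq> 0" if "bp u \<in> pts X - ?F" using that S_zero_bp[OF f, of _ u] by blast
    show "bp u \<in> pts X - ?F" if "f u \<noteq> 0" using that bp_pts[OF u] bp_self[OF u] by blast
  qed
  then have "{u \<in> cox_points n. bp u \<in> pts X - ?F} = {u \<in> cox_points n. f u \<noteq> 0}" by blast
  then have "openin (ftop X) (pts X - ?F)" unfolding openin_X using openin_cox_points[OF S_poly[OF f]] by simp
  then show ?thesis by (simp add: closedin_def Collect_mono_iff)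
qed

text \<open>The tower of height one is the projective line, where orbits are pairs up to a scalar;
  proportionality is the vanishing of a determinant.\<close>

lemma fibre_iff:
  assumes u: "u \<in> cox_points n" and v: "v \<in> cox_points n"
  shows "bp v \<in> bott_fibre c n (bp u) \<longleftrightarrow> fibre_form u v = 0"
proof -
  interpret B: bott 1 c by unfold_locales auto
  have tr: "trunc_coords 1 u \<in> cox_points 1" "trunc_coords 1 v \<in> cox_points 1"
    using u v n_pos by (auto simp: trunc_coords_def cox_points_def)
  have nz: "u 1 \<noteq> (0, 0)" "v 1 \<noteq> (0, 0)" using u v n_pos by (auto simp: cox_points_def)
  have "bp v \<in> bott_fibre c n (bp u) \<longleftrightarrow> B.bp (trunc_coords 1 v) = B.bp (trunc_coords 1 u)"
    unfolding bott_fibre_def mem_Collect_eq bott_proj_bott_point[OF n_pos] using bp_pts[OF v] by blast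
  also have "\<dots> \<longleftrightarrow> trunc_coords 1 v \<in> B.bp (trunc_coords 1 u)"
    by (rule iffI, erule subst, rule B.bp_self[OF tr(2)], rule B.bp_mem)
  also have "\<dots> \<longleftrightarrow> (\<exists>s. s \<noteq> 0 \<and> v 1 = (s * fst (u 1), s * snd (u 1)))"
  proof
    assume "trunc_coords 1 v \<in> B.bp (trunc_coords 1 u)"
    then obtain t where t: "B.nz t" "trunc_coords 1 v = torus_act c 1 t (trunc_coords 1 u)"
      unfolding B.bp_iff by (elim exE conjE)
    have "v 1 = (t 1 * fst (u 1), t 1 * snd (u 1))"
      using fun_cong[OF t(2), of 1] by (simp add: trunc_coords_def torus_act_def)
    moreover have "t 1 \<noteq> 0" using t(1) unfolding B.nz_def by simp
    ultimately show "\<exists>s. s \<noteq> 0 \<and> v 1 = (s * fst (u 1), s * snd (u 1))" by (intro exI[of _ "t 1"] conjI)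
  next
    assume "\<exists>s. s \<noteq> 0 \<and> v 1 = (s * fst (u 1), s * snd (u 1))"
    then obtain s where s: "s \<noteq> 0" "v 1 = (s * fst (u 1), s * snd (u 1))" by (elim exE conjE)
    have "trunc_coords 1 v = torus_act c 1 (\<lambda>_. s) (trunc_coords 1 u)"
      using s by (auto simp: trunc_coords_def torus_act_def fun_eq_iff)
    moreover have "B.nz (\<lambda>_. s)" using s unfolding B.nz_def by simp
    ultimately show "trunc_coords 1 v \<in> B.bp (trunc_coords 1 u)" unfolding B.bp_iff by (intro exI conjI)
  qed
  also have "\<dots> \<longleftrightarrow> fibre_form u v = 0"
  proof
    assume "\<exists>s. s \<noteq> 0 \<and> v 1 = (s * fst (u 1), s * snd (u 1))"
    then show "fibre_form u v = 0" by (elim exE conjE) (simp add: fibre_form_def)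
  next
    assume f: "fibre_form u v = 0"
    show "\<exists>s. s \<noteq> 0 \<and> v 1 = (s * fst (u 1), s * snd (u 1))"
    proof (cases "fst (u 1) = 0")
      case True
      then have "snd (u 1) \<noteq> 0" using nz by (auto simp: prod_eq_iff)
      moreover from this have "fst (v 1) = 0" using f True by (simp add: fibre_form_def)
      ultimately show ?thesis using True nz
        by (intro exI[of _ "snd (v 1) / snd (u 1)"]) (auto simp: prod_eq_iff)
    next
      case False
      then have *: "snd (v 1) = fst (v 1) / fst (u 1) * snd (u 1)"
        using f by (simp add: fibre_form_def field_simps)
      then have "fst (v 1) \<noteq> 0" using nz by (auto simp: prod_eq_iff)
      then show ?thesis using False *
        by (intro exI[of _ "fst (v 1) / fst (u 1)"]) (auto simp: prod_eq_iff)
    qed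
  qed
  finally show ?thesis .
qed

lemma fibre_eq_zeros:
  assumes u: "u \<in> cox_points n"
  shows "bott_fibre c n (bp u) = {y \<in> pts X. \<forall>v\<in>y. fibre_form u v = 0}"
proof (intro equalityI subsetI)
  fix y assume y: "y \<in> bott_fibre c n (bp u)"
  then have yp: "y \<in> pts X" by (simp add: bott_fibre_def)
  have "fibre_form u v = 0" if "v \<in> y" for v
    using pts_mem[OF yp that] y fibre_iff[OF u] by blast
  with yp show "y \<in> {y \<in> pts X. \<forall>v\<in>y. fibre_form u v = 0}" by blast
next
  fix y assume y: "y \<in> {y \<in> pts X. \<forall>v\<in>y. fibre_form u v = 0}"
  then obtain v where v: "v \<in> cox_points n" "y = bp v" using ptsE by blast
  then show "y \<in> bott_fibre c n (bp u)" using y fibre_iff[OF u v(1)] bp_self[OF v(1)] by blast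
qed

text \<open>Where \<open>z_i\<close> vanishes, \<open>w_i\<close> is nonzero and can be scaled to 1
  by its own torus entry.\<close>

lemma normalised_rep:
  assumes x: "x \<in> pts X" and z: "\<And>i v. i \<in> {k<..n} \<Longrightarrow> v \<in> x \<Longrightarrow> fst (v i) = 0"
  obtains u where "u \<in> cox_points n" "x = bp u" "\<forall>i\<in>{1..n}. k < i \<longrightarrow> u i = (0, 1)"
proof -
  obtain v where v: "v \<in> cox_points n" "x = bp v" using ptsE[OF x] .
  have vx: "v \<in> x" unfolding v(2) by (rule bp_self[OF v(1)])
  have sv: "snd (v i) \<noteq> 0" if "i \<in> {1..n}" "k < i" for i
    using v(1) that z[OF _ vx, of i] by (auto simp: cox_points_def prod_eq_iff)
  define t where "t = (\<lambda>i. if i \<in> {1..n} \<and> k < i then 1 / snd (v i) else 1)"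
  have t: "nz t" using sv by (auto simp: nz_def t_def)
  have "act t v i = (0, 1)" if i: "i \<in> {1..n}" "k < i" for i
  proof -
    have "fst (v i) = 0" using z[OF _ vx, of i] i by simp
    then have "fst (act t v i) = 0" using fst_act_eq_0[OF t i(1)] by simp
    moreover have "snd (act t v i) = 1" unfolding snd_act[OF i(1)] using sv[OF i] i by (simp add: t_def)
    ultimately show ?thesis by (simp add: prod_eq_iff)
  qed
  moreover have "bp (act t v) = x" using bp_act[OF t] v(2) by simp
  ultimately show thesis using that[of "act t v"] act_cox[OF v(1) t] by blast
qed

end

context bott_curve
begin

lemma intersection_nonneg:
  assumes i: "i \<in> {1..n}"
  shows "0 \<le> intersection_number X (divisor_bundle X (bott_divisor c n i)) C"
proof -
  obtain x where x: "x \<in> C" using Z_ne by blast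
  let ?u = "rep (tc x) x"
  have u: "?u \<in> cox_points n" "?u \<in> x" using rep_cox rep_mem tc_C[OF x] by auto
  obtain f where f: "f \<in> S (ew i)" "f ?u \<noteq> 0" using base_point_free[OF u(1) i] by (elim bexE conjE)
  have "\<not> zeroC f" unfolding zeroC_def using x u(2) f(2) by blast
  from intersection_divisor[OF i f(1) this] show ?thesis by simp
qed

text \<open>The product of \<open>z_k\<close> with forms of lower weights, chosen nonzero at one
  common point of \<open>C\<close>, has the weight of \<open>w_k\<close> and contains a form of the
  weight of \<open>w_1\<close> as a factor.\<close>

lemma intersection_first_le:
  assumes k: "k \<in> {2..n}" and z: "\<not> zeroC (\<lambda>u. fst (u k))"
  shows "intersection_number X (divisor_bundle X (bott_divisor c n 1)) C
    \<le> intersection_number X (divisor_bundle X (bott_divisor c n k)) C"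
proof -
  have k1: "k \<in> {1..n}" "1 \<in> {1..n}" using k by auto
  obtain x u where xu: "x \<in> C" "u \<in> x" "fst (u k) \<noteq> 0" using z unfolding zeroC_def by blast
  have u: "u \<in> cox_points n" using pts_mem[OF _ xu(2)] xu(1) Z_pts by blast
  have nzC: "\<not> zeroC f" if "f u \<noteq> 0" for f using that xu unfolding zeroC_def by blast
  have "\<forall>l\<in>{1..<k}. \<exists>f. f \<in> S (ew l) \<and> f u \<noteq> 0"
  proof
    fix l assume "l \<in> {1..<k}"
    then have "l \<in> {1..n}" using k by auto
    from base_point_free[OF u this] show "\<exists>f. f \<in> S (ew l) \<and> f u \<noteq> 0" by (elim bexE conjE, intro exI conjI)
  qed
  then obtain f where f: "\<forall>l\<in>{1..<k}. f l \<in> S (ew l) \<and> f l u \<noteq> 0" unfolding bchoice_iff by (elim exE)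
  have fS: "f l \<in> S (ew l)" and fu: "f l u \<noteq> 0" if "l \<in> {1..<k}" for l using bspec[OF f that] by auto
  have one: "1 \<in> {1..<k}" using k by simp
  define g where "g = (\<lambda>u. fst (u k) * (\<Prod>l\<in>{1..<k}. f l u ^ nat (c l k)))"
  \<comment> \<open>The cofactor of \<open>f 1\<close> in \<open>g\<close>; the exponent of
    \<open>f 1\<close> drops by one, which is possible since \<open>c 1 k\<close> is
    positive.\<close>
  define r where "r = (\<lambda>u. fst (u k) * (f 1 u ^ (nat (c 1 k) - 1) * (\<Prod>l\<in>{2..<k}. f l u ^ nat (c l k))))"
  have gS: "g \<in> S (ew k)" unfolding g_def by (rule z_times_section[OF k1(1) fS])
  have "(\<lambda>u. \<Prod>l\<in>{2..<k}. f l u ^ nat (c l k)) \<in> S (\<lambda>j. \<Sum>l\<in>{2..<k}. int (nat (c l k)) * ew l j)"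
    by (rule S_prod[where \<alpha> = "\<lambda>l j. int (nat (c l k)) * ew l j"], rule finite_atLeastLessThan, rule S_power[OF fS]) auto
  from S_mult[OF z_section[OF k1(1)] S_mult[OF S_power[OF fS[OF one], of "nat (c 1 k) - 1"] this]]
  have rS: "r \<in> S (\<lambda>j. ew k j - (if j < k then c j k else 0) +
      (int (nat (c 1 k) - 1) * ew 1 j + (\<Sum>l\<in>{2..<k}. int (nat (c l k)) * ew l j)))"
    unfolding r_def .
  have c1: "0 < c 1 k" using k by (intro c_pos) auto
  then obtain m where m: "nat (c 1 k) = Suc m" by (cases "nat (c 1 k)") auto
  have ins: "{1..<k} = insert 1 {2..<k}" using k by auto
  have gr: "g = (\<lambda>u. f 1 u * r u)"
  proof
    fix u
    have "(\<Prod>l\<in>{1..<k}. f l u ^ nat (c l k)) = f 1 u ^ nat (c 1 k) * (\<Prod>l\<in>{2..<k}. f l u ^ nat (c l k))"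
      unfolding ins by (rule prod.insert) auto
    moreover have "f 1 u ^ nat (c 1 k) = f 1 u * f 1 u ^ (nat (c 1 k) - 1)" unfolding m by simp
    ultimately show "g u = f 1 u * r u" unfolding g_def r_def by (simp only: mult_ac)
  qed
  have "(\<Prod>l\<in>{1..<k}. f l u ^ nat (c l k)) \<noteq> 0" using fu by simp
  then have "g u \<noteq> 0" using xu(3) unfolding g_def by simp
  moreover from this have "r u \<noteq> 0" unfolding gr by simp
  ultimately have "N g = N (f 1) + N r"
    unfolding gr using N_mult[OF fS[OF one] rS nzC[of "f 1", OF fu[OF one]] nzC[of r]] by simp
  then show ?thesis
    using intersection_divisor[OF k1(1) gS nzC[of g, OF \<open>g u \<noteq> 0\<close>]]
      intersection_divisor[OF k1(2) fS[OF one] nzC[of "f 1", OF fu[OF one]]] by simp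
qed

text \<open>The equation of the fibre is a nonzero element of the maximal ideal at \<open>x\<close>.
  Its order there bounds the multiplicity, and that order is one of the nonnegative summands of
  \<open>D_1 . C\<close>.\<close>

lemma mult_le_intersection_first:
  assumes x: "x \<in> C" "u0 \<in> x" and nz: "\<not> zeroC (fibre_form u0)"
  shows "1 \<le> mult_at X C x"
    and "mult_at X C x \<le> real_of_int (intersection_number X (divisor_bundle X (bott_divisor c n 1)) C)"
proof -
  interpret P: local_curve Y x "C \<inter> chart (tc x)" "A (tc x)" by (rule local_curve_p[OF x(1)])
  let ?f = "fibre_form u0"
  note fS = fibre_form_S[of u0]
  have "?f u0 = 0" by (simp add: fibre_form_def)
  then have "?f (rep (tc x) x) = 0" using S_zero_rep[OF fS tc_C[OF x(1)] x(2)] by simp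
  then have l0: "loc x ?f x = 0" by (simp add: loc_def)
  then have mm: "loc x ?f \<in> max_ideal Y x" using loc_stalk[OF x(1) S_poly[OF fS]] by (simp add: P.mm_iff)
  have gz: "\<not> germ_eq Y x (loc x ?f) (\<lambda>_. 0)" using germ_loc[OF x(1) fS] nz by simp
  have b: "\<And>k. k \<le> colength Y x (P.MP k)" "\<And>k. colength Y x (P.MP k) \<le> k * ordp x ?f"
    using P.colength_MP_ge[OF mm gz] P.colength_MP_le[OF mm gz] by (auto simp: ordp_def PIs_def)
  note lim = limsup_ratio_bounds[OF b]
  show "1 \<le> mult_at X C x" unfolding mult_at_def by (rule lim(1))
  have "x \<in> Zs ?f" using Zs_iff[OF fS x(1)] l0 by simp
  then have "ordp x ?f \<le> N ?f" unfolding N_def by (rule member_le_sum) (auto intro: finite_Zs[OF fS nz])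
  moreover have "intersection_number X (divisor_bundle X (bott_divisor c n 1)) C = int (N ?f)"
    by (rule intersection_divisor[OF _ fS nz]) (use n_pos in simp)
  moreover have "mult_at X C x \<le> real (ordp x ?f)" unfolding mult_at_def by (rule lim(2))
  ultimately show "mult_at X C x \<le> real_of_int (intersection_number X (divisor_bundle X (bott_divisor c n 1)) C)"
    by simp
qed

end

section \<open>Curves in a closed subspace\<close>

lemma irreducible_closed_subtopology_iff:
  assumes "closedin T Z"
  shows "irreducible_closed (subtopology T Z) A \<longleftrightarrow> irreducible_closed T A \<and> A \<subseteq> Z"
  using irreducible_closed_of_subtopology[OF _ assms] irreducible_closed_subtopology[OF _ _ assms] by blast

lemma is_curve_subspace:
  assumes "closedin (ftop X) F"
  shows "is_curve (subspace_of X F) C \<longleftrightarrow> is_curve X C \<and> C \<subseteq> F"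
proof -
  have "subtopology (subtopology (ftop X) F) C = subtopology (ftop X) C" if "C \<subseteq> F"
    using that by (simp add: subtopology_subtopology Int_absorb1)
  then show ?thesis unfolding is_curve_def subspace_of_def using irreducible_closed_subtopology_iff[OF assms] by auto
qed

text \<open>The curve as a subspace of the fibre and as a subspace of \<open>X\<close>. Regular
  functions are compared only on subsets of the space, which is all that local rings, orders and
  degrees see.\<close>

locale same_fspace =
  fixes T T' :: "'a fspace"
  assumes ftop_eq: "ftop T' = ftop T" and reg_eq: "V \<subseteq> pts T \<Longrightarrow> reg T' V = reg T V"
begin

lemma germ_eq_eq: "germ_eq T' = germ_eq T"
  by (simp add: germ_eq_def fun_eq_iff ftop_eq)

lemma reg_open: "openin (ftop T) U \<Longrightarrow> reg T' U = reg T U"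
  by (rule reg_eq) (rule openin_subset)

lemma stalk_eq: "stalk T' p = stalk T p"
  unfolding stalk_def ftop_eq using reg_open by auto

lemma max_ideal_power_eq: "max_ideal_power T' p k = max_ideal_power T p k"
  by (induction k) (simp_all add: stalk_eq max_ideal_def)

lemma principal_ideal_eq: "principal_ideal T' p f = principal_ideal T p f"
  by (simp add: principal_ideal_def stalk_eq germ_eq_eq)

lemma colength_eq: "colength T' p J = colength T p J"
  by (simp add: colength_def stalk_eq)

lemma order_at_eq: "order_at T' p W h = order_at T p W h"
  unfolding order_at_def ftop_eq germ_eq_eq colength_eq principal_ideal_eq
  using reg_open by (simp cong: conj_cong)

lemma rational_section_eq: "rational_section T' L W s \<longleftrightarrow> rational_section T L W s"
proof (cases "openin (ftop T) W")
  case True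
  have r: "reg T' (W \<inter> V) = reg T (W \<inter> V)" for V
    by (rule reg_eq) (use openin_subset[OF True] in blast)
  show ?thesis unfolding rational_section_def ftop_eq r by (rule refl)
qed (simp add: rational_section_def ftop_eq)

lemma degree_of_eq: "degree_of T' L = degree_of T L"
  unfolding degree_of_def rational_section_eq order_at_eq ftop_eq by (rule refl)

end

lemma same_fspace_subspace_subspace:
  assumes CF: "C \<subseteq> F" and restr: "\<And>f U V. f \<in> reg X U \<Longrightarrow> V \<subseteq> U \<Longrightarrow> f \<in> reg X V"
  shows "same_fspace (subspace_of X C) (subspace_of (subspace_of X F) C)"
proof
  have FC: "F \<inter> C = C" using CF by blast
  show "ftop (subspace_of (subspace_of X F) C) = ftop (subspace_of X C)"
    unfolding subspace_of_def by (simp add: subtopology_subtopology FC)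
  fix V assume "V \<subseteq> pts (subspace_of X C)"
  then have VF: "V \<subseteq> F" using CF by (auto simp: subspace_of_def)
  have regF: "h \<in> reg (subspace_of X F) U \<longleftrightarrow>
      (\<forall>p\<in>U. \<exists>W g. openin (ftop X) W \<and> p \<in> W \<and> g \<in> reg X W \<and> (\<forall>y\<in>W \<inter> U. h y = g y))" for h U
    by (simp add: subspace_of_def)
  have "(\<exists>U h. openin (subtopology (ftop X) F) U \<and> p \<in> U \<and> h \<in> reg (subspace_of X F) U \<and> (\<forall>y\<in>U \<inter> V. f y = h y))
    \<longleftrightarrow> (\<exists>U h. openin (ftop X) U \<and> p \<in> U \<and> h \<in> reg X U \<and> (\<forall>y\<in>U \<inter> V. f y = h y))" (is "?L \<longleftrightarrow> ?R")
    if p: "p \<in> V" for f p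
  proof
    assume ?L
    then obtain U h where U: "openin (subtopology (ftop X) F) U" "p \<in> U" "h \<in> reg (subspace_of X F) U"
      "\<forall>y\<in>U \<inter> V. f y = h y" by (elim exE conjE)
    obtain T where T: "openin (ftop X) T" "U = T \<inter> F" using U(1) unfolding openin_subtopology by (elim exE conjE)
    from bspec[OF U(3)[unfolded regF] U(2)] obtain W g where W: "openin (ftop X) W" "p \<in> W" "g \<in> reg X W"
      "\<forall>y\<in>W \<inter> U. h y = g y" by (elim exE conjE)
    \<comment> \<open>A function regular on the fibre is locally induced from \<open>X\<close>; it
      is shrunk to the intersection of both neighbourhoods.\<close>
    have "g \<in> reg X (T \<inter> W)" by (rule restr[OF W(3)]) simp
    moreover have "\<forall>y\<in>T \<inter> W \<inter> V. f y = g y"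
    proof
      fix y assume "y \<in> T \<inter> W \<inter> V"
      then have "y \<in> U \<inter> V" "y \<in> W \<inter> U" using T(2) VF by auto
      with U(4) W(4) show "f y = g y" by simp
    qed
    ultimately show ?R using openin_Int[OF T(1) W(1)] U(2) W(2) T(2)
      by (intro exI[of _ "T \<inter> W"] exI[of _ g] conjI) auto
  next
    assume ?R
    then obtain U h where U: "openin (ftop X) U" "p \<in> U" "h \<in> reg X U" "\<forall>y\<in>U \<inter> V. f y = h y"
      by (elim exE conjE)
    have "h \<in> reg (subspace_of X F) (U \<inter> F)" unfolding regF
    proof
      fix q assume "q \<in> U \<inter> F"
      then show "\<exists>W g. openin (ftop X) W \<and> q \<in> W \<and> g \<in> reg X W \<and> (\<forall>y\<in>W \<inter> (U \<inter> F). h y = g y)"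
        by (intro exI[of _ U] exI[of _ h] conjI U ballI refl) blast
    qed
    moreover have "openin (subtopology (ftop X) F) (U \<inter> F)" using U(1) by (rule openin_subtopology_Int)
    ultimately show ?L using U p VF by (intro exI[of _ "U \<inter> F"] exI[of _ h] conjI) auto
  qed
  then show "reg (subspace_of (subspace_of X F) C) V = reg (subspace_of X C) V"
    unfolding subspace_of_def by (auto simp: subspace_of_def)
qed

context bott
begin

lemma subspace_curve:
  assumes "C \<subseteq> F"
  shows "intersection_number (subspace_of X F) (restrict_bundle L F) C = intersection_number X L C"
    and "mult_at (subspace_of X F) C p = mult_at X C p"
proof -
  interpret same_fspace "subspace_of X C" "subspace_of (subspace_of X F) C"
    by (rule same_fspace_subspace_subspace[OF assms]) (rule reg_cong, assumption+, rule refl)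
  have "restrict_bundle (restrict_bundle L F) C = restrict_bundle L C"
    using assms by (auto simp: restrict_bundle_def fun_eq_iff)
  then show "intersection_number (subspace_of X F) (restrict_bundle L F) C = intersection_number X L C"
    unfolding intersection_number_def by (simp add: degree_of_eq)
  show "mult_at (subspace_of X F) C p = mult_at X C p"
    unfolding mult_at_def colength_eq max_ideal_power_eq by (rule refl)
qed

end


context bott_gc
begin

lemma bp_in_gc: "bp u \<in> gc"
proof -
  have "u k \<noteq> (0, 0)" using u_cox k by (auto simp: cox_points_def)
  then show ?thesis unfolding gc_def by (intro CollectI exI[of _ "u k"] conjI) simp
qed

lemma intersection_gc:
  assumes "num_equiv_divisor X L {1..n} a (bott_divisor c n)"
  shows "intersection_number X L gc = a k"
proof -
  have "intersection_number X L gc = (\<Sum>i\<in>{1..n}. a i * intersection_number X (divisor_bundle X (bott_divisor c n i)) gc)"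
    using assms gc_curve unfolding num_equiv_divisor_def by (elim allE impE)
  also have "\<dots> = (\<Sum>i\<in>{1..n}. if i = k then a k else 0)"
    by (rule sum.cong) (use intersection_gc_self intersection_gc_other in auto)
  finally show ?thesis using k by simp
qed

lemma gc_fibre:
  assumes "2 \<le> k"
  shows "gc \<subseteq> bott_fibre c n (bp u)"
proof
  fix y assume "y \<in> gc"
  then obtain a where a: "y = bp (u(k := a))" "a \<noteq> (0, 0)" unfolding gc_def mem_Collect_eq by (elim exE conjE)
  have "fibre_form u (u(k := a)) = 0" using assms by (simp add: fibre_form_def)
  then show "y \<in> bott_fibre c n (bp u)" unfolding a(1) fibre_iff[OF u_cox upd_cox[OF a(2)]] .
qed

lemma gc_eq_Gamma:
  assumes k1: "k = 1"
  shows "gc = bott_Gamma c n"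
proof (intro equalityI subsetI)
  fix y assume "y \<in> gc"
  then obtain a where a: "y = bp (u(k := a))" "a \<noteq> (0, 0)" unfolding gc_def mem_Collect_eq by (elim exE conjE)
  show "y \<in> bott_Gamma c n" unfolding bott_Gamma_def
    by (intro CollectI exI[of _ "u(k := a)"] conjI a(1) upd_cox[OF a(2)]) (use u_gt k1 in auto)
next
  fix y assume "y \<in> bott_Gamma c n"
  then obtain v where v: "y = bp v" "v \<in> cox_points n" "\<forall>i\<in>{2..n}. v i = (0, 1)"
    unfolding bott_Gamma_def mem_Collect_eq by (elim exE conjE)
  have "v i = (u(k := v 1)) i" for i
  proof (cases "i \<in> {1..n}")
    case True
    then show ?thesis using v(3) u_gt[of i] k1 by (cases "i = 1") auto
  next
    case False
    then show ?thesis using cox_outside[OF v(2) False] cox_outside[OF u_cox False] k k1 by auto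
  qed
  then have "v = u(k := v 1)" by (rule ext)
  moreover have "v 1 \<noteq> (0, 0)" using v(2) n_pos by (auto simp: cox_points_def)
  ultimately show "y \<in> gc" unfolding gc_def v(1) by (intro CollectI exI[of _ "v 1"] conjI) simp_all
qed

end

section \<open>Seshadri constants\<close>

locale bott_nef = bott +
  fixes L :: "coords set line_bundle_data" and a :: "nat \<Rightarrow> int"
  assumes nef: "nef X L" and num: "num_equiv_divisor X L {1..n} a (bott_divisor c n)"
begin

abbreviation ratio :: "coords set \<Rightarrow> coords set set \<Rightarrow> real" where
  "ratio x C \<equiv> real_of_int (intersection_number X L C) / mult_at X C x"

lemma ratio_nonneg: "is_curve X C \<Longrightarrow> 0 \<le> ratio x C"
  using nef mult_at_nonneg[of X C x] by (simp add: nef_def)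

text \<open>The curve \<open>gc\<close> meets only \<open>D_k\<close>, once, and is smooth, so its
  ratio is \<open>a k\<close>; nefness tested on it gives the sign of \<open>a k\<close>.\<close>

lemma coordinate_curve:
  assumes u: "u \<in> cox_points n" and k: "k \<in> {1..n}" and u_gt: "\<forall>i\<in>{1..n}. k < i \<longrightarrow> u i = (0, 1)"
  obtains G where "is_curve X G" "bp u \<in> G" "ratio (bp u) G = real_of_int (a k)"
    "0 \<le> a k" "2 \<le> k \<longrightarrow> G \<subseteq> bott_fibre c n (bp u)" "k = 1 \<longrightarrow> G = bott_Gamma c n"
proof -
  interpret G: bott_gc n c u k by unfold_locales (use u k u_gt in auto)
  have "0 \<le> a k" using nef G.gc_curve G.intersection_gc[OF num] by (auto simp: nef_def)
  moreover have "ratio (bp u) G.gc = real_of_int (a k)"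
    using G.intersection_gc[OF num] G.mult_gc[OF G.bp_in_gc] by simp
  ultimately show thesis using that[of G.gc] G.gc_curve G.bp_in_gc G.gc_fibre G.gc_eq_Gamma by blast
qed

lemma coefficient_nonneg:
  assumes k: "k \<in> {1..n}"
  shows "0 \<le> a k"
proof -
  \<comment> \<open>The point with all pairs \<open>(0, 1)\<close> satisfies the condition on the
    later pairs for every \<open>k\<close>.\<close>
  let ?u = "\<lambda>i. if i \<in> {1..n} then (0, 1) else (0, 0) :: complex \<times> complex"
  have "?u \<in> cox_points n" by (simp add: cox_points_def)
  then show ?thesis by (rule coordinate_curve[OF _ k]) auto
qed

lemma Gamma_curve: "is_curve X (bott_Gamma c n)"
proof -
  let ?u = "\<lambda>i. if i \<in> {1..n} then (0, 1) else (0, 0) :: complex \<times> complex"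
  have "?u \<in> cox_points n" by (simp add: cox_points_def)
  then show ?thesis by (rule coordinate_curve[of ?u 1]) (use n_pos in auto)
qed

lemma ratio_Gamma:
  assumes x: "x \<in> bott_Gamma c n"
  shows "ratio x (bott_Gamma c n) = real_of_int (a 1)"
proof -
  obtain u where u: "x = bp u" "u \<in> cox_points n" "\<forall>i\<in>{2..n}. u i = (0, 1)"
    using x unfolding bott_Gamma_def mem_Collect_eq by (elim exE conjE)
  show ?thesis unfolding u(1)
    by (rule coordinate_curve[OF u(2), of 1]) (use n_pos u(3) in auto)
qed

text \<open>Such a curve is contained in \<open>bott_Gamma\<close>, and a curve contains no other
  curve.\<close>

lemma curve_eq_Gamma:
  assumes C: "is_curve X C" and z: "\<And>y v i. y \<in> C \<Longrightarrow> v \<in> y \<Longrightarrow> i \<in> {2..n} \<Longrightarrow> fst (v i) = 0"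
  shows "C = bott_Gamma c n"
proof (rule curve_subset_eq[OF Gamma_curve C], rule subsetI)
  fix y assume y: "y \<in> C"
  interpret bott_curve n c C by unfold_locales (rule C)
  have yp: "y \<in> pts X" using y Z_pts by blast
  obtain v where v: "v \<in> cox_points n" "y = bp v" "\<forall>i\<in>{1..n}. 1 < i \<longrightarrow> v i = (0, 1)"
    by (rule normalised_rep[OF yp, of 1]) (use z[OF y] in auto)
  show "y \<in> bott_Gamma c n" unfolding bott_Gamma_def
    by (intro CollectI exI[of _ v] conjI v(1,2)) (use v(3) in auto)
qed

lemma ratio_outside_fibre:
  assumes C: "is_curve X C" "x \<in> C" and out: "\<not> C \<subseteq> bott_fibre c n x" and ne: "C \<noteq> bott_Gamma c n"
  obtains G where "is_curve X G" "x \<in> G" "G \<subseteq> bott_fibre c n x" "ratio x G \<le> ratio x C"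
proof -
  interpret bott_curve n c C by unfold_locales (rule C)
  have xp: "x \<in> pts X" using C(2) Z_pts by blast
  define K where "K = {k \<in> {2..n}. \<not> zeroC (\<lambda>u. fst (u k))}"
  have K: "finite K" "K \<noteq> {}"
  proof -
    show "K \<noteq> {}"
    proof
      assume "K = {}"
      then have "zeroC (\<lambda>u. fst (u i))" if "i \<in> {2..n}" for i using that unfolding K_def by blast
      then have "C = bott_Gamma c n" by (intro curve_eq_Gamma[OF C(1)]) (simp add: zeroC_def)
      with ne show False by simp
    qed
  qed (simp add: K_def)
  define k where "k = Max K"
  have "k \<in> K" unfolding k_def by (rule Max_in[OF K])
  then have k: "k \<in> {2..n}" "k \<in> {1..n}" and zk: "\<not> zeroC (\<lambda>u. fst (u k))" by (auto simp: K_def)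
  have z: "zeroC (\<lambda>u. fst (u i))" if "i \<in> {k<..n}" for i
  proof (rule ccontr)
    assume "\<not> zeroC (\<lambda>u. fst (u i))"
    then have "i \<in> K" using that k by (auto simp: K_def)
    from Max_ge[OF K(1) this] show False using that by (simp add: k_def)
  qed
  obtain u where u: "u \<in> cox_points n" "x = bp u" "\<forall>i\<in>{1..n}. k < i \<longrightarrow> u i = (0, 1)"
    by (rule normalised_rep[OF xp, of k]) (use z C(2) in \<open>auto simp: zeroC_def\<close>)
  obtain G where G: "is_curve X G" "x \<in> G" "ratio x G = real_of_int (a k)" "G \<subseteq> bott_fibre c n x"
    by (rule coordinate_curve[OF u(1) k(2) u(3)]) (use k(1) u(2) in auto)
  have ux: "u \<in> x" unfolding u(2) by (rule bp_self[OF u(1)])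
  \<comment> \<open>Vanishing of this form on \<open>C\<close> would mean that \<open>C\<close> lies
    in the fibre.\<close>
  have "\<not> zeroC (fibre_form u)"
    using out Z_pts unfolding u(2) fibre_eq_zeros[OF u(1)] zeroC_def by blast
  note m = mult_le_intersection_first[OF C(2) ux this]
  define D where "D = (\<lambda>i. intersection_number X (divisor_bundle X (bott_divisor c n i)) C)"
  have "a k * D k \<le> (\<Sum>i\<in>{1..n}. a i * D i)"
    by (rule member_le_sum[OF k(2)])
      (use coefficient_nonneg intersection_nonneg in \<open>auto simp: D_def intro!: mult_nonneg_nonneg\<close>)
  also have "\<dots> = intersection_number X L C"
    using num C(1) unfolding num_equiv_divisor_def D_def by simp
  finally have "a k * D k \<le> intersection_number X L C" .
  moreover have "a k * D 1 \<le> a k * D k"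
    unfolding D_def by (intro mult_left_mono intersection_first_le[OF k(1) zk] coefficient_nonneg[OF k(2)])
  ultimately have "real_of_int (a k) * real_of_int (D 1) \<le> real_of_int (intersection_number X L C)"
    by (metis of_int_le_iff of_int_mult order_trans)
  moreover have "real_of_int (a k) * mult_at X C x \<le> real_of_int (a k) * real_of_int (D 1)"
    using m(2) coefficient_nonneg[OF k(2)] unfolding D_def by (intro mult_left_mono) auto
  ultimately have "real_of_int (a k) \<le> ratio x C" using m(1) by (simp add: pos_le_divide_eq)
  then have "ratio x G \<le> ratio x C" unfolding G(3) .
  with G show thesis by (intro that)
qed

text \<open>The fibre is closed, so its curves are the curves of \<open>X\<close> inside it, with
  the same degrees and multiplicities; both constants become infima of one ratio over nested
  families.\<close>

lemma seshadri_fibre: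
  assumes x: "x \<in> pts X"
  defines "F \<equiv> bott_fibre c n x"
  shows "seshadri (subspace_of X F) (restrict_bundle L F) x = Inf {ratio x C |C. is_curve X C \<and> C \<subseteq> F \<and> x \<in> C}"
proof -
  obtain u where u: "u \<in> cox_points n" "x = bp u" using ptsE[OF x] .
  have "closedin (ftop X) F"
    unfolding F_def u(2) fibre_eq_zeros[OF u(1)] by (rule closedin_zeros[OF fibre_form_S])
  note cs = is_curve_subspace[OF this]
  have "(r = real_of_int (intersection_number (subspace_of X F) (restrict_bundle L F) C) / mult_at (subspace_of X F) C x \<and>
      is_curve (subspace_of X F) C \<and> x \<in> C) = (r = ratio x C \<and> is_curve X C \<and> C \<subseteq> F \<and> x \<in> C)" for r C
    unfolding cs by (cases "C \<subseteq> F") (auto simp: subspace_curve)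
  then show ?thesis unfolding seshadri_def by (simp only:)
qed

text \<open>There is only one curve, so the infimum is over a single value.\<close>

lemma seshadri_height_one:
  assumes n1: "n = 1" and x: "x \<in> pts X"
  shows "seshadri X L x = real_of_int (a 1)"
proof -
  have eq: "C = bott_Gamma c n" if "is_curve X C" for C
    by (rule curve_eq_Gamma[OF that]) (use n1 in simp)
  obtain u where u: "u \<in> cox_points n" "x = bp u" using ptsE[OF x] .
  have "x \<in> bott_Gamma c n" unfolding bott_Gamma_def using u n1 by auto
  with eq Gamma_curve have "is_curve X C \<and> x \<in> C \<longleftrightarrow> C = bott_Gamma c n" for C by metis
  moreover note ratio_Gamma[OF \<open>x \<in> bott_Gamma c n\<close>]
  ultimately have "{ratio x C |C. is_curve X C \<and> x \<in> C} = {real_of_int (a 1)}" by simp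
  then show ?thesis unfolding seshadri_def by simp
qed

lemma seshadri_height_ge_two:
  assumes n2: "2 \<le> n" and x: "x \<in> pts X"
  defines "eF \<equiv> Inf {ratio x C |C. is_curve X C \<and> C \<subseteq> bott_fibre c n x \<and> x \<in> C}"
  shows "seshadri X L x = (if x \<in> bott_Gamma c n then min (real_of_int (a 1)) eF else eF)"
proof -
  let ?F = "bott_fibre c n x" and ?\<Gamma> = "bott_Gamma c n"
  define B where "B = {ratio x C |C. is_curve X C \<and> C \<subseteq> ?F \<and> x \<in> C}"
  define B' where "B' = {ratio x C |C. is_curve X C \<and> x \<in> C}"
  have eF: "eF = Inf B" by (simp add: eF_def B_def)
  have sX: "seshadri X L x = Inf B'" by (simp add: seshadri_def B'_def)
  have BB': "B \<subseteq> B'" unfolding B_def B'_def by blast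
  \<comment> \<open>Nefness bounds the ratios below by 0, without which the real infimum would carry
    no information.\<close>
  have bdd: "bdd_below B'" by (rule bdd_belowI[of _ 0]) (auto simp: B'_def intro: ratio_nonneg)
  then have bddB: "bdd_below B" by (rule bdd_below_mono) (rule BB')
  have lowerF: "eF \<le> ratio x C" if "is_curve X C" "C \<subseteq> ?F" "x \<in> C" for C
    unfolding eF by (rule cInf_lower[OF _ bddB]) (use that in \<open>auto simp: B_def\<close>)
  have lower: "eF \<le> ratio x C" if C: "is_curve X C" "x \<in> C" "C \<noteq> ?\<Gamma>" for C
  proof (cases "C \<subseteq> ?F")
    case False
    obtain G where G: "is_curve X G" "x \<in> G" "G \<subseteq> ?F" "ratio x G \<le> ratio x C"
      by (rule ratio_outside_fibre[OF C(1,2) False C(3)])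
    show ?thesis using lowerF[OF G(1,3,2)] G(4) by simp
  qed (rule lowerF[OF C(1) _ C(2)])
  obtain u where u: "u \<in> cox_points n" "x = bp u" using ptsE[OF x] .
  \<comment> \<open>The fibre of the last projection through \<open>x\<close> lies in the fibre over
    the first factor, so the smaller infimum is over a nonempty set.\<close>
  obtain G where G: "is_curve X G" "x \<in> G" "G \<subseteq> ?F"
    by (rule coordinate_curve[OF u(1), of n]) (use n2 u(2) in auto)
  have Bne: "B \<noteq> {}" unfolding B_def using G by blast
  then have B'ne: "B' \<noteq> {}" using BB' by blast
  have le: "Inf B' \<le> eF" unfolding eF by (rule cInf_superset_mono[OF Bne bdd BB'])
  show ?thesis
  proof (cases "x \<in> ?\<Gamma>")
    case True
    have "real_of_int (a 1) \<in> B'" unfolding B'_def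
      using Gamma_curve True ratio_Gamma[OF True] by (intro CollectI exI[of _ ?\<Gamma>]) simp
    then have "Inf B' \<le> real_of_int (a 1)" by (rule cInf_lower[OF _ bdd])
    moreover have "min (real_of_int (a 1)) eF \<le> Inf B'"
    proof (rule cInf_greatest[OF B'ne])
      fix r assume "r \<in> B'"
      then obtain C where C: "r = ratio x C" "is_curve X C" "x \<in> C" unfolding B'_def mem_Collect_eq by (elim exE conjE)
      show "min (real_of_int (a 1)) eF \<le> r"
        unfolding C(1) using ratio_Gamma[OF True] lower[OF C(2,3)] by (cases "C = ?\<Gamma>") auto
    qed
    ultimately show ?thesis using le True unfolding sX by simp
  next
    case False
    have "eF \<le> Inf B'"
    proof (rule cInf_greatest[OF B'ne])
      fix r assume "r \<in> B'"
      then obtain C where C: "r = ratio x C" "is_curve X C" "x \<in> C" unfolding B'_def mem_Collect_eq by (elim exE conjE)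
      show "eF \<le> r" unfolding C(1) by (rule lower[OF C(2,3)]) (use False C(3) in blast)
    qed
    then show ?thesis using le False unfolding sX by simp
  qed
qed

end

theorem theorem3p1:
  fixes n :: nat and c :: "nat \<Rightarrow> nat \<Rightarrow> int" and x :: "coords set"
    and L :: "coords set line_bundle_data" and a :: "nat \<Rightarrow> int"
  assumes "1 \<le> n"
    and "\<And>i j. 1 \<le> i \<Longrightarrow> i < j \<Longrightarrow> j \<le> n \<Longrightarrow> 0 < c i j"
    and "x \<in> pts (bott_tower c n)"
    and "line_bundle (bott_tower c n) L"
    and "nef (bott_tower c n) L"
    and "num_equiv_divisor (bott_tower c n) L {1..n} a (bott_divisor c n)"
  shows "(n = 1 \<longrightarrow> seshadri (bott_tower c n) L x = real_of_int (a 1)) \<and>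
    (2 \<le> n \<longrightarrow>
      (let F = bott_fibre c n x;
           eF = seshadri (subspace_of (bott_tower c n) F) (restrict_bundle L F) x
       in seshadri (bott_tower c n) L x =
            (if x \<in> bott_Gamma c n then min (real_of_int (a 1)) eF else eF)))"
proof -
  interpret bott_nef n c L a by unfold_locales (rule assms(1), rule assms(2), assumption+, rule assms(5), rule assms(6))
  show ?thesis unfolding Let_def seshadri_fibre[OF assms(3)]
    using seshadri_height_one[OF _ assms(3)] seshadri_height_ge_two[OF _ assms(3)] by blast
qed

end
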